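(* The Dirichlet to Neumann map $\Lambda_q:C(\partial\overline{\mathcal G})\to M(\partial\overline{\mathcal G})$, with domain the set $\mathcal D$ of continuous functions $F:\partial\overline{\mathcal G}\to\mathbb R$ with finite range, is densely defined, symmetric, and nonnegative. That is, $\mathcal D$ is dense in $C(\partial\overline{\mathcal G})$; $\langle\Lambda_qF,G\rangle=\langle\Lambda_qG,F\rangle$ for all $F,G\in\mathcal D$; and $\langle\Lambda_qF,F\rangle\ge 0$ for all $F\in\mathcal D$.
   Context: A metric graph $\mathcal G$ is a locally finite graph with countable vertex set and edge set $\mathcal E$, without loops or multiple edges, in which each edge is identified with a real interval of finite positive length; Lebesgue measure on the intervals gives a measure on $\mathcal G$. The distance $d(p_1,p_2)$ is the infimum of lengths of paths joining $p_1$ and $p_2$; $\overline{\mathcal G}$ is the metric completion. $\partial\mathcal G$ is the set of vertices of degree one and $\partial\overline{\mathcal G}=\partial\mathcal G\cup(\overline{\mathcal G}\setminus\mathcal G)$. $\overline{\mathcal G}$ is weakly connected if for every pair of distinct points $x,y\in\overline{\mathcal G}$ there is a finite set of points $W\subset\mathcal G$ and disjoint open sets $U,V$ with $\overline{\mathcal G}\setminus W=U\cup V$, $x\in U$, $y\in V$. Clopen means both closed and open (here relative to $\partial\overline{\mathcal G}$). A function $u:\mathcal G\to\mathbb R$ is $q$-harmonic if on each edge $u'$ is absolutely continuous and $u''=qu$ a.e., and at each vertex $v$ of degree at least $2$, $u$ is continuous and $\sum_{e(i)\sim v}\partial_\nu u_i(v)=0$, where $u_i$ is the restriction of $u$ to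 the incident edge $e(i)$ and $\partial_\nu u_i(v)$ is the derivative at $v$ in the local coordinate identifying $e(i)$ with $[a,b]$ so that $a$ corresponds to $v$. $\mathcal A$ is the algebra of functions $\phi:\overline{\mathcal G}\to\mathbb R$ which are continuous, infinitely differentiable on the open edges of $\mathcal G$, and for which $\phi'(x)=0$ for all $x$ in the complement of a finite set of edges and in a neighborhood of each vertex of $\mathcal G$. Standing assumptions: $\mathcal G$ is connected; $\overline{\mathcal G}$ is weakly connected and compact; $\partial\overline{\mathcal G}\ne\emptyset$; $q:\mathcal G\to\mathbb R$ is nonnegative, locally integrable, and integrable over $\mathcal G$; and there is a weight $\omega:\mathcal E\to(0,\infty)$ with $\sum_e\omega(e)<\infty$ and $\sum_e\int_e (q(x)/\omega(e))^2\omega(e)\,dx<\infty$. Under these assumptions every continuous $U:\partial\overline{\mathcal G}\to\mathbb R$ has a unique continuous extension $u:\overline{\mathcal G}\to\mathbb R$ that is $q$-harmonic on $\mathcal G$. Write $L\phi=-\phi''+q\phi$. For continuous $U:\partial\overline{\mathcal G}\to\mathbb R$ with $q$-harmonic extension $u$ and clopen $E\subset\partial\overline{\mathcal G}$, the Dirichlet-Neumann function is $$\Lambda_q(U,E)=\int_{\mathcal G}u\,L\phi,$$ where $\phi\in\mathcal A$ is any function with $\phi=1$ on $E$ and $\phi=0$ on $\partial\overline{\mathcal G}\setminus E$ (such $\phi$ exists and the value does not depend on its choice). $C(\partial\overline{\mathcal G})$ is the Banach space of real continuous functions on $\partial\overline{\mathcal G}$ with the maximum norm; $M(\partial\overline{\mathcal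 G})$ is the Banach space of signed finite Radon measures on $\partial\overline{\mathcal G}$ with the total variation norm, the dual of $C(\partial\overline{\mathcal G})$, with pairing $\langle\mu,F\rangle=\int_{\partial\overline{\mathcal G}}F\,d\mu$. A continuous $F:\partial\overline{\mathcal G}\to\mathbb R$ with finite range is a linear combination $F=\sum_{k=1}^n\alpha_k1_{\Omega(k)}$ of characteristic functions of clopen sets. For each clopen $\Omega$ the set function $E\mapsto\Lambda_q(1_\Omega,E)$ on clopen sets extends uniquely to a finite signed Radon measure on $\partial\overline{\mathcal G}$, also denoted $\Lambda_q(1_\Omega,\cdot)$. For a continuous $F:\partial\overline{\mathcal G}\to\mathbb R$ with finite range, written as $F=\sum_{k=1}^n\alpha_k1_{\Omega(k)}$ with $\alpha_k\in\mathbb R$ and $\Omega(k)\subset\partial\overline{\mathcal G}$ clopen, the Dirichlet to Neumann map is defined by $\Lambda_qF(E)=\sum_{k=1}^n\alpha_k\Lambda_q(1_{\Omega(k)},E)$ for Borel $E$; equivalently $\Lambda_qF$ is the signed finite Radon measure with $\Lambda_qF(E)=\Lambda_q(F,E)$ for all clopen $E$ (so it is independent of the representation of $F$). *)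

theory Defs
  imports "HOL-Analysis.Analysis"
begin

section \<open>Metric graphs and their completion\<close>

text \<open>
  An edge joining \<open>v\<close> and \<open>w\<close> is stored as one of the two pairs \<open>(v, w)\<close>, \<open>(w, v)\<close>; the pair
  \<open>e\<close> is identified with the interval \<open>[lo e, hi e]\<close>, where \<open>lo e\<close> corresponds to \<open>fst e\<close> and
  \<open>hi e\<close> to \<open>snd e\<close>. The orientation only fixes this coordinate.
\<close>

record 'v metric_graph =
  verts :: "'v set"
  edges :: "('v \<times> 'v) set"
  lo :: "'v \<times> 'v \<Rightarrow> real"
  hi :: "'v \<times> 'v \<Rightarrow> real"

definition incident :: "'v metric_graph \<Rightarrow> 'v \<Rightarrow> ('v \<times> 'v) set" where
  "incident \<Gamma> v = {e \<in> edges \<Gamma>. v = fst e \<or> v = snd e}"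

definition degree :: "'v metric_graph \<Rightarrow> 'v \<Rightarrow> nat" where
  "degree \<Gamma> v = card (incident \<Gamma> v)"

definition metric_graph :: "'v metric_graph \<Rightarrow> bool" where
  "metric_graph \<Gamma> \<longleftrightarrow>
     countable (verts \<Gamma>) \<and>
     edges \<Gamma> \<subseteq> verts \<Gamma> \<times> verts \<Gamma> \<and>
     (\<forall>v w. (v, w) \<in> edges \<Gamma> \<longrightarrow> v \<noteq> w \<and> (w, v) \<notin> edges \<Gamma>) \<and>
     (\<forall>v\<in>verts \<Gamma>. finite (incident \<Gamma> v)) \<and>
     (\<forall>e\<in>edges \<Gamma>. lo \<Gamma> e < hi \<Gamma> e)"

datatype 'v graph_point = Vertex 'v | Inner "'v \<times> 'v" real

definition points :: "'v metric_graph \<Rightarrow> 'v graph_point set" where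
  "points \<Gamma> = Vertex ` verts \<Gamma> \<union> {Inner e x | e x. e \<in> edges \<Gamma> \<and> lo \<Gamma> e < x \<and> x < hi \<Gamma> e}"

definition edge_point :: "'v metric_graph \<Rightarrow> 'v \<times> 'v \<Rightarrow> real \<Rightarrow> 'v graph_point" where
  "edge_point \<Gamma> e x =
     (if x = lo \<Gamma> e then Vertex (fst e) else if x = hi \<Gamma> e then Vertex (snd e) else Inner e x)"

text \<open>
  \<open>path_of_length \<Gamma> p l p'\<close>: there is a path from \<open>p\<close> to \<open>p'\<close> of length \<open>l\<close>, that is, a
  concatenation of finitely many segments, each contained in one closed edge.
\<close>

inductive path_of_length ::
  "'v metric_graph \<Rightarrow> 'v graph_point \<Rightarrow> real \<Rightarrow> 'v graph_point \<Rightarrow> bool" for \<Gamma> where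
  path_refl: "p \<in> points \<Gamma> \<Longrightarrow> path_of_length \<Gamma> p 0 p"
| path_step: "path_of_length \<Gamma> p l (edge_point \<Gamma> e s) \<Longrightarrow> e \<in> edges \<Gamma> \<Longrightarrow>
    s \<in> {lo \<Gamma> e..hi \<Gamma> e} \<Longrightarrow> t \<in> {lo \<Gamma> e..hi \<Gamma> e} \<Longrightarrow>
    path_of_length \<Gamma> p (l + \<bar>t - s\<bar>) (edge_point \<Gamma> e t)"

definition connected_graph :: "'v metric_graph \<Rightarrow> bool" where
  "connected_graph \<Gamma> \<longleftrightarrow> (\<forall>p\<in>points \<Gamma>. \<forall>p'\<in>points \<Gamma>. \<exists>l. path_of_length \<Gamma> p l p')"

definition graph_dist :: "'v metric_graph \<Rightarrow> 'v graph_point \<Rightarrow> 'v graph_point \<Rightarrow> real" where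
  "graph_dist \<Gamma> p p' = Inf {l. path_of_length \<Gamma> p l p'}"

text \<open>
  The completion is given by an isometric map \<open>\<iota>\<close> of the graph into some metric space such that the
  closure of the image is complete; that closure is then the metric completion of the graph. Every
  completion is of this form. The graph is identified with its image \<open>graph_set \<Gamma> \<iota>\<close>, so
  functions on the graph or on its completion are functions on the ambient type \<open>'x\<close> of which only
  the values on these sets matter.
\<close>

definition graph_set :: "'v metric_graph \<Rightarrow> ('v graph_point \<Rightarrow> 'x) \<Rightarrow> 'x set" where
  "graph_set \<Gamma> \<iota> = \<iota> ` points \<Gamma>"

definition completed ::
  "'v metric_graph \<Rightarrow> ('v graph_point \<Rightarrow> 'x::metric_space) \<Rightarrow> 'x set" where
  "completed \<Gamma> \<iota> = closure (graph_set \<Gamma> \<iota>)"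

definition is_completion ::
  "'v metric_graph \<Rightarrow> ('v graph_point \<Rightarrow> 'x::metric_space) \<Rightarrow> bool" where
  "is_completion \<Gamma> \<iota> \<longleftrightarrow>
     (\<forall>p\<in>points \<Gamma>. \<forall>p'\<in>points \<Gamma>. dist (\<iota> p) (\<iota> p') = graph_dist \<Gamma> p p') \<and>
     complete (completed \<Gamma> \<iota>)"

definition boundary ::
  "'v metric_graph \<Rightarrow> ('v graph_point \<Rightarrow> 'x::metric_space) \<Rightarrow> 'x set" where
  "boundary \<Gamma> \<iota> =
     {\<iota> (Vertex v) | v. v \<in> verts \<Gamma> \<and> degree \<Gamma> v = 1} \<union> (completed \<Gamma> \<iota> - graph_set \<Gamma> \<iota>)"

definition weakly_connected ::
  "'v metric_graph \<Rightarrow> ('v graph_point \<Rightarrow> 'x::metric_space) \<Rightarrow> bool" where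
  "weakly_connected \<Gamma> \<iota> \<longleftrightarrow>
     (\<forall>x\<in>completed \<Gamma> \<iota>. \<forall>y\<in>completed \<Gamma> \<iota>. x \<noteq> y \<longrightarrow>
        (\<exists>W U V. finite W \<and> W \<subseteq> graph_set \<Gamma> \<iota> \<and>
           openin (top_of_set (completed \<Gamma> \<iota>)) U \<and> openin (top_of_set (completed \<Gamma> \<iota>)) V \<and>
           U \<inter> V = {} \<and> completed \<Gamma> \<iota> - W = U \<union> V \<and> x \<in> U \<and> y \<in> V))"

section \<open>Functions on the graph\<close>

definition on_edge ::
  "'v metric_graph \<Rightarrow> ('v graph_point \<Rightarrow> 'x) \<Rightarrow> ('x \<Rightarrow> real) \<Rightarrow> 'v \<times> 'v \<Rightarrow> real \<Rightarrow> real" where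
  "on_edge \<Gamma> \<iota> f e x = f (\<iota> (edge_point \<Gamma> e x))"

text \<open>
  Lebesgue integration over the graph, for functions \<open>h e x\<close> given in the coordinates of the edges.
\<close>

definition graph_integrable ::
  "'v metric_graph \<Rightarrow> ('v \<times> 'v \<Rightarrow> real \<Rightarrow> real) \<Rightarrow> bool" where
  "graph_integrable \<Gamma> h \<longleftrightarrow>
     (\<forall>e\<in>edges \<Gamma>. set_integrable lebesgue {lo \<Gamma> e..hi \<Gamma> e} (h e)) \<and>
     (\<lambda>e. LINT x:{lo \<Gamma> e..hi \<Gamma> e}|lebesgue. \<bar>h e x\<bar>) summable_on edges \<Gamma>"

definition graph_integral ::
  "'v metric_graph \<Rightarrow> ('v \<times> 'v \<Rightarrow> real \<Rightarrow> real) \<Rightarrow> real" where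
  "graph_integral \<Gamma> h = (\<Sum>\<^sub>\<infinity>e\<in>edges \<Gamma>. LINT x:{lo \<Gamma> e..hi \<Gamma> e}|lebesgue. h e x)"

text \<open>The conditions on the potential; \<open>graph_integrable\<close> subsumes local integrability.\<close>

definition admissible_potential ::
  "'v metric_graph \<Rightarrow> ('v graph_point \<Rightarrow> 'x) \<Rightarrow> ('x \<Rightarrow> real) \<Rightarrow> bool" where
  "admissible_potential \<Gamma> \<iota> q \<longleftrightarrow>
     (\<forall>x\<in>graph_set \<Gamma> \<iota>. 0 \<le> q x) \<and>
     graph_integrable \<Gamma> (on_edge \<Gamma> \<iota> q) \<and>
     (\<exists>\<omega> :: 'v \<times> 'v \<Rightarrow> real.
        (\<forall>e\<in>edges \<Gamma>. 0 < \<omega> e) \<and> \<omega> summable_on edges \<Gamma> \<and>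
        graph_integrable \<Gamma> (\<lambda>e x. (on_edge \<Gamma> \<iota> q e x / \<omega> e)\<^sup>2 * \<omega> e))"

definition abs_cont_on :: "real \<Rightarrow> real \<Rightarrow> (real \<Rightarrow> real) \<Rightarrow> bool" where
  "abs_cont_on a b f \<longleftrightarrow>
     (\<forall>\<epsilon>>0. \<exists>\<delta>>0. \<forall>(n::nat) s t.
        (\<forall>i<n. a \<le> s i \<and> s i \<le> t i \<and> t i \<le> b) \<and>
        (\<forall>i<n. \<forall>j<n. i \<noteq> j \<longrightarrow> {s i<..<t i} \<inter> {s j<..<t j} = {}) \<and>
        (\<Sum>i<n. t i - s i) < \<delta> \<longrightarrow>
        (\<Sum>i<n. \<bar>f (t i) - f (s i)\<bar>) < \<epsilon>)"

text \<open>Derivative along the closed edge, one-sided at the two end points.\<close>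

definition edge_deriv ::
  "'v metric_graph \<Rightarrow> ('v graph_point \<Rightarrow> 'x) \<Rightarrow> ('x \<Rightarrow> real) \<Rightarrow> 'v \<times> 'v \<Rightarrow> real \<Rightarrow> real" where
  "edge_deriv \<Gamma> \<iota> u e x =
     vector_derivative (on_edge \<Gamma> \<iota> u e) (at x within {lo \<Gamma> e..hi \<Gamma> e})"

text \<open>
  Derivative at \<open>v\<close> in the coordinate of \<open>e\<close> that starts at \<open>v\<close>; at \<open>v = snd e\<close> the stored
  coordinate has to be reversed.
\<close>

definition normal_deriv ::
  "'v metric_graph \<Rightarrow> ('v graph_point \<Rightarrow> 'x) \<Rightarrow> ('x \<Rightarrow> real) \<Rightarrow> 'v \<times> 'v \<Rightarrow> 'v \<Rightarrow> real" where
  "normal_deriv \<Gamma> \<iota> u e v =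
     (if v = fst e then edge_deriv \<Gamma> \<iota> u e (lo \<Gamma> e) else - edge_deriv \<Gamma> \<iota> u e (hi \<Gamma> e))"

definition q_harmonic ::
  "'v metric_graph \<Rightarrow> ('v graph_point \<Rightarrow> 'x::metric_space) \<Rightarrow> ('x \<Rightarrow> real) \<Rightarrow> ('x \<Rightarrow> real) \<Rightarrow> bool"
  where
  "q_harmonic \<Gamma> \<iota> q u \<longleftrightarrow>
     (\<forall>e\<in>edges \<Gamma>.
        on_edge \<Gamma> \<iota> u e differentiable_on {lo \<Gamma> e..hi \<Gamma> e} \<and>
        abs_cont_on (lo \<Gamma> e) (hi \<Gamma> e) (edge_deriv \<Gamma> \<iota> u e) \<and>
        (AE x in lebesgue. x \<in> {lo \<Gamma> e<..<hi \<Gamma> e} \<longrightarrow>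
           (edge_deriv \<Gamma> \<iota> u e has_real_derivative on_edge \<Gamma> \<iota> q e x * on_edge \<Gamma> \<iota> u e x) (at x))) \<and>
     (\<forall>v\<in>verts \<Gamma>. 2 \<le> degree \<Gamma> v \<longrightarrow>
        continuous (at (\<iota> (Vertex v)) within graph_set \<Gamma> \<iota>) u \<and>
        (\<Sum>e\<in>incident \<Gamma> v. normal_deriv \<Gamma> \<iota> u e v) = 0)"

text \<open>The algebra of test functions.\<close>

definition test_functions ::
  "'v metric_graph \<Rightarrow> ('v graph_point \<Rightarrow> 'x::metric_space) \<Rightarrow> ('x \<Rightarrow> real) set" where
  "test_functions \<Gamma> \<iota> = {\<phi>.
     continuous_on (completed \<Gamma> \<iota>) \<phi> \<and>
     (\<forall>e\<in>edges \<Gamma>. \<forall>x\<in>{lo \<Gamma> e<..<hi \<Gamma> e}. \<forall>n.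
        (deriv ^^ n) (on_edge \<Gamma> \<iota> \<phi> e) field_differentiable at x) \<and>
     (\<exists>S. finite S \<and> S \<subseteq> edges \<Gamma> \<and>
        (\<forall>e\<in>edges \<Gamma> - S. \<forall>x\<in>{lo \<Gamma> e<..<hi \<Gamma> e}. deriv (on_edge \<Gamma> \<iota> \<phi> e) x = 0)) \<and>
     (\<forall>v\<in>verts \<Gamma>. \<exists>N. open N \<and> \<iota> (Vertex v) \<in> N \<and>
        (\<forall>e\<in>edges \<Gamma>. \<forall>x\<in>{lo \<Gamma> e<..<hi \<Gamma> e}.
           \<iota> (edge_point \<Gamma> e x) \<in> N \<longrightarrow> deriv (on_edge \<Gamma> \<iota> \<phi> e) x = 0))}"

section \<open>The Dirichlet-Neumann function\<close>

definition clopen_in :: "'x::topological_space set \<Rightarrow> 'x set \<Rightarrow> bool" where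
  "clopen_in B E \<longleftrightarrow> openin (top_of_set B) E \<and> closedin (top_of_set B) E"

definition is_harmonic_extension ::
  "'v metric_graph \<Rightarrow> ('v graph_point \<Rightarrow> 'x::metric_space) \<Rightarrow> ('x \<Rightarrow> real) \<Rightarrow>
   ('x \<Rightarrow> real) \<Rightarrow> ('x \<Rightarrow> real) \<Rightarrow> bool" where
  "is_harmonic_extension \<Gamma> \<iota> q U u \<longleftrightarrow>
     continuous_on (completed \<Gamma> \<iota>) u \<and> q_harmonic \<Gamma> \<iota> q u \<and> (\<forall>x\<in>boundary \<Gamma> \<iota>. u x = U x)"

definition harmonic_extension ::
  "'v metric_graph \<Rightarrow> ('v graph_point \<Rightarrow> 'x::metric_space) \<Rightarrow> ('x \<Rightarrow> real) \<Rightarrow>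
   ('x \<Rightarrow> real) \<Rightarrow> 'x \<Rightarrow> real" where
  "harmonic_extension \<Gamma> \<iota> q U = (SOME u. is_harmonic_extension \<Gamma> \<iota> q U u)"

definition cutoff ::
  "'v metric_graph \<Rightarrow> ('v graph_point \<Rightarrow> 'x::metric_space) \<Rightarrow> 'x set \<Rightarrow> 'x \<Rightarrow> real" where
  "cutoff \<Gamma> \<iota> E = (SOME \<phi>. \<phi> \<in> test_functions \<Gamma> \<iota> \<and>
     (\<forall>x\<in>E. \<phi> x = 1) \<and> (\<forall>x\<in>boundary \<Gamma> \<iota> - E. \<phi> x = 0))"

definition schroedinger ::
  "'v metric_graph \<Rightarrow> ('v graph_point \<Rightarrow> 'x) \<Rightarrow> ('x \<Rightarrow> real) \<Rightarrow> ('x \<Rightarrow> real) \<Rightarrow>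
   'v \<times> 'v \<Rightarrow> real \<Rightarrow> real" where
  "schroedinger \<Gamma> \<iota> q \<phi> e x =
     - deriv (deriv (on_edge \<Gamma> \<iota> \<phi> e)) x + on_edge \<Gamma> \<iota> q e x * on_edge \<Gamma> \<iota> \<phi> e x"

definition DN_function ::
  "'v metric_graph \<Rightarrow> ('v graph_point \<Rightarrow> 'x::metric_space) \<Rightarrow> ('x \<Rightarrow> real) \<Rightarrow>
   ('x \<Rightarrow> real) \<Rightarrow> 'x set \<Rightarrow> real" where
  "DN_function \<Gamma> \<iota> q U E =
     graph_integral \<Gamma> (\<lambda>e x. on_edge \<Gamma> \<iota> (harmonic_extension \<Gamma> \<iota> q U) e x *
       schroedinger \<Gamma> \<iota> q (cutoff \<Gamma> \<iota> E) e x)"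

section \<open>Signed Radon measures and the Dirichlet to Neumann map\<close>

text \<open>
  A finite signed measure on \<open>B\<close> is a real function on the Borel sets of \<open>B\<close> (values on other sets
  are irrelevant). The last clause is inner regularity of its total variation, since
  \<open>sup {|\<mu> C| : C \<subseteq> A}\<close> lies between \<open>|\<mu>|(A) / 2\<close> and \<open>|\<mu>|(A)\<close>.
\<close>

definition signed_radon_measures :: "'x::metric_space set \<Rightarrow> ('x set \<Rightarrow> real) set" where
  "signed_radon_measures B = {\<mu>.
     (\<forall>A :: nat \<Rightarrow> 'x set. range A \<subseteq> sets (restrict_space borel B) \<longrightarrow> disjoint_family A \<longrightarrow>
        (\<lambda>n. \<mu> (A n)) sums \<mu> (\<Union>n. A n)) \<and>
     (\<forall>A\<in>sets (restrict_space borel B). \<forall>\<epsilon>>0. \<exists>K. compact K \<and> K \<subseteq> A \<and>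
        (\<forall>C\<in>sets (restrict_space borel B). C \<subseteq> A - K \<longrightarrow> \<bar>\<mu> C\<bar> < \<epsilon>))}"

text \<open>Positive part of the Jordan decomposition.\<close>

definition positive_variation :: "'x::metric_space set \<Rightarrow> ('x set \<Rightarrow> real) \<Rightarrow> 'x measure" where
  "positive_variation B \<mu> = measure_of B (sets (restrict_space borel B))
     (\<lambda>A. SUP C\<in>{C \<in> sets (restrict_space borel B). C \<subseteq> A}. ennreal (\<mu> C))"

definition pairing :: "'x::metric_space set \<Rightarrow> ('x set \<Rightarrow> real) \<Rightarrow> ('x \<Rightarrow> real) \<Rightarrow> real" where
  "pairing B \<mu> F =
     integral\<^sup>L (positive_variation B \<mu>) F - integral\<^sup>L (positive_variation B (\<lambda>A. - \<mu> A)) F"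

text \<open>
  The space of real continuous functions on (compact) \<open>B\<close> with the maximum norm distance; its
  elements are undefined outside \<open>B\<close>.
\<close>

definition C_space :: "'x::metric_space set \<Rightarrow> ('x \<Rightarrow> real) metric" where
  "C_space B = cfunspace (top_of_set B) euclidean_metric"

definition finite_range_functions :: "'x::metric_space set \<Rightarrow> ('x \<Rightarrow> real) set" where
  "finite_range_functions B = {F \<in> mspace (C_space B). finite (F ` B)}"

definition DN_measure ::
  "'v metric_graph \<Rightarrow> ('v graph_point \<Rightarrow> 'x::metric_space) \<Rightarrow> ('x \<Rightarrow> real) \<Rightarrow>
   'x set \<Rightarrow> 'x set \<Rightarrow> real" where
  "DN_measure \<Gamma> \<iota> q \<Omega> = (SOME \<mu>. \<mu> \<in> signed_radon_measures (boundary \<Gamma> \<iota>) \<and>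
     (\<forall>E. clopen_in (boundary \<Gamma> \<iota>) E \<longrightarrow> \<mu> E = DN_function \<Gamma> \<iota> q (indicator \<Omega>) E))"

text \<open>
  Defined through the canonical representation of \<open>F\<close> as the sum over its values \<open>c\<close> of
  \<open>c\<close> times the characteristic function of the level set of \<open>c\<close>, which is clopen.
\<close>

definition DN_map ::
  "'v metric_graph \<Rightarrow> ('v graph_point \<Rightarrow> 'x::metric_space) \<Rightarrow> ('x \<Rightarrow> real) \<Rightarrow>
   ('x \<Rightarrow> real) \<Rightarrow> 'x set \<Rightarrow> real" where
  "DN_map \<Gamma> \<iota> q F A =
     (\<Sum>c\<in>F ` boundary \<Gamma> \<iota>. c * DN_measure \<Gamma> \<iota> q {x \<in> boundary \<Gamma> \<iota>. F x = c} A)"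

end

theory Submission
  imports Defs "HOL-Analysis.Analysis"
begin

text \<open>
  Everything reduces to the energy form \<open>Q(f, g) = \<integral> f' g' + \<integral> q f g\<close>. To avoid Sobolev spaces, the
  first summand is the limit of the difference quotient forms of \<open>f\<close> and \<open>g\<close> over the dyadic
  subdivisions of the first \<open>n\<close> edges; these increase with \<open>n\<close> when \<open>f = g\<close>. A function of finite
  energy satisfies \<open>(f y - f x)\<^sup>2 \<le> dist x y * Q(f, f)\<close>, so a minimizing sequence with given boundary
  values converges uniformly to a minimizer of \<open>Q\<close>. Testing the Euler-Lagrange equation with tent
  functions shows that the minimizer is \<open>q\<close>-harmonic, and the maximum principle identifies it with
  the harmonic extension. Writing \<open>u\<^sub>C\<close> for the minimizer with boundary values \<open>1\<^sub>C\<close>, \<open>C\<close> clopen,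
  integration by parts gives \<open>\<Lambda>\<^sub>q(1\<^sub>C, D) = Q(u\<^sub>C, u\<^sub>D)\<close>, which makes symmetry and nonnegativity
  visible.

  Contractions do not increase \<open>Q\<close>, hence \<open>Q(u\<^sub>C, u\<^sub>D)\<close> is nonnegative if \<open>D \<subseteq> C\<close> and nonpositive if
  \<open>C\<close> and \<open>D\<close> are disjoint. So \<open>D \<mapsto> Q(u\<^sub>C, u\<^sub>D)\<close> is a difference of two nonnegative additive set
  functions on the clopen sets, which extend to Borel measures because the boundary is compact and
  its clopen sets generate its topology. Weak connectedness enters only here and in the existence
  of test functions: it separates the points of the boundary by clopen sets.
\<close>

text \<open>The harmonic extension inside \<open>DN_function\<close> is a choice among continuous
  \<open>q\<close>-harmonic functions, and nothing in that notion bounds its energy. So it cannot be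
  compared with the minimizer through the form itself; this is why uniqueness has to come from a
  maximum principle. Monotonicity of the dyadic forms serves twice: bounded forms converge, and by
  polarization so do the mixed ones; and since a form of fixed level sees only finitely many values,
  the energy is lower semicontinuous under pointwise convergence. Dyadic subdivisions are chosen
  because of the tents whose kinks are nodes: refinement does not change the form of such a tent
  with any other function, so a minimizer can be tested before anything is known about its
  derivative. On the measure side the sign rules are essential, because a finitely additive signed
  set function on an algebra may have infinite variation; the rules bring everything back to
  nonnegative contents.\<close>

section \<open>Absolute continuity and indefinite integrals\<close>

text \<open>Vitali covering by intervals on which the Henstock lemma is violated.\<close>
lemma negligible_not_derivative_indefinite_integral:
  fixes f :: "real \<Rightarrow> real"
  assumes f: "f integrable_on {a..b}" and "\<epsilon> > 0"
  shows "negligible {x \<in> {a<..<b}. \<forall>d>0. \<exists>y\<in>{a<..<b}. y \<noteq> x \<and> \<bar>y - x\<bar> < d \<and>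
           \<epsilon> * \<bar>y - x\<bar> < \<bar>integral {a..y} f - integral {a..x} f - f x * (y - x)\<bar>}"
    (is "negligible ?B")
proof -
  define F where "F x = integral {a..x} f" for x
  have Fdiff: "F y - F x = integral {x..y} f" if "a \<le> x" "x \<le> y" "y \<le> b" for x y
  proof -
    have "f integrable_on {a..y}" using f that by (meson atLeastatMost_subset_iff integrable_on_subinterval order_refl)
    then show ?thesis
      unfolding F_def using Henstock_Kurzweil_Integration.integral_combine[of a x y f] that by simp
  qed
  show ?thesis
  proof (subst negligible_outer_le, intro allI impI)
    fix \<eta> :: real assume "\<eta> > 0"
    then have pos: "\<epsilon> * \<eta> > 0" using \<open>\<epsilon> > 0\<close> by simp
    have f': "f integrable_on cbox a b" using f by simp
    obtain \<gamma> where \<gamma>: "gauge \<gamma>"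
      and hen: "\<And>p. \<lbrakk>p tagged_partial_division_of cbox a b; \<gamma> fine p\<rbrakk>
          \<Longrightarrow> (\<Sum>(x,k)\<in>p. norm (measure lborel k *\<^sub>R f x - integral k f)) < \<epsilon> * \<eta>"
      by (rule Henstock_lemma[OF f' pos]) (rule that)
    define dev where "dev x y = \<bar>F y - F x - f x * (y - x)\<bar>" for x y
    \<comment> \<open>The interval spanned by \<open>x\<close> and \<open>y\<close>, written as a
      ball to fit the covering theorem. The bad point \<open>x\<close> is one of its end points and
      will be its tag.\<close>
    define I where "I = (\<lambda>(x::real, y::real). cball ((x + y) / 2) (\<bar>y - x\<bar> / 2))"
    have I_eq: "I (x, y) = {min x y..max x y}" for x y
      unfolding I_def by (auto simp: cball_eq_atLeastAtMost min_def max_def field_simps abs_if)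
    define K where "K = {(x, y). x \<in> ?B \<and> y \<in> {a<..<b} \<and> y \<noteq> x \<and> I (x, y) \<subseteq> \<gamma> x \<and> \<epsilon> * \<bar>y - x\<bar> < dev x y}"
    have r: "0 < (\<lambda>(x, y). \<bar>y - x\<bar> / 2) i" if "i \<in> K" for i
      using that by (auto simp: K_def)
    have S: "\<exists>i. i \<in> K \<and> x \<in> cball ((\<lambda>(x, y). (x + y) / 2) i) ((\<lambda>(x, y). \<bar>y - x\<bar> / 2) i)
        \<and> (\<lambda>(x, y). \<bar>y - x\<bar> / 2) i < d" if x: "x \<in> ?B" and d: "0 < d" for x d :: real
    proof -
      obtain e where "e > 0" and e: "ball x e \<subseteq> \<gamma> x"
        using \<gamma> by (meson gauge_def openE)
      from x \<open>e > 0\<close> d have "\<exists>y\<in>{a<..<b}. y \<noteq> x \<and> \<bar>y - x\<bar> < min d e \<and> \<epsilon> * \<bar>y - x\<bar> < dev x y"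
        unfolding dev_def F_def mem_Collect_eq by (elim conjE allE[of _ "min d e"]) simp
      then obtain y where y: "y \<in> {a<..<b}" "y \<noteq> x" "\<bar>y - x\<bar> < min d e" "\<epsilon> * \<bar>y - x\<bar> < dev x y"
        by blast
      have "I (x, y) \<subseteq> ball x e"
        unfolding I_eq using y by (auto simp: ball_eq_greaterThanLessThan min_def max_def abs_if split: if_splits)
      then have "(x, y) \<in> K" using x y e unfolding K_def by blast
      moreover have "x \<in> I (x, y)" unfolding I_eq by auto
      ultimately show ?thesis
        using y d unfolding I_def by (intro exI[of _ "(x, y)"]) auto
    qed
    obtain C where C: "countable C" "C \<subseteq> K"
      and dis: "pairwise (\<lambda>i j. disjnt (cball ((\<lambda>(x, y). (x + y) / 2) i) ((\<lambda>(x, y). \<bar>y - x\<bar> / 2) i))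
         (cball ((\<lambda>(x, y). (x + y) / 2) j) ((\<lambda>(x, y). \<bar>y - x\<bar> / 2) j))) C"
      and neg: "negligible (?B - (\<Union>i\<in>C. cball ((\<lambda>(x, y). (x + y) / 2) i) ((\<lambda>(x, y). \<bar>y - x\<bar> / 2) i)))"
      by (rule Vitali_covering_theorem_cballs[of K "\<lambda>(x, y). \<bar>y - x\<bar> / 2" ?B "\<lambda>(x, y). (x + y) / 2"])
        (erule r, erule (1) S, rule that)
    have I': "cball ((\<lambda>(x, y). (x + y) / 2) i) ((\<lambda>(x, y). \<bar>y - x\<bar> / 2) i) = I i" for i
      unfolding I_def by (cases i) auto
    note dis = dis[unfolded I'] and neg = neg[unfolded I']
    \<comment> \<open>A finite disjoint subfamily is a fine tagged partial division. Each of its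
      intervals deviates by more than \<open>\<epsilon>\<close> times its length, while the Henstock
      lemma bounds the sum of the deviations by \<open>\<epsilon> * \<eta>\<close>.\<close>
    have bound: "measure lebesgue (\<Union>(I ` D)) \<le> \<eta>" if D: "D \<subseteq> C" "finite D" for D
    proof -
      define p where "p = (\<lambda>i. (fst i, I i)) ` D"
      have DK: "i \<in> K" if "i \<in> D" for i using that D C by auto
      have inj: "inj_on (\<lambda>i. (fst i, I i)) D"
      proof (rule inj_onI)
        fix i j assume ij: "i \<in> D" "j \<in> D" "(fst i, I i) = (fst j, I j)"
        have "fst i \<in> I i" by (cases i) (simp add: I_eq)
        with ij have "\<not> disjnt (I i) (I j)" by (auto simp: disjnt_def)
        then show "i = j" using pairwiseD[OF dis, of i j] ij D by blast
      qed
      have tp: "p tagged_partial_division_of cbox a b"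
        unfolding tagged_partial_division_of_def
      proof (intro conjI allI impI; (elim conjE)?)
        show "finite p" using D by (simp add: p_def)
        fix x k assume "(x, k) \<in> p"
        then obtain y where i: "(x, y) \<in> D" and k: "k = I (x, y)" by (auto simp: p_def)
        show "x \<in> k" "k \<subseteq> cbox a b" using DK[OF i] unfolding k I_eq by (auto simp: K_def)
        show "\<exists>a b. k = cbox a b" using k I_eq[of x y] by (metis box_real(2))
        fix x' k' assume xk': "(x', k') \<in> p" and "(x, k) \<noteq> (x', k')"
        from xk' obtain y' where j: "(x', y') \<in> D" "k' = I (x', y')" by (auto simp: p_def)
        with k \<open>(x, k) \<noteq> (x', k')\<close> have "(x, y) \<noteq> (x', y')" by auto
        then have "disjnt k k'" using i k j pairwiseD[OF dis] D by blast
        then show "interior k \<inter> interior k' = {}"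
          using interior_subset[of k] interior_subset[of k'] unfolding disjnt_def by blast
      qed
      have fine: "\<gamma> fine p"
        unfolding fine_def
      proof (intro ballI, clarify)
        fix x k z assume "(x, k) \<in> p" "z \<in> k"
        then obtain y where i: "(x, y) \<in> D" "k = I (x, y)" by (auto simp: p_def)
        show "z \<in> \<gamma> x" using DK[OF i(1)] i(2) \<open>z \<in> k\<close> unfolding K_def by auto
      qed
      have "(\<Sum>(x,k)\<in>p. norm (measure lborel k *\<^sub>R f x - integral k f)) < \<epsilon> * \<eta>"
        by (rule hen[OF tp fine])
      then have le: "(\<Sum>i\<in>D. norm (measure lborel (I i) *\<^sub>R f (fst i) - integral (I i) f)) < \<epsilon> * \<eta>"
        unfolding p_def by (subst (asm) sum.reindex[OF inj]) (simp add: o_def)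
      have each: "\<epsilon> * measure lebesgue (I i) \<le> norm (measure lborel (I i) *\<^sub>R f (fst i) - integral (I i) f)"
        if "i \<in> D" for i
      proof -
        obtain x y where i: "i = (x, y)" by (cases i)
        with DK[OF that] have xy: "x \<in> {a<..<b}" "y \<in> {a<..<b}" "\<epsilon> * \<bar>y - x\<bar> < dev x y"
          by (auto simp: K_def)
        have m: "measure lborel (I i) = \<bar>y - x\<bar>" "measure lebesgue (I i) = \<bar>y - x\<bar>"
          unfolding i I_eq by (simp_all add: min_def max_def abs_if)
        have "norm (measure lborel (I i) *\<^sub>R f x - integral (I i) f) = dev x y"
        proof (cases "x \<le> y")
          case True
          then have "integral (I i) f = F y - F x" unfolding i I_eq using Fdiff[of x y] xy by simp
          moreover have "\<bar>y - x\<bar> * f x - (F y - F x) = - (F y - F x - f x * (y - x))"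
            using True by (simp add: algebra_simps)
          ultimately show ?thesis
            by (simp only: m dev_def real_norm_def real_scaleR_def abs_minus_cancel)
        next
          case False
          then have "integral (I i) f = F x - F y" unfolding i I_eq using Fdiff[of y x] xy by simp
          moreover have "\<bar>y - x\<bar> * f x - (F x - F y) = F y - F x - f x * (y - x)"
            using False by (simp add: algebra_simps)
          ultimately show ?thesis
            by (simp only: m dev_def real_norm_def real_scaleR_def abs_minus_cancel)
        qed
        then show ?thesis using xy(3) m(2) i by simp
      qed
      have "measure lebesgue (\<Union>(I ` D)) \<le> (\<Sum>i\<in>D. measure lebesgue (I i))"
        using D by (intro measure_UNION_le) (auto simp: I_def split: prod.split)
      moreover have "\<epsilon> * (\<Sum>i\<in>D. measure lebesgue (I i)) \<le> \<epsilon> * \<eta>"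
        unfolding sum_distrib_left by (rule order_trans[OF sum_mono[OF each] less_imp_le[OF le]])
      ultimately show ?thesis using \<open>\<epsilon> > 0\<close> by (simp add: mult_le_cancel_left_pos)
    qed
    have meas: "I i \<in> lmeasurable" for i unfolding I_def by (cases i) auto
    define T where "T = (\<Union>(I ` C)) \<union> (?B - (\<Union>(I ` C)))"
    have U: "\<Union>(I ` C) \<in> lmeasurable" "measure lebesgue (\<Union>(I ` C)) \<le> \<eta>"
      by (rule fmeasurable_UN_bound[OF C(1) meas bound], assumption+) (rule measure_UN_bound[OF C(1) meas bound], assumption+)
    show "\<exists>T. ?B \<subseteq> T \<and> T \<in> lmeasurable \<and> measure lebesgue T \<le> \<eta>"
    proof (intro exI conjI)
      show "?B \<subseteq> T" unfolding T_def by blast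
      show "T \<in> lmeasurable" unfolding T_def
        using U neg negligible_imp_measurable by (intro fmeasurable.Un) blast+
      show "measure lebesgue T \<le> \<eta>" unfolding T_def
        using measure_Un_le[of "\<Union>(I ` C)" lebesgue "?B - \<Union>(I ` C)", OF fmeasurableD[OF U(1)] fmeasurableD[OF negligible_imp_measurable[OF neg]]]
          U(2) negligible_imp_measure0[OF neg] by linarith
    qed
  qed
qed

text \<open>Lebesgue's differentiation theorem: the exceptional set is the union of the negligible
  sets for the tolerances \<open>1 / Suc n\<close>. It yields the equation u'' = qu almost
  everywhere.\<close>

theorem AE_has_derivative_indefinite_integral:
  fixes f :: "real \<Rightarrow> real"
  assumes f: "f integrable_on {a..b}"
  shows "AE x in lebesgue. x \<in> {a<..<b} \<longrightarrow> ((\<lambda>x. integral {a..x} f) has_real_derivative f x) (at x)"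
proof -
  let ?F = "\<lambda>x. integral {a..x} f"
  let ?B = "\<lambda>\<epsilon>. {x \<in> {a<..<b}. \<forall>d>0. \<exists>y\<in>{a<..<b}. y \<noteq> x \<and> \<bar>y - x\<bar> < d \<and>
           \<epsilon> * \<bar>y - x\<bar> < \<bar>?F y - ?F x - f x * (y - x)\<bar>}"
  have "negligible (?B (1 / real (Suc n)))" for n
    by (rule negligible_not_derivative_indefinite_integral[OF f]) simp
  then have "negligible (\<Union>n. ?B (1 / real (Suc n)))"
    by (intro negligible_countable_Union) (simp, elim imageE, simp only:)
  moreover have "(?F has_real_derivative f x) (at x)"
    if x: "x \<in> {a<..<b}" "x \<notin> (\<Union>n. ?B (1 / real (Suc n)))" for x
    unfolding has_field_derivative_def has_derivative_at_alt
  proof (intro conjI allI impI)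
    show "bounded_linear ((*) (f x))" by (rule bounded_linear_mult_right)
    fix e :: real assume "e > 0"
    then obtain n where n: "1 / real (Suc n) < e" using nat_approx_posE by auto
    from x have "\<not> (\<forall>d>0. \<exists>y\<in>{a<..<b}. y \<noteq> x \<and> \<bar>y - x\<bar> < d \<and>
        1 / real (Suc n) * \<bar>y - x\<bar> < \<bar>?F y - ?F x - f x * (y - x)\<bar>)"
      by blast
    then obtain d where "d > 0" and d: "\<And>y. y \<in> {a<..<b} \<Longrightarrow> y \<noteq> x \<Longrightarrow> \<bar>y - x\<bar> < d \<Longrightarrow>
         \<bar>?F y - ?F x - f x * (y - x)\<bar> \<le> (1 / real (Suc n)) * \<bar>y - x\<bar>"
      by (meson not_le)
    obtain d' where "d' > 0" and d': "ball x d' \<subseteq> {a<..<b}"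
      using x(1) open_greaterThanLessThan by (meson openE)
    show "\<exists>d>0. \<forall>y. norm (y - x) < d \<longrightarrow> norm (?F y - ?F x - f x * (y - x)) \<le> e * norm (y - x)"
    proof (intro exI[of _ "min d d'"] conjI allI impI)
      show "0 < min d d'" using \<open>d > 0\<close> \<open>d' > 0\<close> by simp
      fix y assume y: "norm (y - x) < min d d'"
      show "norm (?F y - ?F x - f x * (y - x)) \<le> e * norm (y - x)"
      proof (cases "y = x")
        case False
        have "y \<in> {a<..<b}" using y d' by (auto simp: dist_real_def subset_iff)
        then have "\<bar>?F y - ?F x - f x * (y - x)\<bar> \<le> (1 / real (Suc n)) * \<bar>y - x\<bar>" using d False y by auto
        also have "\<dots> \<le> e * \<bar>y - x\<bar>" using n by (intro mult_right_mono) auto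
        finally show ?thesis by simp
      qed simp
    qed
  qed
  ultimately show ?thesis
    unfolding negligible_iff_null_sets by (intro AE_I'[where N="\<Union>n. ?B (1 / real (Suc n))"]) blast+
qed

text \<open>Truncate |f| at a level \<open>N\<close> so large that the part above it has integral
  below \<open>\<epsilon> / 2\<close>; what remains contributes at most \<open>N\<close> times the
  total length of the intervals.\<close>

theorem abs_cont_on_indefinite_integral:
  fixes f :: "real \<Rightarrow> real"
  assumes f: "f absolutely_integrable_on {a..b}"
  shows "abs_cont_on a b (\<lambda>x. integral {a..x} f)"
  unfolding abs_cont_on_def
proof (intro allI impI)
  fix \<epsilon> :: real assume "\<epsilon> > 0"
  define g where "g x = \<bar>f x\<bar>" for x
  have g: "g absolutely_integrable_on {a..b}"
    using absolutely_integrable_norm[OF f] unfolding g_def[abs_def] by (simp add: o_def)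
  have fsub: "f absolutely_integrable_on {s..t}" "g absolutely_integrable_on {s..t}" if "a \<le> s" "t \<le> b" for s t
    using f g that by (meson absolutely_integrable_on_subinterval atLeastatMost_subset_iff)+
  have gm: "(\<lambda>x. min (g x) (real N)) absolutely_integrable_on {a..b}" for N
    by (intro absolutely_integrable_min_1 g) auto
  have "(\<lambda>N. integral {a..b} (\<lambda>x. min (g x) (real N))) \<longlonglongrightarrow> integral {a..b} g"
  proof (rule dominated_convergence(2)[where h=g])
    show "(\<lambda>x. min (g x) (real N)) integrable_on {a..b}" for N
      using gm by (simp add: absolutely_integrable_on_def)
    show "g integrable_on {a..b}" using g by (simp add: absolutely_integrable_on_def)
    show "norm (min (g x) (real N)) \<le> g x" for N x by (auto simp: g_def)
    show "(\<lambda>N. min (g x) (real N)) \<longlonglongrightarrow> g x" for x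
    proof (rule tendsto_eventually)
      obtain N where "g x \<le> real N" using real_arch_simple by blast
      then show "\<forall>\<^sub>F n in sequentially. min (g x) (real n) = g x"
        by (auto simp: eventually_sequentially intro!: exI[of _ N])
    qed
  qed
  then have "\<forall>\<^sub>F N in sequentially. \<bar>integral {a..b} (\<lambda>x. min (g x) (real N)) - integral {a..b} g\<bar> < \<epsilon> / 2"
    using \<open>\<epsilon> > 0\<close> unfolding tendsto_iff dist_real_def by (elim allE[of _ "\<epsilon> / 2"]) simp
  then obtain N where N: "\<bar>integral {a..b} (\<lambda>x. min (g x) (real N)) - integral {a..b} g\<bar> < \<epsilon> / 2"
    by (meson eventually_sequentially order_refl)
  define h where "h x = g x - min (g x) (real N)" for x
  have h: "h absolutely_integrable_on {a..b}" unfolding h_def using g gm by (rule set_integral_diff(1))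
  have hint: "integral {a..b} h < \<epsilon> / 2"
  proof -
    have "integral {a..b} h = integral {a..b} g - integral {a..b} (\<lambda>x. min (g x) (real N))"
      using g gm[of N] unfolding h_def
      by (intro Henstock_Kurzweil_Integration.integral_diff) (auto simp: absolutely_integrable_on_def)
    then show ?thesis using N by linarith
  qed
  have hpos: "0 \<le> h x" for x by (simp add: h_def)
  have each: "\<bar>integral {a..t} f - integral {a..s} f\<bar> \<le> integral {s..t} h + real N * (t - s)"
    if st: "a \<le> s" "s \<le> t" "t \<le> b" for s t
  proof -
    have "f integrable_on {a..t}" using fsub[of a t] st by (simp add: absolutely_integrable_on_def)
    then have "integral {a..t} f - integral {a..s} f = integral {s..t} f"
      using Henstock_Kurzweil_Integration.integral_combine[of a s t f] st by simp
    also have "\<bar>\<dots>\<bar> \<le> integral {s..t} (\<lambda>x. h x + real N)"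
    proof (rule integral_norm_bound_integral[where f=f, unfolded real_norm_def])
      show "f integrable_on {s..t}" using fsub[of s t] st by (simp add: absolutely_integrable_on_def)
      have "h absolutely_integrable_on {s..t}"
        using h st by (meson absolutely_integrable_on_subinterval atLeastatMost_subset_iff)
      then show "(\<lambda>x. h x + real N) integrable_on {s..t}"
        by (intro integrable_add) (auto simp: absolutely_integrable_on_def)
      show "\<bar>f x\<bar> \<le> h x + real N" for x by (auto simp: h_def g_def)
    qed
    also have "\<dots> = integral {s..t} h + real N * (t - s)"
    proof -
      have "h absolutely_integrable_on {s..t}"
        using h st by (meson absolutely_integrable_on_subinterval atLeastatMost_subset_iff)
      then show ?thesis
        using st by (subst Henstock_Kurzweil_Integration.integral_add) (auto simp: absolutely_integrable_on_def)
    qed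
    finally show ?thesis .
  qed
  \<comment> \<open>Leaves \<open>\<epsilon> / 2\<close> for the bounded part; \<open>N + 1\<close>
    avoids a division by zero.\<close>
  define \<delta> where "\<delta> = \<epsilon> / (2 * (real N + 1))"
  have \<delta>: "\<delta> > 0" "real N * \<delta> \<le> \<epsilon> / 2" using \<open>\<epsilon> > 0\<close> by (auto simp: \<delta>_def field_simps)
  show "\<exists>\<delta>>0. \<forall>(n::nat) s t.
        (\<forall>i<n. a \<le> s i \<and> s i \<le> t i \<and> t i \<le> b) \<and>
        (\<forall>i<n. \<forall>j<n. i \<noteq> j \<longrightarrow> {s i<..<t i} \<inter> {s j<..<t j} = {}) \<and>
        (\<Sum>i<n. t i - s i) < \<delta> \<longrightarrow>
        (\<Sum>i<n. \<bar>integral {a..t i} f - integral {a..s i} f\<bar>) < \<epsilon>"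
  proof (intro exI[of _ \<delta>] conjI allI impI \<delta>, elim conjE)
    fix n :: nat and s t :: "nat \<Rightarrow> real"
    assume st: "\<forall>i<n. a \<le> s i \<and> s i \<le> t i \<and> t i \<le> b"
      and dis: "\<forall>i<n. \<forall>j<n. i \<noteq> j \<longrightarrow> {s i<..<t i} \<inter> {s j<..<t j} = {}"
      and small: "(\<Sum>i<n. t i - s i) < \<delta>"
    have hI: "(h has_integral integral {s i..t i} h) {s i<..<t i}" if "i < n" for i
    proof -
      have "h absolutely_integrable_on {s i..t i}"
        using h st that by (meson absolutely_integrable_on_subinterval atLeastatMost_subset_iff)
      then show ?thesis
        by (auto simp: absolutely_integrable_on_def simp flip: has_integral_Icc_iff_Ioo)
    qed
    have U: "(h has_integral (\<Sum>i<n. integral {s i..t i} h)) (\<Union>i<n. {s i<..<t i})"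
      by (rule has_integral_UN) (use hI dis in \<open>auto simp: pairwise_def\<close>)
    have "(\<Sum>i<n. integral {s i..t i} h) \<le> integral {a..b} h"
    proof (rule has_integral_subset_le[OF _ U])
      show "(\<Union>i<n. {s i<..<t i}) \<subseteq> {a..b}" using st by fastforce
      show "(h has_integral integral {a..b} h) {a..b}" using h by (auto simp: absolutely_integrable_on_def)
    qed (auto simp: hpos)
    moreover have "(\<Sum>i<n. \<bar>integral {a..t i} f - integral {a..s i} f\<bar>)
        \<le> (\<Sum>i<n. integral {s i..t i} h + real N * (t i - s i))"
      using st by (intro sum_mono each) auto
    moreover have "\<dots> = (\<Sum>i<n. integral {s i..t i} h) + real N * (\<Sum>i<n. t i - s i)"
      by (simp add: sum.distrib sum_distrib_left)
    moreover have "real N * (\<Sum>i<n. t i - s i) \<le> real N * \<delta>"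
      using small by (intro mult_left_mono) auto
    ultimately show "(\<Sum>i<n. \<bar>integral {a..t i} f - integral {a..s i} f\<bar>) < \<epsilon>"
      using hint \<delta> by linarith
  qed
qed

text \<open>\<open>abs_cont_on\<close> numbers its intervals by naturals; here they may be indexed
  by any finite set, such as the elements of a tagged division.\<close>

lemma abs_cont_on_finite_family:
  assumes F: "abs_cont_on a b F" and "\<epsilon> > 0"
  obtains \<delta> where "\<delta> > 0"
    "\<forall>p s t. finite p \<longrightarrow> (\<forall>i\<in>p. a \<le> s i \<and> s i \<le> t i \<and> t i \<le> b) \<longrightarrow>
      (\<forall>i\<in>p. \<forall>j\<in>p. i \<noteq> j \<longrightarrow> {s i<..<t i} \<inter> {s j<..<t j} = {}) \<longrightarrow>
      (\<Sum>i\<in>p. t i - s i) < \<delta> \<longrightarrow> (\<Sum>i\<in>p. \<bar>F (t i) - F (s i)\<bar>) < \<epsilon>"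
proof -
  obtain \<delta> where "\<delta> > 0" and \<delta>: "\<forall>(n::nat) s t.
        (\<forall>i<n. a \<le> s i \<and> s i \<le> t i \<and> t i \<le> b) \<and>
        (\<forall>i<n. \<forall>j<n. i \<noteq> j \<longrightarrow> {s i<..<t i} \<inter> {s j<..<t j} = {}) \<and>
        (\<Sum>i<n. t i - s i) < \<delta> \<longrightarrow>
        (\<Sum>i<n. \<bar>F (t i) - F (s i)\<bar>) < \<epsilon>"
    using F[unfolded abs_cont_on_def, THEN spec, of \<epsilon>] \<open>\<epsilon> > 0\<close> by (elim impE exE conjE) (assumption, rule that)
  show thesis
  proof (rule that[OF \<open>\<delta> > 0\<close>], intro allI impI)
    fix p :: "'i set" and s t
    assume p: "finite p" and st: "\<forall>i\<in>p. a \<le> s i \<and> s i \<le> t i \<and> t i \<le> b"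
      and dis: "\<forall>i\<in>p. \<forall>j\<in>p. i \<noteq> j \<longrightarrow> {s i<..<t i} \<inter> {s j<..<t j} = {}"
      and small: "(\<Sum>i\<in>p. t i - s i) < \<delta>"
    obtain c where c: "bij_betw c {..<card p} p"
      using ex_bij_betw_nat_finite[OF p] by (auto simp: atLeast0LessThan)
    have reidx: "(\<Sum>i\<in>p. G i) = (\<Sum>k<card p. G (c k))" for G :: "'i \<Rightarrow> real"
      using sum.reindex_bij_betw[OF c] by metis
    have cp: "c k \<in> p" if "k < card p" for k using c that by (auto simp: bij_betw_def)
    have "(\<Sum>k<card p. \<bar>F (t (c k)) - F (s (c k))\<bar>) < \<epsilon>"
    proof (rule \<delta>[rule_format, of "card p" "\<lambda>k. s (c k)" "\<lambda>k. t (c k)"], intro conjI allI impI)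
      fix i j assume ij: "i < card p" "j < card p" "i \<noteq> j"
      then have "c i \<noteq> c j" using c by (auto simp: bij_betw_def inj_on_def)
      then show "{s (c i)<..<t (c i)} \<inter> {s (c j)<..<t (c j)} = {}" using dis cp ij by blast
    next
      show "(\<Sum>i<card p. t (c i) - s (c i)) < \<delta>" using small unfolding reidx .
    qed (use st cp in auto)
    then show "(\<Sum>i\<in>p. \<bar>F (t i) - F (s i)\<bar>) < \<epsilon>" unfolding reidx .
  qed
qed

text \<open>Take a division fine for a gauge that treats good and bad tags differently. Cells with a
  bad tag lie in an open set of small measure, where absolute continuity controls \<open>F\<close>.
  A cell with a good tag contains the point of differentiability, so \<open>F\<close> drops there by
  at most \<open>\<epsilon>\<close> times the length.\<close>

theorem abs_cont_on_AE_deriv_nonneg_imp_le: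
  fixes F :: "real \<Rightarrow> real"
  assumes "a \<le> b" and F: "abs_cont_on a b F"
    and deriv: "AE x in lebesgue. x \<in> {a<..<b} \<longrightarrow> (\<exists>d\<ge>0. (F has_real_derivative d) (at x))"
  shows "F a \<le> F b"
proof -
  have key: "F a - F b \<le> \<epsilon> + \<epsilon> * (b - a)" if "\<epsilon> > 0" for \<epsilon>
  proof -
    obtain \<delta> where "\<delta> > 0" and \<delta>: "\<forall>p s t. finite (p :: (real \<times> real set) set) \<longrightarrow>
      (\<forall>i\<in>p. a \<le> s i \<and> s i \<le> t i \<and> t i \<le> b) \<longrightarrow>
      (\<forall>i\<in>p. \<forall>j\<in>p. i \<noteq> j \<longrightarrow> {s i<..<t i} \<inter> {s j<..<t j} = {}) \<longrightarrow>
      (\<Sum>i\<in>p. t i - s i) < \<delta> \<longrightarrow> (\<Sum>i\<in>p. \<bar>F (t i) - F (s i)\<bar>) < \<epsilon>"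
      by (rule abs_cont_on_finite_family[OF F \<open>\<epsilon> > 0\<close>]) (rule that)
    obtain N\<^sub>0 where N0: "\<And>x. x \<notin> N\<^sub>0 \<Longrightarrow> x \<in> {a<..<b} \<longrightarrow> (\<exists>d\<ge>0. (F has_real_derivative d) (at x))"
        "N\<^sub>0 \<in> null_sets lebesgue"
      using AE_E3[OF deriv] by auto
    \<comment> \<open>The derivative is only assumed on the open interval, so both end points count
      as bad.\<close>
    define N where "N = N\<^sub>0 \<union> {a, b}"
    have "N \<in> null_sets lebesgue"
      using N0(2) unfolding N_def by (simp add: negligible_Un flip: negligible_iff_null_sets)
    then obtain T where T: "open T" "N \<subseteq> T" "emeasure lebesgue (T - N) < ennreal \<delta>" "T - N \<in> lmeasurable"
      using sets_lebesgue_outer_open[of N \<delta>] \<open>\<delta> > 0\<close> by (metis null_setsD2)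
    have mT: "T \<in> lmeasurable" "measure lebesgue T < \<delta>"
    proof -
      have "emeasure lebesgue T = emeasure lebesgue (T - N)"
        using emeasure_Diff_null_set[OF \<open>N \<in> null_sets lebesgue\<close>, of T] T by (simp add: borel_open)
      then have *: "emeasure lebesgue T < ennreal \<delta>" using T by simp
      then have "emeasure lebesgue T < \<infinity>" by (rule less_trans) simp
      then show "T \<in> lmeasurable" using T by (simp add: fmeasurable_def)
      then show "measure lebesgue T < \<delta>"
        using * \<open>\<delta> > 0\<close> by (simp add: emeasure_eq_measure2 ennreal_less_iff)
    qed
    have "\<exists>e>0. \<forall>y z. y \<in> ball x e \<longrightarrow> z \<in> ball x e \<longrightarrow> y \<le> x \<longrightarrow> x \<le> z \<longrightarrow> F y - F z \<le> \<epsilon> * (z - y)"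
      if "x \<in> {a..b}" "x \<notin> N" for x
    proof -
      from that obtain d where d: "d \<ge> 0" "(F has_real_derivative d) (at x)"
        using N0(1)[of x] unfolding N_def by force
      then obtain e where "e > 0" and e: "\<And>y. norm (y - x) < e \<Longrightarrow> norm (F y - F x - d * (y - x)) \<le> \<epsilon> * norm (y - x)"
        using \<open>\<epsilon> > 0\<close> unfolding has_field_derivative_def has_derivative_at_alt by blast
      show ?thesis
      proof (intro exI[of _ e] conjI allI impI \<open>e > 0\<close>)
        fix y z assume yz: "y \<in> ball x e" "z \<in> ball x e" "y \<le> x" "x \<le> z"
        have 1: "\<bar>F y - F x - d * (y - x)\<bar> \<le> \<epsilon> * (x - y)" using e[of y] yz by (auto simp: dist_real_def)
        have 2: "\<bar>F z - F x - d * (z - x)\<bar> \<le> \<epsilon> * (z - x)" using e[of z] yz by (auto simp: dist_real_def)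
        have "d * (z - x) \<ge> 0" "d * (y - x) \<le> 0" using d yz by (auto simp: mult_nonneg_nonpos)
        with 1 2 show "F y - F z \<le> \<epsilon> * (z - y)" by (simp add: algebra_simps abs_le_iff)
      qed
    qed
    then obtain e where e: "\<And>x. x \<in> {a..b} \<Longrightarrow> x \<notin> N \<Longrightarrow> e x > 0 \<and>
      (\<forall>y z. y \<in> ball x (e x) \<longrightarrow> z \<in> ball x (e x) \<longrightarrow> y \<le> x \<longrightarrow> x \<le> z \<longrightarrow> F y - F z \<le> \<epsilon> * (z - y))"
      by metis
    define \<gamma> where "\<gamma> x = (if x \<in> N then T else if x \<in> {a..b} then ball x (e x) else UNIV)" for x
    have "gauge \<gamma>" unfolding gauge_def \<gamma>_def using T e by auto
    then obtain p where p: "p tagged_division_of {a..b}" and fine: "\<gamma> fine p"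
      using fine_division_exists_real by blast
    note pD = tagged_division_ofD[OF p]
    let ?l = "\<lambda>i :: real \<times> real set. Inf (snd i)" and ?u = "\<lambda>i :: real \<times> real set. Sup (snd i)"
    have K: "fst i \<in> snd i" "snd i = {?l i..?u i}" "a \<le> ?l i" "?l i \<le> ?u i" "?u i \<le> b" if "i \<in> p" for i
    proof -
      have i: "(fst i, snd i) \<in> p" using that by simp
      obtain u v where "snd i = cbox u v" using pD(4)[OF i] by blast
      moreover have "fst i \<in> snd i" "snd i \<subseteq> {a..b}" using pD(2,3)[OF i] by auto
      ultimately show "fst i \<in> snd i" "snd i = {?l i..?u i}" "a \<le> ?l i" "?l i \<le> ?u i" "?u i \<le> b"
        by auto
    qed
    define p1 where "p1 = {i \<in> p. fst i \<in> N}"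
    define p2 where "p2 = p - p1"
    have fin: "finite p" "finite p1" "finite p2" using pD(1) by (auto simp: p1_def p2_def)
    have tot: "F b - F a = (\<Sum>i\<in>p. F (?u i) - F (?l i))"
      using additive_tagged_division_1[OF \<open>a \<le> b\<close> p, of F] by (simp add: case_prod_unfold)
    have len: "b - a = (\<Sum>i\<in>p. ?u i - ?l i)"
      using additive_tagged_division_1[OF \<open>a \<le> b\<close> p, of "\<lambda>x. x"] by (simp add: case_prod_unfold)
    have split: "(\<Sum>i\<in>p. G i) = (\<Sum>i\<in>p1. G i) + (\<Sum>i\<in>p2. G i)" for G :: "_ \<Rightarrow> real"
      unfolding p2_def using fin by (subst sum.subset_diff[of p1 p]) (auto simp: p1_def)
    have fine': "snd i \<subseteq> \<gamma> (fst i)" if "i \<in> p" for i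
    proof -
      have "(fst i, snd i) \<in> p" using that by simp
      then show ?thesis using fine unfolding fine_def by blast
    qed
    have dis: "{?l i<..<?u i} \<inter> {?l j<..<?u j} = {}" if "i \<in> p" "j \<in> p" "i \<noteq> j" for i j
    proof -
      have "interior (snd i) \<inter> interior (snd j) = {}"
        using pD(5)[of "fst i" "snd i" "fst j" "snd j"] that by (simp add: prod_eq_iff)
      moreover have "interior (snd i) = {?l i<..<?u i}" "interior (snd j) = {?l j<..<?u j}"
        by (subst K(2)[OF that(1)], simp) (subst K(2)[OF that(2)], simp)
      ultimately show ?thesis by simp
    qed
    have "(\<Sum>i\<in>p1. ?u i - ?l i) \<le> measure lebesgue T"
    proof -
      have "(\<Sum>i\<in>p1. ?u i - ?l i) = (\<Sum>i\<in>p1. measure lebesgue {?l i<..<?u i})"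
        using K(4) by (intro sum.cong) (auto simp: p1_def)
      also have "\<dots> = measure lebesgue (\<Union>i\<in>p1. {?l i<..<?u i})"
      proof (rule measure_UNION'[symmetric])
        show "pairwise (\<lambda>i j. disjnt {?l i<..<?u i} {?l j<..<?u j}) p1"
          unfolding disjnt_def by (rule pairwiseI, rule dis) (auto simp: p1_def)
      qed (use fin in auto)
      also have "\<dots> \<le> measure lebesgue T"
      proof (rule measure_mono_fmeasurable)
        have "{?l i<..<?u i} \<subseteq> T" if "i \<in> p1" for i
        proof -
          have ip: "i \<in> p" "fst i \<in> N" using that by (auto simp: p1_def)
          then have "snd i \<subseteq> \<gamma> (fst i)" by (intro fine')
          then have "snd i \<subseteq> T" using ip unfolding \<gamma>_def by simp
          moreover have "{?l i<..<?u i} \<subseteq> snd i" by (subst (3) K(2)[OF ip(1)]) auto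
          ultimately show ?thesis by blast
        qed
        then show "(\<Union>i\<in>p1. {?l i<..<?u i}) \<subseteq> T" by blast
        show "(\<Union>i\<in>p1. {?l i<..<?u i}) \<in> sets lebesgue"
          using fin by (intro sets.finite_UN) auto
      qed (rule mT)
      finally show ?thesis .
    qed
    then have small: "(\<Sum>i\<in>p1. ?u i - ?l i) < \<delta>" using mT by simp
    have "(\<Sum>i\<in>p1. \<bar>F (?u i) - F (?l i)\<bar>) < \<epsilon>"
      by (rule \<delta>[rule_format, OF _ _ _ small]) (use fin K(3,4,5) dis in \<open>auto simp: p1_def\<close>)
    then have 1: "(\<Sum>i\<in>p1. F (?u i) - F (?l i)) > - \<epsilon>"
      using sum_abs[of "\<lambda>i. F (?u i) - F (?l i)" p1] by linarith
    have "(\<Sum>i\<in>p2. - (\<epsilon> * (?u i - ?l i))) \<le> (\<Sum>i\<in>p2. F (?u i) - F (?l i))"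
    proof (rule sum_mono)
      fix i assume "i \<in> p2"
      then have ip: "i \<in> p" "fst i \<notin> N" by (auto simp: p1_def p2_def)
      have x: "fst i \<in> {?l i..?u i}" using K(1,2)[OF ip(1)] by simp
      then have xab: "fst i \<in> {a..b}" using K(3,5)[OF ip(1)] by auto
      have "snd i \<subseteq> \<gamma> (fst i)" by (intro fine' ip)
      then have "{?l i..?u i} \<subseteq> ball (fst i) (e (fst i))"
        using ip xab K(2)[OF ip(1)] unfolding \<gamma>_def by simp
      then have "?l i \<in> ball (fst i) (e (fst i))" "?u i \<in> ball (fst i) (e (fst i))"
        using K(4)[OF ip(1)] by (meson atLeastAtMost_iff order_refl subsetD)+
      then have "F (?l i) - F (?u i) \<le> \<epsilon> * (?u i - ?l i)"
        using e[OF xab ip(2)] x by simp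
      then show "- (\<epsilon> * (?u i - ?l i)) \<le> F (?u i) - F (?l i)" by simp
    qed
    moreover have "(\<Sum>i\<in>p2. - (\<epsilon> * (?u i - ?l i))) = - \<epsilon> * (\<Sum>i\<in>p2. ?u i - ?l i)"
      by (simp add: sum_negf sum_distrib_left)
    moreover have "(\<Sum>i\<in>p2. ?u i - ?l i) \<le> b - a"
    proof -
      have "(\<Sum>i\<in>p1. ?u i - ?l i) \<ge> 0" by (rule sum_nonneg) (use K(4) in \<open>auto simp: p1_def\<close>)
      then show ?thesis using len split[of "\<lambda>i. ?u i - ?l i"] by simp
    qed
    moreover from this have "\<epsilon> * (\<Sum>i\<in>p2. ?u i - ?l i) \<le> \<epsilon> * (b - a)"
      using \<open>\<epsilon> > 0\<close> by (intro mult_left_mono) auto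
    ultimately show ?thesis
      using tot split[of "\<lambda>i. F (?u i) - F (?l i)"] 1 by linarith
  qed
  show ?thesis
  proof (rule ccontr)
    assume "\<not> F a \<le> F b"
    define c where "c = F a - F b"
    have c: "c > 0" using \<open>\<not> F a \<le> F b\<close> by (simp add: c_def)
    \<comment> \<open>Chosen so that the bound in \<open>key\<close> becomes c / 2.\<close>
    define \<epsilon> where "\<epsilon> = c / (2 * (1 + (b - a)))"
    have "\<epsilon> > 0" using c \<open>a \<le> b\<close> by (simp add: \<epsilon>_def)
    have "c \<le> \<epsilon> * (1 + (b - a))" using key[OF \<open>\<epsilon> > 0\<close>] by (simp add: c_def algebra_simps)
    also have "\<dots> = c / 2" using \<open>a \<le> b\<close> by (simp add: \<epsilon>_def field_simps)
    finally show False using c by simp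
  qed
qed

lemma absolutely_integrable_continuous_mult:
  fixes g r :: "real \<Rightarrow> real"
  assumes "continuous_on {a..b} g" "r absolutely_integrable_on {a..b}"
  shows "(\<lambda>x. g x * r x) absolutely_integrable_on {a..b}"
proof (rule absolutely_integrable_bounded_measurable_product_real)
  show "g \<in> borel_measurable (lebesgue_on {a..b})"
    using assms(1) by (intro continuous_imp_measurable_on_sets_lebesgue) auto
  show "bounded (g ` {a..b})"
    using assms(1) by (intro compact_imp_bounded compact_continuous_image) auto
qed (use assms in auto)

section \<open>Second antiderivatives and dyadic difference forms\<close>

text \<open>Taylor's kernel, so that the second derivative is \<open>r\<close>.\<close>
definition second_antideriv :: "real \<Rightarrow> real \<Rightarrow> (real \<Rightarrow> real) \<Rightarrow> real \<Rightarrow> real" where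
  "second_antideriv a b r x = integral {a..b} (\<lambda>y. max 0 (x - y) * r y)"

text \<open>The second difference of \<open>max 0 (x - y)\<close> in \<open>x\<close> is a tent in
  \<open>y\<close>. Hence testing with tents gives exact second differences and not approximations
  to them.\<close>

lemma second_antideriv_second_difference:
  assumes r: "r absolutely_integrable_on {a..b}" and "\<delta> > 0"
  shows "second_antideriv a b r (x + \<delta>) + second_antideriv a b r (x - \<delta>) - 2 * second_antideriv a b r x
    = \<delta> * integral {a..b} (\<lambda>y. max 0 (1 - \<bar>y - x\<bar> / \<delta>) * r y)"
proof -
  have int: "(\<lambda>y. max 0 (z - y) * r y) integrable_on {a..b}" for z
  proof -
    have "continuous_on {a..b} (\<lambda>y. max 0 (z - y))" by (intro continuous_intros)
    from absolutely_integrable_continuous_mult[OF this r] show ?thesis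
      by (simp add: absolutely_integrable_on_def)
  qed
  have pw: "max 0 (x + \<delta> - y) + max 0 (x - \<delta> - y) - 2 * max 0 (x - y) = \<delta> * max 0 (1 - \<bar>y - x\<bar> / \<delta>)" for y
  proof -
    have "\<delta> * max 0 (1 - \<bar>y - x\<bar> / \<delta>) = max 0 (\<delta> - \<bar>y - x\<bar>)"
      using \<open>\<delta> > 0\<close> by (auto simp: max_def field_simps)
    then show ?thesis using \<open>\<delta> > 0\<close> by (auto simp: max_def abs_if)
  qed
  have "second_antideriv a b r (x + \<delta>) + second_antideriv a b r (x - \<delta>) - 2 * second_antideriv a b r x
    = integral {a..b} (\<lambda>y. max 0 (x + \<delta> - y) * r y + max 0 (x - \<delta> - y) * r y - 2 * (max 0 (x - y) * r y))"
    unfolding second_antideriv_def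
    by (rule integral_unique[symmetric])
       (intro has_integral_diff has_integral_add has_integral_mult_right integrable_integral int)
  also have "\<dots> = integral {a..b} (\<lambda>y. \<delta> * (max 0 (1 - \<bar>y - x\<bar> / \<delta>) * r y))"
  proof (intro integral_cong)
    fix y
    show "max 0 (x + \<delta> - y) * r y + max 0 (x - \<delta> - y) * r y - 2 * (max 0 (x - y) * r y)
      = \<delta> * (max 0 (1 - \<bar>y - x\<bar> / \<delta>) * r y)"
      unfolding mult.assoc[symmetric] pw[symmetric] by (simp add: algebra_simps)
  qed
  finally show ?thesis by simp
qed

text \<open>The error of the linear approximation involves \<open>r\<close> only between
  \<open>x\<close> and \<open>z\<close>. It is at most |z - x| times an increment of the indefinite
  integral of |r|, which tends to 0 although \<open>r\<close> is merely integrable.\<close>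

lemma second_antideriv_has_derivative:
  assumes r: "r absolutely_integrable_on {a..b}" and x: "x \<in> {a..b}"
  shows "(second_antideriv a b r has_real_derivative integral {a..x} r) (at x within {a..b})"
proof -
  define v where "v = second_antideriv a b r"
  define A where "A z = integral {a..z} (\<lambda>y. \<bar>r y\<bar>)" for z
  have ai: "(\<lambda>y. \<bar>r y\<bar>) integrable_on {a..b}" using r by (simp add: absolutely_integrable_on_def)
  have ri: "r integrable_on {a..b}" using r by (simp add: absolutely_integrable_on_def)
  have contA: "continuous_on {a..b} A"
    unfolding A_def by (rule indefinite_integral_continuous_1[OF ai])
  have int: "(\<lambda>y. max 0 (z - y) * r y) integrable_on {a..b}" for z
  proof -
    have "continuous_on {a..b} (\<lambda>y. max 0 (z - y))" by (intro continuous_intros)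
    from absolutely_integrable_continuous_mult[OF this r] show ?thesis
      by (simp add: absolutely_integrable_on_def)
  qed
  have bound: "\<bar>v z - v x - (z - x) * integral {a..x} r\<bar> \<le> \<bar>z - x\<bar> * \<bar>A z - A x\<bar>" if z: "z \<in> {a..b}" for z
  proof -
    define p where "p = min x z"
    define q where "q = max x z"
    have pq: "a \<le> p" "p \<le> q" "q \<le> b" using x z by (auto simp: p_def q_def)
    have Apq: "\<bar>A z - A x\<bar> = integral {p..q} (\<lambda>y. \<bar>r y\<bar>)"
    proof -
      have "(\<lambda>y. \<bar>r y\<bar>) integrable_on {a..q}" using ai pq by (meson atLeastatMost_subset_iff integrable_on_subinterval order_refl)
      then have "A q - A p = integral {p..q} (\<lambda>y. \<bar>r y\<bar>)"
        unfolding A_def using Henstock_Kurzweil_Integration.integral_combine[of a p q "\<lambda>y. \<bar>r y\<bar>"] pq by simp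
      moreover have "0 \<le> integral {p..q} (\<lambda>y. \<bar>r y\<bar>)"
        using ai pq by (intro Henstock_Kurzweil_Integration.integral_nonneg) (meson atLeastatMost_subset_iff integrable_on_subinterval, auto)
      ultimately show ?thesis unfolding p_def q_def by (auto simp: min_def max_def split: if_splits)
    qed
    let ?k = "\<lambda>y. max 0 (z - y) * r y - max 0 (x - y) * r y - (z - x) * (if y \<in> {a..x} then r y else 0)"
    have rx: "((\<lambda>y. if y \<in> {a..x} then r y else 0) has_integral integral {a..x} r) {a..b}"
    proof -
      have "r integrable_on {a..x}" using ri x by (meson atLeastAtMost_iff atLeastatMost_subset_iff integrable_on_subinterval order_refl)
      then show ?thesis using x by (subst has_integral_restrict) (auto intro: integrable_integral)
    qed
    have k: "(?k has_integral (v z - v x - (z - x) * integral {a..x} r)) {a..b}"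
      unfolding v_def second_antideriv_def
      by (intro has_integral_diff has_integral_mult_right rx integrable_integral int)
    have m: "((\<lambda>y. \<bar>z - x\<bar> * (if y \<in> {p..q} then \<bar>r y\<bar> else 0)) has_integral (\<bar>z - x\<bar> * integral {p..q} (\<lambda>y. \<bar>r y\<bar>))) {a..b}"
    proof (intro has_integral_mult_right)
      have "(\<lambda>y. \<bar>r y\<bar>) integrable_on {p..q}" using ai pq by (meson atLeastatMost_subset_iff integrable_on_subinterval)
      then show "((\<lambda>y. if y \<in> {p..q} then \<bar>r y\<bar> else 0) has_integral integral {p..q} (\<lambda>y. \<bar>r y\<bar>)) {a..b}"
        using pq by (subst has_integral_restrict) (auto intro: integrable_integral)
    qed
    have "norm (integral {a..b} ?k) \<le> integral {a..b} (\<lambda>y. \<bar>z - x\<bar> * (if y \<in> {p..q} then \<bar>r y\<bar> else 0))"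
    proof (rule integral_norm_bound_integral)
      fix y assume y: "y \<in> {a..b}"
      have "?k y = (max 0 (z - y) - max 0 (x - y) - (z - x) * (if y \<le> x then 1 else 0)) * r y"
        using y by (auto simp: algebra_simps)
      moreover have "\<bar>max 0 (z - y) - max 0 (x - y) - (z - x) * (if y \<le> x then 1 else 0)\<bar>
         \<le> \<bar>z - x\<bar> * (if y \<in> {p..q} then 1 else 0)"
        unfolding p_def q_def by (auto simp: max_def min_def abs_if)
      ultimately have "norm (?k y) \<le> (\<bar>z - x\<bar> * (if y \<in> {p..q} then 1 else 0)) * \<bar>r y\<bar>"
        by (simp only: real_norm_def abs_mult) (rule mult_right_mono, auto)
      moreover have "(if c then 1 else 0) * R = (if c then R else 0)" for c and R :: real by simp
      ultimately show "norm (?k y) \<le> \<bar>z - x\<bar> * (if y \<in> {p..q} then \<bar>r y\<bar> else 0)" by (simp only: mult.assoc)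
    qed (use k m in auto)
    then show ?thesis
      unfolding integral_unique[OF k] integral_unique[OF m] Apq real_norm_def .
  qed
  show ?thesis
    unfolding v_def[symmetric] has_field_derivative_def has_derivative_within_alt
  proof (intro conjI allI impI)
    show "bounded_linear ((*) (integral {a..x} r))" by (rule bounded_linear_mult_right)
    fix e :: real assume "e > 0"
    then obtain d where "d > 0" and d: "\<And>z. z \<in> {a..b} \<Longrightarrow> \<bar>z - x\<bar> < d \<Longrightarrow> \<bar>A z - A x\<bar> < e"
      using contA x unfolding continuous_on_iff dist_real_def by blast
    show "\<exists>d>0. \<forall>y\<in>{a..b}. norm (y - x) < d \<longrightarrow>
        norm (v y - v x - integral {a..x} r * (y - x)) \<le> e * norm (y - x)"
    proof (intro exI[of _ d] conjI ballI impI \<open>d > 0\<close>)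
      fix y assume that: "y \<in> {a..b}" "norm (y - x) < d"
      have "\<bar>v y - v x - (y - x) * integral {a..x} r\<bar> \<le> \<bar>y - x\<bar> * \<bar>A y - A x\<bar>" by (rule bound[OF that(1)])
      also have "\<dots> \<le> \<bar>y - x\<bar> * e" using d[of y] that by (intro mult_left_mono) auto
      finally show "norm (v y - v x - integral {a..x} r * (y - x)) \<le> e * norm (y - x)" by (simp add: mult.commute)
    qed
  qed
qed

section \<open>Dyadic subdivisions of an interval and their difference forms\<close>

lemma tendsto_half_powers: "(\<lambda>n. c * (1 / 2) ^ n) \<longlonglongrightarrow> (0::real)"
  by (intro tendsto_mult_right_zero LIMSEQ_power_zero) simp

definition node :: "real \<Rightarrow> real \<Rightarrow> nat \<Rightarrow> nat \<Rightarrow> real" where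
  "node a b n k = a + (b - a) * real k / 2 ^ n"

text \<open>For \<open>a < b\<close> this is the integral of f' g' for the interpolants of
  \<open>f\<close> and \<open>g\<close> that are affine between the nodes; the factor
  \<open>2 ^ n / (b - a)\<close> is the inverse length of a cell.\<close>

definition dyadic_form :: "real \<Rightarrow> real \<Rightarrow> nat \<Rightarrow> (real \<Rightarrow> real) \<Rightarrow> (real \<Rightarrow> real) \<Rightarrow> real" where
  "dyadic_form a b n f g =
     (\<Sum>k<2 ^ n. (f (node a b n (Suc k)) - f (node a b n k)) * (g (node a b n (Suc k)) - g (node a b n k)))
       * 2 ^ n / (b - a)"

lemma node_0 [simp]: "node a b n 0 = a"
  by (simp add: node_def)

lemma node_top [simp]: "node a b n (2 ^ n) = b"
  by (simp add: node_def)

lemma node_Suc_double [simp]: "node a b (Suc n) (2 * k) = node a b n k"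
  by (simp add: node_def)

lemma node_Suc_Suc_double [simp]: "node a b (Suc n) (Suc (Suc (2 * k))) = node a b n (Suc k)"
  using node_Suc_double[of a b n "Suc k"] by simp

lemma node_diff: "node a b n (Suc k) - node a b n k = (b - a) / 2 ^ n"
  by (simp add: node_def field_simps)

lemma node_mono: "a \<le> b \<Longrightarrow> j \<le> k \<Longrightarrow> node a b n j \<le> node a b n k"
  unfolding node_def by (intro add_left_mono divide_right_mono mult_left_mono) auto

lemma node_mem: "a \<le> b \<Longrightarrow> k \<le> 2 ^ n \<Longrightarrow> node a b n k \<in> {a..b}"
  using node_mono[of a b 0 k n] node_mono[of a b k "2 ^ n" n] by auto

lemma node_strict_mono: "a < b \<Longrightarrow> j < k \<Longrightarrow> node a b n j < node a b n k"
  unfolding node_def by (intro add_strict_left_mono divide_strict_right_mono mult_strict_left_mono) auto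

lemma sum_lessThan_double: "(\<Sum>k<2 * m. h k) = (\<Sum>k<m. h (2 * k) + h (Suc (2 * k)) :: real)"
  by (induction m) (simp_all add: algebra_simps)

lemma dyadic_form_commute: "dyadic_form a b n f g = dyadic_form a b n g f"
  by (simp add: dyadic_form_def mult.commute)

lemma dyadic_form_add_right:
  "dyadic_form a b n f (\<lambda>x. g x + h x) = dyadic_form a b n f g + dyadic_form a b n f h"
proof -
  have "(\<Sum>k<2 ^ n. (f (node a b n (Suc k)) - f (node a b n k)) * (g (node a b n (Suc k)) + h (node a b n (Suc k)) - (g (node a b n k) + h (node a b n k))))
     = (\<Sum>k<2 ^ n. (f (node a b n (Suc k)) - f (node a b n k)) * (g (node a b n (Suc k)) - g (node a b n k)))
      + (\<Sum>k<2 ^ n. (f (node a b n (Suc k)) - f (node a b n k)) * (h (node a b n (Suc k)) - h (node a b n k)))"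
    unfolding sum.distrib[symmetric] by (intro sum.cong) (simp_all add: algebra_simps)
  then show ?thesis unfolding dyadic_form_def by (simp add: distrib_right add_divide_distrib)
qed

lemma dyadic_form_cmult_right:
  "dyadic_form a b n f (\<lambda>x. c * g x) = c * dyadic_form a b n f g"
proof -
  have "(\<Sum>k<2 ^ n. (f (node a b n (Suc k)) - f (node a b n k)) * (c * g (node a b n (Suc k)) - c * g (node a b n k)))
     = c * (\<Sum>k<2 ^ n. (f (node a b n (Suc k)) - f (node a b n k)) * (g (node a b n (Suc k)) - g (node a b n k)))"
    unfolding sum_distrib_left by (intro sum.cong) (simp_all add: algebra_simps)
  then show ?thesis unfolding dyadic_form_def by simp
qed

lemma dyadic_form_const_zero:
  assumes "a < b" "\<And>x. x \<in> {a..b} \<Longrightarrow> g x = g a"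
  shows "dyadic_form a b n f g = 0"
proof -
  have "g (node a b n k) = g a" if "k \<le> 2 ^ n" for k
    using assms(1) that by (intro assms(2) node_mem) auto
  then have "g (node a b n (Suc k)) - g (node a b n k) = 0" if "k < 2 ^ n" for k using that by simp
  then show ?thesis unfolding dyadic_form_def by simp
qed

lemma dyadic_form_nonneg: "a < b \<Longrightarrow> 0 \<le> dyadic_form a b n f f"
  unfolding dyadic_form_def by (intro divide_nonneg_pos mult_nonneg_nonneg[OF sum_nonneg] zero_le_square) auto

lemma dyadic_form_mono_contraction:
  assumes "a < b"
    and "\<And>s t. s \<in> {a..b} \<Longrightarrow> t \<in> {a..b} \<Longrightarrow> \<bar>g t - g s\<bar> \<le> \<bar>f t - f s\<bar>"
  shows "dyadic_form a b n g g \<le> dyadic_form a b n f f"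
  unfolding dyadic_form_def
proof (intro divide_right_mono mult_right_mono sum_mono)
  fix k assume "k \<in> {..<(2::nat) ^ n}"
  then have "node a b n (Suc k) \<in> {a..b}" "node a b n k \<in> {a..b}" using assms(1) by (intro node_mem; simp)+
  then have "\<bar>g (node a b n (Suc k)) - g (node a b n k)\<bar> \<le> \<bar>f (node a b n (Suc k)) - f (node a b n k)\<bar>"
    by (rule assms(2)[rotated])
  then show "(g (node a b n (Suc k)) - g (node a b n k)) * (g (node a b n (Suc k)) - g (node a b n k))
     \<le> (f (node a b n (Suc k)) - f (node a b n k)) * (f (node a b n (Suc k)) - f (node a b n k))"
    by (simp only: abs_le_square_iff power2_eq_square)
qed (use assms in auto)

text \<open>Follows from (x + y)^2 \<le> 2 (x^2 + y^2) on each halved cell, since halving the cells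
  doubles the factor in front of the sum.\<close>

lemma dyadic_form_Suc_ge:
  assumes "a < b"
  shows "dyadic_form a b n f f \<le> dyadic_form a b (Suc n) f f"
proof -
  let ?d = "\<lambda>n k. f (node a b n (Suc k)) - f (node a b n k)"
  have "(\<Sum>k<2 ^ n. ?d n k * ?d n k) \<le> (\<Sum>k<2 ^ n. 2 * (?d (Suc n) (2 * k) * ?d (Suc n) (2 * k) + ?d (Suc n) (Suc (2 * k)) * ?d (Suc n) (Suc (2 * k))))"
  proof (rule sum_mono)
    fix k
    have "?d n k = ?d (Suc n) (2 * k) + ?d (Suc n) (Suc (2 * k))" by simp
    moreover have "(x + y) * (x + y) \<le> 2 * (x * x + y * y)" for x y :: real
      using zero_le_square[of "x - y"] by (simp add: algebra_simps)
    ultimately show "?d n k * ?d n k \<le> 2 * (?d (Suc n) (2 * k) * ?d (Suc n) (2 * k) + ?d (Suc n) (Suc (2 * k)) * ?d (Suc n) (Suc (2 * k)))"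
      by (simp only:)
  qed
  also have "\<dots> = 2 * (\<Sum>k<2 ^ Suc n. ?d (Suc n) k * ?d (Suc n) k)"
    unfolding power_Suc sum_lessThan_double sum_distrib_left ..
  finally have "(\<Sum>k<2 ^ n. ?d n k * ?d n k) * 2 ^ n / (b - a) \<le> (2 * (\<Sum>k<2 ^ Suc n. ?d (Suc n) k * ?d (Suc n) k)) * 2 ^ n / (b - a)"
    using assms by (intro divide_right_mono mult_right_mono) auto
  then show ?thesis unfolding dyadic_form_def by (simp add: mult_ac)
qed

text \<open>If the new nodes lie on the chords of \<open>g\<close>, the increments of
  \<open>g\<close> are halved and those of \<open>f\<close> over the two halves simply add
  up.\<close>

lemma dyadic_form_Suc_eq:
  assumes g: "\<And>k. k < 2 ^ n \<Longrightarrow> 2 * g (node a b (Suc n) (Suc (2 * k))) = g (node a b n k) + g (node a b n (Suc k))"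
  shows "dyadic_form a b (Suc n) f g = dyadic_form a b n f g"
proof -
  let ?d = "\<lambda>f n k. f (node a b n (Suc k)) - f (node a b n k)"
  have "(\<Sum>k<2 ^ Suc n. ?d f (Suc n) k * ?d g (Suc n) k) =
     (\<Sum>k<2 ^ n. ?d f (Suc n) (2 * k) * ?d g (Suc n) (2 * k) + ?d f (Suc n) (Suc (2 * k)) * ?d g (Suc n) (Suc (2 * k)))"
    unfolding power_Suc sum_lessThan_double ..
  also have "\<dots> = (\<Sum>k<2 ^ n. ?d f n k * ?d g n k / 2)"
  proof (rule sum.cong)
    fix k assume "k \<in> {..<(2::nat) ^ n}"
    then have "2 * g (node a b (Suc n) (Suc (2 * k))) = g (node a b n k) + g (node a b n (Suc k))" using g by simp
    then have 1: "?d g (Suc n) (2 * k) = ?d g n k / 2" "?d g (Suc n) (Suc (2 * k)) = ?d g n k / 2"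
      by (simp_all del: node_Suc_double node_Suc_Suc_double add: node_Suc_double[of a b n k] node_Suc_Suc_double[of a b n k])
    have sum_d: "?d f (Suc n) (2 * k) + ?d f (Suc n) (Suc (2 * k)) = ?d f n k" by simp
    show "?d f (Suc n) (2 * k) * ?d g (Suc n) (2 * k) + ?d f (Suc n) (Suc (2 * k)) * ?d g (Suc n) (Suc (2 * k))
      = ?d f n k * ?d g n k / 2"
      unfolding 1 unfolding sum_d[symmetric] by (simp only: distrib_right add_divide_distrib times_divide_eq_right)
  qed simp
  also have "\<dots> = (\<Sum>k<2 ^ n. ?d f n k * ?d g n k) / 2" by (simp add: sum_divide_distrib)
  finally show ?thesis unfolding dyadic_form_def by simp
qed

lemma sum_integral_nodes:
  fixes h :: "real \<Rightarrow> real"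
  assumes "a < b" "h integrable_on {a..b}" "m \<le> 2 ^ n"
  shows "(\<Sum>k<m. integral {node a b n k..node a b n (Suc k)} h) = integral {a..node a b n m} h"
  using assms(3)
proof (induction m)
  case (Suc m)
  have "h integrable_on {a..node a b n (Suc m)}"
    using assms(2) node_mem[of a b "Suc m" n] assms(1) Suc.prems
    by (intro integrable_on_subinterval[OF assms(2)]) auto
  then have "integral {a..node a b n m} h + integral {node a b n m..node a b n (Suc m)} h = integral {a..node a b n (Suc m)} h"
    using assms(1) node_mono[of a b 0 m n] node_mono[of a b m "Suc m" n]
    by (intro Henstock_Kurzweil_Integration.integral_combine) auto
  then show ?case using Suc by simp
qed simp

text \<open>On each cell the mean value theorem gives two intermediate points, in general different
  ones for \<open>f\<close> and \<open>g\<close>; uniform continuity of both derivatives moves them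
  to a common point.\<close>

lemma dyadic_form_tendsto_integral:
  assumes "a < b"
    and f: "\<And>x. x \<in> {a..b} \<Longrightarrow> (f has_real_derivative f' x) (at x within {a..b})" and f': "continuous_on {a..b} f'"
    and g: "\<And>x. x \<in> {a..b} \<Longrightarrow> (g has_real_derivative g' x) (at x within {a..b})" and g': "continuous_on {a..b} g'"
  shows "(\<lambda>n. dyadic_form a b n f g) \<longlonglongrightarrow> integral {a..b} (\<lambda>x. f' x * g' x)"
proof -
  define h where "h x = f' x * g' x" for x
  have hc: "continuous_on {a..b} h" unfolding h_def using f' g' by (intro continuous_intros)
  have hi: "h integrable_on {a..b}" using hc by (rule integrable_continuous_real)
  obtain M where M: "M > 0" "\<And>x. x \<in> {a..b} \<Longrightarrow> \<bar>f' x\<bar> \<le> M" "\<And>x. x \<in> {a..b} \<Longrightarrow> \<bar>g' x\<bar> \<le> M"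
  proof -
    have "bounded (f' ` {a..b})" "bounded (g' ` {a..b})"
      using f' g' by (auto intro!: compact_imp_bounded compact_continuous_image)
    then obtain M1 M2 where "\<forall>y\<in>f' ` {a..b}. norm y \<le> M1" "\<forall>y\<in>g' ` {a..b}. norm y \<le> M2"
      unfolding bounded_iff by auto
    then show thesis by (intro that[of "max 1 (max M1 M2)"]) (fastforce simp: le_max_iff_disj)+
  qed
  have uc: "uniformly_continuous_on {a..b} f'" "uniformly_continuous_on {a..b} g'"
    using f' g' by (auto intro: compact_uniformly_continuous)
  show ?thesis unfolding h_def[symmetric]
  proof (rule LIMSEQ_I)
    fix e :: real assume "e > 0"
    \<comment> \<open>The error on a cell is at most \<open>2 * M * \<eta>\<close> times its length,
      so the total error is e / 2.\<close>
    define \<eta> where "\<eta> = e / (4 * M * (b - a))"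
    have \<eta>: "\<eta> > 0" using \<open>e > 0\<close> M(1) \<open>a < b\<close> by (simp add: \<eta>_def)
    obtain d1 where d1: "d1 > 0" "\<And>x y. x \<in> {a..b} \<Longrightarrow> y \<in> {a..b} \<Longrightarrow> \<bar>y - x\<bar> < d1 \<Longrightarrow> \<bar>f' y - f' x\<bar> < \<eta>"
      using uc(1) \<eta> unfolding uniformly_continuous_on_def dist_real_def by metis
    obtain d2 where d2: "d2 > 0" "\<And>x y. x \<in> {a..b} \<Longrightarrow> y \<in> {a..b} \<Longrightarrow> \<bar>y - x\<bar> < d2 \<Longrightarrow> \<bar>g' y - g' x\<bar> < \<eta>"
      using uc(2) \<eta> unfolding uniformly_continuous_on_def dist_real_def by metis
    have "\<forall>\<^sub>F n in sequentially. (b - a) * (1 / 2) ^ n < min d1 d2"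
      using d1(1) d2(1) by (intro order_tendstoD[OF tendsto_half_powers]) auto
    then obtain N where N: "\<And>n. n \<ge> N \<Longrightarrow> (b - a) / 2 ^ n < min d1 d2"
      by (auto simp: eventually_sequentially power_divide)
    show "\<exists>N. \<forall>n\<ge>N. norm (dyadic_form a b n f g - integral {a..b} h) < e"
    proof (intro exI[of _ N] allI impI)
      fix n assume "n \<ge> N"
      define \<delta> where "\<delta> = (b - a) / 2 ^ n"
      have \<delta>: "\<delta> > 0" "\<delta> < d1" "\<delta> < d2" using N[OF \<open>n \<ge> N\<close>] \<open>a < b\<close> by (auto simp: \<delta>_def)
      let ?x = "\<lambda>k. node a b n k"
      have cell: "\<bar>(f (?x (Suc k)) - f (?x k)) * (g (?x (Suc k)) - g (?x k)) / \<delta> - integral {?x k..?x (Suc k)} h\<bar> \<le> 2 * M * \<eta> * \<delta>"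
        if "k < 2 ^ n" for k
      proof -
        have sub: "{?x k..?x (Suc k)} \<subseteq> {a..b}" using node_mem[of a b k n] node_mem[of a b "Suc k" n] that \<open>a < b\<close> by auto
        have len: "?x (Suc k) - ?x k = \<delta>" unfolding \<delta>_def by (rule node_diff)
        have lt: "?x k < ?x (Suc k)" using len \<delta> by simp
        have "\<exists>z\<in>{?x k<..<?x (Suc k)}. f (?x (Suc k)) - f (?x k) = f' z * (?x (Suc k) - ?x k)"
        proof (rule mvt_simple[OF lt])
          fix z assume "?x k \<le> z" "z \<le> ?x (Suc k)"
          then have "z \<in> {a..b}" using sub by auto
          from has_field_derivative_subset[OF f[OF this] sub]
          show "(f has_derivative (*) (f' z)) (at z within {?x k..?x (Suc k)})"
            by (simp add: has_field_derivative_def)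
        qed
        then obtain \<xi> where \<xi>: "\<xi> \<in> {?x k<..<?x (Suc k)}" "f (?x (Suc k)) - f (?x k) = f' \<xi> * \<delta>"
          unfolding len by blast
        have "\<exists>z\<in>{?x k<..<?x (Suc k)}. g (?x (Suc k)) - g (?x k) = g' z * (?x (Suc k) - ?x k)"
        proof (rule mvt_simple[OF lt])
          fix z assume "?x k \<le> z" "z \<le> ?x (Suc k)"
          then have "z \<in> {a..b}" using sub by auto
          from has_field_derivative_subset[OF g[OF this] sub]
          show "(g has_derivative (*) (g' z)) (at z within {?x k..?x (Suc k)})"
            by (simp add: has_field_derivative_def)
        qed
        then obtain \<zeta> where \<zeta>: "\<zeta> \<in> {?x k<..<?x (Suc k)}" "g (?x (Suc k)) - g (?x k) = g' \<zeta> * \<delta>"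
          unfolding len by blast
        have eq: "(f (?x (Suc k)) - f (?x k)) * (g (?x (Suc k)) - g (?x k)) / \<delta> = integral {?x k..?x (Suc k)} (\<lambda>_. f' \<xi> * g' \<zeta>)"
          using \<delta> len lt unfolding \<xi>(2) \<zeta>(2) by simp
        have hi': "h integrable_on {?x k..?x (Suc k)}" using hi sub by (rule integrable_on_subinterval)
        have "norm (integral {?x k..?x (Suc k)} (\<lambda>y. f' \<xi> * g' \<zeta> - h y)) \<le> integral {?x k..?x (Suc k)} (\<lambda>_. 2 * M * \<eta>)"
        proof (rule integral_norm_bound_integral)
          show "(\<lambda>y. f' \<xi> * g' \<zeta> - h y) integrable_on {?x k..?x (Suc k)}" using hi' by (intro integrable_diff) auto
          fix y assume y: "y \<in> {?x k..?x (Suc k)}"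
          have mem: "\<xi> \<in> {a..b}" "\<zeta> \<in> {a..b}" "y \<in> {a..b}" using \<xi>(1) \<zeta>(1) y sub by auto
          have close: "\<bar>\<xi> - y\<bar> < d1" "\<bar>\<zeta> - y\<bar> < d2" using \<xi>(1) \<zeta>(1) y \<delta> len by auto
          have "f' \<xi> * g' \<zeta> - h y = (f' \<xi> - f' y) * g' \<zeta> + f' y * (g' \<zeta> - g' y)" by (simp add: h_def algebra_simps)
          also have "\<bar>\<dots>\<bar> \<le> \<bar>f' \<xi> - f' y\<bar> * \<bar>g' \<zeta>\<bar> + \<bar>f' y\<bar> * \<bar>g' \<zeta> - g' y\<bar>"
            by (rule order_trans[OF abs_triangle_ineq]) (simp add: abs_mult)
          also have "\<dots> \<le> \<eta> * M + M * \<eta>"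
            by (rule add_mono; rule mult_mono)
               (use less_imp_le[OF d1(2)[OF mem(3,1) close(1)]] less_imp_le[OF d2(2)[OF mem(3,2) close(2)]]
                  M(1) M(2)[OF mem(3)] M(3)[OF mem(2)] \<eta> in \<open>assumption | simp\<close>)+
          finally show "norm (f' \<xi> * g' \<zeta> - h y) \<le> 2 * M * \<eta>" by (simp add: algebra_simps)
        qed auto
        also have "\<dots> = 2 * M * \<eta> * \<delta>" using len lt by simp
        finally show ?thesis
          unfolding eq by (subst (asm) Henstock_Kurzweil_Integration.integral_diff) (use hi' in auto)
      qed
      have "dyadic_form a b n f g = (\<Sum>k<2 ^ n. (f (?x (Suc k)) - f (?x k)) * (g (?x (Suc k)) - g (?x k)) / \<delta>)"
        unfolding dyadic_form_def \<delta>_def by (simp add: sum_divide_distrib sum_distrib_right)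
      moreover have "integral {a..b} h = (\<Sum>k<2 ^ n. integral {?x k..?x (Suc k)} h)"
        using sum_integral_nodes[OF \<open>a < b\<close> hi, of "2 ^ n" n] by simp
      ultimately have "\<bar>dyadic_form a b n f g - integral {a..b} h\<bar>
         \<le> (\<Sum>k<2 ^ n. \<bar>(f (?x (Suc k)) - f (?x k)) * (g (?x (Suc k)) - g (?x k)) / \<delta> - integral {?x k..?x (Suc k)} h\<bar>)"
        by (simp only: sum_subtractf[symmetric] sum_abs)
      also have "\<dots> \<le> (\<Sum>k<(2::nat) ^ n. 2 * M * \<eta> * \<delta>)" by (intro sum_mono cell) auto
      also have "\<dots> = 2 * M * \<eta> * (b - a)" by (simp add: \<delta>_def)
      also have "\<dots> = e / 2" using M(1) \<open>a < b\<close> by (simp add: \<eta>_def field_simps)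
      finally show "norm (dyadic_form a b n f g - integral {a..b} h) < e" using \<open>e > 0\<close> by simp
    qed
  qed
qed

lemma continuous_eq_on_nodes:
  fixes f g :: "real \<Rightarrow> real"
  assumes "a < b" "continuous_on {a..b} f" "continuous_on {a..b} g"
    and eq: "\<And>n k. k \<le> 2 ^ n \<Longrightarrow> f (node a b n k) = g (node a b n k)" and x: "x \<in> {a..b}"
  shows "f x = g x"
proof -
  define k where "k n = nat \<lfloor>(x - a) / (b - a) * 2 ^ n\<rfloor>" for n
  define y where "y n = node a b n (k n)" for n
  have t: "0 \<le> (x - a) / (b - a)" "(x - a) / (b - a) \<le> 1" using x \<open>a < b\<close> by auto
  have k: "k n \<le> 2 ^ n" for n
  proof -
    have "(x - a) / (b - a) * 2 ^ n \<le> 1 * 2 ^ n" using t by (intro mult_right_mono) auto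
    then have "\<lfloor>(x - a) / (b - a) * 2 ^ n\<rfloor> \<le> 2 ^ n" by (simp add: floor_le_iff)
    then show ?thesis unfolding k_def by (simp add: nat_le_iff)
  qed
  have close: "\<bar>y n - x\<bar> \<le> (b - a) * (1 / 2) ^ n" for n
  proof -
    have 1: "real (k n) \<le> (x - a) / (b - a) * 2 ^ n" "(x - a) / (b - a) * 2 ^ n \<le> real (k n) + 1"
    proof -
      have "0 \<le> (x - a) / (b - a) * 2 ^ n" using t(1) by (intro mult_nonneg_nonneg) auto
      then show "real (k n) \<le> (x - a) / (b - a) * 2 ^ n" "(x - a) / (b - a) * 2 ^ n \<le> real (k n) + 1"
        unfolding k_def by linarith+
    qed
    define s where "s = (x - a) / (b - a)"
    have xs: "x = a + (b - a) * s" using \<open>a < b\<close> by (simp add: s_def)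
    have "x - y n = (b - a) / 2 ^ n * (s * 2 ^ n - real (k n))"
      unfolding y_def node_def by (subst xs) (simp add: right_diff_distrib)
    then have "x - y n = (b - a) / 2 ^ n * ((x - a) / (b - a) * 2 ^ n - real (k n))"
      unfolding s_def .
    moreover have "\<bar>(b - a) / 2 ^ n * ((x - a) / (b - a) * 2 ^ n - real (k n))\<bar> \<le> (b - a) / 2 ^ n * 1"
      unfolding abs_mult using 1 \<open>a < b\<close> by (intro mult_mono) auto
    ultimately show ?thesis by (simp add: power_divide abs_minus_commute)
  qed
  have "(\<lambda>n. y n - x) \<longlonglongrightarrow> 0"
    by (rule Lim_null_comparison[OF _ tendsto_half_powers[of "b - a"]]) (use close in auto)
  then have y: "y \<longlonglongrightarrow> x" by (simp add: LIM_zero_iff)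
  have ym: "y n \<in> {a..b}" for n unfolding y_def using k \<open>a < b\<close> by (intro node_mem) auto
  have "(\<lambda>n. f (y n)) \<longlonglongrightarrow> f x" "(\<lambda>n. g (y n)) \<longlonglongrightarrow> g x"
    by (rule continuous_on_tendsto_compose[OF assms(2) y x always_eventually], use ym in blast)
       (rule continuous_on_tendsto_compose[OF assms(3) y x always_eventually], use ym in blast)
  moreover have "f (y n) = g (y n)" for n unfolding y_def by (rule eq[OF k])
  ultimately show ?thesis using LIMSEQ_unique[of "\<lambda>n. g (y n)" "f x" "g x"] by simp
qed

section \<open>Smooth functions on the line\<close>

text \<open>Level \<open>n\<close> says that the derivatives of orders 0 to \<open>n\<close> are
  differentiable, so there are \<open>n + 1\<close> derivatives. Recursion through the first
  derivative lets products and reciprocals be handled by induction.\<close>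

primrec times_differentiable :: "nat \<Rightarrow> real set \<Rightarrow> (real \<Rightarrow> real) \<Rightarrow> bool" where
  "times_differentiable 0 S f \<longleftrightarrow> (\<forall>x\<in>S. f field_differentiable at x)"
| "times_differentiable (Suc n) S f \<longleftrightarrow> (\<forall>x\<in>S. f field_differentiable at x) \<and> times_differentiable n S (deriv f)"

definition smooth_on :: "real set \<Rightarrow> (real \<Rightarrow> real) \<Rightarrow> bool" where
  "smooth_on S f \<longleftrightarrow> (\<forall>n. times_differentiable n S f)"

lemma times_differentiable_iff:
  "times_differentiable n S f \<longleftrightarrow> (\<forall>k\<le>n. \<forall>x\<in>S. (deriv ^^ k) f field_differentiable at x)"
proof (induction n arbitrary: f)
  case (Suc n)
  have "(\<forall>k\<le>Suc n. \<forall>x\<in>S. (deriv ^^ k) f field_differentiable at x) \<longleftrightarrow>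
     (\<forall>x\<in>S. f field_differentiable at x) \<and> (\<forall>k\<le>n. \<forall>x\<in>S. (deriv ^^ Suc k) f field_differentiable at x)"
    by (metis (no_types, lifting) Suc_le_mono funpow_0 le_0_eq linorder_linear not0_implies_Suc)
  then show ?case using Suc by (simp add: funpow_Suc_right del: funpow.simps)
qed simp

lemma smooth_on_iff: "smooth_on S f \<longleftrightarrow> (\<forall>n. \<forall>x\<in>S. (deriv ^^ n) f field_differentiable at x)"
  unfolding smooth_on_def times_differentiable_iff by blast

lemma times_differentiable_D: "times_differentiable n S f \<Longrightarrow> x \<in> S \<Longrightarrow> f field_differentiable at x"
  by (cases n) auto

lemma smooth_onD: "smooth_on S f \<Longrightarrow> x \<in> S \<Longrightarrow> f field_differentiable at x"
  unfolding smooth_on_def by (meson times_differentiable_D)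

lemma times_differentiable_mono: "times_differentiable n S f \<Longrightarrow> m \<le> n \<Longrightarrow> times_differentiable m S f"
  unfolding times_differentiable_iff by auto

lemma field_differentiable_cong_open:
  assumes "open S" "x \<in> S" "\<And>x. x \<in> S \<Longrightarrow> f x = g x" "f field_differentiable at x"
  shows "g field_differentiable at x"
proof -
  obtain D where "(f has_field_derivative D) (at x)" using assms(4) unfolding field_differentiable_def by blast
  then have "(g has_field_derivative D) (at x)"
    by (rule has_field_derivative_transform_within_open[OF _ assms(1-3)])
  then show ?thesis unfolding field_differentiable_def by blast
qed

lemma deriv_cong_open:
  assumes "open S" "x \<in> S" "\<And>x. x \<in> S \<Longrightarrow> f x = g x"
  shows "deriv f x = deriv g x"
  using assms by (intro deriv_cong_ev) (auto simp: eventually_nhds)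

lemma times_differentiable_cong:
  assumes "open S" "\<And>x. x \<in> S \<Longrightarrow> f x = g x" "times_differentiable n S f"
  shows "times_differentiable n S g"
  using assms(2,3)
proof (induction n arbitrary: f g)
  case 0
  then show ?case using field_differentiable_cong_open[OF assms(1), of _ f g] by auto
next
  case (Suc n)
  have "\<And>x. x \<in> S \<Longrightarrow> deriv f x = deriv g x"
    using deriv_cong_open[OF assms(1)] Suc.prems(1) by blast
  then have "times_differentiable n S (deriv g)" using Suc by auto
  then show ?case using Suc.prems field_differentiable_cong_open[OF assms(1), of _ f g] by auto
qed

lemma times_differentiable_const: "times_differentiable n S (\<lambda>_. c)"
  by (induction n arbitrary: c) (auto simp: field_differentiable_const)

lemma times_differentiable_add:
  assumes "open S" "times_differentiable n S f" "times_differentiable n S g"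
  shows "times_differentiable n S (\<lambda>x. f x + g x)"
  using assms(2,3)
proof (induction n arbitrary: f g)
  case 0
  then show ?case by (auto intro: field_differentiable_add)
next
  case (Suc n)
  then have fd: "f field_differentiable at x" "g field_differentiable at x" if "x \<in> S" for x using that by auto
  have "times_differentiable n S (\<lambda>x. deriv f x + deriv g x)" using Suc by auto
  then have "times_differentiable n S (deriv (\<lambda>x. f x + g x))"
    by (rule times_differentiable_cong[OF assms(1), rotated]) (simp add: fd deriv_add)
  then show ?case using fd by (auto intro: field_differentiable_add)
qed

lemma times_differentiable_mult:
  assumes "open S" "times_differentiable n S f" "times_differentiable n S g"
  shows "times_differentiable n S (\<lambda>x. f x * g x)"
  using assms(2,3)
proof (induction n arbitrary: f g)
  case 0
  then show ?case by (auto intro: field_differentiable_mult)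
next
  case (Suc n)
  then have fd: "f field_differentiable at x" "g field_differentiable at x" if "x \<in> S" for x using that by auto
  have "times_differentiable n S f" "times_differentiable n S g"
    using Suc.prems by (auto intro: times_differentiable_mono[of "Suc n"] simp del: times_differentiable.simps)
  then have "times_differentiable n S (\<lambda>x. f x * deriv g x + deriv f x * g x)"
    using Suc by (intro times_differentiable_add[OF assms(1)] Suc.IH) auto
  then have "times_differentiable n S (deriv (\<lambda>x. f x * g x))"
    by (rule times_differentiable_cong[OF assms(1), rotated]) (simp add: fd deriv_mult)
  then show ?case using fd by (auto intro: field_differentiable_mult)
qed

lemma times_differentiable_inverse:
  assumes "open S" "times_differentiable n S f" "\<And>x. x \<in> S \<Longrightarrow> f x \<noteq> 0"
  shows "times_differentiable n S (\<lambda>x. inverse (f x))"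
  using assms(2)
proof (induction n)
  case 0
  then show ?case using assms(3) by (auto intro: field_differentiable_inverse)
next
  case (Suc n)
  then have fd: "f field_differentiable at x" if "x \<in> S" for x using that by auto
  have "times_differentiable n S f"
    using Suc.prems by (auto intro: times_differentiable_mono[of "Suc n"] simp del: times_differentiable.simps)
  then have "times_differentiable n S (\<lambda>x. inverse (f x))" by (rule Suc.IH)
  then have "times_differentiable n S (\<lambda>x. (-1) * (deriv f x * (inverse (f x) * inverse (f x))))"
    using Suc.prems by (intro times_differentiable_mult[OF assms(1)] times_differentiable_const) auto
  then have "times_differentiable n S (deriv (\<lambda>x. inverse (f x)))"
  proof (rule times_differentiable_cong[OF assms(1), rotated])
    fix x assume x: "x \<in> S"
    have "((\<lambda>x. inverse (f x)) has_field_derivative - (inverse (f x) * deriv f x * inverse (f x))) (at x)"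
      using fd[OF x] assms(3)[OF x] by (intro DERIV_inverse') (auto simp: DERIV_deriv_iff_field_differentiable)
    from DERIV_imp_deriv[OF this]
    show "- 1 * (deriv f x * (inverse (f x) * inverse (f x))) = deriv (\<lambda>x. inverse (f x)) x" by simp
  qed
  then show ?case using fd assms(3) by (auto intro: field_differentiable_inverse)
qed

lemma times_differentiable_affine:
  assumes "times_differentiable n UNIV f"
  shows "times_differentiable n UNIV (\<lambda>x. f (c * x + d))"
  using assms
proof (induction n arbitrary: f)
  case 0
  have "(\<lambda>x. f (c * x + d)) field_differentiable at x" for x
  proof -
    have "((\<lambda>x. f (c * x + d)) has_field_derivative deriv f (c * x + d) * c) (at x)"
    proof (rule DERIV_chain2[of f])
      show "(f has_field_derivative deriv f (c * x + d)) (at (c * x + d))"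
        using 0 by (auto simp: DERIV_deriv_iff_field_differentiable)
      show "((\<lambda>x. c * x + d) has_field_derivative c) (at x)" by (auto intro!: derivative_eq_intros)
    qed
    then show ?thesis unfolding field_differentiable_def by blast
  qed
  then show ?case by simp
next
  case (Suc n)
  have der: "((\<lambda>x. f (c * x + d)) has_field_derivative deriv f (c * x + d) * c) (at x)" for x
  proof (rule DERIV_chain2[of f])
    show "(f has_field_derivative deriv f (c * x + d)) (at (c * x + d))"
      using Suc.prems by (auto simp: DERIV_deriv_iff_field_differentiable)
    show "((\<lambda>x. c * x + d) has_field_derivative c) (at x)" by (auto intro!: derivative_eq_intros)
  qed
  then have "deriv (\<lambda>x. f (c * x + d)) = (\<lambda>x. deriv f (c * x + d) * c)" by (intro ext DERIV_imp_deriv)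
  moreover have "times_differentiable n UNIV (\<lambda>x. deriv f (c * x + d) * c)"
    using Suc by (intro times_differentiable_mult times_differentiable_const) auto
  ultimately show ?case using der by (auto simp: field_differentiable_def)
qed

lemma smooth_on_cong: "open S \<Longrightarrow> (\<And>x. x \<in> S \<Longrightarrow> f x = g x) \<Longrightarrow> smooth_on S f \<Longrightarrow> smooth_on S g"
  unfolding smooth_on_def using times_differentiable_cong by blast

lemma smooth_on_const: "smooth_on S (\<lambda>_. c)"
  unfolding smooth_on_def using times_differentiable_const by blast

lemma smooth_on_add: "open S \<Longrightarrow> smooth_on S f \<Longrightarrow> smooth_on S g \<Longrightarrow> smooth_on S (\<lambda>x. f x + g x)"
  unfolding smooth_on_def using times_differentiable_add by blast

lemma smooth_on_mult: "open S \<Longrightarrow> smooth_on S f \<Longrightarrow> smooth_on S g \<Longrightarrow> smooth_on S (\<lambda>x. f x * g x)"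
  unfolding smooth_on_def using times_differentiable_mult by blast

lemma smooth_on_affine: "smooth_on UNIV f \<Longrightarrow> smooth_on UNIV (\<lambda>x. f (c * x + d))"
  unfolding smooth_on_def using times_differentiable_affine by blast

lemma times_differentiable_subset: "times_differentiable n T f \<Longrightarrow> S \<subseteq> T \<Longrightarrow> times_differentiable n S f"
  unfolding times_differentiable_iff by blast

lemma smooth_on_subset: "smooth_on T f \<Longrightarrow> S \<subseteq> T \<Longrightarrow> smooth_on S f"
  unfolding smooth_on_def using times_differentiable_subset by blast

lemma smooth_on_locally:
  assumes "\<And>x. x \<in> S \<Longrightarrow> \<exists>T. open T \<and> x \<in> T \<and> smooth_on T f"
  shows "smooth_on S f"
  using assms unfolding smooth_on_iff by metis

text \<open>Class of functions closed under differentiation that contains \<open>exp (- 1 / x)\<close>.\<close>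
definition flat :: "real poly \<Rightarrow> real \<Rightarrow> real" where
  "flat P x = (if x > 0 then poly P (1 / x) * exp (- (1 / x)) else 0)"

lemma poly_div_exp_tendsto_0: "((\<lambda>t. poly P t * exp (- t)) \<longlongrightarrow> (0::real)) at_top"
proof -
  have "((\<lambda>t. \<Sum>i\<le>Polynomial.degree P. coeff P i * (t ^ i / exp t)) \<longlongrightarrow> (\<Sum>i\<le>Polynomial.degree P. coeff P i * 0)) at_top"
    by (intro tendsto_sum tendsto_mult tendsto_const tendsto_power_div_exp_0)
  moreover have "(\<lambda>t. \<Sum>i\<le>Polynomial.degree P. coeff P i * (t ^ i / exp t)) = (\<lambda>t. poly P t * exp (- t))"
    by (simp add: poly_altdef sum_distrib_right exp_minus divide_inverse mult.assoc)
  ultimately show ?thesis by simp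
qed

text \<open>With t = 1 / x the chain rule produces the factor t^2, the polynomial
  \<open>[:0, 0, 1:]\<close>. At 0 exponential decay beats every polynomial in t.\<close>

lemma flat_has_derivative:
  "(flat P has_real_derivative flat ([:0, 0, 1:] * (P - pderiv P)) x) (at x)"
proof -
  consider "x > 0" | "x < 0" | "x = 0" by linarith
  then show ?thesis
  proof cases
    case 1
    have "((\<lambda>x. poly P (1 / x) * exp (- (1 / x))) has_real_derivative
       poly ([:0, 0, 1:] * (P - pderiv P)) (1 / x) * exp (- (1 / x))) (at x)"
      using 1 by (auto intro!: derivative_eq_intros poly_DERIV[THEN DERIV_chain2] simp: field_simps power2_eq_square)
    then have "((\<lambda>x. poly P (1 / x) * exp (- (1 / x))) has_real_derivative
       flat ([:0, 0, 1:] * (P - pderiv P)) x) (at x)" using 1 by (simp add: flat_def)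
    then show ?thesis
      by (rule has_field_derivative_transform_within_open[of _ _ _ "{0<..}"]) (use 1 in \<open>auto simp: flat_def\<close>)
  next
    case 2
    have "((\<lambda>x. 0) has_real_derivative flat ([:0, 0, 1:] * (P - pderiv P)) x) (at x)"
      using 2 by (simp add: flat_def)
    then show ?thesis
      by (rule has_field_derivative_transform_within_open[of _ _ _ "{..<0}"]) (use 2 in \<open>auto simp: flat_def\<close>)
  next
    case 3
    have "((\<lambda>h. flat P h / h) \<longlongrightarrow> 0) (at 0)"
      unfolding filterlim_at_split
    proof
      show "((\<lambda>h. flat P h / h) \<longlongrightarrow> 0) (at_left 0)"
        by (rule tendsto_eventually) (auto simp: eventually_at_filter flat_def)
      \<comment> \<open>Division by \<open>h\<close> is multiplication by t, which raises
        \<open>P\<close> to \<open>pCons 0 P\<close>.\<close>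
      have "((\<lambda>h. poly (pCons 0 P) (inverse h) * exp (- inverse h)) \<longlongrightarrow> 0) (at_right 0)"
        by (rule filterlim_compose[OF poly_div_exp_tendsto_0 filterlim_inverse_at_top_right])
      then show "((\<lambda>h. flat P h / h) \<longlongrightarrow> 0) (at_right 0)"
        by (rule Lim_transform_eventually)
          (auto simp: eventually_at_filter flat_def divide_inverse)
    qed
    then show ?thesis unfolding 3 DERIV_def by (simp add: flat_def)
  qed
qed

lemma smooth_on_flat: "smooth_on UNIV (flat P)"
proof -
  have d: "deriv (flat P) = flat ([:0, 0, 1:] * (P - pderiv P))" for P
    by (intro ext DERIV_imp_deriv flat_has_derivative)
  have "times_differentiable n UNIV (flat P)" for n
  proof (induction n arbitrary: P)
    case 0 then show ?case using flat_has_derivative by (auto simp: field_differentiable_def)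
  next
    case (Suc n) then show ?case using flat_has_derivative unfolding times_differentiable.simps d
      by (auto simp: field_differentiable_def)
  qed
  then show ?thesis by (simp add: smooth_on_def)
qed

text \<open>The quotient of flat(x) by flat(x) + flat(1 - x); the denominator is positive because x
  and 1 - x are never both nonpositive.\<close>

lemma smooth_step:
  obtains s :: "real \<Rightarrow> real" where "smooth_on UNIV s" "\<And>x. x \<le> 0 \<Longrightarrow> s x = 0" "\<And>x. 1 \<le> x \<Longrightarrow> s x = 1"
proof
  define d where "d x = flat 1 x + flat 1 ((-1) * x + 1)" for x
  have pos: "d x > 0" for x unfolding d_def flat_def by (auto intro: add_pos_pos)
  have "smooth_on UNIV d" unfolding d_def by (intro smooth_on_add smooth_on_affine smooth_on_flat) auto
  then have "smooth_on UNIV (\<lambda>x. inverse (d x))"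
    unfolding smooth_on_def using times_differentiable_inverse[of UNIV _ d] pos by (metis less_irrefl open_UNIV)
  then show "smooth_on UNIV (\<lambda>x. flat 1 x * inverse (d x))"
    by (intro smooth_on_mult smooth_on_flat) auto
  show "flat 1 x * inverse (d x) = 0" if "x \<le> 0" for x using that by (simp add: flat_def)
  show "flat 1 x * inverse (d x) = 1" if "1 \<le> x" for x
    using that pos[of x] by (auto simp: flat_def d_def)
qed

text \<open>The product of two steps that change on 1/3 \<le> |r| \<le> 2/3. Evenness matters
  because the bump will be composed with a distance |x - c|, and an even function turns this into a
  smooth function of x - c.\<close>

lemma smooth_bump:
  obtains B :: "real \<Rightarrow> real" where "smooth_on UNIV B" "\<And>r. \<bar>r\<bar> \<le> 1/3 \<Longrightarrow> B r = 1" "\<And>r. 2/3 \<le> \<bar>r\<bar> \<Longrightarrow> B r = 0"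
    "\<And>r. B (- r) = B r"
proof -
  obtain s :: "real \<Rightarrow> real" where s: "smooth_on UNIV s" "\<And>x. x \<le> 0 \<Longrightarrow> s x = 0" "\<And>x. 1 \<le> x \<Longrightarrow> s x = 1"
    by (rule smooth_step) (rule that)
  show thesis
  proof
    show "smooth_on UNIV (\<lambda>r. s ((-3) * r + 2) * s (3 * r + 2))"
      by (intro smooth_on_mult smooth_on_affine s) auto
    show "s ((-3) * r + 2) * s (3 * r + 2) = 1" if "\<bar>r\<bar> \<le> 1/3" for r using that by (simp add: s(3))
    show "s ((-3) * r + 2) * s (3 * r + 2) = 0" if "2/3 \<le> \<bar>r\<bar>" for r
      using that by (cases "r \<ge> 0") (auto simp: s(2))
    show "s ((-3) * (- r) + 2) * s (3 * (- r) + 2) = s ((-3) * r + 2) * s (3 * r + 2)" for r by simp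
  qed
qed

section \<open>Signed measures on spaces with a base of clopen sets\<close>

lemma clopen_in_Diff: "clopen_in B C \<Longrightarrow> clopen_in B (B - C)"
  unfolding clopen_in_def using openin_diff[of "top_of_set B" B C] closedin_diff[of "top_of_set B" B C] by simp

lemma clopen_in_Int: "clopen_in B C \<Longrightarrow> clopen_in B C' \<Longrightarrow> clopen_in B (C \<inter> C')"
  unfolding clopen_in_def by (simp add: openin_Int closedin_Int)

lemma clopen_in_Un: "clopen_in B C \<Longrightarrow> clopen_in B C' \<Longrightarrow> clopen_in B (C \<union> C')"
  unfolding clopen_in_def by (simp add: openin_Un closedin_Un)

lemma clopen_in_subset: "clopen_in B C \<Longrightarrow> C \<subseteq> B"
  unfolding clopen_in_def using openin_subset by fastforce

lemma clopen_in_empty: "clopen_in B {}" and clopen_in_whole: "clopen_in B B"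
  unfolding clopen_in_def by auto

locale clopen_generated =
  fixes B :: "'x::metric_space set"
  assumes compact_B: "compact B"
    and generated: "sigma_sets B {C. clopen_in B C} = sets (restrict_space borel B)"
begin

abbreviation "\<B> \<equiv> sets (restrict_space borel B)"

lemma space_restrict_borel: "space (restrict_space borel B) = B"
  by (simp add: space_restrict_space)

interpretation \<B>: sigma_algebra B \<B>
  using sets.sigma_algebra_axioms[of "restrict_space borel B"] by (simp add: space_restrict_borel)

lemma clopen_in_sets: "clopen_in B C \<Longrightarrow> C \<in> \<B>"
  unfolding generated[symmetric] by auto

lemma clopen_compact: "clopen_in B C \<Longrightarrow> compact C"
  unfolding clopen_in_def using closedin_compact[OF compact_B] by blast

lemma algebra_clopen: "algebra B {C. clopen_in B C}"
  unfolding algebra_iff_Un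
  using clopen_in_subset clopen_in_empty clopen_in_Diff clopen_in_Un by blast

text \<open>Clopen sets are compact, so a decreasing sequence of them with empty intersection is
  eventually empty. Continuity at the empty set is therefore automatic, and Caratheodory's theorem
  applies to any additive content.\<close>

lemma content_extension:
  fixes p :: "'x set \<Rightarrow> real"
  assumes nonneg: "\<And>C. clopen_in B C \<Longrightarrow> 0 \<le> p C"
    and add: "\<And>C D. clopen_in B C \<Longrightarrow> clopen_in B D \<Longrightarrow> C \<inter> D = {} \<Longrightarrow> p (C \<union> D) = p C + p D"
  obtains M where "finite_measure M" "sets M = \<B>" "\<And>C. clopen_in B C \<Longrightarrow> measure M C = p C"
proof -
  interpret C: algebra B "{C. clopen_in B C}" by (rule algebra_clopen)
  have p0: "p {} = 0" using add[OF clopen_in_empty clopen_in_empty] by simp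
  have "\<exists>\<mu> :: 'x set \<Rightarrow> ennreal. (\<forall>s\<in>{C. clopen_in B C}. \<mu> s = ennreal (p s)) \<and>
      measure_space B (sigma_sets B {C. clopen_in B C}) \<mu>"
  proof (rule C.caratheodory_empty_continuous)
    show "positive {C. clopen_in B C} (\<lambda>s. ennreal (p s))" by (simp add: positive_def p0)
    show "additive {C. clopen_in B C} (\<lambda>s. ennreal (p s))"
      unfolding additive_def using add nonneg by (auto simp: ennreal_plus)
    fix A :: "nat \<Rightarrow> 'x set" assume A: "range A \<subseteq> {C. clopen_in B C}" "decseq A" "(\<Inter>i. A i) = {}"
    then have cl: "clopen_in B (A n)" for n by auto
    have "\<exists>n. A n = {}"
    proof (rule ccontr)
      assume ne: "\<not> (\<exists>n. A n = {})"
      have "B \<inter> (\<Inter>i\<in>UNIV. A i) \<noteq> {}"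
      proof (rule compact_imp_fip_image[OF compact_B compact_imp_closed[OF clopen_compact[OF cl]]])
        fix I :: "nat set" assume "finite I"
        then obtain n where n: "\<And>i. i \<in> I \<Longrightarrow> i \<le> n" unfolding finite_nat_set_iff_bounded_le by blast
        have "A n \<subseteq> (\<Inter>i\<in>I. A i)" using n A(2) unfolding decseq_def by blast
        moreover have "A n \<subseteq> B" by (rule clopen_in_subset[OF cl])
        ultimately show "B \<inter> (\<Inter>i\<in>I. A i) \<noteq> {}" using ne by blast
      qed
      then show False using A(3) by simp
    qed
    then obtain n where "A n = {}" by blast
    then have "A m = {}" if "n \<le> m" for m using A(2) that unfolding decseq_def by blast
    then have "\<forall>\<^sub>F m in sequentially. ennreal (p (A m)) = 0"
      unfolding eventually_sequentially by (intro exI[of _ n]) (simp add: p0)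
    then show "(\<lambda>i. ennreal (p (A i))) \<longlonglongrightarrow> 0" by (rule tendsto_eventually)
  qed simp
  then obtain \<mu> :: "'x set \<Rightarrow> ennreal" where \<mu>: "\<forall>s\<in>{C. clopen_in B C}. \<mu> s = ennreal (p s)" "measure_space B \<B> \<mu>"
    unfolding generated by blast
  define M where "M = measure_of B \<B> \<mu>"
  have sM: "sets M = \<B>" unfolding M_def using \<B>.sets_measure_of_eq by simp
  have spM: "space M = B" using sets_eq_imp_space_eq[OF sM] by (simp add: space_restrict_borel)
  have em: "emeasure M C = ennreal (p C)" if "clopen_in B C" for C
  proof -
    have "emeasure M C = \<mu> C"
      using \<mu>(2) clopen_in_sets[OF that] sM unfolding M_def measure_space_def
      by (intro emeasure_measure_of_sigma) auto
    then show ?thesis using \<mu>(1) that by simp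
  qed
  show thesis
  proof (rule that[OF _ sM])
    show "finite_measure M" by (rule finite_measureI) (simp add: spM em[OF clopen_in_whole])
    show "measure M C = p C" if "clopen_in B C" for C
      using em[OF that] nonneg[OF that] by (simp add: measure_def)
  qed
qed

text \<open>The sets with this property form a sigma-algebra that contains the clopen sets.
  Approximating the complement at the same time makes the property symmetric, so that complements
  are immediate.\<close>

lemma inner_outer_compact:
  assumes M: "finite_measure M" "sets M = \<B>" and A: "A \<in> \<B>" and "0 < (\<epsilon>::real)"
  shows "\<exists>K K'. compact K \<and> K \<subseteq> A \<and> compact K' \<and> K' \<subseteq> B - A \<and> measure M (B - K - K') < \<epsilon>"
proof -
  interpret M: finite_measure M by fact
  have comp: "K \<in> \<B>" if "compact K" "K \<subseteq> B" for K
    using that compact_imp_closed unfolding sets_restrict_space by (metis borel_closed image_eqI inf.absorb2)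
  have "A \<in> sigma_sets B {C. clopen_in B C}" using A generated by simp
  then show ?thesis using \<open>0 < \<epsilon>\<close>
  proof (induction arbitrary: \<epsilon> rule: sigma_sets.induct)
    case (Basic C)
    then have "clopen_in B C" by simp
    then have "compact C" "compact (B - C)" "B - C - (B - C) = {}" using clopen_compact clopen_in_Diff by blast+
    then show ?case using Basic.prems by (intro exI[of _ C] exI[of _ "B - C"]) simp
  next
    case Empty
    then show ?case using compact_B by (intro exI[of _ "{}"] exI[of _ B]) simp
  next
    case (Compl A)
    then obtain K K' where "compact K" "K \<subseteq> A" "compact K'" "K' \<subseteq> B - A" "measure M (B - K - K') < \<epsilon>" by meson
    moreover have "B - K' - K = B - K - K'" by blast
    moreover have "A \<subseteq> B" using Compl.hyps sigma_sets_into_sp[of "{C. clopen_in B C}" B] clopen_in_subset by blast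
    ultimately show ?case by (intro exI[of _ K'] exI[of _ K]) auto
  next
    case (Union A)
    \<comment> \<open>These errors add up to \<open>\<epsilon> / 2\<close>; the other half pays for
      cutting off the union of the inner compact sets at a finite stage.\<close>
    have ex: "\<exists>KK. compact (fst KK) \<and> fst KK \<subseteq> A n \<and> compact (snd KK) \<and> snd KK \<subseteq> B - A n \<and>
      measure M (B - fst KK - snd KK) < (\<epsilon> / 2) * (1 / 2) ^ Suc n" for n
    proof -
      have "0 < (\<epsilon> / 2) * (1 / 2) ^ Suc n" using Union.prems by simp
      from Union.IH[OF this, of n] obtain K K' where "compact K" "K \<subseteq> A n" "compact K'" "K' \<subseteq> B - A n"
        "measure M (B - K - K') < (\<epsilon> / 2) * (1 / 2) ^ Suc n" by auto
      then show ?thesis by (intro exI[of _ "(K, K')"]) simp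
    qed
    define KK where "KK n = (SOME KK. compact (fst KK) \<and> fst KK \<subseteq> A n \<and> compact (snd KK) \<and> snd KK \<subseteq> B - A n \<and>
      measure M (B - fst KK - snd KK) < (\<epsilon> / 2) * (1 / 2) ^ Suc n)" for n
    define K where "K n = fst (KK n)" for n
    define K' where "K' n = snd (KK n)" for n
    have K: "compact (K n)" "K n \<subseteq> A n" "compact (K' n)" "K' n \<subseteq> B - A n" "measure M (B - K n - K' n) < (\<epsilon> / 2) * (1 / 2) ^ Suc n" for n
      using someI_ex[OF ex, of n] unfolding K_def K'_def KK_def[symmetric] by auto
    have AB: "A n \<subseteq> B" for n using Union.hyps sigma_sets_into_sp[of "{C. clopen_in B C}" B "A n"] clopen_in_subset by blast
    have Ks: "K n \<in> sets M" "K' n \<in> sets M" for n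
      using comp[OF K(1)] comp[OF K(3)] K(2,4) AB M(2) by blast+
    have Bs: "B \<in> sets M" using M(2) by simp
    define U where "U = (\<Union>n. K n)"
    have Us: "U \<in> sets M" unfolding U_def using Ks by auto
    define V where "V = (\<Union>n. B - K n - K' n)"
    have "(\<lambda>n. (\<epsilon> / 2) * (1 / 2) ^ Suc n) sums (\<epsilon> / 2)" using sums_mult[OF power_half_series, of "\<epsilon> / 2"] by simp
    then have Vsm: "summable (\<lambda>n. (\<epsilon> / 2) * (1 / 2) ^ Suc n)" "(\<Sum>n. (\<epsilon> / 2) * (1 / 2) ^ Suc n) = \<epsilon> / 2"
      by (simp_all only: sums_iff)
    have sm: "summable (\<lambda>n. measure M (B - K n - K' n))"
      by (rule summable_comparison_test'[OF Vsm(1), of 0]) (use K(5) less_imp_le in \<open>auto simp del: power_Suc\<close>)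
    have V: "measure M V \<le> \<epsilon> / 2"
    proof -
      have "measure M V \<le> (\<Sum>n. measure M (B - K n - K' n))"
        unfolding V_def using Ks Bs by (intro M.finite_measure_subadditive_countably sm) auto
      also have "\<dots> \<le> (\<Sum>n. (\<epsilon> / 2) * (1 / 2) ^ Suc n)"
        by (intro suminf_le sm Vsm(1) less_imp_le K(5))
      finally show ?thesis unfolding Vsm(2) .
    qed
    \<comment> \<open>\<open>U\<close> is a countable union of compact sets and need not be compact.
      Its finite stages are, and they exhaust it in measure. The intersection of the outer sets is
      compact as it stands.\<close>
    have "(\<lambda>n. measure M (U - (\<Union>i<n. K i))) \<longlonglongrightarrow> measure M (\<Inter>n. U - (\<Union>i<n. K i))"
    proof (rule M.finite_Lim_measure_decseq)
      show "range (\<lambda>n. U - (\<Union>i<n. K i)) \<subseteq> sets M" using Us Ks by auto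
      show "decseq (\<lambda>n. U - (\<Union>i<n. K i))" unfolding decseq_def by fastforce
    qed
    moreover have "(\<Inter>n. U - (\<Union>i<n. K i)) = {}" unfolding U_def by auto
    ultimately have "(\<lambda>n. measure M (U - (\<Union>i<n. K i))) \<longlonglongrightarrow> 0" by (simp only: measure_empty)
    then have "\<forall>\<^sub>F n in sequentially. measure M (U - (\<Union>i<n. K i)) < \<epsilon> / 2"
      using Union.prems by (intro order_tendstoD(2)[where a = "\<epsilon> / 2"]) auto
    then obtain n where n: "measure M (U - (\<Union>i<n. K i)) < \<epsilon> / 2" unfolding eventually_sequentially by blast
    have "measure M (B - (\<Union>i<n. K i) - (\<Inter>i. K' i)) \<le> measure M (V \<union> (U - (\<Union>i<n. K i)))"
      using Us Ks Bs by (intro M.finite_measure_mono) (auto simp: V_def U_def)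
    also have "\<dots> \<le> measure M V + measure M (U - (\<Union>i<n. K i))"
      using Us Ks Bs by (intro measure_Un_le) (auto simp: V_def)
    finally have "measure M (B - (\<Union>i<n. K i) - (\<Inter>i. K' i)) < \<epsilon>" using V n by linarith
    moreover have "compact (\<Union>i<n. K i)" using K(1) by (intro compact_UN) auto
    moreover have "compact (\<Inter>i. K' i)"
    proof -
      have "closed (\<Inter>i. K' i)" by (intro closed_INT ballI compact_imp_closed K(3))
      moreover have "K' 0 \<inter> (\<Inter>i. K' i) = (\<Inter>i. K' i)" by blast
      ultimately show ?thesis using compact_Int_closed[OF K(3)] by metis
    qed
    moreover have "(\<Union>i<n. K i) \<subseteq> (\<Union>i. A i)" "(\<Inter>i. K' i) \<subseteq> B - (\<Union>i. A i)" using K(2,4) by blast+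
    ultimately show ?case by blast
  qed
qed

lemma measure_difference_signed_radon:
  assumes M: "finite_measure M" "sets M = \<B>" and N: "finite_measure N" "sets N = \<B>"
  shows "(\<lambda>A. measure M A - measure N A) \<in> signed_radon_measures B"
  unfolding signed_radon_measures_def
proof (intro CollectI conjI allI impI ballI)
  interpret M: finite_measure M by fact
  interpret N: finite_measure N by fact
  fix A :: "nat \<Rightarrow> 'x set" assume "range A \<subseteq> \<B>" "disjoint_family A"
  then show "(\<lambda>n. measure M (A n) - measure N (A n)) sums (measure M (\<Union>n. A n) - measure N (\<Union>n. A n))"
    using M(2) N(2) by (intro sums_diff M.finite_measure_UNION N.finite_measure_UNION) auto
next
  interpret M: finite_measure M by fact
  interpret N: finite_measure N by fact
  fix A and \<epsilon> :: real assume A: "A \<in> \<B>" and "0 < \<epsilon>"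
  then have \<epsilon>: "0 < \<epsilon> / 2" by simp
  obtain K1 K1' where 1: "compact K1" "K1 \<subseteq> A" "K1' \<subseteq> B - A" "compact K1'" "measure M (B - K1 - K1') < \<epsilon> / 2"
    using inner_outer_compact[OF M A \<epsilon>] by blast
  obtain K2 K2' where 2: "compact K2" "K2 \<subseteq> A" "K2' \<subseteq> B - A" "compact K2'" "measure N (B - K2 - K2') < \<epsilon> / 2"
    using inner_outer_compact[OF N A \<epsilon>] by blast
  have AB: "A \<subseteq> B" using A \<B>.sets_into_space by blast
  have comp: "K \<in> \<B>" if "compact K" "K \<subseteq> B" for K
    using that compact_imp_closed unfolding sets_restrict_space by (metis borel_closed image_eqI inf.absorb2)
  show "\<exists>K. compact K \<and> K \<subseteq> A \<and> (\<forall>C\<in>\<B>. C \<subseteq> A - K \<longrightarrow> \<bar>measure M C - measure N C\<bar> < \<epsilon>)"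
  proof (intro exI[of _ "K1 \<union> K2"] conjI ballI impI)
    fix C assume C: "C \<in> \<B>" "C \<subseteq> A - (K1 \<union> K2)"
    have "measure M C \<le> measure M (B - K1 - K1')"
    proof (rule M.finite_measure_mono)
      show "C \<subseteq> B - K1 - K1'" using C 1 AB by blast
      have "K1 \<in> \<B>" "K1' \<in> \<B>" using 1 AB by (auto intro!: comp)
      then show "B - K1 - K1' \<in> sets M" using M(2) by auto
    qed
    moreover have "measure N C \<le> measure N (B - K2 - K2')"
    proof (rule N.finite_measure_mono)
      show "C \<subseteq> B - K2 - K2'" using C 2 AB by blast
      have "K2 \<in> \<B>" "K2' \<in> \<B>" using 2 AB by (auto intro!: comp)
      then show "B - K2 - K2' \<in> sets N" using N(2) by auto
    qed
    moreover have "0 \<le> measure M C" "0 \<le> measure N C" by simp_all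
    ultimately show "\<bar>measure M C - measure N C\<bar> < \<epsilon>" using 1(5) 2(5) by linarith
  qed (use 1 2 in auto)
qed

section \<open>Signed Radon measures: linear operations, uniqueness and pairing with finite-valued
  functions\<close>

lemma signed_radon_sums:
  "\<mu> \<in> signed_radon_measures B \<Longrightarrow> range A \<subseteq> \<B> \<Longrightarrow> disjoint_family A \<Longrightarrow> (\<lambda>n. \<mu> (A n)) sums \<mu> (\<Union>n. A n)"
  unfolding signed_radon_measures_def by blast

lemma signed_radon_empty:
  assumes "\<mu> \<in> signed_radon_measures B"
  shows "\<mu> {} = 0"
proof -
  have "(\<lambda>n::nat. \<mu> {}) sums \<mu> (\<Union>n::nat. {})"
    by (rule signed_radon_sums[OF assms]) (auto simp: disjoint_family_on_def)
  then show ?thesis using sums_summable summable_const_iff by blast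
qed

lemma signed_radon_Un:
  assumes \<mu>: "\<mu> \<in> signed_radon_measures B" and "A \<in> \<B>" "A' \<in> \<B>" "A \<inter> A' = {}"
  shows "\<mu> (A \<union> A') = \<mu> A + \<mu> A'"
proof -
  have "(\<lambda>n. \<mu> (binaryset A A' n)) sums \<mu> (\<Union>n. binaryset A A' n)"
    using assms(2-4) by (intro signed_radon_sums[OF \<mu>]) (auto simp: range_binaryset_eq disjoint_family_on_def binaryset_def)
  then show ?thesis
    using binaryset_sums[of \<mu> A A', OF signed_radon_empty[OF \<mu>]] sums_unique2 by (fastforce simp: UN_binaryset_eq)
qed

lemma signed_radon_add:
  assumes \<mu>: "\<mu> \<in> signed_radon_measures B" and \<nu>: "\<nu> \<in> signed_radon_measures B"
  shows "(\<lambda>A. \<mu> A + \<nu> A) \<in> signed_radon_measures B"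
  unfolding signed_radon_measures_def
proof (intro CollectI conjI allI impI ballI)
  fix A and \<epsilon> :: real assume A: "A \<in> \<B>" and "0 < \<epsilon>"
  then have "0 < \<epsilon> / 2" by simp
  with \<mu> A obtain K where K: "compact K" "K \<subseteq> A" "\<forall>C\<in>\<B>. C \<subseteq> A - K \<longrightarrow> \<bar>\<mu> C\<bar> < \<epsilon> / 2"
    unfolding signed_radon_measures_def by blast
  from \<nu> A \<open>0 < \<epsilon> / 2\<close> obtain K' where K': "compact K'" "K' \<subseteq> A" "\<forall>C\<in>\<B>. C \<subseteq> A - K' \<longrightarrow> \<bar>\<nu> C\<bar> < \<epsilon> / 2"
    unfolding signed_radon_measures_def by blast
  show "\<exists>K. compact K \<and> K \<subseteq> A \<and> (\<forall>C\<in>\<B>. C \<subseteq> A - K \<longrightarrow> \<bar>\<mu> C + \<nu> C\<bar> < \<epsilon>)"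
  proof (intro exI[of _ "K \<union> K'"] conjI ballI impI)
    fix C assume "C \<in> \<B>" "C \<subseteq> A - (K \<union> K')"
    then have "\<bar>\<mu> C\<bar> < \<epsilon> / 2" "\<bar>\<nu> C\<bar> < \<epsilon> / 2" using K(3) K'(3) by blast+
    then show "\<bar>\<mu> C + \<nu> C\<bar> < \<epsilon>" by linarith
  qed (use K K' in auto)
qed (intro sums_add signed_radon_sums \<mu> \<nu>)

lemma signed_radon_cmult:
  assumes \<mu>: "\<mu> \<in> signed_radon_measures B"
  shows "(\<lambda>A. c * \<mu> A) \<in> signed_radon_measures B"
  unfolding signed_radon_measures_def
proof (intro CollectI conjI allI impI ballI)
  fix A and \<epsilon> :: real assume A: "A \<in> \<B>" and "0 < \<epsilon>"
  then have "0 < \<epsilon> / (\<bar>c\<bar> + 1)" by simp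
  with \<mu> A obtain K where K: "compact K" "K \<subseteq> A" "\<forall>C\<in>\<B>. C \<subseteq> A - K \<longrightarrow> \<bar>\<mu> C\<bar> < \<epsilon> / (\<bar>c\<bar> + 1)"
    unfolding signed_radon_measures_def by blast
  show "\<exists>K. compact K \<and> K \<subseteq> A \<and> (\<forall>C\<in>\<B>. C \<subseteq> A - K \<longrightarrow> \<bar>c * \<mu> C\<bar> < \<epsilon>)"
  proof (intro exI[of _ K] conjI ballI impI K(1,2))
    fix C assume "C \<in> \<B>" "C \<subseteq> A - K"
    then have "\<bar>\<mu> C\<bar> * (\<bar>c\<bar> + 1) < \<epsilon>" using K(3) by (simp add: pos_less_divide_eq)
    moreover have "\<bar>c * \<mu> C\<bar> \<le> \<bar>\<mu> C\<bar> * (\<bar>c\<bar> + 1)" by (simp add: abs_mult algebra_simps)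
    ultimately show "\<bar>c * \<mu> C\<bar> < \<epsilon>" by linarith
  qed
qed (intro sums_mult signed_radon_sums \<mu>)

lemma signed_radon_sum:
  assumes "finite I" "\<And>i. i \<in> I \<Longrightarrow> \<mu> i \<in> signed_radon_measures B"
  shows "(\<lambda>A. \<Sum>i\<in>I. c i * \<mu> i A) \<in> signed_radon_measures B"
  using assms
proof (induction I rule: finite_induct)
  case empty
  show ?case unfolding signed_radon_measures_def by auto
next
  case (insert i I)
  then show ?case using signed_radon_add[OF signed_radon_cmult[of "\<mu> i" "c i"], of "\<lambda>A. \<Sum>i\<in>I. c i * \<mu> i A"] by simp
qed

text \<open>The pi-lambda theorem: clopen sets are stable under intersection, and complements are
  handled by additivity together with agreement on \<open>B\<close>. It identifies a measure
  obtained by choice with one that was constructed.\<close>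

lemma signed_radon_eqI:
  assumes \<mu>: "\<mu> \<in> signed_radon_measures B" and \<nu>: "\<nu> \<in> signed_radon_measures B"
    and eq: "\<And>C. clopen_in B C \<Longrightarrow> \<mu> C = \<nu> C" and A: "A \<in> \<B>"
  shows "\<mu> A = \<nu> A"
proof -
  have "Int_stable {C. clopen_in B C}" unfolding Int_stable_def using clopen_in_Int by auto
  moreover have "{C. clopen_in B C} \<subseteq> Pow B" using clopen_in_subset by blast
  moreover have "A \<in> sigma_sets B {C. clopen_in B C}" using A generated by simp
  ultimately show ?thesis
  proof (induction rule: sigma_sets_induct_disjoint)
    case (compl A)
    then have AB: "A \<in> \<B>" by (simp only: generated)
    then have "B - A \<in> \<B>" "A \<union> (B - A) = B" using \<B>.sets_into_space by auto
    then have "\<mu> B = \<mu> A + \<mu> (B - A)" "\<nu> B = \<nu> A + \<nu> (B - A)"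
      using signed_radon_Un[OF \<mu> AB, of "B - A"] signed_radon_Un[OF \<nu> AB, of "B - A"] by auto
    then show ?case using compl.IH eq[OF clopen_in_whole] by simp
  next
    case (union A)
    then have "range A \<subseteq> \<B>" by (simp only: generated)
    from signed_radon_sums[OF \<mu> this union.hyps(1)] signed_radon_sums[OF \<nu> this union.hyps(1)] union.IH
    show ?case by (simp add: sums_unique2)
  qed (use eq signed_radon_empty[OF \<mu>] signed_radon_empty[OF \<nu>] in auto)
qed

lemma integral_finite_valued:
  assumes M: "finite_measure M" "sets M = \<B>" and G: "finite (G ` B)" "\<And>c. {x \<in> B. G x = c} \<in> \<B>"
  shows "integral\<^sup>L M G = (\<Sum>c\<in>G ` B. c * measure M {x \<in> B. G x = c})"
proof -
  interpret M: finite_measure M by fact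
  have sp: "space M = B" using sets_eq_imp_space_eq[OF M(2)] by (simp add: space_restrict_borel)
  have "integral\<^sup>L M G = integral\<^sup>L M (\<lambda>x. \<Sum>c\<in>G ` B. c * indicator {x \<in> B. G x = c} x)"
  proof (rule Bochner_Integration.integral_cong[OF refl])
    fix x assume "x \<in> space M"
    then have "x \<in> B" using sp by simp
    then have "(\<Sum>c\<in>G ` B. c * indicator {x \<in> B. G x = c} x) = (\<Sum>c\<in>G ` B. if c = G x then c else 0)"
      by (intro sum.cong refl) (auto simp: indicator_def)
    then show "G x = (\<Sum>c\<in>G ` B. c * indicator {x \<in> B. G x = c} x)" using G(1) \<open>x \<in> B\<close> by simp
  qed
  also have "\<dots> = (\<Sum>c\<in>G ` B. integral\<^sup>L M (\<lambda>x. c * indicator {x \<in> B. G x = c} x))"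
    using G(2) M(2) by (intro Bochner_Integration.integral_sum integrable_mult_right M.integrable_const_bound[where B = 1]) auto
  also have "\<dots> = (\<Sum>c\<in>G ` B. c * measure M {x \<in> B. G x = c})"
    by (intro sum.cong refl) (auto simp: sp intro!: arg_cong[where f = "measure M"])
  finally show ?thesis .
qed

text \<open>Given a Hahn set \<open>Y\<close>, the supremum in \<open>positive_variation\<close> is
  attained at \<open>A \<inter> Y\<close>, which makes it countably additive. That
  \<open>ennreal\<close> sends negative values to 0 does no harm, since the maximum is
  nonnegative.\<close>

lemma positive_variation_Hahn:
  assumes \<mu>: "\<mu> \<in> signed_radon_measures B" and Y: "Y \<in> \<B>"
    and pos: "\<And>A. A \<in> \<B> \<Longrightarrow> A \<subseteq> Y \<Longrightarrow> 0 \<le> \<mu> A" and neg: "\<And>A. A \<in> \<B> \<Longrightarrow> A \<inter> Y = {} \<Longrightarrow> \<mu> A \<le> 0"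
  shows "finite_measure (positive_variation B \<mu>)" "sets (positive_variation B \<mu>) = \<B>"
    and "A \<in> \<B> \<Longrightarrow> measure (positive_variation B \<mu>) A = \<mu> (A \<inter> Y)"
proof -
  have le: "\<mu> C \<le> \<mu> (A \<inter> Y)" if A: "A \<in> \<B>" and C: "C \<in> \<B>" "C \<subseteq> A" for A C
  proof -
    have "\<mu> C = \<mu> (C \<inter> Y) + \<mu> (C - Y)"
      using signed_radon_Un[OF \<mu>, of "C \<inter> Y" "C - Y"] C(1) Y by (auto simp: Int_Diff_Un)
    also have "\<dots> \<le> \<mu> (C \<inter> Y) + \<mu> (A \<inter> Y - C)" using neg[of "C - Y"] pos[of "A \<inter> Y - C"] A C(1) Y by fastforce
    also have "\<dots> = \<mu> (C \<inter> Y \<union> (A \<inter> Y - C))" using A C(1) Y by (intro signed_radon_Un[OF \<mu>, symmetric]) auto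
    also have "C \<inter> Y \<union> (A \<inter> Y - C) = A \<inter> Y" using C(2) by blast
    finally show ?thesis .
  qed
  have sup: "(SUP C\<in>{C \<in> \<B>. C \<subseteq> A}. ennreal (\<mu> C)) = ennreal (\<mu> (A \<inter> Y))" if A: "A \<in> \<B>" for A
  proof (rule antisym)
    show "(SUP C\<in>{C \<in> \<B>. C \<subseteq> A}. ennreal (\<mu> C)) \<le> ennreal (\<mu> (A \<inter> Y))"
      by (intro SUP_least ennreal_leI le[OF A]) auto
    show "ennreal (\<mu> (A \<inter> Y)) \<le> (SUP C\<in>{C \<in> \<B>. C \<subseteq> A}. ennreal (\<mu> C))"
      using A Y by (intro SUP_upper) auto
  qed
  have meas: "measure_space B \<B> (\<lambda>A. SUP C\<in>{C \<in> \<B>. C \<subseteq> A}. ennreal (\<mu> C))"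
    unfolding measure_space_def
  proof (intro conjI \<B>.sigma_algebra_axioms)
    show "positive \<B> (\<lambda>A. SUP C\<in>{C \<in> \<B>. C \<subseteq> A}. ennreal (\<mu> C))"
      unfolding positive_def using sup[of "{}"] signed_radon_empty[OF \<mu>] by simp
    show "countably_additive \<B> (\<lambda>A. SUP C\<in>{C \<in> \<B>. C \<subseteq> A}. ennreal (\<mu> C))"
    proof (rule countably_additiveI)
      fix A :: "nat \<Rightarrow> 'x set" assume A: "range A \<subseteq> \<B>" "disjoint_family A" "(\<Union>i. A i) \<in> \<B>"
      then have AY: "A i \<inter> Y \<in> \<B>" for i using Y by blast
      have "(\<lambda>i. \<mu> (A i \<inter> Y)) sums \<mu> (\<Union>i. A i \<inter> Y)"
        using A AY by (intro signed_radon_sums[OF \<mu>]) (auto simp: disjoint_family_on_def)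
      then have "(\<Sum>i. ennreal (\<mu> (A i \<inter> Y))) = ennreal (\<mu> (\<Union>i. A i \<inter> Y))"
        using AY by (intro suminf_ennreal_eq pos) auto
      moreover have "(\<Union>i. A i \<inter> Y) = (\<Union>i. A i) \<inter> Y" by blast
      ultimately show "(\<Sum>i. SUP C\<in>{C \<in> \<B>. C \<subseteq> A i}. ennreal (\<mu> C)) = (SUP C\<in>{C \<in> \<B>. C \<subseteq> (\<Union>i. A i)}. ennreal (\<mu> C))"
        using A(1) sup[OF A(3)] sup[of "A _"] by (simp add: image_subset_iff)
    qed
  qed
  show sets: "sets (positive_variation B \<mu>) = \<B>"
    unfolding positive_variation_def using \<B>.sets_measure_of_eq by simp
  have em: "emeasure (positive_variation B \<mu>) A = ennreal (\<mu> (A \<inter> Y))" if A: "A \<in> \<B>" for A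
  proof -
    have "emeasure (positive_variation B \<mu>) A = (SUP C\<in>{C \<in> \<B>. C \<subseteq> A}. ennreal (\<mu> C))"
      using meas A unfolding positive_variation_def measure_space_def by (intro emeasure_measure_of_sigma) auto
    then show ?thesis using sup[OF A] by simp
  qed
  have "space (positive_variation B \<mu>) = B" using sets_eq_imp_space_eq[OF sets] by (simp add: space_restrict_borel)
  then show "finite_measure (positive_variation B \<mu>)" by (intro finite_measureI) (simp add: em)
  show "measure (positive_variation B \<mu>) A = \<mu> (A \<inter> Y)" if "A \<in> \<B>"
    using em[OF that] pos[of "A \<inter> Y"] that Y by (simp add: measure_def)
qed

text \<open>A representation of \<open>\<mu>\<close> as a difference of two finite measures gives a
  Hahn set, hence both parts of the Jordan decomposition; on each level set their values recombine
  to that of \<open>\<mu>\<close>.\<close>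

lemma pairing_finite_valued:
  assumes \<mu>: "\<mu> \<in> signed_radon_measures B"
    and M: "finite_measure M" "sets M = \<B>" and N: "finite_measure N" "sets N = \<B>"
    and eq: "\<And>A. A \<in> \<B> \<Longrightarrow> \<mu> A = measure M A - measure N A"
    and G: "finite (G ` B)" "\<And>c. {x \<in> B. G x = c} \<in> \<B>"
  shows "pairing B \<mu> G = (\<Sum>c\<in>G ` B. c * \<mu> {x \<in> B. G x = c})"
proof -
  interpret M: finite_measure M by fact
  interpret N: finite_measure N by fact
  obtain Y where Y: "Y \<in> \<B>" "\<forall>A\<in>\<B>. A \<subseteq> Y \<longrightarrow> emeasure N A \<le> emeasure M A" "\<forall>A\<in>\<B>. A \<inter> Y = {} \<longrightarrow> emeasure M A \<le> emeasure N A"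
    using finite_unsigned_Hahn_decomposition[OF M(1) N(1)] M(2) N(2) by auto
  have neg: "(\<lambda>A. - \<mu> A) \<in> signed_radon_measures B" using signed_radon_cmult[OF \<mu>, of "-1"] by simp
  have p: "0 \<le> \<mu> A" if "A \<in> \<B>" "A \<subseteq> Y" for A
    using Y(2) that eq[OF that(1)] by (simp add: M.emeasure_eq_measure N.emeasure_eq_measure)
  have n: "\<mu> A \<le> 0" if "A \<in> \<B>" "A \<inter> Y = {}" for A
    using Y(3) that eq[OF that(1)] by (simp add: M.emeasure_eq_measure N.emeasure_eq_measure)
  have BY: "B - Y \<in> \<B>" using Y(1) by auto
  have n1: "0 \<le> - \<mu> A" if "A \<in> \<B>" "A \<subseteq> B - Y" for A using n[of A] that by auto
  have n2: "- \<mu> A \<le> 0" if "A \<in> \<B>" "A \<inter> (B - Y) = {}" for A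
    using p[of A] that \<B>.sets_into_space[OF that(1)] by auto
  note P = positive_variation_Hahn[OF \<mu> Y(1)] and Q = positive_variation_Hahn[OF neg BY]
  have P1: "finite_measure (positive_variation B \<mu>)" "sets (positive_variation B \<mu>) = \<B>"
    "measure (positive_variation B \<mu>) A = \<mu> (A \<inter> Y)" if "A \<in> \<B>" for A
    by (rule P; use p n that in blast)+
  have Q1: "finite_measure (positive_variation B (\<lambda>A. - \<mu> A))" "sets (positive_variation B (\<lambda>A. - \<mu> A)) = \<B>"
    "measure (positive_variation B (\<lambda>A. - \<mu> A)) A = - \<mu> (A \<inter> (B - Y))" if "A \<in> \<B>" for A
    by (rule Q; use n1 n2 that in blast)+
  have split: "\<mu> A = \<mu> (A \<inter> Y) + \<mu> (A \<inter> (B - Y))" if "A \<in> \<B>" for A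
  proof -
    have "A \<inter> Y \<union> A \<inter> (B - Y) = A" using \<B>.sets_into_space[OF that] by blast
    then show ?thesis using signed_radon_Un[OF \<mu>, of "A \<inter> Y" "A \<inter> (B - Y)"] that Y(1) BY by auto
  qed
  show ?thesis
    unfolding pairing_def integral_finite_valued[OF P1(1,2)[OF Y(1)] G] integral_finite_valued[OF Q1(1,2)[OF Y(1)] G]
      P1(3)[OF G(2)] Q1(3)[OF G(2)] sum_subtractf[symmetric]
    by (intro sum.cong refl) (simp add: split[OF G(2)] algebra_simps)
qed

end

section \<open>Completed metric graphs\<close>

declare split_paired_All [simp del] split_paired_Ex [simp del]

locale completed_graph =
  fixes \<Gamma> :: "'v metric_graph" and \<iota> :: "'v graph_point \<Rightarrow> 'x::metric_space"
  assumes graph: "metric_graph \<Gamma>"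
    and conn: "connected_graph \<Gamma>"
    and completion: "is_completion \<Gamma> \<iota>"
    and wconn: "weakly_connected \<Gamma> \<iota>"
    and compact_X: "compact (completed \<Gamma> \<iota>)"
    and boundary_nonempty: "boundary \<Gamma> \<iota> \<noteq> {}"
begin

abbreviation "E \<equiv> edges \<Gamma>"
abbreviation "ep \<equiv> edge_point \<Gamma>"
abbreviation "X \<equiv> completed \<Gamma> \<iota>"
abbreviation "B \<equiv> boundary \<Gamma> \<iota>"
abbreviation "seg e \<equiv> {lo \<Gamma> e..hi \<Gamma> e}"

lemma lo_less_hi: "e \<in> E \<Longrightarrow> lo \<Gamma> e < hi \<Gamma> e"
  using graph by (auto simp: metric_graph_def)

lemma edge_verts: "e \<in> E \<Longrightarrow> fst e \<in> verts \<Gamma>" "e \<in> E \<Longrightarrow> snd e \<in> verts \<Gamma>" "e \<in> E \<Longrightarrow> fst e \<noteq> snd e"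
  using graph unfolding metric_graph_def by (cases e; auto)+

lemma finite_incident: "v \<in> verts \<Gamma> \<Longrightarrow> finite (incident \<Gamma> v)"
  using graph by (auto simp: metric_graph_def)

lemma countable_edges: "countable E"
  using graph unfolding metric_graph_def by (meson countable_SIGMA countable_subset)

lemma ep_lo [simp]: "ep e (lo \<Gamma> e) = Vertex (fst e)"
  by (simp add: edge_point_def)

lemma ep_hi: "e \<in> E \<Longrightarrow> ep e (hi \<Gamma> e) = Vertex (snd e)"
  using lo_less_hi[of e] by (simp add: edge_point_def)

lemma ep_inner: "lo \<Gamma> e < x \<Longrightarrow> x < hi \<Gamma> e \<Longrightarrow> ep e x = Inner e x"
  by (simp add: edge_point_def)

lemma ep_cases:
  assumes "e \<in> E" "x \<in> seg e"
  obtains "x = lo \<Gamma> e" "ep e x = Vertex (fst e)" | "x = hi \<Gamma> e" "ep e x = Vertex (snd e)"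
    | "lo \<Gamma> e < x" "x < hi \<Gamma> e" "ep e x = Inner e x"
  using assms ep_hi ep_inner by (cases "x = lo \<Gamma> e"; cases "x = hi \<Gamma> e") auto

lemma ep_vertexD: "e \<in> E \<Longrightarrow> x \<in> seg e \<Longrightarrow> ep e x = Vertex v \<Longrightarrow> (v = fst e \<and> x = lo \<Gamma> e) \<or> (v = snd e \<and> x = hi \<Gamma> e)"
  unfolding edge_point_def by (simp split: if_splits)

lemma ep_mem_points: "e \<in> E \<Longrightarrow> x \<in> seg e \<Longrightarrow> ep e x \<in> points \<Gamma>"
  by (rule ep_cases[of e x]; simp add: points_def edge_verts)

lemma ep_eq_same_edge:
  assumes "e \<in> E" "x \<in> seg e" "y \<in> seg e" "ep e x = ep e y"
  shows "x = y"
  using assms(4) edge_verts(3)[OF assms(1)] unfolding edge_point_def by (simp split: if_splits)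

lemma ep_eq_inner:
  assumes "e \<in> E" "lo \<Gamma> e < x" "x < hi \<Gamma> e" "e' \<in> E" "y \<in> seg e'" "ep e x = ep e' y"
  shows "e = e'" "x = y"
  using assms(6) ep_inner[OF assms(2,3)] unfolding edge_point_def by (simp_all split: if_splits)

lemma path_nonneg: "path_of_length \<Gamma> p d p' \<Longrightarrow> 0 \<le> d"
  by (induction rule: path_of_length.induct) auto

lemma graph_dist_le: "path_of_length \<Gamma> p d p' \<Longrightarrow> graph_dist \<Gamma> p p' \<le> d"
  unfolding graph_dist_def
  by (rule cInf_lower) (auto intro!: bdd_belowI[of _ 0] path_nonneg)

lemma dist_\<iota>: "p \<in> points \<Gamma> \<Longrightarrow> p' \<in> points \<Gamma> \<Longrightarrow> dist (\<iota> p) (\<iota> p') = graph_dist \<Gamma> p p'"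
  using completion by (auto simp: is_completion_def)

lemma lipschitz_path:
  assumes "path_of_length \<Gamma> p d p'"
    and "\<And>e s t. e \<in> E \<Longrightarrow> s \<in> seg e \<Longrightarrow> t \<in> seg e \<Longrightarrow> \<bar>g (ep e t) - g (ep e s)\<bar> \<le> K * \<bar>t - s\<bar>"
  shows "\<bar>g p' - g p\<bar> \<le> K * (d::real)"
  using assms(1)
proof (induction rule: path_of_length.induct)
  case (path_step p d e s t)
  then have "\<bar>g (ep e t) - g (ep e s)\<bar> \<le> K * \<bar>t - s\<bar>" using assms(2) by blast
  then show ?case using path_step.IH by (simp add: distrib_left)
qed simp

text \<open>A source of lower bounds for the path metric: a function that is Lipschitz along every
  edge is Lipschitz for the distance, because the estimate adds up along each path.\<close>

lemma lipschitz_dist: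
  assumes "p \<in> points \<Gamma>" "p' \<in> points \<Gamma>" "0 < K"
    and lip: "\<And>e s t. e \<in> E \<Longrightarrow> s \<in> seg e \<Longrightarrow> t \<in> seg e \<Longrightarrow> \<bar>g (ep e t) - g (ep e s)\<bar> \<le> K * \<bar>t - s\<bar>"
  shows "\<bar>g p' - g p\<bar> \<le> K * dist (\<iota> p) (\<iota> p')"
proof -
  have "\<bar>g p' - g p\<bar> / K \<le> graph_dist \<Gamma> p p'"
    unfolding graph_dist_def
  proof (rule cInf_greatest)
    show "{d. path_of_length \<Gamma> p d p'} \<noteq> {}" using conn assms(1,2) unfolding connected_graph_def by blast
    fix d assume "d \<in> {d. path_of_length \<Gamma> p d p'}"
    then have "\<bar>g p' - g p\<bar> \<le> K * d" using lipschitz_path[OF _ lip, of p d p'] by blast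
    then show "\<bar>g p' - g p\<bar> / K \<le> d" using \<open>0 < K\<close> by (simp add: field_simps)
  qed
  then show ?thesis using dist_\<iota>[OF assms(1,2)] \<open>0 < K\<close> by (simp add: field_simps)
qed

lemma dist_edge:
  assumes "e \<in> E" "s \<in> seg e" "t \<in> seg e"
  shows "dist (\<iota> (ep e s)) (\<iota> (ep e t)) \<le> \<bar>t - s\<bar>"
proof -
  have "path_of_length \<Gamma> (ep e s) (0 + \<bar>t - s\<bar>) (ep e t)"
    using assms by (intro path_step path_refl ep_mem_points)
  from graph_dist_le[OF this] show ?thesis using assms by (simp add: dist_\<iota> ep_mem_points)
qed

lemma graph_subset_X: "p \<in> points \<Gamma> \<Longrightarrow> \<iota> p \<in> X"
  unfolding completed_def graph_set_def by (rule subsetD[OF closure_subset]) (rule imageI)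

lemma ep_mem_X: "e \<in> E \<Longrightarrow> x \<in> seg e \<Longrightarrow> \<iota> (ep e x) \<in> X"
  by (intro graph_subset_X ep_mem_points)

lemma continuous_on_edge_map:
  assumes "e \<in> E"
  shows "continuous_on (seg e) (\<lambda>x. \<iota> (ep e x))"
proof (rule continuous_onI)
  fix s r :: real assume "s \<in> seg e" "0 < r"
  have "dist (\<iota> (ep e t)) (\<iota> (ep e s)) \<le> r" if "t \<in> seg e" "dist t s < r" for t
    using dist_edge[OF assms \<open>t \<in> seg e\<close> \<open>s \<in> seg e\<close>] that(2) by (simp add: dist_real_def abs_minus_commute)
  then show "\<exists>d>0. \<forall>t\<in>seg e. dist t s < d \<longrightarrow> dist (\<iota> (ep e t)) (\<iota> (ep e s)) \<le> r"
    using \<open>0 < r\<close> by (intro exI[of _ r]) simp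
qed

lemma continuous_on_edge:
  assumes "continuous_on X f" "e \<in> E"
  shows "continuous_on (seg e) (on_edge \<Gamma> \<iota> f e)"
  unfolding on_edge_def
  using ep_mem_X[OF assms(2)]
  by (intro continuous_on_compose2[OF assms(1) continuous_on_edge_map[OF assms(2)]]) blast

lemma closed_X: "closed X"
  by (simp add: completed_def)

lemma boundary_subset: "B \<subseteq> X"
  unfolding boundary_def using graph_subset_X by (auto simp: points_def)

text \<open>Only the one-point graph has an isolated vertex, and its boundary is empty.\<close>
lemma point_on_edge:
  assumes "p \<in> points \<Gamma>"
  shows "\<exists>e x. e \<in> E \<and> x \<in> seg e \<and> p = ep e x"
proof (cases p)
  case (Inner e x)
  then have "e \<in> E" "lo \<Gamma> e < x" "x < hi \<Gamma> e" using assms by (auto simp: points_def)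
  then show ?thesis using Inner ep_inner[of e x] by (intro exI[of _ e] exI[of _ x]) simp
next
  case (Vertex v)
  then have v: "v \<in> verts \<Gamma>" using assms by (auto simp: points_def)
  show ?thesis
  proof (cases "incident \<Gamma> v = {}")
    case True
    have stay: "p' = Vertex v" if "path_of_length \<Gamma> q d p'" "q = Vertex v" for q d p'
      using that
    proof (induction rule: path_of_length.induct)
      case (path_step q d e s t)
      then have eq: "ep e s = Vertex v" by simp
      then have "e \<in> incident \<Gamma> v"
        using path_step.hyps(2) ep_vertexD[OF path_step.hyps(2,3) eq] by (auto simp: incident_def)
      then show ?case using True by blast
    qed simp
    have pts: "points \<Gamma> = {Vertex v}"
    proof -
      have "p' = Vertex v" if "p' \<in> points \<Gamma>" for p'
        using conn that assms Vertex stay unfolding connected_graph_def by metis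
      then show ?thesis using assms Vertex by blast
    qed
    have "X = graph_set \<Gamma> \<iota>" unfolding completed_def graph_set_def pts by simp
    moreover have "degree \<Gamma> v = 0" using True by (simp add: degree_def)
    moreover have "verts \<Gamma> \<subseteq> {v}" using pts by (auto simp: points_def)
    ultimately have "B = {}" unfolding boundary_def by auto
    then show ?thesis using boundary_nonempty by simp
  next
    case False
    then obtain e where e: "e \<in> E" "v = fst e \<or> v = snd e" by (auto simp: incident_def)
    then show ?thesis
      using Vertex ep_hi[OF e(1)] lo_less_hi[OF e(1)]
      by (metis atLeastAtMost_iff ep_lo less_imp_le order_refl)
  qed
qed

lemma graph_set_eq: "graph_set \<Gamma> \<iota> = (\<Union>e\<in>E. (\<lambda>x. \<iota> (ep e x)) ` seg e)"
  unfolding graph_set_def using point_on_edge ep_mem_points by fast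

section \<open>Stars: the metric near a point of the graph\<close>

definition at_coord :: "'v graph_point \<Rightarrow> 'v \<times> 'v \<Rightarrow> real \<Rightarrow> bool" where
  "at_coord w e c \<longleftrightarrow> e \<in> E \<and> c \<in> seg e \<and> ep e c = w"

lemma at_coord_unique: "at_coord w e c \<Longrightarrow> at_coord w e c' \<Longrightarrow> c = c'"
  unfolding at_coord_def using ep_eq_same_edge by metis

lemma finite_at_coord:
  assumes "w \<in> points \<Gamma>"
  shows "finite {e. \<exists>c. at_coord w e c}"
proof (cases w)
  case (Inner e x)
  then have "{e'. \<exists>c. at_coord w e' c} \<subseteq> {e}"
    unfolding at_coord_def edge_point_def by (auto split: if_splits)
  then show ?thesis using finite_subset by blast
next
  case (Vertex v)
  then have "v \<in> verts \<Gamma>" using assms by (auto simp: points_def)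
  moreover have "{e. \<exists>c. at_coord w e c} \<subseteq> incident \<Gamma> v"
    using Vertex ep_vertexD unfolding at_coord_def incident_def by blast
  ultimately show ?thesis using finite_incident finite_subset by blast
qed

text \<open>Makes the ball of radius \<open>\<delta>\<close> around \<open>w\<close> a star without
  further vertices. Inner points and vertices are treated alike: a vertex has a coordinate on each
  incident edge, an inner point only on its own.\<close>

definition star_radius :: "'v graph_point \<Rightarrow> real \<Rightarrow> bool" where
  "star_radius w \<delta> \<longleftrightarrow> 0 < \<delta> \<and> (\<forall>e c. at_coord w e c \<longrightarrow>
     (c = lo \<Gamma> e \<or> \<delta> \<le> c - lo \<Gamma> e) \<and> (c = hi \<Gamma> e \<or> \<delta> \<le> hi \<Gamma> e - c))"

lemma star_radius_mono: "star_radius w \<delta> \<Longrightarrow> 0 < \<delta>' \<Longrightarrow> \<delta>' \<le> \<delta> \<Longrightarrow> star_radius w \<delta>'"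
  unfolding star_radius_def by (meson order_trans)

lemma star_radius_pos: "star_radius w \<delta> \<Longrightarrow> 0 < \<delta>"
  by (simp add: star_radius_def)

lemma star_radius_exists:
  assumes "w \<in> points \<Gamma>"
  obtains \<delta> where "star_radius w \<delta>"
proof -
  \<comment> \<open>The value 1 stands for an end that coincides with \<open>w\<close> and imposes
    no condition.\<close>
  define d where "d e = (let c = (THE c. at_coord w e c) in
     min (if c = lo \<Gamma> e then 1 else c - lo \<Gamma> e) (if c = hi \<Gamma> e then 1 else hi \<Gamma> e - c))" for e
  define \<delta> where "\<delta> = Min (insert 1 (d ` {e. \<exists>c. at_coord w e c}))"
  have the: "(THE c. at_coord w e c) = c" if "at_coord w e c" for e c
    using that at_coord_unique by blast
  have fin: "finite (insert 1 (d ` {e. \<exists>c. at_coord w e c}))" using finite_at_coord[OF assms] by simp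
  have dpos: "d e > 0" if "at_coord w e c" for e c
    using that the[OF that] unfolding d_def at_coord_def by (auto simp: Let_def)
  have "star_radius w \<delta>"
    unfolding star_radius_def
  proof (intro conjI allI impI)
    show "0 < \<delta>" unfolding \<delta>_def using fin dpos by (subst Min_gr_iff) auto
    fix e c assume ec: "at_coord w e c"
    then have "\<delta> \<le> d e" unfolding \<delta>_def using fin by (intro Min_le) auto
    then show "c = lo \<Gamma> e \<or> \<delta> \<le> c - lo \<Gamma> e" "c = hi \<Gamma> e \<or> \<delta> \<le> hi \<Gamma> e - c"
      unfolding d_def the[OF ec] by (auto simp: Let_def split: if_splits)
  qed
  then show thesis by (rule that)
qed

text \<open>A point close to \<open>w\<close> lies on several edges only if it is \<open>w\<close>;
  otherwise it is an inner point of one edge. So its distance to \<open>w\<close> along an edge does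
  not depend on the coordinates used.\<close>

lemma near_coord_unique:
  assumes \<delta>: "star_radius w \<delta>" and ec: "at_coord w e c" "x \<in> seg e" "\<bar>x - c\<bar> < \<delta>"
    and y: "e' \<in> E" "y \<in> seg e'" "ep e' y = ep e x"
  shows "\<exists>c'. at_coord w e' c' \<and> \<bar>y - c'\<bar> = \<bar>x - c\<bar>"
proof -
  have e: "e \<in> E" "c \<in> seg e" "ep e c = w" using ec(1) by (auto simp: at_coord_def)
  have *: "c = lo \<Gamma> e \<or> \<delta> \<le> c - lo \<Gamma> e" "c = hi \<Gamma> e \<or> \<delta> \<le> hi \<Gamma> e - c"
    using \<delta> ec(1) unfolding star_radius_def by blast+
  have "x = c \<or> (lo \<Gamma> e < x \<and> x < hi \<Gamma> e)"
    using * ec(2,3) e(2) by (auto simp: abs_if split: if_splits)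
  then show ?thesis
  proof
    assume "x = c"
    then have "at_coord w e' y" using y e by (simp add: at_coord_def)
    then show ?thesis using \<open>x = c\<close> by auto
  next
    assume x: "lo \<Gamma> e < x \<and> x < hi \<Gamma> e"
    have "e = e'" "x = y" using ep_eq_inner[OF e(1) _ _ y(1,2)] x y(3) by auto
    then show ?thesis using ec by auto
  qed
qed

text \<open>The distance to \<open>w\<close> along the star, cut off at \<open>\<delta>\<close> and
  set to \<open>\<delta>\<close> off the star, is well defined and 1-Lipschitz along every edge. It
  therefore bounds the path metric from below; the segment from \<open>w\<close> gives the bound
  from above.\<close>

lemma local_dist:
  assumes \<delta>: "star_radius w \<delta>" and w: "w \<in> points \<Gamma>" and e: "e \<in> E" "x \<in> seg e"
  shows "at_coord w e c \<Longrightarrow> min \<delta> (dist (\<iota> w) (\<iota> (ep e x))) = min \<delta> \<bar>x - c\<bar>"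
    and "\<nexists>c. at_coord w e c \<Longrightarrow> \<delta> \<le> dist (\<iota> w) (\<iota> (ep e x))"
proof -
  define near where "near p r \<longleftrightarrow> (\<exists>e c x. at_coord w e c \<and> x \<in> seg e \<and> p = ep e x \<and> r = \<bar>x - c\<bar> \<and> r < \<delta>)" for p r
  have near_edge: "near (ep e y) r \<longleftrightarrow> (\<exists>c. at_coord w e c \<and> r = \<bar>y - c\<bar> \<and> r < \<delta>)" if "e \<in> E" "y \<in> seg e" for e y r
  proof
    assume "near (ep e y) r"
    then obtain e' c x where "at_coord w e' c" "x \<in> seg e'" "ep e y = ep e' x" "r = \<bar>x - c\<bar>" "r < \<delta>"
      unfolding near_def by blast
    then show "\<exists>c. at_coord w e c \<and> r = \<bar>y - c\<bar> \<and> r < \<delta>" using near_coord_unique[OF \<delta>, of e' c x e y] that by metis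
  next
    assume "\<exists>c. at_coord w e c \<and> r = \<bar>y - c\<bar> \<and> r < \<delta>"
    then show "near (ep e y) r" unfolding near_def using that(2) by blast
  qed
  define g where "g p = (if \<exists>r. near p r then (THE r. near p r) else \<delta>)" for p
  have g_in: "g (ep e y) = min \<delta> \<bar>y - c\<bar>" if "at_coord w e c" "y \<in> seg e" for e c y
  proof -
    have e: "e \<in> E" using that by (simp add: at_coord_def)
    have iff: "near (ep e y) r \<longleftrightarrow> r = \<bar>y - c\<bar> \<and> r < \<delta>" for r
      unfolding near_edge[OF e that(2)] using at_coord_unique[OF that(1)] that(1) by blast
    show ?thesis
    proof (cases "\<bar>y - c\<bar> < \<delta>")
      case True
      then have "near (ep e y) = (\<lambda>r. r = \<bar>y - c\<bar>)" using iff by (intro ext) auto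
      then show ?thesis using True unfolding g_def by simp
    next
      case False
      then have "near (ep e y) = (\<lambda>r. False)" using iff by (intro ext) auto
      then show ?thesis using False unfolding g_def by simp
    qed
  qed
  have g_out: "g (ep e y) = \<delta>" if "\<nexists>c. at_coord w e c" "e \<in> E" "y \<in> seg e" for e y
  proof -
    have "near (ep e y) = (\<lambda>r. False)" using that near_edge[OF that(2,3)] by (intro ext) auto
    then show ?thesis unfolding g_def by simp
  qed
  have lip: "\<bar>g (ep e t) - g (ep e s)\<bar> \<le> 1 * \<bar>t - s\<bar>" if "e \<in> E" "s \<in> seg e" "t \<in> seg e" for e s t
  proof (cases "\<exists>c. at_coord w e c")
    case True
    then obtain c where "at_coord w e c" by blast
    then show ?thesis using that by (simp add: g_in min_def abs_if)
  next
    case False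
    then show ?thesis using that by (simp add: g_out)
  qed
  obtain e0 c0 where "e0 \<in> E" "c0 \<in> seg e0" "w = ep e0 c0" using point_on_edge[OF w] by blast
  then have "at_coord w e0 c0" "c0 \<in> seg e0" "w = ep e0 c0" by (auto simp: at_coord_def)
  then have g0: "g w = 0" using g_in[of e0 c0 c0] star_radius_pos[OF \<delta>] by simp
  have le: "g (ep e x) \<le> dist (\<iota> w) (\<iota> (ep e x))"
    using lipschitz_dist[of w "ep e x" 1 g, OF w ep_mem_points[OF e] zero_less_one lip] g0 by simp
  show "min \<delta> (dist (\<iota> w) (\<iota> (ep e x))) = min \<delta> \<bar>x - c\<bar>" if c: "at_coord w e c"
  proof -
    have "dist (\<iota> w) (\<iota> (ep e x)) \<le> \<bar>x - c\<bar>"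
      using c dist_edge[OF e(1) _ e(2), of c] by (auto simp: at_coord_def)
    then show ?thesis using le g_in[OF c e(2)] by simp
  qed
  show "\<delta> \<le> dist (\<iota> w) (\<iota> (ep e x))" if "\<nexists>c. at_coord w e c"
    using le g_out[OF that e] by simp
qed

text \<open>As an infimum over paths, \<open>graph_dist\<close> might vanish for distinct points;
  the star around one of them excludes this.\<close>

lemma inj_\<iota>: "inj_on \<iota> (points \<Gamma>)"
proof (rule inj_onI)
  fix w p assume wp: "w \<in> points \<Gamma>" "p \<in> points \<Gamma>" "\<iota> w = \<iota> p"
  obtain \<delta> where \<delta>: "star_radius w \<delta>" by (rule star_radius_exists[OF wp(1)])
  note \<delta>0 = star_radius_pos[OF \<delta>]
  obtain e x where e: "e \<in> E" "x \<in> seg e" "p = ep e x" using point_on_edge[OF wp(2)] by blast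
  have d0: "dist (\<iota> w) (\<iota> (ep e x)) = 0" using wp e by simp
  obtain c where c: "at_coord w e c" using local_dist(2)[OF \<delta> wp(1) e(1,2)] d0 \<delta>0 by force
  from local_dist(1)[OF \<delta> wp(1) e(1,2) c] d0 \<delta>0 have "x = c" by (simp add: min_def split: if_splits)
  then show "w = p" using c e by (simp add: at_coord_def)
qed

text \<open>By local finiteness the star meets finitely many closed edges, whose union is compact.
  So the completion adds no points near a point of the graph.\<close>

lemma star_point:
  assumes w: "w \<in> points \<Gamma>" and \<delta>: "star_radius w \<delta>" and y: "y \<in> X" "dist (\<iota> w) y < \<delta>"
  obtains e c x where "at_coord w e c" "x \<in> seg e" "y = \<iota> (ep e x)" "\<bar>x - c\<bar> = dist (\<iota> w) y"
    "x = c \<or> (lo \<Gamma> e < x \<and> x < hi \<Gamma> e)"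
proof -
  define K where "K = (\<Union>e\<in>{e. \<exists>c. at_coord w e c}. (\<lambda>x. \<iota> (ep e x)) ` seg e)"
  have "closed K" unfolding K_def
  proof (intro closed_UN finite_at_coord w ballI)
    fix e assume "e \<in> {e. \<exists>c. at_coord w e c}"
    then have "e \<in> E" by (auto simp: at_coord_def)
    then show "closed ((\<lambda>x. \<iota> (ep e x)) ` seg e)"
      by (intro compact_imp_closed compact_continuous_image continuous_on_edge_map compact_Icc)
  qed
  have "ball (\<iota> w) \<delta> \<inter> graph_set \<Gamma> \<iota> \<subseteq> K"
  proof
    fix z assume z: "z \<in> ball (\<iota> w) \<delta> \<inter> graph_set \<Gamma> \<iota>"
    then obtain e x where e: "e \<in> E" "x \<in> seg e" "z = \<iota> (ep e x)" unfolding graph_set_eq by auto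
    have "\<exists>c. at_coord w e c" using local_dist(2)[OF \<delta> w e(1,2)] z e by force
    then show "z \<in> K" unfolding K_def using e by blast
  qed
  then have "ball (\<iota> w) \<delta> \<inter> closure (graph_set \<Gamma> \<iota>) \<subseteq> K"
    using open_Int_closure_subset[of "ball (\<iota> w) \<delta>"] closure_minimal[OF _ \<open>closed K\<close>] by (meson open_ball order_trans)
  then have "y \<in> K" using y unfolding completed_def by auto
  then obtain e c x where c: "at_coord w e c" and x: "x \<in> seg e" "y = \<iota> (ep e x)" unfolding K_def by auto
  have e: "e \<in> E" "c \<in> seg e" using c by (auto simp: at_coord_def)
  have d: "\<bar>x - c\<bar> = dist (\<iota> w) y"
    using local_dist(1)[OF \<delta> w e(1) x(1) c] y(2) x(2) by (simp add: min_def split: if_splits)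
  have *: "c = lo \<Gamma> e \<or> \<delta> \<le> c - lo \<Gamma> e" "c = hi \<Gamma> e \<or> \<delta> \<le> hi \<Gamma> e - c"
    using \<delta> c unfolding star_radius_def by blast+
  have "x = c \<or> (lo \<Gamma> e < x \<and> x < hi \<Gamma> e)"
    using * x e(2) d y(2) by (auto simp: abs_if split: if_splits)
  then show thesis using that c x d by blast
qed

section \<open>The boundary as a compact space\<close>

lemma inner_notin_boundary:
  assumes "e \<in> E" "lo \<Gamma> e < x" "x < hi \<Gamma> e"
  shows "\<iota> (ep e x) \<notin> B"
proof
  have p: "ep e x \<in> points \<Gamma>" using assms by (intro ep_mem_points) auto
  assume "\<iota> (ep e x) \<in> B"
  then obtain v where "v \<in> verts \<Gamma>" "\<iota> (ep e x) = \<iota> (Vertex v)"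
    using imageI[OF p, of \<iota>] unfolding boundary_def graph_set_def by blast
  moreover from this have "Vertex v \<in> points \<Gamma>" by (simp add: points_def)
  ultimately have "ep e x = Vertex v" using inj_onD[OF inj_\<iota> _ p] by blast
  then show False using ep_inner[OF assms(2,3)] by simp
qed

text \<open>Apart from its centre a star consists of inner points. Thus graph points of the boundary
  are isolated in it, which gives closedness and, later, clopen separation.\<close>

lemma boundary_isolated:
  assumes w: "w \<in> points \<Gamma>" and \<delta>: "star_radius w \<delta>" and y: "y \<in> B" "dist (\<iota> w) y < \<delta>"
  shows "y = \<iota> w"
proof -
  have "y \<in> X" using y boundary_subset by blast
  then obtain e c x where "at_coord w e c" "x \<in> seg e" "y = \<iota> (ep e x)"
    "x = c \<or> (lo \<Gamma> e < x \<and> x < hi \<Gamma> e)" using star_point[OF w \<delta> _ y(2)] by metis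
  then show ?thesis using inner_notin_boundary[of e x] y(1) by (auto simp: at_coord_def)
qed

lemma closed_boundary: "closed B"
proof (rule closure_subset_eq[THEN iffD1], rule subsetI)
  fix y assume y: "y \<in> closure B"
  then have yX: "y \<in> X" using closure_minimal[OF boundary_subset closed_X] by blast
  show "y \<in> B"
  proof (cases "y \<in> graph_set \<Gamma> \<iota>")
    case True
    then obtain w where w: "w \<in> points \<Gamma>" "y = \<iota> w" by (auto simp: graph_set_def)
    obtain \<delta> where \<delta>: "star_radius w \<delta>" by (rule star_radius_exists[OF w(1)])
    obtain b where "b \<in> B" "dist b y < \<delta>" using y star_radius_pos[OF \<delta>] unfolding closure_approachable by blast
    then show ?thesis using boundary_isolated[OF w(1) \<delta>, of b] w by (simp add: dist_commute)
  next
    case False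
    then show ?thesis using yX by (simp add: boundary_def)
  qed
qed

lemma compact_boundary: "compact B"
  using compact_X boundary_subset closed_boundary by (metis compact_Int_closed inf.absorb_iff2)

lemma degree_ge_2:
  assumes "v \<in> verts \<Gamma>" "\<iota> (Vertex v) \<notin> B"
  shows "2 \<le> degree \<Gamma> v"
proof -
  have "Vertex v \<in> points \<Gamma>" using assms by (simp add: points_def)
  then obtain e x where e: "e \<in> E" "x \<in> seg e" "Vertex v = ep e x" using point_on_edge by blast
  then have "e \<in> incident \<Gamma> v" using ep_vertexD[OF e(1,2) e(3)[symmetric]] e(1) by (auto simp: incident_def)
  then have "degree \<Gamma> v \<noteq> 0" unfolding degree_def using finite_incident[OF assms(1)] by auto
  moreover have "degree \<Gamma> v \<noteq> 1" using assms unfolding boundary_def by auto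
  ultimately show ?thesis by simp
qed

lemma at_coord_vertex:
  assumes "v \<in> verts \<Gamma>"
  shows "at_coord (Vertex v) e c \<longleftrightarrow> (e \<in> E \<and> ((v = fst e \<and> c = lo \<Gamma> e) \<or> (v = snd e \<and> c = hi \<Gamma> e)))"
proof
  assume "at_coord (Vertex v) e c"
  then have "e \<in> E" "c \<in> seg e" "ep e c = Vertex v" by (auto simp: at_coord_def)
  then show "e \<in> E \<and> ((v = fst e \<and> c = lo \<Gamma> e) \<or> (v = snd e \<and> c = hi \<Gamma> e))"
    using ep_vertexD by blast
next
  assume "e \<in> E \<and> ((v = fst e \<and> c = lo \<Gamma> e) \<or> (v = snd e \<and> c = hi \<Gamma> e))"
  then show "at_coord (Vertex v) e c"
    using lo_less_hi[of e] ep_hi[of e] unfolding at_coord_def by auto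
qed

end

section \<open>Test functions and clopen subsets of the boundary\<close>

lemma continuous_on_locally_equal:
  assumes "\<And>y. y \<in> S \<Longrightarrow> \<exists>N h. open N \<and> y \<in> N \<and> continuous_on S h \<and> (\<forall>z\<in>N \<inter> S. f z = h z)"
  shows "continuous_on S f"
  unfolding continuous_on_def
proof
  fix y assume y: "y \<in> S"
  then obtain N h where N: "open N" "y \<in> N" and h: "continuous_on S h" and eq: "\<forall>z\<in>N \<inter> S. f z = h z"
    using assms by blast
  have lim: "(h \<longlongrightarrow> h y) (at y within S)" using h y by (simp add: continuous_on_def)
  have fy: "f y = h y" using eq N y by blast
  show "(f \<longlongrightarrow> f y) (at y within S)"
    unfolding fy
  proof (rule Lim_transform_eventually[OF lim])
    show "\<forall>\<^sub>F x in at y within S. h x = f x"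
      unfolding eventually_at_topological using N eq by (intro exI[of _ N]) auto
  qed
qed

context completed_graph
begin

text \<open>Test functions that are constant, and not just of vanishing derivative, near the vertices: this
  class is visibly closed under sums and products.\<close>
definition flat_function :: "('x \<Rightarrow> real) \<Rightarrow> bool" where
  "flat_function \<phi> \<longleftrightarrow> continuous_on X \<phi> \<and>
     (\<forall>e\<in>E. smooth_on {lo \<Gamma> e<..<hi \<Gamma> e} (on_edge \<Gamma> \<iota> \<phi> e)) \<and>
     (\<exists>S. finite S \<and> S \<subseteq> E \<and> (\<forall>e\<in>E - S. \<exists>k. \<forall>x\<in>{lo \<Gamma> e<..<hi \<Gamma> e}. on_edge \<Gamma> \<iota> \<phi> e x = k)) \<and>
     (\<forall>v\<in>verts \<Gamma>. \<exists>N k. open N \<and> \<iota> (Vertex v) \<in> N \<and> (\<forall>y\<in>N \<inter> X. \<phi> y = k))"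

lemma open_edge_preimage:
  assumes "e \<in> E" "open N"
  shows "open {x \<in> {lo \<Gamma> e<..<hi \<Gamma> e}. \<iota> (ep e x) \<in> N}"
proof -
  have "continuous_on {lo \<Gamma> e<..<hi \<Gamma> e} (\<lambda>x. \<iota> (ep e x))"
    by (rule continuous_on_subset[OF continuous_on_edge_map[OF assms(1)]]) auto
  then have "open ((\<lambda>x. \<iota> (ep e x)) -` N \<inter> {lo \<Gamma> e<..<hi \<Gamma> e})"
    using assms(2) by (simp add: continuous_on_open_vimage)
  moreover have "(\<lambda>x. \<iota> (ep e x)) -` N \<inter> {lo \<Gamma> e<..<hi \<Gamma> e} = {x \<in> {lo \<Gamma> e<..<hi \<Gamma> e}. \<iota> (ep e x) \<in> N}"
    by blast
  ultimately show ?thesis by simp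
qed

lemma flat_function_const: "flat_function (\<lambda>_. c)"
  unfolding flat_function_def on_edge_def
proof (intro conjI ballI)
  show "\<exists>S. finite S \<and> S \<subseteq> E \<and> (\<forall>e\<in>E - S. \<exists>k. \<forall>x\<in>{lo \<Gamma> e<..<hi \<Gamma> e}. c = k)"
    by (rule exI[of _ "{}"]) simp
  show "\<exists>N k. open N \<and> \<iota> (Vertex v) \<in> N \<and> (\<forall>y\<in>N \<inter> X. c = k)" for v
    by (rule exI[of _ UNIV]) simp
qed (simp_all add: smooth_on_const)

lemma flat_function_combine:
  assumes f: "flat_function f" and g: "flat_function g"
    and cont: "continuous_on X (\<lambda>y. F (f y) (g y))"
    and smooth: "\<And>S u v. open S \<Longrightarrow> smooth_on S u \<Longrightarrow> smooth_on S v \<Longrightarrow> smooth_on S (\<lambda>x. F (u x) (v x))"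
  shows "flat_function (\<lambda>y. F (f y) (g y))"
  unfolding flat_function_def
proof (intro conjI ballI cont)
  fix e assume "e \<in> E"
  then show "smooth_on {lo \<Gamma> e<..<hi \<Gamma> e} (on_edge \<Gamma> \<iota> (\<lambda>y. F (f y) (g y)) e)"
    using f g smooth[of "{lo \<Gamma> e<..<hi \<Gamma> e}" "on_edge \<Gamma> \<iota> f e" "on_edge \<Gamma> \<iota> g e"]
    unfolding flat_function_def on_edge_def by simp
next
  obtain S where S: "finite S" "S \<subseteq> E" "\<forall>e\<in>E - S. \<exists>k. \<forall>x\<in>{lo \<Gamma> e<..<hi \<Gamma> e}. on_edge \<Gamma> \<iota> f e x = k"
    using f unfolding flat_function_def by (elim conjE exE) (rule that)
  obtain T where T: "finite T" "T \<subseteq> E" "\<forall>e\<in>E - T. \<exists>k. \<forall>x\<in>{lo \<Gamma> e<..<hi \<Gamma> e}. on_edge \<Gamma> \<iota> g e x = k"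
    using g unfolding flat_function_def by (elim conjE exE) (rule that)
  have "\<exists>k. \<forall>x\<in>{lo \<Gamma> e<..<hi \<Gamma> e}. on_edge \<Gamma> \<iota> (\<lambda>y. F (f y) (g y)) e x = k" if "e \<in> E - (S \<union> T)" for e
  proof -
    from S(3) that obtain k where k: "\<forall>x\<in>{lo \<Gamma> e<..<hi \<Gamma> e}. on_edge \<Gamma> \<iota> f e x = k" by blast
    from T(3) that obtain k' where k': "\<forall>x\<in>{lo \<Gamma> e<..<hi \<Gamma> e}. on_edge \<Gamma> \<iota> g e x = k'" by blast
    show ?thesis using k k' unfolding on_edge_def by (intro exI[of _ "F k k'"]) simp
  qed
  then show "\<exists>S. finite S \<and> S \<subseteq> E \<and>
       (\<forall>e\<in>E - S. \<exists>k. \<forall>x\<in>{lo \<Gamma> e<..<hi \<Gamma> e}. on_edge \<Gamma> \<iota> (\<lambda>y. F (f y) (g y)) e x = k)"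
    using S(1,2) T(1,2) by (intro exI[of _ "S \<union> T"] conjI ballI) auto
next
  fix v assume v: "v \<in> verts \<Gamma>"
  obtain N k where N: "open N" "\<iota> (Vertex v) \<in> N" "\<forall>y\<in>N \<inter> X. f y = k"
    using f v unfolding flat_function_def by blast
  obtain N' k' where N': "open N'" "\<iota> (Vertex v) \<in> N'" "\<forall>y\<in>N' \<inter> X. g y = k'"
    using g v unfolding flat_function_def by blast
  show "\<exists>N k. open N \<and> \<iota> (Vertex v) \<in> N \<and> (\<forall>y\<in>N \<inter> X. F (f y) (g y) = k)"
    using N N' by (intro exI[of _ "N \<inter> N'"] exI[of _ "F k k'"]) auto
qed

lemma flat_function_continuous: "flat_function f \<Longrightarrow> continuous_on X f"
  by (simp add: flat_function_def)

lemma flat_function_add: "flat_function f \<Longrightarrow> flat_function g \<Longrightarrow> flat_function (\<lambda>y. f y + g y)"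
  by (rule flat_function_combine[of f g "(+)"]) (auto intro: continuous_intros flat_function_continuous smooth_on_add)

lemma flat_function_mult: "flat_function f \<Longrightarrow> flat_function g \<Longrightarrow> flat_function (\<lambda>y. f y * g y)"
  by (rule flat_function_combine[of f g "(*)"]) (auto intro: continuous_intros flat_function_continuous smooth_on_mult)

lemma flat_function_one_minus: "flat_function f \<Longrightarrow> flat_function (\<lambda>y. 1 - f y)"
  using flat_function_add[OF flat_function_const[of 1] flat_function_mult[OF flat_function_const[of "-1"]], of f]
  by simp

lemma flat_function_prod: "finite D \<Longrightarrow> (\<And>d. d \<in> D \<Longrightarrow> flat_function (f d)) \<Longrightarrow> flat_function (\<lambda>y. \<Prod>d\<in>D. f d y)"
  by (induction D rule: finite_induct) (auto intro: flat_function_const flat_function_mult)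

text \<open>All conditions but one are local. The exception, being constant on all but finitely many
  edges, is inherited from \<open>g\<close>: where \<open>g\<close> has the constant value
  \<open>k\<close>, the continuous \<open>\<phi>\<close> takes only the values \<open>k\<close> and
  0 on an interval, so it is constant.\<close>

lemma flat_function_patch:
  assumes loc: "\<And>y. y \<in> X \<Longrightarrow> \<exists>N h. open N \<and> y \<in> N \<and> flat_function h \<and> (\<forall>z\<in>N \<inter> X. \<phi> z = h z)"
    and g: "flat_function g" "\<And>y. y \<in> X \<Longrightarrow> \<phi> y = g y \<or> \<phi> y = 0"
  shows "flat_function \<phi>"
  unfolding flat_function_def
proof (intro conjI ballI)
  show cont: "continuous_on X \<phi>"
    by (rule continuous_on_locally_equal) (meson loc flat_function_continuous)
  fix e assume e: "e \<in> E"
  show "smooth_on {lo \<Gamma> e<..<hi \<Gamma> e} (on_edge \<Gamma> \<iota> \<phi> e)"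
  proof (rule smooth_on_locally)
    fix x assume x: "x \<in> {lo \<Gamma> e<..<hi \<Gamma> e}"
    then have "\<iota> (ep e x) \<in> X" by (intro ep_mem_X[OF e]) auto
    from loc[OF this] obtain N h where N: "open N" "\<iota> (ep e x) \<in> N" "flat_function h" "\<forall>z\<in>N \<inter> X. \<phi> z = h z"
      by blast
    let ?T = "{x \<in> {lo \<Gamma> e<..<hi \<Gamma> e}. \<iota> (ep e x) \<in> N}"
    have T: "open ?T" by (rule open_edge_preimage[OF e N(1)])
    have "smooth_on {lo \<Gamma> e<..<hi \<Gamma> e} (on_edge \<Gamma> \<iota> h e)" using N(3) e by (simp add: flat_function_def)
    then have "smooth_on ?T (on_edge \<Gamma> \<iota> h e)" by (rule smooth_on_subset) blast
    then have "smooth_on ?T (on_edge \<Gamma> \<iota> \<phi> e)"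
    proof (rule smooth_on_cong[OF T, rotated])
      fix t assume t: "t \<in> ?T"
      then have "\<iota> (ep e t) \<in> X" by (intro ep_mem_X[OF e]) auto
      then show "on_edge \<Gamma> \<iota> h e t = on_edge \<Gamma> \<iota> \<phi> e t" using t N(4) by (simp add: on_edge_def)
    qed
    then show "\<exists>T. open T \<and> x \<in> T \<and> smooth_on T (on_edge \<Gamma> \<iota> \<phi> e)" using T x N(2) by blast
  qed
next
  have cont: "continuous_on X \<phi>"
    by (rule continuous_on_locally_equal) (meson loc flat_function_continuous)
  obtain S where S: "finite S" "S \<subseteq> E" "\<forall>e\<in>E - S. \<exists>k. \<forall>x\<in>{lo \<Gamma> e<..<hi \<Gamma> e}. on_edge \<Gamma> \<iota> g e x = k"
    using g(1) unfolding flat_function_def by (elim conjE exE) (rule that)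
  have "\<exists>k. \<forall>x\<in>{lo \<Gamma> e<..<hi \<Gamma> e}. on_edge \<Gamma> \<iota> \<phi> e x = k" if "e \<in> E - S" for e
  proof -
    from S(3) that obtain k where k: "\<forall>x\<in>{lo \<Gamma> e<..<hi \<Gamma> e}. on_edge \<Gamma> \<iota> g e x = k" by blast
    have e: "e \<in> E" using that by simp
    have "on_edge \<Gamma> \<iota> \<phi> e ` {lo \<Gamma> e<..<hi \<Gamma> e} \<subseteq> {k, 0}"
    proof (intro image_subsetI)
      fix x assume x: "x \<in> {lo \<Gamma> e<..<hi \<Gamma> e}"
      then have "\<iota> (ep e x) \<in> X" by (intro ep_mem_X[OF e]) auto
      from g(2)[OF this] k x show "on_edge \<Gamma> \<iota> \<phi> e x \<in> {k, 0}" by (auto simp: on_edge_def)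
    qed
    then have fin: "finite (on_edge \<Gamma> \<iota> \<phi> e ` {lo \<Gamma> e<..<hi \<Gamma> e})" by (rule finite_subset) simp
    have "continuous_on {lo \<Gamma> e<..<hi \<Gamma> e} (on_edge \<Gamma> \<iota> \<phi> e)"
      by (rule continuous_on_subset[OF continuous_on_edge[OF cont e]]) auto
    then have "on_edge \<Gamma> \<iota> \<phi> e constant_on {lo \<Gamma> e<..<hi \<Gamma> e}"
      using fin by (intro continuous_finite_range_constant) auto
    then show ?thesis by (simp add: constant_on_def)
  qed
  then show "\<exists>S. finite S \<and> S \<subseteq> E \<and> (\<forall>e\<in>E - S. \<exists>k. \<forall>x\<in>{lo \<Gamma> e<..<hi \<Gamma> e}. on_edge \<Gamma> \<iota> \<phi> e x = k)"
    using S(1,2) by (intro exI[of _ S]) simp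
next
  fix v assume v: "v \<in> verts \<Gamma>"
  then have "\<iota> (Vertex v) \<in> X" by (intro graph_subset_X) (simp add: points_def)
  from loc[OF this] obtain N h where N: "open N" "\<iota> (Vertex v) \<in> N" "flat_function h" "\<forall>z\<in>N \<inter> X. \<phi> z = h z"
    by blast
  obtain N' k' where N': "open N'" "\<iota> (Vertex v) \<in> N'" "\<forall>y\<in>N' \<inter> X. h y = k'"
    using N(3) v unfolding flat_function_def by blast
  show "\<exists>N k. open N \<and> \<iota> (Vertex v) \<in> N \<and> (\<forall>y\<in>N \<inter> X. \<phi> y = k)"
    using N N' by (intro exI[of _ "N \<inter> N'"] exI[of _ k']) auto
qed

lemma flat_function_test_function:
  assumes "flat_function \<phi>"
  shows "\<phi> \<in> test_functions \<Gamma> \<iota>"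
  unfolding test_functions_def
proof (intro CollectI conjI ballI allI)
  show "continuous_on X \<phi>" using assms by (rule flat_function_continuous)
  fix e x n assume "e \<in> E" "x \<in> {lo \<Gamma> e<..<hi \<Gamma> e}"
  then show "(deriv ^^ n) (on_edge \<Gamma> \<iota> \<phi> e) field_differentiable at x"
    using assms unfolding flat_function_def smooth_on_iff by blast
next
  obtain S where S: "finite S" "S \<subseteq> E" "\<forall>e\<in>E - S. \<exists>k. \<forall>x\<in>{lo \<Gamma> e<..<hi \<Gamma> e}. on_edge \<Gamma> \<iota> \<phi> e x = k"
    using assms unfolding flat_function_def by (elim conjE exE) (rule that)
  have "deriv (on_edge \<Gamma> \<iota> \<phi> e) x = 0" if "e \<in> E - S" "x \<in> {lo \<Gamma> e<..<hi \<Gamma> e}" for e x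
  proof -
    from S(3) that obtain k where k: "\<forall>x\<in>{lo \<Gamma> e<..<hi \<Gamma> e}. on_edge \<Gamma> \<iota> \<phi> e x = k" by blast
    have "deriv (on_edge \<Gamma> \<iota> \<phi> e) x = deriv (\<lambda>_. k) x"
      by (rule deriv_cong_open[OF _ that(2)]) (use k in auto)
    then show ?thesis by simp
  qed
  then show "\<exists>S. finite S \<and> S \<subseteq> E \<and> (\<forall>e\<in>E - S. \<forall>x\<in>{lo \<Gamma> e<..<hi \<Gamma> e}. deriv (on_edge \<Gamma> \<iota> \<phi> e) x = 0)"
    using S(1,2) by (intro exI[of _ S]) simp
next
  fix v assume "v \<in> verts \<Gamma>"
  then obtain N k where N: "open N" "\<iota> (Vertex v) \<in> N" "\<forall>y\<in>N \<inter> X. \<phi> y = k"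
    using assms unfolding flat_function_def by blast
  have "deriv (on_edge \<Gamma> \<iota> \<phi> e) x = 0" if e: "e \<in> E" and x: "x \<in> {lo \<Gamma> e<..<hi \<Gamma> e}" "\<iota> (ep e x) \<in> N" for e x
  proof -
    have "deriv (on_edge \<Gamma> \<iota> \<phi> e) x = deriv (\<lambda>_. k) x"
    proof (rule deriv_cong_open[OF open_edge_preimage[OF e N(1)]])
      fix t assume t: "t \<in> {x \<in> {lo \<Gamma> e<..<hi \<Gamma> e}. \<iota> (ep e x) \<in> N}"
      then have "\<iota> (ep e t) \<in> X" by (intro ep_mem_X[OF e]) auto
      then show "on_edge \<Gamma> \<iota> \<phi> e t = k" using t N(3) by (simp add: on_edge_def)
    qed (use x in simp)
    then show ?thesis by simp
  qed
  then show "\<exists>N. open N \<and> \<iota> (Vertex v) \<in> N \<and>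
      (\<forall>e\<in>E. \<forall>x\<in>{lo \<Gamma> e<..<hi \<Gamma> e}. \<iota> (ep e x) \<in> N \<longrightarrow> deriv (on_edge \<Gamma> \<iota> \<phi> e) x = 0)"
    using N(1,2) by (intro exI[of _ N]) simp
qed

text \<open>An even bump of the distance to \<open>w\<close>. Inside the star the distance is |x -
  c|, and evenness removes the kink at \<open>c\<close>.\<close>

lemma flat_bump:
  assumes w: "w \<in> points \<Gamma>" and "0 < \<eta>"
  obtains b N where "flat_function b" "open N" "\<iota> w \<in> N" "\<And>y. y \<in> N \<Longrightarrow> b y = 1"
    "\<And>y. \<eta> \<le> dist (\<iota> w) y \<Longrightarrow> b y = 0"
proof -
  obtain \<beta> :: "real \<Rightarrow> real" where \<beta>: "smooth_on UNIV \<beta>" "\<And>r. \<bar>r\<bar> \<le> 1/3 \<Longrightarrow> \<beta> r = 1" "\<And>r. 2/3 \<le> \<bar>r\<bar> \<Longrightarrow> \<beta> r = 0"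
    "\<And>r. \<beta> (- r) = \<beta> r" by (rule smooth_bump) (rule that)
  obtain \<delta>' where "star_radius w \<delta>'" by (rule star_radius_exists[OF w])
  define \<delta> where "\<delta> = min \<delta>' \<eta>"
  have \<delta>: "star_radius w \<delta>" "0 < \<delta>" "\<delta> \<le> \<eta>"
    using star_radius_mono[OF \<open>star_radius w \<delta>'\<close>, of \<delta>] star_radius_pos[OF \<open>star_radius w \<delta>'\<close>] \<open>0 < \<eta>\<close>
    by (auto simp: \<delta>_def)
  define b where "b y = \<beta> (dist (\<iota> w) y / \<delta>)" for y
  have b0: "b y = 0" if "2 / 3 * \<delta> \<le> dist (\<iota> w) y" for y
    unfolding b_def using that \<delta>(2) by (intro \<beta>(3)) (simp add: field_simps)
  have b1: "b y = 1" if "dist (\<iota> w) y < \<delta> / 3" for y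
    unfolding b_def using that \<delta>(2) by (intro \<beta>(2)) (simp add: field_simps)
  have out: "on_edge \<Gamma> \<iota> b e x = 0" if "e \<in> E" "x \<in> seg e" "\<nexists>c. at_coord w e c" for e x
    unfolding on_edge_def using local_dist(2)[OF \<delta>(1) w that] \<delta>(2) by (intro b0) simp
  have within: "on_edge \<Gamma> \<iota> b e x = \<beta> (1 / \<delta> * x + - c / \<delta>)" if "e \<in> E" "x \<in> seg e" "at_coord w e c" for e x c
  proof -
    have m: "min \<delta> (dist (\<iota> w) (\<iota> (ep e x))) = min \<delta> \<bar>x - c\<bar>" by (rule local_dist(1)[OF \<delta>(1) w that])
    have arg: "1 / \<delta> * x + - c / \<delta> = (x - c) / \<delta>" by (simp add: diff_divide_distrib)
    show ?thesis
    proof (cases "\<bar>x - c\<bar> < \<delta>")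
      case True
      then have "dist (\<iota> w) (\<iota> (ep e x)) = \<bar>x - c\<bar>" using m by (simp add: min_def split: if_splits)
      then have "on_edge \<Gamma> \<iota> b e x = \<beta> (\<bar>x - c\<bar> / \<delta>)" by (simp add: on_edge_def b_def)
      also have "\<bar>x - c\<bar> / \<delta> = (x - c) / \<delta> \<or> \<bar>x - c\<bar> / \<delta> = - ((x - c) / \<delta>)"
        by (simp add: abs_if minus_divide_left)
      then have "\<beta> (\<bar>x - c\<bar> / \<delta>) = \<beta> ((x - c) / \<delta>)"
        by (elim disjE) (simp_all only: \<beta>(4))
      finally show ?thesis using arg by simp
    next
      case False
      then have "\<delta> \<le> dist (\<iota> w) (\<iota> (ep e x))" using m by (simp add: min_def split: if_splits)
      then have "on_edge \<Gamma> \<iota> b e x = 0" unfolding on_edge_def using \<delta>(2) by (intro b0) simp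
      moreover have "\<beta> ((x - c) / \<delta>) = 0" using False \<delta>(2) by (intro \<beta>(3)) (simp add: field_simps)
      ultimately show ?thesis using arg by simp
    qed
  qed
  have "flat_function b"
    unfolding flat_function_def
  proof (intro conjI ballI)
    have "continuous_on UNIV \<beta>"
      by (intro continuous_at_imp_continuous_on ballI field_differentiable_imp_continuous_at smooth_onD[OF \<beta>(1)])
    then show "continuous_on X b"
      unfolding b_def using \<delta>(2) by (intro continuous_on_compose2[of UNIV \<beta> X] continuous_intros) auto
    fix e assume e: "e \<in> E"
    show "smooth_on {lo \<Gamma> e<..<hi \<Gamma> e} (on_edge \<Gamma> \<iota> b e)"
    proof (cases "\<exists>c. at_coord w e c")
      case True
      then obtain c where c: "at_coord w e c" by blast
      have "smooth_on {lo \<Gamma> e<..<hi \<Gamma> e} (\<lambda>x. \<beta> (1 / \<delta> * x + - c / \<delta>))"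
        by (rule smooth_on_subset[OF smooth_on_affine[OF \<beta>(1)]]) simp
      then show ?thesis
        by (rule smooth_on_cong[rotated 2]) (use within[OF e _ c] in auto)
    next
      case False
      show ?thesis
        by (rule smooth_on_cong[OF _ _ smooth_on_const[of _ 0]]) (use out[OF e _ False] in auto)
    qed
  next
    have "\<exists>k. \<forall>x\<in>{lo \<Gamma> e<..<hi \<Gamma> e}. on_edge \<Gamma> \<iota> b e x = k" if "e \<in> E - {e. \<exists>c. at_coord w e c}" for e
      using that out[of e] by (intro exI[of _ 0]) simp
    moreover have "{e. \<exists>c. at_coord w e c} \<subseteq> E" by (auto simp: at_coord_def)
    ultimately show "\<exists>S. finite S \<and> S \<subseteq> E \<and> (\<forall>e\<in>E - S. \<exists>k. \<forall>x\<in>{lo \<Gamma> e<..<hi \<Gamma> e}. on_edge \<Gamma> \<iota> b e x = k)"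
      using finite_at_coord[OF w] by (intro exI[of _ "{e. \<exists>c. at_coord w e c}"]) blast
  next
    fix v assume v: "v \<in> verts \<Gamma>"
    have vp: "Vertex v \<in> points \<Gamma>" using v by (simp add: points_def)
    show "\<exists>N k. open N \<and> \<iota> (Vertex v) \<in> N \<and> (\<forall>y\<in>N \<inter> X. b y = k)"
    proof (cases "Vertex v = w")
      case True
      then show ?thesis using b1 \<delta>(2) by (intro exI[of _ "ball (\<iota> w) (\<delta> / 3)"] exI[of _ 1]) simp
    next
      case False
      obtain e x where e: "e \<in> E" "x \<in> seg e" "Vertex v = ep e x" using point_on_edge[OF vp] by blast
      \<comment> \<open>The bump is 0 from distance 2/3 of \<open>\<delta>\<close> on, while other
        vertices are at distance at least \<open>\<delta>\<close>. So it vanishes on a ball of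
        radius \<open>\<delta> / 3\<close> around each of them.\<close>
      have far: "\<delta> \<le> dist (\<iota> w) (\<iota> (Vertex v))"
      proof (cases "\<exists>c. at_coord w e c")
        case True
        then obtain c where c: "at_coord w e c" by blast
        have "x \<noteq> c" using c e False by (auto simp: at_coord_def)
        moreover have "x = lo \<Gamma> e \<or> x = hi \<Gamma> e" using ep_vertexD[OF e(1,2) e(3)[symmetric]] by blast
        moreover have "c = lo \<Gamma> e \<or> \<delta> \<le> c - lo \<Gamma> e" "c = hi \<Gamma> e \<or> \<delta> \<le> hi \<Gamma> e - c"
          using \<delta>(1) c unfolding star_radius_def by blast+
        ultimately have "\<delta> \<le> \<bar>x - c\<bar>" by auto
        then show ?thesis using local_dist(1)[OF \<delta>(1) w e(1,2) c] e(3) by (simp add: min_def split: if_splits)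
      next
        case False
        then show ?thesis using local_dist(2)[OF \<delta>(1) w e(1,2)] e(3) by simp
      qed
      have "b y = 0" if "dist (\<iota> (Vertex v)) y < \<delta> / 3" for y
        using far that dist_triangle[of "\<iota> w" "\<iota> (Vertex v)" y] by (intro b0) (simp add: dist_commute)
      then show ?thesis using \<delta>(2) by (intro exI[of _ "ball (\<iota> (Vertex v)) (\<delta> / 3)"] exI[of _ 0]) simp
    qed
  qed
  then show thesis
  proof (rule that)
    show "open (ball (\<iota> w) (\<delta> / 3))" "\<iota> w \<in> ball (\<iota> w) (\<delta> / 3)" using \<delta>(2) by auto
    show "\<And>y. y \<in> ball (\<iota> w) (\<delta> / 3) \<Longrightarrow> b y = 1" using b1 by simp
    show "\<And>y. \<eta> \<le> dist (\<iota> w) y \<Longrightarrow> b y = 0" using b0 \<delta>(2,3) by simp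
  qed
qed

section \<open>Separation of points and compact sets by test functions\<close>

lemma weak_separation:
  assumes "x \<in> X" "y \<in> X" "x \<noteq> y"
  obtains W U V where "finite W" "W \<subseteq> graph_set \<Gamma> \<iota>" "open U" "open V" "U \<inter> V \<inter> X = {}"
    "X - W = (U \<union> V) \<inter> X" "x \<in> U" "y \<in> V"
proof -
  obtain W U V where *: "finite W" "W \<subseteq> graph_set \<Gamma> \<iota>"
     "openin (top_of_set X) U" "openin (top_of_set X) V" "U \<inter> V = {}" "X - W = U \<union> V" "x \<in> U" "y \<in> V"
    using wconn[unfolded weakly_connected_def, rule_format, OF assms] by (elim exE conjE) (rule that)
  obtain U' V' where "open U'" "U = U' \<inter> X" "open V'" "V = V' \<inter> X" using *(3,4) by (auto simp: openin_open)
  then show thesis using * by (intro that[of W U' V']) blast+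
qed

text \<open>Weak connectedness separates \<open>x\<close> and \<open>y\<close> only after finitely
  many graph points have been removed. Bumps at these points force a function to 0 near each of
  them, so that it can be continued by 0 across them to the side of \<open>y\<close>.\<close>

lemma flat_separation:
  assumes x: "x \<in> X" and y: "y \<in> X" and "x \<noteq> y"
  shows "\<exists>\<phi> M N. flat_function \<phi> \<and> open M \<and> x \<in> M \<and> (\<forall>z\<in>M \<inter> X. \<phi> z = 1) \<and> open N \<and> y \<in> N \<and> (\<forall>z\<in>N \<inter> X. \<phi> z = 0)"
proof -
  obtain W U V where W: "finite W" "W \<subseteq> graph_set \<Gamma> \<iota>" and UV: "open U" "open V" "U \<inter> V \<inter> X = {}"
    "X - W = (U \<union> V) \<inter> X" "x \<in> U" "y \<in> V" using weak_separation[OF assms] by metis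
  \<comment> \<open>Half the distance to \<open>x\<close> keeps every bump equal to 0 near
    \<open>x\<close>.\<close>
  have "\<exists>b N. flat_function b \<and> open N \<and> w \<in> N \<and> (\<forall>y\<in>N. b y = 1) \<and> (\<forall>y. dist w x / 2 \<le> dist w y \<longrightarrow> b y = 0)"
    if "w \<in> W" for w
  proof -
    obtain p where p: "p \<in> points \<Gamma>" "w = \<iota> p" using W(2) \<open>w \<in> W\<close> unfolding graph_set_def by blast
    have "w \<noteq> x" using UV(4,5) x that by blast
    then have "0 < dist (\<iota> p) x / 2" using p by simp
    then obtain b N where "flat_function b" "open N" "\<iota> p \<in> N" "\<And>y. y \<in> N \<Longrightarrow> b y = 1"
      "\<And>y. dist (\<iota> p) x / 2 \<le> dist (\<iota> p) y \<Longrightarrow> b y = 0"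
      by (rule flat_bump[OF p(1)]) (rule that)
    then show ?thesis unfolding p(2) by blast
  qed
  then have "\<forall>w\<in>W. \<exists>b N. flat_function b \<and> open N \<and> w \<in> N \<and> (\<forall>y\<in>N. b y = 1) \<and> (\<forall>y. dist w x / 2 \<le> dist w y \<longrightarrow> b y = 0)"
    by blast
  from bchoice[OF this] obtain b where "\<forall>w\<in>W. \<exists>N. flat_function (b w) \<and> open N \<and> w \<in> N \<and> (\<forall>y\<in>N. b w y = 1) \<and> (\<forall>y. dist w x / 2 \<le> dist w y \<longrightarrow> b w y = 0)"
    by (elim exE) (rule that)
  from bchoice[OF this] obtain N where *: "\<forall>w\<in>W. flat_function (b w) \<and> open (N w) \<and> w \<in> N w \<and> (\<forall>y\<in>N w. b w y = 1) \<and> (\<forall>y. dist w x / 2 \<le> dist w y \<longrightarrow> b w y = 0)"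
    by (elim exE) (rule that)
  have b: "\<And>w. w \<in> W \<Longrightarrow> flat_function (b w)" and N: "\<And>w. w \<in> W \<Longrightarrow> open (N w)" "\<And>w. w \<in> W \<Longrightarrow> w \<in> N w"
    "\<And>w y. w \<in> W \<Longrightarrow> y \<in> N w \<Longrightarrow> b w y = 1" and b0: "\<And>w y. w \<in> W \<Longrightarrow> dist w x / 2 \<le> dist w y \<Longrightarrow> b w y = 0"
    using * by blast+
  define g where "g z = (\<Prod>w\<in>W. 1 - b w z)" for z
  have g: "flat_function g" unfolding g_def by (intro flat_function_prod W(1) flat_function_one_minus b)
  have g0: "g z = 0" if "w \<in> W" "z \<in> N w" for w z
    unfolding g_def using W(1) that N(3) by (intro prod_zero) auto
  define \<phi> where "\<phi> z = (if z \<in> U then g z else 0)" for z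
  have "flat_function \<phi>"
  proof (rule flat_function_patch[OF _ g])
    fix z assume z: "z \<in> X"
    consider "z \<in> U" | "z \<in> V" | "z \<in> W" using UV(4) z by blast
    then show "\<exists>N h. open N \<and> z \<in> N \<and> flat_function h \<and> (\<forall>y\<in>N \<inter> X. \<phi> y = h y)"
    proof cases
      case 1
      then show ?thesis using UV(1) g by (intro exI[of _ U] exI[of _ g]) (simp add: \<phi>_def)
    next
      case 2
      have "\<forall>y\<in>V \<inter> X. \<phi> y = 0" using UV(3) unfolding \<phi>_def by auto
      then show ?thesis using 2 UV(2) flat_function_const[of 0] by (intro exI[of _ V] exI[of _ "\<lambda>_. 0"]) simp
    next
      case 3
      have "\<forall>y\<in>N z \<inter> X. \<phi> y = 0" using g0[OF 3] unfolding \<phi>_def by auto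
      then show ?thesis using 3 N flat_function_const[of 0] by (intro exI[of _ "N z"] exI[of _ "\<lambda>_. 0"]) simp
    qed
  qed (simp add: \<phi>_def)
  moreover have "\<exists>M. open M \<and> x \<in> M \<and> (\<forall>z\<in>M \<inter> X. \<phi> z = 1)"
  proof (intro exI conjI ballI)
    let ?M = "U \<inter> (\<Inter>w\<in>W. ball x (dist w x / 2))"
    show "open ?M" using W(1) UV(1) by (intro open_Int open_INT) auto
    have "w \<noteq> x" if "w \<in> W" for w using UV(4,5) x that by blast
    then show "x \<in> ?M" using UV(5) by simp
    fix z assume z: "z \<in> ?M \<inter> X"
    have "b w z = 0" if "w \<in> W" for w
    proof (rule b0[OF that])
      have "dist x z < dist w x / 2" using z that by simp
      then show "dist w x / 2 \<le> dist w z" using dist_triangle[of w x z] by (simp add: dist_commute)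
    qed
    then show "\<phi> z = 1" using z by (simp add: \<phi>_def g_def)
  qed
  moreover have "\<forall>z\<in>V \<inter> X. \<phi> z = 0" using UV(3) unfolding \<phi>_def by auto
  ultimately show ?thesis using UV(2,6) by blast
qed

lemma flat_cutoff_point:
  assumes x: "x \<in> X" and F: "compact F" "F \<subseteq> X" "x \<notin> F"
  shows "\<exists>\<psi> M. flat_function \<psi> \<and> open M \<and> x \<in> M \<and> (\<forall>z\<in>M \<inter> X. \<psi> z = 1) \<and> (\<forall>z\<in>F. \<psi> z = 0)"
proof -
  have "\<forall>y\<in>F. \<exists>\<phi> M N. flat_function \<phi> \<and> open M \<and> x \<in> M \<and> (\<forall>z\<in>M \<inter> X. \<phi> z = 1) \<and> open N \<and> y \<in> N \<and> (\<forall>z\<in>N \<inter> X. \<phi> z = 0)"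
    using x F by (intro ballI flat_separation) auto
  from bchoice[OF this] obtain \<phi> where "\<forall>y\<in>F. \<exists>M N. flat_function (\<phi> y) \<and> open M \<and> x \<in> M \<and> (\<forall>z\<in>M \<inter> X. \<phi> y z = 1) \<and> open N \<and> y \<in> N \<and> (\<forall>z\<in>N \<inter> X. \<phi> y z = 0)"
    by (elim exE) (rule that)
  from bchoice[OF this] obtain M where "\<forall>y\<in>F. \<exists>N. flat_function (\<phi> y) \<and> open (M y) \<and> x \<in> M y \<and> (\<forall>z\<in>M y \<inter> X. \<phi> y z = 1) \<and> open N \<and> y \<in> N \<and> (\<forall>z\<in>N \<inter> X. \<phi> y z = 0)"
    by (elim exE) (rule that)
  from bchoice[OF this] obtain N where *: "\<forall>y\<in>F. flat_function (\<phi> y) \<and> open (M y) \<and> x \<in> M y \<and> (\<forall>z\<in>M y \<inter> X. \<phi> y z = 1) \<and> open (N y) \<and> y \<in> N y \<and> (\<forall>z\<in>N y \<inter> X. \<phi> y z = 0)"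
    by (elim exE) (rule that)
  have \<phi>: "\<And>y. y \<in> F \<Longrightarrow> flat_function (\<phi> y)" and M: "\<And>y. y \<in> F \<Longrightarrow> open (M y)" "\<And>y. y \<in> F \<Longrightarrow> x \<in> M y"
    "\<And>y z. y \<in> F \<Longrightarrow> z \<in> M y \<inter> X \<Longrightarrow> \<phi> y z = 1" and N: "\<And>y. y \<in> F \<Longrightarrow> open (N y)" "\<And>y. y \<in> F \<Longrightarrow> y \<in> N y"
    "\<And>y z. y \<in> F \<Longrightarrow> z \<in> N y \<inter> X \<Longrightarrow> \<phi> y z = 0" using * by blast+
  have cover: "F \<subseteq> (\<Union>y\<in>F. N y)" using N(2) by blast
  obtain D where D: "D \<subseteq> F" "finite D" "F \<subseteq> (\<Union>y\<in>D. N y)"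
    by (rule compactE_image[OF F(1) N(1) cover])
  show ?thesis
  proof (intro exI conjI ballI)
    show "flat_function (\<lambda>z. \<Prod>y\<in>D. \<phi> y z)" using D \<phi> by (intro flat_function_prod) auto
    show "open (\<Inter>y\<in>D. M y)" "x \<in> (\<Inter>y\<in>D. M y)" using D M by (auto intro!: open_INT)
    show "(\<Prod>y\<in>D. \<phi> y z) = 1" if "z \<in> (\<Inter>y\<in>D. M y) \<inter> X" for z
      using that D(1) M(3) by (intro prod.neutral) blast
    show "(\<Prod>y\<in>D. \<phi> y z) = 0" if "z \<in> F" for z
    proof -
      obtain y where "y \<in> D" "z \<in> N y" using D(3) \<open>z \<in> F\<close> by blast
      then have "y \<in> D \<and> \<phi> y z = 0" using N(3)[of y z] D(1) F(2) \<open>z \<in> F\<close> by blast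
      then show ?thesis using D(2) by (intro prod_zero) auto
    qed
  qed
qed

text \<open>Compactness for the second time: products produced the zeros on \<open>F\<close>, and
  \<open>1 - (\<Prod>x\<in>D. 1 - \<psi> x z)\<close> produces the value 1 on
  \<open>C\<close>.\<close>

theorem flat_cutoff:
  assumes C: "compact C" "C \<subseteq> X" and F: "compact F" "F \<subseteq> X" "C \<inter> F = {}"
  obtains \<psi> where "flat_function \<psi>" "\<And>z. z \<in> C \<Longrightarrow> \<psi> z = 1" "\<And>z. z \<in> F \<Longrightarrow> \<psi> z = 0"
proof -
  have "\<forall>x\<in>C. \<exists>\<psi> M. flat_function \<psi> \<and> open M \<and> x \<in> M \<and> (\<forall>z\<in>M \<inter> X. \<psi> z = 1) \<and> (\<forall>z\<in>F. \<psi> z = 0)"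
    using C F by (intro ballI flat_cutoff_point) auto
  from bchoice[OF this] obtain \<psi> where
    "\<forall>x\<in>C. \<exists>M. flat_function (\<psi> x) \<and> open M \<and> x \<in> M \<and> (\<forall>z\<in>M \<inter> X. \<psi> x z = 1) \<and> (\<forall>z\<in>F. \<psi> x z = 0)"
    by (elim exE) (rule that)
  from bchoice[OF this] obtain M where *:
    "\<forall>x\<in>C. flat_function (\<psi> x) \<and> open (M x) \<and> x \<in> M x \<and> (\<forall>z\<in>M x \<inter> X. \<psi> x z = 1) \<and> (\<forall>z\<in>F. \<psi> x z = 0)"
    by (elim exE) (rule that)
  have \<psi>: "\<And>x. x \<in> C \<Longrightarrow> flat_function (\<psi> x)" and M: "\<And>x. x \<in> C \<Longrightarrow> open (M x)" "\<And>x. x \<in> C \<Longrightarrow> x \<in> M x"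
    "\<And>x z. x \<in> C \<Longrightarrow> z \<in> M x \<inter> X \<Longrightarrow> \<psi> x z = 1" and \<psi>0: "\<And>x z. x \<in> C \<Longrightarrow> z \<in> F \<Longrightarrow> \<psi> x z = 0"
    using * by blast+
  have cover: "C \<subseteq> (\<Union>x\<in>C. M x)" using M(2) by blast
  obtain D where D: "D \<subseteq> C" "finite D" "C \<subseteq> (\<Union>x\<in>D. M x)"
    by (rule compactE_image[OF C(1) M(1) cover])
  show thesis
  proof (rule that)
    show "flat_function (\<lambda>z. 1 - (\<Prod>x\<in>D. 1 - \<psi> x z))"
      using D \<psi> by (intro flat_function_one_minus flat_function_prod) auto
    show "1 - (\<Prod>x\<in>D. 1 - \<psi> x z) = 1" if "z \<in> C" for z
    proof -
      obtain x where "x \<in> D" "z \<in> M x" using D(3) \<open>z \<in> C\<close> by blast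
      then have "x \<in> D \<and> 1 - \<psi> x z = 0" using M(3)[of x z] D(1) C(2) \<open>z \<in> C\<close> by auto
      then have "(\<Prod>x\<in>D. 1 - \<psi> x z) = 0" using D(2) by (intro prod_zero) auto
      then show ?thesis by simp
    qed
    show "1 - (\<Prod>x\<in>D. 1 - \<psi> x z) = 0" if "z \<in> F" for z
    proof -
      have "(\<Prod>x\<in>D. 1 - \<psi> x z) = 1" using D(1) \<psi>0 that by (intro prod.neutral) auto
      then show ?thesis by simp
    qed
  qed
qed

section \<open>Clopen subsets of the boundary and density of the finite-valued functions\<close>

lemma clopen_in_compact: "clopen_in B C \<Longrightarrow> compact C \<and> C \<subseteq> X"
  unfolding clopen_in_def using boundary_subset closedin_compact[OF compact_boundary] closedin_subset by fastforce

text \<open>\<open>cutoff\<close> is a choice, so its properties rest on the existence of a suitable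
  test function.\<close>

lemma cutoff_props:
  assumes "clopen_in B C"
  shows "cutoff \<Gamma> \<iota> C \<in> test_functions \<Gamma> \<iota>" "x \<in> C \<Longrightarrow> cutoff \<Gamma> \<iota> C x = 1" "x \<in> B - C \<Longrightarrow> cutoff \<Gamma> \<iota> C x = 0"
proof -
  have c: "compact C" "C \<subseteq> X" "compact (B - C)" "B - C \<subseteq> X" using clopen_in_compact[OF assms] clopen_in_compact[OF clopen_in_Diff[OF assms]] by auto
  obtain \<psi> where "flat_function \<psi>" "\<And>z. z \<in> C \<Longrightarrow> \<psi> z = 1" "\<And>z. z \<in> B - C \<Longrightarrow> \<psi> z = 0"
    by (rule flat_cutoff[OF c]) blast+
  then have "\<psi> \<in> test_functions \<Gamma> \<iota> \<and> (\<forall>x\<in>C. \<psi> x = 1) \<and> (\<forall>x\<in>B - C. \<psi> x = 0)"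
    using flat_function_test_function by blast
  then have "cutoff \<Gamma> \<iota> C \<in> test_functions \<Gamma> \<iota> \<and> (\<forall>x\<in>C. cutoff \<Gamma> \<iota> C x = 1) \<and> (\<forall>x\<in>B - C. cutoff \<Gamma> \<iota> C x = 0)"
    unfolding cutoff_def
    by (rule someI[where P = "\<lambda>\<phi>. \<phi> \<in> test_functions \<Gamma> \<iota> \<and> (\<forall>x\<in>C. \<phi> x = 1) \<and> (\<forall>x\<in>B - C. \<phi> x = 0)"])
  then show "cutoff \<Gamma> \<iota> C \<in> test_functions \<Gamma> \<iota>" "x \<in> C \<Longrightarrow> cutoff \<Gamma> \<iota> C x = 1" "x \<in> B - C \<Longrightarrow> cutoff \<Gamma> \<iota> C x = 0"
    by blast+
qed

text \<open>The set \<open>U \<inter> B\<close> is open in \<open>B\<close>. Its complement is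
  covered by \<open>V\<close> and by those removed points that lie in the boundary; these are
  isolated there, so the complement is open as well.\<close>

lemma clopen_separation:
  assumes x: "x \<in> B" and y: "y \<in> B" and "x \<noteq> y"
  shows "\<exists>C. clopen_in B C \<and> x \<in> C \<and> y \<notin> C"
proof -
  have "x \<in> X" "y \<in> X" using x y boundary_subset by auto
  then obtain W U V where W: "finite W" "W \<subseteq> graph_set \<Gamma> \<iota>" and UV: "open U" "open V" "U \<inter> V \<inter> X = {}"
    "X - W = (U \<union> V) \<inter> X" "x \<in> U" "y \<in> V" using weak_separation[OF _ _ \<open>x \<noteq> y\<close>] by metis
  have "\<exists>r>0. ball w r \<inter> B \<subseteq> {w}" if "w \<in> W" for w
  proof -
    obtain p where p: "p \<in> points \<Gamma>" "w = \<iota> p" using W(2) \<open>w \<in> W\<close> unfolding graph_set_def by blast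
    obtain \<delta> where \<delta>: "star_radius p \<delta>" by (rule star_radius_exists[OF p(1)])
    have "ball w \<delta> \<inter> B \<subseteq> {w}" using boundary_isolated[OF p(1) \<delta>] p(2) by auto
    then show ?thesis using star_radius_pos[OF \<delta>] by blast
  qed
  then obtain r where r: "\<And>w. w \<in> W \<Longrightarrow> 0 < r w" "\<And>w. w \<in> W \<Longrightarrow> ball w (r w) \<inter> B \<subseteq> {w}" by metis
  have 1: "openin (top_of_set B) (U \<inter> B)" using UV(1) by (auto simp: openin_open)
  have "B - U \<inter> B = (V \<union> (\<Union>w\<in>W. ball w (r w))) \<inter> B - (U \<inter> B)"
  proof
    show "B - U \<inter> B \<subseteq> (V \<union> (\<Union>w\<in>W. ball w (r w))) \<inter> B - (U \<inter> B)"
    proof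
      fix z assume z: "z \<in> B - U \<inter> B"
      have "z \<in> V \<or> z \<in> W" using z UV(4) boundary_subset by blast
      moreover have "z \<in> ball z (r z)" if "z \<in> W" using r(1)[OF that] by simp
      ultimately show "z \<in> (V \<union> (\<Union>w\<in>W. ball w (r w))) \<inter> B - (U \<inter> B)" using z by blast
    qed
  qed blast
  also have "\<dots> = (V \<union> (\<Union>w\<in>W - U. ball w (r w))) \<inter> B"
  proof
    show "(V \<union> (\<Union>w\<in>W. ball w (r w))) \<inter> B - (U \<inter> B) \<subseteq> (V \<union> (\<Union>w\<in>W - U. ball w (r w))) \<inter> B"
      using r(2) by blast
    show "(V \<union> (\<Union>w\<in>W - U. ball w (r w))) \<inter> B \<subseteq> (V \<union> (\<Union>w\<in>W. ball w (r w))) \<inter> B - (U \<inter> B)"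
      using r(2) UV(3) boundary_subset by blast
  qed
  finally have "openin (top_of_set B) (B - U \<inter> B)"
    using UV(2) by (auto simp: openin_open intro!: exI[of _ "V \<union> (\<Union>w\<in>W - U. ball w (r w))"])
  then have "clopen_in B (U \<inter> B)" using 1 unfolding clopen_in_def closedin_def by simp
  moreover have "y \<notin> U" using UV(3,6) \<open>y \<in> X\<close> by blast
  ultimately show ?thesis using x UV(5) by blast
qed

definition finite_valued :: "('x \<Rightarrow> real) \<Rightarrow> bool" where
  "finite_valued f \<longleftrightarrow> continuous_on B f \<and> finite (f ` B)"

lemma finite_valued_level_clopen:
  assumes "finite_valued f"
  shows "clopen_in B {x \<in> B. f x \<in> T}"
proof -
  have cl: "closedin (top_of_set B) {x \<in> B. f x \<in> T}" for T
  proof -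
    have "closed (T \<inter> f ` B)" using assms by (intro finite_imp_closed) (simp add: finite_valued_def)
    then have "closedin (top_of_set B) (B \<inter> f -` (T \<inter> f ` B))"
      using assms by (intro continuous_closedin_preimage) (simp_all add: finite_valued_def)
    moreover have "B \<inter> f -` (T \<inter> f ` B) = {x \<in> B. f x \<in> T}" by blast
    ultimately show ?thesis by simp
  qed
  have "B - {x \<in> B. f x \<in> - T} = {x \<in> B. f x \<in> T}" by blast
  then have "openin (top_of_set B) {x \<in> B. f x \<in> T}"
    using openin_diff[OF openin_subtopology_self cl[of "- T"]] by simp
  then show ?thesis using cl unfolding clopen_in_def by blast
qed

lemma clopen_in_indicator:
  assumes "clopen_in B C"
  shows "finite_valued (indicator C)"
  unfolding finite_valued_def
proof
  obtain U V where "open U" "C = B \<inter> U" "open V" "B - C = B \<inter> V"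
    using assms openin_diff[of "top_of_set B" B C] unfolding clopen_in_def by (auto simp: openin_open)
  then have "\<exists>N h. open N \<and> y \<in> N \<and> continuous_on B h \<and> (\<forall>z\<in>N \<inter> B. indicator C z = (h z :: real))" if "y \<in> B" for y
  proof (cases "y \<in> C")
    case True
    then show ?thesis using \<open>open U\<close> \<open>C = B \<inter> U\<close> by (intro exI[of _ U] exI[of _ "\<lambda>_. 1"]) auto
  next
    case False
    then show ?thesis using \<open>open V\<close> \<open>B - C = B \<inter> V\<close> that by (intro exI[of _ V] exI[of _ "\<lambda>_. 0"]) (auto simp: indicator_def)
  qed
  then show "continuous_on B (indicator C :: 'x \<Rightarrow> real)" by (rule continuous_on_locally_equal)
  have "(indicator C :: 'x \<Rightarrow> real) ` B \<subseteq> {0, 1}" by (auto simp: indicator_def)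
  then show "finite ((indicator C :: 'x \<Rightarrow> real) ` B)" by (rule finite_subset) simp
qed

lemma finite_valued_combine:
  assumes "finite_valued f" "finite_valued g" "continuous_on B (\<lambda>x. F (f x) (g x))"
  shows "finite_valued (\<lambda>x. F (f x) (g x))"
proof -
  have "(\<lambda>x. F (f x) (g x)) ` B \<subseteq> (\<lambda>(s, t). F s t) ` (f ` B \<times> g ` B)" by auto
  then have "finite ((\<lambda>x. F (f x) (g x)) ` B)"
    by (rule finite_subset) (use assms in \<open>simp add: finite_valued_def\<close>)
  then show ?thesis using assms(3) by (simp add: finite_valued_def)
qed

text \<open>Stone-Weierstrass: finite-valued functions form an algebra, and indicators of clopen
  sets separate points.\<close>

theorem finite_valued_dense:
  assumes "continuous_on B f" "0 < \<epsilon>"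
  obtains g where "finite_valued g" "\<And>x. x \<in> B \<Longrightarrow> \<bar>f x - g x\<bar> < \<epsilon>"
proof -
  interpret function_ring_on "Collect finite_valued" B
  proof
    show "compact B" by (rule compact_boundary)
    show "continuous_on B f" if "f \<in> Collect finite_valued" for f using that by (simp add: finite_valued_def)
    show "(\<lambda>x. f x + g x) \<in> Collect finite_valued" if "f \<in> Collect finite_valued" "g \<in> Collect finite_valued" for f g
      using that by (auto intro!: finite_valued_combine[of f g "(+)"] continuous_intros simp: finite_valued_def[of f] finite_valued_def[of g])
    show "(\<lambda>x. f x * g x) \<in> Collect finite_valued" if "f \<in> Collect finite_valued" "g \<in> Collect finite_valued" for f g
      using that by (auto intro!: finite_valued_combine[of f g "(*)"] continuous_intros simp: finite_valued_def[of f] finite_valued_def[of g])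
    show "(\<lambda>_. c) \<in> Collect finite_valued" for c by (auto simp: finite_valued_def image_constant_conv)
    fix x y assume "x \<in> B" "y \<in> B" "x \<noteq> y"
    then obtain C where "clopen_in B C" "x \<in> C" "y \<notin> C" using clopen_separation by blast
    then show "\<exists>f\<in>Collect finite_valued. f x \<noteq> f y"
      by (intro bexI[of _ "indicator C"]) (auto simp: clopen_in_indicator)
  qed
  show thesis using Stone_Weierstrass_basic[OF assms] that by auto
qed

text \<open>Approximate the distance to the complement of \<open>U\<close> by finite-valued
  functions within \<open>1 / Suc n\<close>. A value above \<open>1 / Suc n\<close> then forces the
  distance to be positive, and every point of \<open>U \<inter> B\<close> is caught once
  \<open>2 / Suc n\<close> is below its distance.\<close>

lemma open_boundary_UN_clopen:
  assumes "open U"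
  obtains C :: "nat \<Rightarrow> 'x set" where "\<And>n. clopen_in B (C n)" "U \<inter> B = (\<Union>n. C n)"
proof (cases "B - U = {}")
  case True
  then show thesis using that[of "\<lambda>_. B"] clopen_in_whole by auto
next
  case False
  define f where "f x = infdist x (B - U)" for x
  have closed: "closed (B - U)" using closed_boundary assms by blast
  have cont: "continuous_on B f" unfolding f_def by (intro continuous_intros)
  have "\<exists>g. finite_valued g \<and> (\<forall>x\<in>B. \<bar>f x - g x\<bar> < 1 / real (Suc n))" for n
    using finite_valued_dense[OF cont, of "1 / real (Suc n)"] by (metis of_nat_0_less_iff zero_less_Suc zero_less_divide_1_iff)
  then obtain g where g: "\<And>n. finite_valued (g n)" "\<And>n x. x \<in> B \<Longrightarrow> \<bar>f x - g n x\<bar> < 1 / real (Suc n)" by metis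
  define C where "C n = {x \<in> B. g n x \<in> {1 / real (Suc n)<..}}" for n
  show thesis
  proof (rule that)
    show "clopen_in B (C n)" for n unfolding C_def by (rule finite_valued_level_clopen[OF g(1)])
    show "U \<inter> B = (\<Union>n. C n)"
    proof (intro equalityI subsetI)
      fix x assume x: "x \<in> U \<inter> B"
      then have "f x > 0" unfolding f_def using False closed by (subst infdist_pos_not_in_closed) auto
      then obtain n where n: "1 / real (Suc n) < f x / 2" using nat_approx_posE[of "f x / 2"] by auto
      then have "x \<in> C n" using g(2)[of x n] x unfolding C_def by auto
      then show "x \<in> (\<Union>n. C n)" by blast
    next
      fix x assume "x \<in> (\<Union>n. C n)"
      then obtain n where n: "x \<in> B" "g n x > 1 / real (Suc n)" unfolding C_def by auto
      then have "f x > 0" using g(2)[of x n] by linarith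
      then show "x \<in> U \<inter> B" using n(1) unfolding f_def by (metis DiffI Int_iff infdist_zero less_irrefl)
    qed
  qed
qed

lemma finite_range_functions_iff:
  "F \<in> finite_range_functions B \<longleftrightarrow> F \<in> extensional B \<and> finite_valued F"
  unfolding finite_range_functions_def C_space_def finite_valued_def
  using compactin_mspace_cfunspace[of "top_of_set B" euclidean_metric] compact_boundary
  by (auto simp: compactin_subtopology)

theorem finite_range_functions_dense:
  "mtopology_of (C_space B) closure_of finite_range_functions B = mspace (C_space B)"
proof -
  interpret M: Metric_space "mspace (C_space B)" "mdist (C_space B)" by (rule Metric_space_mspace_mdist)
  have eq: "mtopology_of (C_space B) = M.mtopology" by (simp add: mtopology_of_def)
  have "f \<in> M.mtopology closure_of finite_range_functions B" if f: "f \<in> mspace (C_space B)" for f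
    unfolding M.metric_closure_of
  proof (intro CollectI conjI allI impI f)
    fix r :: real assume "0 < r"
    have fc: "continuous_on B f" using f by (simp add: C_space_def)
    obtain g where g: "finite_valued g" "\<And>x. x \<in> B \<Longrightarrow> \<bar>f x - g x\<bar> < r / 2"
      using finite_valued_dense[OF fc, of "r / 2"] \<open>0 < r\<close> by auto
    \<comment> \<open>Elements of \<open>C_space\<close> are undefined outside \<open>B\<close>,
      hence the restriction.\<close>
    define g' where "g' = restrict g B"
    have "finite_valued g'" using g(1) unfolding finite_valued_def g'_def
      by (auto cong: continuous_on_cong image_cong)
    then have g': "g' \<in> finite_range_functions B" by (simp add: finite_range_functions_iff g'_def)
    then have g'm: "g' \<in> mspace (C_space B)" by (simp add: finite_range_functions_def)
    have "mdist (C_space B) f g' \<le> r / 2"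
      unfolding C_space_def
    proof (rule mdist_cfunspace_le)
      fix x assume "x \<in> topspace (top_of_set B)"
      then show "mdist euclidean_metric (f x) (g' x) \<le> r / 2"
        using g(2)[of x] by (simp add: g'_def dist_real_def)
    qed (use \<open>0 < r\<close> in simp)
    then show "\<exists>y\<in>finite_range_functions B. y \<in> M.mball f r"
      using g' g'm f \<open>0 < r\<close> by (intro bexI[of _ g']) (auto simp: M.in_mball)
  qed
  moreover have "M.mtopology closure_of finite_range_functions B \<subseteq> mspace (C_space B)"
    using closure_of_subset_topspace[of M.mtopology] by simp
  ultimately show ?thesis unfolding eq by blast
qed

end

lemma sum_telescope_interval:
  fixes F :: "nat \<Rightarrow> real"
  shows "i \<le> j \<Longrightarrow> (\<Sum>k\<in>{i..<j}. F (Suc k) - F k) = F j - F i"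
  by (rule sum_Suc_diff')

text \<open>The cells inside [a, b] are consecutive, from the first node above \<open>a\<close> to
  the last one below \<open>b\<close>. Increments over them telescope, and their total length is at
  most b - a.\<close>

lemma cells_within:
  fixes a b l h :: real
  assumes "l < h" "l \<le> a" "a \<le> b" "b \<le> h"
  defines "cells n \<equiv> {k. k < 2 ^ n \<and> a \<le> node l h n k \<and> node l h n (Suc k) \<le> b}"
  shows sum_cells_tendsto: "continuous_on {l..h} f \<Longrightarrow>
      (\<lambda>n. \<Sum>k\<in>cells n. f (node l h n (Suc k)) - f (node l h n k)) \<longlonglongrightarrow> f b - (f a :: real)"
    and card_cells_le: "real (card (cells n)) * ((h - l) / 2 ^ n) \<le> b - a"
proof -
  define i where "i n = nat \<lceil>(a - l) / (h - l) * 2 ^ n\<rceil>" for n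
  \<comment> \<open>If no cell fits, the last node below \<open>b\<close> may precede the first one
    above \<open>a\<close>; the maximum then makes the block empty.\<close>
  define j where "j n = max (i n) (nat \<lfloor>(b - l) / (h - l) * 2 ^ n\<rfloor>)" for n
  have node_eq: "node l h n k = l + (h - l) / 2 ^ n * real k" for n k by (simp add: node_def)
  have d: "(h - l) / 2 ^ n > 0" for n using assms(1) by simp
  have node_ge: "y \<le> node l h n k \<longleftrightarrow> (y - l) / (h - l) * 2 ^ n \<le> real k" for y n k
    unfolding node_eq using assms(1) by (simp add: field_simps)
  have node_le: "node l h n k \<le> y \<longleftrightarrow> real k \<le> (y - l) / (h - l) * 2 ^ n" for y n k
    unfolding node_eq using assms(1) by (simp add: field_simps)
  have pos: "0 \<le> (y - l) / (h - l) * 2 ^ n" if "l \<le> y" for y n using that assms(1) by simp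
  have le: "(y - l) / (h - l) * 2 ^ n \<le> 2 ^ n" if "y \<le> h" for y n
  proof -
    have "(y - l) / (h - l) \<le> 1" using that assms(1) by simp
    then have "(y - l) / (h - l) * 2 ^ n \<le> 1 * 2 ^ n" by (intro mult_right_mono) auto
    then show ?thesis by simp
  qed
  have i_iff: "i n \<le> k \<longleftrightarrow> a \<le> node l h n k" for n k
    unfolding node_ge i_def using pos[of a n] assms(2) by (simp add: nat_le_iff ceiling_le_iff)
  have j'_iff: "k \<le> nat \<lfloor>(b - l) / (h - l) * 2 ^ n\<rfloor> \<longleftrightarrow> node l h n k \<le> b" for n k
    unfolding node_le using pos[of b n] assms(2,3) by (simp add: le_nat_iff le_floor_iff)
  have i2: "i n \<le> 2 ^ n" for n unfolding i_iff using assms(3,4) by simp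
  have j'2: "nat \<lfloor>(b - l) / (h - l) * 2 ^ n\<rfloor> \<le> 2 ^ n" for n
    using le[of b n] assms(4) by (simp add: nat_le_iff floor_le_iff)
  have j2: "j n \<le> 2 ^ n" for n unfolding j_def using i2 j'2 by simp
  have ij: "i n \<le> j n" for n by (simp add: j_def)
  have aux: "k < 2 ^ n \<and> i \<le> k \<and> Suc k \<le> J \<longleftrightarrow> k \<in> {i..<max i J}" if "J \<le> 2 ^ n" for i J k n :: nat
    using that by auto
  have cells: "cells n = {i n..<j n}" for n
  proof (rule set_eqI)
    fix k
    have "k \<in> cells n \<longleftrightarrow> k < 2 ^ n \<and> i n \<le> k \<and> Suc k \<le> nat \<lfloor>(b - l) / (h - l) * 2 ^ n\<rfloor>"
      unfolding cells_def i_iff j'_iff by simp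
    also have "\<dots> \<longleftrightarrow> k \<in> {i n..<j n}" unfolding j_def by (rule aux[OF j'2])
    finally show "k \<in> cells n \<longleftrightarrow> k \<in> {i n..<j n}" .
  qed
  have ia: "\<bar>node l h n (i n) - a\<bar> \<le> (h - l) * (1 / 2) ^ n" for n
  proof -
    have 1: "a \<le> node l h n (i n)" using i_iff[of n "i n"] by simp
    have 2: "node l h n (i n) \<le> a + (h - l) / 2 ^ n"
    proof (cases "i n")
      case 0
      then have "node l h n (i n) = l" by simp
      then show ?thesis using assms(2) d[of n] by simp
    next
      case (Suc k)
      then have "node l h n k < a" using i_iff[of n k] by simp
      then show ?thesis using node_diff[of l h n k] Suc by simp
    qed
    show ?thesis using 1 2 by (simp add: power_divide)
  qed
  have jb: "\<bar>node l h n (j n) - b\<bar> \<le> (h - l) * (1 / 2) ^ n" for n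
  proof (cases "i n \<le> nat \<lfloor>(b - l) / (h - l) * 2 ^ n\<rfloor>")
    case True
    then have j: "j n = nat \<lfloor>(b - l) / (h - l) * 2 ^ n\<rfloor>" by (simp add: j_def)
    have "node l h n (j n) \<le> b" using j'_iff[of "j n" n] j by simp
    moreover have "b < node l h n (Suc (j n))" using j'_iff[of "Suc (j n)" n] j by simp
    ultimately show ?thesis using node_diff[of l h n "j n"] by (simp add: power_divide)
  next
    case False
    then have j: "j n = i n" by (simp add: j_def)
    have "b < node l h n (i n)" using j'_iff[of "i n" n] False by simp
    moreover have "node l h n (i n) \<le> a + (h - l) * (1 / 2) ^ n" using ia[of n] by simp
    ultimately show ?thesis using j assms(3) by simp
  qed
  show "real (card (cells n)) * ((h - l) / 2 ^ n) \<le> b - a" for n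
  proof (cases "i n \<le> nat \<lfloor>(b - l) / (h - l) * 2 ^ n\<rfloor>")
    case True
    then have j: "j n = nat \<lfloor>(b - l) / (h - l) * 2 ^ n\<rfloor>" by (simp add: j_def)
    have "node l h n (j n) \<le> b" using j'_iff[of "j n" n] j by simp
    moreover have "a \<le> node l h n (i n)" using i_iff[of n "i n"] by simp
    moreover have "real (card (cells n)) * ((h - l) / 2 ^ n) = node l h n (j n) - node l h n (i n)"
    proof -
      have "real (j n - i n) * c = (l + c * real (j n)) - (l + c * real (i n))" for c
        using ij[of n] by (simp add: of_nat_diff algebra_simps)
      then show ?thesis unfolding cells node_eq card_atLeastLessThan .
    qed
    ultimately show ?thesis by simp
  next
    case False
    then have "j n = i n" by (simp add: j_def)
    then show ?thesis unfolding cells using assms(3) by simp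
  qed
  show "(\<lambda>n. \<Sum>k\<in>cells n. f (node l h n (Suc k)) - f (node l h n k)) \<longlonglongrightarrow> f b - f a" if f: "continuous_on {l..h} f"
  proof -
    have eq: "(\<Sum>k\<in>cells n. f (node l h n (Suc k)) - f (node l h n k)) = f (node l h n (j n)) - f (node l h n (i n))" for n
      unfolding cells using sum_telescope_interval[OF ij, of "\<lambda>k. f (node l h n k)" n] .
    have "(\<lambda>n. node l h n (j n) - b) \<longlonglongrightarrow> 0" "(\<lambda>n. node l h n (i n) - a) \<longlonglongrightarrow> 0"
      by (rule Lim_null_comparison[OF _ tendsto_half_powers[of "h - l"]]; use ia jb in simp)+
    then have "(\<lambda>n. node l h n (j n)) \<longlonglongrightarrow> b" "(\<lambda>n. node l h n (i n)) \<longlonglongrightarrow> a" by (simp_all add: LIM_zero_iff)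
    moreover have "node l h n (j n) \<in> {l..h}" "node l h n (i n) \<in> {l..h}" for n
      using assms(1) by (intro node_mem i2 j2; simp)+
    ultimately have "(\<lambda>n. f (node l h n (j n))) \<longlonglongrightarrow> f b" "(\<lambda>n. f (node l h n (i n))) \<longlonglongrightarrow> f a"
      using assms(2-4) continuous_on_tendsto_compose[OF f, of _ _ sequentially] by simp_all
    then show ?thesis unfolding eq by (rule tendsto_diff)
  qed
qed

section \<open>The Dirichlet energy\<close>

lemma list_split_two:
  assumes "i < j" "j < length L"
  shows "\<exists>A C D. L = A @ L ! i # C @ L ! j # D"
proof -
  have 1: "L = take i L @ L ! i # drop (Suc i) L" using assms by (intro id_take_nth_drop) simp
  have "j - Suc i < length (drop (Suc i) L)" using assms by simp
  from id_take_nth_drop[OF this]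
  have "drop (Suc i) L = take (j - Suc i) (drop (Suc i) L) @ L ! j # drop (Suc (j - Suc i)) (drop (Suc i) L)"
    using assms by simp
  with 1 show ?thesis by metis
qed

context completed_graph
begin

section \<open>Paths as lists of segments, and the removal of overlaps\<close>

fun chain :: "'v graph_point \<Rightarrow> (('v \<times> 'v) \<times> real \<times> real) list \<Rightarrow> 'v graph_point \<Rightarrow> bool" where
  "chain p [] p' \<longleftrightarrow> p = p'"
| "chain p ((e, s, t) # L) p' \<longleftrightarrow> p = ep e s \<and> e \<in> E \<and> s \<in> seg e \<and> t \<in> seg e \<and> chain (ep e t) L p'"

definition chain_length :: "(('v \<times> 'v) \<times> real \<times> real) list \<Rightarrow> real" where
  "chain_length L = (\<Sum>(e, s, t)\<leftarrow>L. \<bar>t - s\<bar>)"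

lemma chain_length_simps [simp]: "chain_length [] = 0" "chain_length ((e, s, t) # L) = \<bar>t - s\<bar> + chain_length L"
  "chain_length (L @ L') = chain_length L + chain_length L'"
  by (simp_all add: chain_length_def)

lemma chain_length_nonneg: "0 \<le> chain_length L"
  by (induction L) auto

lemma chain_append: "chain p (L @ L') p' \<longleftrightarrow> (\<exists>m. chain p L m \<and> chain m L' p')"
  by (induction L arbitrary: p) auto

lemma chain_mem: "chain p L p' \<Longrightarrow> (e, s, t) \<in> set L \<Longrightarrow> e \<in> E \<and> s \<in> seg e \<and> t \<in> seg e"
  by (induction p L p' rule: chain.induct) auto

lemma path_chain: "path_of_length \<Gamma> p d p' \<Longrightarrow> \<exists>L. chain p L p' \<and> chain_length L = d"
proof (induction rule: path_of_length.induct)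
  case (path_refl p)
  show ?case by (rule exI[of _ "[]"]) simp
next
  case (path_step p d e s t)
  then obtain L where "chain p L (ep e s)" "chain_length L = d" by blast
  with path_step.hyps show ?case
    by (intro exI[of _ "L @ [(e, s, t)]"]) (simp add: chain_append)
qed

text \<open>Removing overlaps shortens a path and makes its variation accessible to Cauchy-Schwarz.\<close>
definition overlap :: "('v \<times> 'v) \<times> real \<times> real \<Rightarrow> ('v \<times> 'v) \<times> real \<times> real \<Rightarrow> bool" where
  "overlap = (\<lambda>(e, s, t) (e', s', t'). e = e' \<and> max (min s t) (min s' t') < min (max s t) (max s' t'))"

definition nonoverlapping :: "(('v \<times> 'v) \<times> real \<times> real) list \<Rightarrow> bool" where
  "nonoverlapping L \<longleftrightarrow> (\<forall>i j. i < j \<longrightarrow> j < length L \<longrightarrow> \<not> overlap (L ! i) (L ! j))"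

text \<open>Overlapping segments span an interval no longer than the sum of their lengths, and it
  contains both \<open>s\<close> and \<open>t'\<close>. Going directly from \<open>s\<close> to
  \<open>t'\<close> skips everything between and leaves fewer segments, so the process ends.\<close>

lemma chain_shortcut:
  assumes "chain p (A @ (e, s, t) # C @ (e', s', t') # D) p'" and "overlap (e, s, t) (e', s', t')"
  shows "chain p (A @ (e, s, t') # D) p'"
    and "chain_length (A @ (e, s, t') # D) \<le> chain_length (A @ (e, s, t) # C @ (e', s', t') # D)"
proof -
  have e: "e' = e" and o: "max (min s t) (min s' t') < min (max s t) (max s' t')"
    using assms(2) by (auto simp: overlap_def)
  show "chain p (A @ (e, s, t') # D) p'"
    using assms(1) unfolding chain_append by (auto simp: chain_append e)
  have "\<bar>t' - s\<bar> \<le> \<bar>t - s\<bar> + \<bar>t' - s'\<bar>" using o by (auto simp: max_def min_def abs_if split: if_splits)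
  then show "chain_length (A @ (e, s, t') # D) \<le> chain_length (A @ (e, s, t) # C @ (e', s', t') # D)"
    using chain_length_nonneg[of C] by simp
qed

lemma nonoverlapping_chain:
  "chain p L p' \<Longrightarrow> \<exists>L'. chain p L' p' \<and> chain_length L' \<le> chain_length L \<and> nonoverlapping L'"
proof (induction "length L" arbitrary: L rule: less_induct)
  case less
  show ?case
  proof (cases "nonoverlapping L")
    case True
    then show ?thesis using less.prems by blast
  next
    case False
    then obtain i j where ij: "i < j" "j < length L" "overlap (L ! i) (L ! j)" unfolding nonoverlapping_def by blast
    obtain A C D where L: "L = A @ L ! i # C @ L ! j # D" using list_split_two[OF ij(1,2)] by blast
    obtain e s t where i: "L ! i = (e, s, t)" using prod_cases3 by blast
    obtain e' s' t' where j: "L ! j = (e', s', t')" using prod_cases3 by blast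
    have L': "L = A @ (e, s, t) # C @ (e', s', t') # D" using L unfolding i j .
    have o: "overlap (e, s, t) (e', s', t')" using ij(3) unfolding i j .
    let ?M = "A @ (e, s, t') # D"
    have ch: "chain p ?M p'" "chain_length ?M \<le> chain_length L"
      using chain_shortcut[OF _ o, of p A C D p'] less.prems unfolding L' by blast+
    have "length ?M < length L" unfolding L' by simp
    from less.hyps[OF this ch(1)] ch(2) show ?thesis by (meson order_trans)
  qed
qed

section \<open>The energy form as a limit of dyadic forms\<close>

definition edge_block :: "nat \<Rightarrow> ('v \<times> 'v) set" where
  "edge_block n = {e \<in> E. to_nat_on E e < n}"

lemma finite_edge_block: "finite (edge_block n)"
proof -
  have "inj_on (to_nat_on E) (edge_block n)"
    using inj_on_to_nat_on[OF countable_edges] by (rule inj_on_subset) (auto simp: edge_block_def)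
  moreover have "to_nat_on E ` edge_block n \<subseteq> {..<n}" by (auto simp: edge_block_def)
  ultimately show ?thesis using finite_imageD finite_subset by blast
qed

lemma edge_block_subset: "edge_block n \<subseteq> E"
  by (auto simp: edge_block_def)

lemma edge_block_mono: "m \<le> n \<Longrightarrow> edge_block m \<subseteq> edge_block n"
  by (auto simp: edge_block_def)

lemma edge_block_exhausts: 
  assumes "finite S" "S \<subseteq> E"
  obtains N where "\<And>n. N \<le> n \<Longrightarrow> S \<subseteq> edge_block n"
proof -
  define N where "N = Suc (Max (insert 0 (to_nat_on E ` S)))"
  have "S \<subseteq> edge_block n" if "N \<le> n" for n
  proof
    fix e assume e: "e \<in> S"
    then have "to_nat_on E e \<le> Max (insert 0 (to_nat_on E ` S))" using assms(1) by (intro Max_ge) auto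
    then show "e \<in> edge_block n" using that e assms(2) unfolding N_def edge_block_def by auto
  qed
  then show thesis by (rule that)
qed

text \<open>A single index drives both the exhaustion by finite sets of edges and the refinement on
  each edge; the diagonal forms increase under either.\<close>

definition dyadic_energy :: "nat \<Rightarrow> ('x \<Rightarrow> real) \<Rightarrow> ('x \<Rightarrow> real) \<Rightarrow> real" where
  "dyadic_energy n f g = (\<Sum>e\<in>edge_block n. dyadic_form (lo \<Gamma> e) (hi \<Gamma> e) n (on_edge \<Gamma> \<iota> f e) (on_edge \<Gamma> \<iota> g e))"

lemma on_edge_lambda: "on_edge \<Gamma> \<iota> (\<lambda>y. F (f y)) e = (\<lambda>x. F (on_edge \<Gamma> \<iota> f e x))"
  "on_edge \<Gamma> \<iota> (\<lambda>y. G (f y) (g y)) e = (\<lambda>x. G (on_edge \<Gamma> \<iota> f e x) (on_edge \<Gamma> \<iota> g e x))"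
  by (simp_all add: on_edge_def fun_eq_iff)

lemma dyadic_energy_commute: "dyadic_energy n f g = dyadic_energy n g f"
  unfolding dyadic_energy_def using dyadic_form_commute by metis

lemma dyadic_energy_add_right: "dyadic_energy n f (\<lambda>y. g y + h y) = dyadic_energy n f g + dyadic_energy n f h"
  unfolding dyadic_energy_def on_edge_lambda(2)[where G = "(+)"] dyadic_form_add_right sum.distrib ..

lemma dyadic_energy_cmult_right: "dyadic_energy n f (\<lambda>y. c * g y) = c * dyadic_energy n f g"
  unfolding dyadic_energy_def on_edge_lambda(1)[where F = "(*) c"] dyadic_form_cmult_right sum_distrib_left ..

lemma dyadic_energy_add_left: "dyadic_energy n (\<lambda>y. g y + h y) f = dyadic_energy n g f + dyadic_energy n h f"
  using dyadic_energy_add_right dyadic_energy_commute by metis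

lemma dyadic_energy_cmult_left: "dyadic_energy n (\<lambda>y. c * g y) f = c * dyadic_energy n g f"
  using dyadic_energy_cmult_right dyadic_energy_commute by metis

lemma dyadic_energy_nonneg: "0 \<le> dyadic_energy n f f"
  unfolding dyadic_energy_def using edge_block_subset lo_less_hi by (intro sum_nonneg dyadic_form_nonneg) auto

lemma dyadic_energy_Suc_ge: "dyadic_energy n f f \<le> dyadic_energy (Suc n) f f"
proof -
  have "dyadic_energy n f f \<le> (\<Sum>e\<in>edge_block n. dyadic_form (lo \<Gamma> e) (hi \<Gamma> e) (Suc n) (on_edge \<Gamma> \<iota> f e) (on_edge \<Gamma> \<iota> f e))"
    unfolding dyadic_energy_def using edge_block_subset lo_less_hi by (intro sum_mono dyadic_form_Suc_ge) auto
  also have "\<dots> \<le> dyadic_energy (Suc n) f f"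
    unfolding dyadic_energy_def using edge_block_subset lo_less_hi
    by (intro sum_mono2 finite_edge_block edge_block_mono dyadic_form_nonneg) auto
  finally show ?thesis .
qed

lemma dyadic_energy_mono: "m \<le> n \<Longrightarrow> dyadic_energy m f f \<le> dyadic_energy n f f"
  by (rule lift_Suc_mono_le[of "\<lambda>n. dyadic_energy n f f", OF dyadic_energy_Suc_ge])

lemma dyadic_energy_contraction:
  assumes "\<And>x y. x \<in> X \<Longrightarrow> y \<in> X \<Longrightarrow> \<bar>g x - g y\<bar> \<le> \<bar>f x - f y\<bar>"
  shows "dyadic_energy n g g \<le> dyadic_energy n f f"
  unfolding dyadic_energy_def
proof (intro sum_mono dyadic_form_mono_contraction)
  fix e s t assume "e \<in> edge_block n"
  then have e: "e \<in> E" using edge_block_subset by blast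
  then show "lo \<Gamma> e < hi \<Gamma> e" by (rule lo_less_hi)
  assume "s \<in> seg e" "t \<in> seg e"
  then show "\<bar>on_edge \<Gamma> \<iota> g e t - on_edge \<Gamma> \<iota> g e s\<bar> \<le> \<bar>on_edge \<Gamma> \<iota> f e t - on_edge \<Gamma> \<iota> f e s\<bar>"
    unfolding on_edge_def by (intro assms ep_mem_X[OF e])
qed

definition finite_energy :: "('x \<Rightarrow> real) \<Rightarrow> bool" where
  "finite_energy f \<longleftrightarrow> continuous_on X f \<and> (\<exists>C. \<forall>n. dyadic_energy n f f \<le> C)"

definition energy :: "('x \<Rightarrow> real) \<Rightarrow> ('x \<Rightarrow> real) \<Rightarrow> real" where
  "energy f g = lim (\<lambda>n. dyadic_energy n f g)"

lemma finite_energy_continuous: "finite_energy f \<Longrightarrow> continuous_on X f"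
  by (simp add: finite_energy_def)

lemma dyadic_energy_square_add: "dyadic_energy n (\<lambda>y. f y + g y) (\<lambda>y. f y + g y) = dyadic_energy n f f + 2 * dyadic_energy n f g + dyadic_energy n g g"
  unfolding dyadic_energy_add_left dyadic_energy_add_right using dyadic_energy_commute[of n f g] by simp

lemma dyadic_energy_square_diff: "dyadic_energy n (\<lambda>y. f y + (-1) * g y) (\<lambda>y. f y + (-1) * g y) = dyadic_energy n f f - 2 * dyadic_energy n f g + dyadic_energy n g g"
  unfolding dyadic_energy_square_add dyadic_energy_cmult_right dyadic_energy_cmult_left by simp

lemma finite_energy_add:
  assumes "finite_energy f" "finite_energy g"
  shows "finite_energy (\<lambda>y. f y + g y)"
proof -
  obtain C C' where C: "\<And>n. dyadic_energy n f f \<le> C" and C': "\<And>n. dyadic_energy n g g \<le> C'" using assms unfolding finite_energy_def by auto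
  have "dyadic_energy n (\<lambda>y. f y + g y) (\<lambda>y. f y + g y) \<le> 2 * C + 2 * C'" for n
    using dyadic_energy_nonneg[of n "\<lambda>y. f y + (-1) * g y"] C[of n] C'[of n] dyadic_energy_square_add[of n f g] dyadic_energy_square_diff[of n f g] by linarith
  then show ?thesis using assms unfolding finite_energy_def by (auto intro: continuous_intros)
qed

lemma finite_energy_cmult:
  assumes "finite_energy f"
  shows "finite_energy (\<lambda>y. c * f y)"
proof -
  obtain C where C: "\<And>n. dyadic_energy n f f \<le> C" using assms unfolding finite_energy_def by auto
  have "dyadic_energy n (\<lambda>y. c * f y) (\<lambda>y. c * f y) \<le> c * (c * C)" for n
  proof -
    have "(c * c) * dyadic_energy n f f \<le> (c * c) * C" using C by (intro mult_left_mono) auto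
    then show ?thesis unfolding dyadic_energy_cmult_left dyadic_energy_cmult_right by (simp only: mult.assoc)
  qed
  then show ?thesis using assms unfolding finite_energy_def by (auto intro: continuous_intros)
qed

lemma finite_energy_diff: "finite_energy f \<Longrightarrow> finite_energy g \<Longrightarrow> finite_energy (\<lambda>y. f y + (-1) * g y)"
  using finite_energy_add finite_energy_cmult by blast

lemma finite_energy_contraction:
  assumes "finite_energy f" "continuous_on X g"
    and "\<And>x y. x \<in> X \<Longrightarrow> y \<in> X \<Longrightarrow> \<bar>g x - g y\<bar> \<le> \<bar>f x - f y\<bar>"
  shows "finite_energy g"
  using assms(1,2) dyadic_energy_contraction[of g f, OF assms(3)] unfolding finite_energy_def by (meson order_trans)

lemma dyadic_energy_tendsto_self: "finite_energy f \<Longrightarrow> convergent (\<lambda>n. dyadic_energy n f f)"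
  unfolding finite_energy_def using Bseq_mono_convergent[of "\<lambda>n. dyadic_energy n f f"] dyadic_energy_mono dyadic_energy_nonneg
  by (metis BseqI' abs_of_nonneg real_norm_def)

text \<open>Polarization: the mixed form is a combination of two diagonal ones, and these are
  monotone and bounded.\<close>

lemma dyadic_energy_tendsto:
  assumes "finite_energy f" "finite_energy g"
  shows "(\<lambda>n. dyadic_energy n f g) \<longlonglongrightarrow> energy f g"
proof -
  have eq: "dyadic_energy n f g = (dyadic_energy n (\<lambda>y. f y + g y) (\<lambda>y. f y + g y) - dyadic_energy n (\<lambda>y. f y + (-1) * g y) (\<lambda>y. f y + (-1) * g y)) / 4" for n
    unfolding dyadic_energy_square_add[of n f g] dyadic_energy_square_diff[of n f g] by simp
  obtain L where L: "(\<lambda>n. dyadic_energy n (\<lambda>y. f y + g y) (\<lambda>y. f y + g y)) \<longlonglongrightarrow> L"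
    using dyadic_energy_tendsto_self[OF finite_energy_add[OF assms]] by (auto simp: convergent_def)
  obtain L' where L': "(\<lambda>n. dyadic_energy n (\<lambda>y. f y + (-1) * g y) (\<lambda>y. f y + (-1) * g y)) \<longlonglongrightarrow> L'"
    using dyadic_energy_tendsto_self[OF finite_energy_diff[OF assms]] by (auto simp: convergent_def)
  have lim: "(\<lambda>n. dyadic_energy n f g) \<longlonglongrightarrow> (L - L') / 4"
    unfolding eq by (intro tendsto_divide tendsto_diff L L' tendsto_const) simp
  show ?thesis unfolding energy_def limI[OF lim] by (rule lim)
qed

lemma energy_eqI: "finite_energy f \<Longrightarrow> finite_energy g \<Longrightarrow> (\<lambda>n. dyadic_energy n f g) \<longlonglongrightarrow> L \<Longrightarrow> energy f g = L"
  using dyadic_energy_tendsto LIMSEQ_unique by blast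

lemma dyadic_energy_le_energy: "finite_energy f \<Longrightarrow> dyadic_energy n f f \<le> energy f f"
  using dyadic_energy_tendsto[of f f] incseq_le[of "\<lambda>n. dyadic_energy n f f"] dyadic_energy_mono by (simp add: incseq_def)

lemma energy_nonneg: "finite_energy f \<Longrightarrow> 0 \<le> energy f f"
  using dyadic_energy_le_energy[of f 0] dyadic_energy_nonneg[of 0 f] by linarith

lemma energy_commute: "energy f g = energy g f"
  unfolding energy_def dyadic_energy_commute[of _ f g] ..

lemma energy_add_right:
  assumes "finite_energy f" "finite_energy g" "finite_energy h"
  shows "energy f (\<lambda>y. g y + h y) = energy f g + energy f h"
proof (rule energy_eqI)
  show "(\<lambda>n. dyadic_energy n f (\<lambda>y. g y + h y)) \<longlonglongrightarrow> energy f g + energy f h"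
    unfolding dyadic_energy_add_right by (intro tendsto_add dyadic_energy_tendsto assms)
qed (use assms finite_energy_add in auto)

lemma energy_cmult_right:
  assumes "finite_energy f" "finite_energy g"
  shows "energy f (\<lambda>y. c * g y) = c * energy f g"
proof (rule energy_eqI)
  show "(\<lambda>n. dyadic_energy n f (\<lambda>y. c * g y)) \<longlonglongrightarrow> c * energy f g"
    unfolding dyadic_energy_cmult_right by (intro tendsto_mult tendsto_const dyadic_energy_tendsto assms)
qed (use assms finite_energy_cmult in auto)

text \<open>The Markov property of a Dirichlet form, inherited from the cells.\<close>

lemma energy_contraction:
  assumes "finite_energy f" "continuous_on X g"
    and "\<And>x y. x \<in> X \<Longrightarrow> y \<in> X \<Longrightarrow> \<bar>g x - g y\<bar> \<le> \<bar>f x - f y\<bar>"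
  shows "energy g g \<le> energy f f"
proof (rule LIMSEQ_le)
  have g: "finite_energy g" by (rule finite_energy_contraction[OF assms])
  show "(\<lambda>n. dyadic_energy n g g) \<longlonglongrightarrow> energy g g" "(\<lambda>n. dyadic_energy n f f) \<longlonglongrightarrow> energy f f"
    using dyadic_energy_tendsto assms(1) g by blast+
  show "\<exists>N. \<forall>n\<ge>N. dyadic_energy n g g \<le> dyadic_energy n f f" using dyadic_energy_contraction[of g f, OF assms(3)] by blast
qed

text \<open>Cauchy-Schwarz on the dyadic cells of a subdivision that is fine compared to the chain.\<close>
lemma chain_variation:
  assumes f: "finite_energy f" and L: "chain p L p'" "nonoverlapping L"
  shows "(f (\<iota> p') - f (\<iota> p))\<^sup>2 \<le> chain_length L * energy f f"
proof -
  define ed where "ed i = fst (L ! i)" for i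
  define lf where "lf i = min (fst (snd (L ! i))) (snd (snd (L ! i)))" for i
  define rt where "rt i = max (fst (snd (L ! i))) (snd (snd (L ! i)))" for i
  define F where "F i = on_edge \<Gamma> \<iota> f (ed i)" for i
  let ?N = "length L"
  have mem: "ed i \<in> E \<and> lf i \<in> seg (ed i) \<and> rt i \<in> seg (ed i) \<and> lf i \<le> rt i" if "i < ?N" for i
  proof -
    obtain e s t where est: "L ! i = (e, s, t)" by (rule prod_cases3)
    have "L ! i \<in> set L" using that by simp
    then have "e \<in> E \<and> s \<in> seg e \<and> t \<in> seg e" unfolding est by (rule chain_mem[OF L(1)])
    then show ?thesis unfolding ed_def lf_def rt_def est by (simp add: min_def max_def)
  qed
  have total: "\<bar>f (\<iota> p') - f (\<iota> p)\<bar> \<le> (\<Sum>i<?N. \<bar>F i (rt i) - F i (lf i)\<bar>)"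
  proof -
    have "\<bar>f (\<iota> p') - f (\<iota> p)\<bar> \<le> (\<Sum>(e, s, t)\<leftarrow>L. \<bar>on_edge \<Gamma> \<iota> f e t - on_edge \<Gamma> \<iota> f e s\<bar>)"
      using L(1)
    proof (induction L arbitrary: p)
      case (Cons a L)
      obtain e s t where a: "a = (e, s, t)" by (rule prod_cases3)
      have p: "p = ep e s" and ch: "chain (ep e t) L p'" using Cons.prems by (auto simp: a)
      have "\<bar>f (\<iota> p') - f (\<iota> (ep e t))\<bar> \<le> (\<Sum>(e, s, t)\<leftarrow>L. \<bar>on_edge \<Gamma> \<iota> f e t - on_edge \<Gamma> \<iota> f e s\<bar>)"
        by (rule Cons.IH[OF ch])
      then show ?case unfolding a p by (simp add: on_edge_def)
    qed simp
    also have "\<dots> = (\<Sum>i<?N. case L ! i of (e, s, t) \<Rightarrow> \<bar>on_edge \<Gamma> \<iota> f e t - on_edge \<Gamma> \<iota> f e s\<bar>)"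
      by (simp add: sum_list_sum_nth atLeast0LessThan)
    also have "\<dots> = (\<Sum>i<?N. \<bar>F i (rt i) - F i (lf i)\<bar>)"
    proof (rule sum.cong[OF refl])
      fix i
      obtain e s t where a: "L ! i = (e, s, t)" by (rule prod_cases3)
      show "(case L ! i of (e, s, t) \<Rightarrow> \<bar>on_edge \<Gamma> \<iota> f e t - on_edge \<Gamma> \<iota> f e s\<bar>) = \<bar>F i (rt i) - F i (lf i)\<bar>"
        unfolding F_def ed_def rt_def lf_def a by (cases "s \<le> t") (simp_all add: min_def max_def abs_minus_commute)
    qed
    finally show ?thesis .
  qed
  have len: "chain_length L = (\<Sum>i<?N. rt i - lf i)"
  proof -
    have "chain_length L = (\<Sum>i<?N. case L ! i of (e, s, t) \<Rightarrow> \<bar>t - s\<bar>)"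
      unfolding chain_length_def by (simp add: sum_list_sum_nth atLeast0LessThan)
    also have "\<dots> = (\<Sum>i<?N. rt i - lf i)"
    proof (rule sum.cong[OF refl])
      fix i
      obtain e s t where a: "L ! i = (e, s, t)" by (rule prod_cases3)
      show "(case L ! i of (e, s, t) \<Rightarrow> \<bar>t - s\<bar>) = rt i - lf i"
        unfolding rt_def lf_def a by (simp add: min_def max_def abs_if)
    qed
    finally show ?thesis .
  qed
  let ?nd = "\<lambda>i n. node (lo \<Gamma> (ed i)) (hi \<Gamma> (ed i)) n"
  let ?w = "\<lambda>e n. (hi \<Gamma> e - lo \<Gamma> e) / 2 ^ n"
  define cells where "cells i n = {k. k < 2 ^ n \<and> lf i \<le> ?nd i n k \<and> ?nd i n (Suc k) \<le> rt i}" for i n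
  define T where "T i n = (\<Sum>k\<in>cells i n. F i (?nd i n (Suc k)) - F i (?nd i n k))" for i n
  have T: "T i \<longlonglongrightarrow> F i (rt i) - F i (lf i)" if "i < ?N" for i
    unfolding T_def cells_def using mem[OF that] lo_less_hi[of "ed i"]
    by (intro sum_cells_tendsto) (auto simp: F_def intro: continuous_on_edge finite_energy_continuous f)
  have fin: "finite (cells i n)" for i n
    by (rule finite_subset[of _ "{..<2 ^ n}"]) (auto simp: cells_def)
  define D where "D e n k = on_edge \<Gamma> \<iota> f e (node (lo \<Gamma> e) (hi \<Gamma> e) n (Suc k)) - on_edge \<Gamma> \<iota> f e (node (lo \<Gamma> e) (hi \<Gamma> e) n k)" for e n k
  obtain N0 where N0: "\<And>n. N0 \<le> n \<Longrightarrow> ed ` {..<?N} \<subseteq> edge_block n"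
    by (rule edge_block_exhausts[of "ed ` {..<?N}"]) (use mem in auto)
  have key: "(\<Sum>i<?N. \<bar>T i n\<bar>)\<^sup>2 \<le> chain_length L * energy f f" if n: "N0 \<le> n" for n
  proof -
    define I where "I = Sigma {..<?N} (\<lambda>i. cells i n)"
    have wpos: "?w (ed i) n > 0" if "i < ?N" for i using mem[OF that] lo_less_hi[of "ed i"] by simp
    have wI: "?w (ed (fst z)) n > 0" if "z \<in> I" for z using that wpos unfolding I_def by auto
    have "(\<Sum>i<?N. \<bar>T i n\<bar>) \<le> (\<Sum>i<?N. \<Sum>k\<in>cells i n. \<bar>D (ed i) n k\<bar>)"
      unfolding T_def D_def F_def by (intro sum_mono sum_abs)
    also have "\<dots> = (\<Sum>z\<in>I. \<bar>D (ed (fst z)) n (snd z)\<bar>)"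
      unfolding I_def using fin by (subst sum.Sigma) (auto simp: case_prod_unfold)
    finally have 1: "(\<Sum>i<?N. \<bar>T i n\<bar>) \<le> (\<Sum>z\<in>I. \<bar>D (ed (fst z)) n (snd z)\<bar>)" .
    \<comment> \<open>Weighting with the square root of the cell length makes one factor of
      Cauchy-Schwarz the total length and the other a part of the dyadic form.\<close>
    have "(\<Sum>z\<in>I. \<bar>D (ed (fst z)) n (snd z)\<bar>) = (\<Sum>z\<in>I. sqrt (?w (ed (fst z)) n) * (\<bar>D (ed (fst z)) n (snd z)\<bar> / sqrt (?w (ed (fst z)) n)))"
    proof (intro sum.cong refl)
      fix z assume "z \<in> I"
      then have "sqrt (?w (ed (fst z)) n) > 0" by (rule real_sqrt_gt_zero[OF wI])
      then show "\<bar>D (ed (fst z)) n (snd z)\<bar> = sqrt (?w (ed (fst z)) n) * (\<bar>D (ed (fst z)) n (snd z)\<bar> / sqrt (?w (ed (fst z)) n))"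
        by (metis less_irrefl nonzero_mult_div_cancel_left times_divide_eq_right)
    qed
    then have "(\<Sum>z\<in>I. \<bar>D (ed (fst z)) n (snd z)\<bar>)\<^sup>2
       \<le> (\<Sum>z\<in>I. (sqrt (?w (ed (fst z)) n))\<^sup>2) * (\<Sum>z\<in>I. (\<bar>D (ed (fst z)) n (snd z)\<bar> / sqrt (?w (ed (fst z)) n))\<^sup>2)"
      by (simp only: Cauchy_Schwarz_ineq_sum)
    also have "(\<Sum>z\<in>I. (sqrt (?w (ed (fst z)) n))\<^sup>2) = (\<Sum>z\<in>I. ?w (ed (fst z)) n)"
      using wI by (intro sum.cong refl) (simp add: less_imp_le)
    also have "(\<Sum>z\<in>I. (\<bar>D (ed (fst z)) n (snd z)\<bar> / sqrt (?w (ed (fst z)) n))\<^sup>2) = (\<Sum>z\<in>I. (D (ed (fst z)) n (snd z))\<^sup>2 / ?w (ed (fst z)) n)"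
    proof (intro sum.cong refl)
      fix z assume "z \<in> I"
      then have "(sqrt (?w (ed (fst z)) n))\<^sup>2 = ?w (ed (fst z)) n" using wI[of z] by (intro real_sqrt_pow2) simp
      then show "(\<bar>D (ed (fst z)) n (snd z)\<bar> / sqrt (?w (ed (fst z)) n))\<^sup>2 = (D (ed (fst z)) n (snd z))\<^sup>2 / ?w (ed (fst z)) n"
        unfolding power_divide by (simp only: power2_abs)
    qed
    finally have 2: "(\<Sum>z\<in>I. \<bar>D (ed (fst z)) n (snd z)\<bar>)\<^sup>2
       \<le> (\<Sum>z\<in>I. ?w (ed (fst z)) n) * (\<Sum>z\<in>I. (D (ed (fst z)) n (snd z))\<^sup>2 / ?w (ed (fst z)) n)" .
    have 3: "(\<Sum>z\<in>I. ?w (ed (fst z)) n) \<le> chain_length L"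
    proof -
      have "(\<Sum>z\<in>I. ?w (ed (fst z)) n) = (\<Sum>i<?N. \<Sum>k\<in>cells i n. ?w (ed i) n)"
        unfolding I_def using fin by (subst sum.Sigma) (auto simp: case_prod_unfold)
      also have "\<dots> = (\<Sum>i<?N. real (card (cells i n)) * ?w (ed i) n)" by simp
      also have "\<dots> \<le> (\<Sum>i<?N. rt i - lf i)"
      proof (rule sum_mono)
        fix i assume "i \<in> {..<?N}"
        then show "real (card (cells i n)) * ?w (ed i) n \<le> rt i - lf i"
          unfolding cells_def using mem[of i] lo_less_hi[of "ed i"] by (intro card_cells_le) auto
      qed
      finally show ?thesis using len by simp
    qed
    have 4: "(\<Sum>z\<in>I. (D (ed (fst z)) n (snd z))\<^sup>2 / ?w (ed (fst z)) n) \<le> dyadic_energy n f f"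
    proof -
      \<comment> \<open>Two segments that contain the same cell would overlap. So each cell of the
        dyadic form is counted at most once.\<close>
      have inj: "inj_on (\<lambda>z. (ed (fst z), snd z)) I"
      proof (rule inj_onI)
        fix z z' assume z: "z \<in> I" "z' \<in> I" "(ed (fst z), snd z) = (ed (fst z'), snd z')"
        obtain i k where zi: "z = (i, k)" by (cases z)
        obtain i' where zi': "z' = (i', k)" using z(3) zi by (cases z') auto
        have ee: "ed i = ed i'" using z(3) zi zi' by simp
        have i: "i < ?N" "k \<in> cells i n" and i': "i' < ?N" "k \<in> cells i' n" using z zi zi' by (auto simp: I_def)
        have lt: "?nd i n k < ?nd i n (Suc k)" using mem[OF i(1)] lo_less_hi[of "ed i"] by (intro node_strict_mono) auto
        have ov: "max (lf i) (lf i') < min (rt i) (rt i')"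
          using i(2) i'(2) lt ee unfolding cells_def by auto
        have ov': "overlap (L ! i) (L ! i')" "overlap (L ! i') (L ! i)"
          using ov ee unfolding overlap_def ed_def lf_def rt_def by (auto simp: case_prod_unfold)
        have "i = i'"
          using L(2) ov' i(1) i'(1) unfolding nonoverlapping_def by (metis linorder_neqE_nat)
        then show "z = z'" using zi zi' by simp
      qed
      have sub: "(\<lambda>z. (ed (fst z), snd z)) ` I \<subseteq> Sigma (edge_block n) (\<lambda>e. {..<2 ^ n})"
        using N0[OF n] unfolding I_def cells_def by auto
      have "(\<Sum>z\<in>I. (D (ed (fst z)) n (snd z))\<^sup>2 / ?w (ed (fst z)) n)
          = (\<Sum>y\<in>(\<lambda>z. (ed (fst z), snd z)) ` I. (D (fst y) n (snd y))\<^sup>2 / ?w (fst y) n)"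
        by (subst sum.reindex[OF inj]) simp
      also have "\<dots> \<le> (\<Sum>y\<in>Sigma (edge_block n) (\<lambda>e. {..<2 ^ n}). (D (fst y) n (snd y))\<^sup>2 / ?w (fst y) n)"
      proof (rule sum_mono2[OF _ sub])
        show "finite (Sigma (edge_block n) (\<lambda>e. {..<(2::nat) ^ n}))" using finite_edge_block by auto
        fix y assume "y \<in> Sigma (edge_block n) (\<lambda>e. {..<(2::nat) ^ n}) - (\<lambda>z. (ed (fst z), snd z)) ` I"
        then have "fst y \<in> edge_block n" by (elim DiffE SigmaE) simp
        then have "fst y \<in> E" using edge_block_subset by blast
        then show "0 \<le> (D (fst y) n (snd y))\<^sup>2 / ?w (fst y) n" using lo_less_hi[of "fst y"] by simp
      qed
      also have "\<dots> = (\<Sum>e\<in>edge_block n. \<Sum>k<2 ^ n. (D e n k)\<^sup>2 / ?w e n)"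
        using finite_edge_block by (subst sum.Sigma) (auto simp: case_prod_unfold)
      also have "\<dots> = dyadic_energy n f f"
        unfolding dyadic_energy_def dyadic_form_def D_def
        by (intro sum.cong refl) (simp add: sum_distrib_right sum_divide_distrib power2_eq_square)
      finally show ?thesis .
    qed
    have "(\<Sum>i<?N. \<bar>T i n\<bar>)\<^sup>2 \<le> (\<Sum>z\<in>I. \<bar>D (ed (fst z)) n (snd z)\<bar>)\<^sup>2"
      using 1 by (intro power_mono sum_nonneg) auto
    also note 2
    also have "(\<Sum>z\<in>I. ?w (ed (fst z)) n) * (\<Sum>z\<in>I. (D (ed (fst z)) n (snd z))\<^sup>2 / ?w (ed (fst z)) n)
        \<le> chain_length L * energy f f"
    proof (rule mult_mono[OF 3 _ chain_length_nonneg])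
      show "(\<Sum>z\<in>I. (D (ed (fst z)) n (snd z))\<^sup>2 / ?w (ed (fst z)) n) \<le> energy f f"
        using 4 dyadic_energy_le_energy[OF f, of n] by linarith
      show "0 \<le> (\<Sum>z\<in>I. (D (ed (fst z)) n (snd z))\<^sup>2 / ?w (ed (fst z)) n)"
        using wI by (intro sum_nonneg divide_nonneg_pos) auto
    qed
    finally show ?thesis .
  qed
  \<comment> \<open>At a finite level the cells miss the ends of the segments. The bound does not
    depend on \<open>n\<close>, so it survives the limit, where the whole segments are
    covered.\<close>
  have lim: "(\<lambda>n. (\<Sum>i<?N. \<bar>T i n\<bar>)\<^sup>2) \<longlonglongrightarrow> (\<Sum>i<?N. \<bar>F i (rt i) - F i (lf i)\<bar>)\<^sup>2"
    by (intro tendsto_power tendsto_sum tendsto_rabs T) auto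
  have "(\<Sum>i<?N. \<bar>F i (rt i) - F i (lf i)\<bar>)\<^sup>2 \<le> chain_length L * energy f f"
    by (rule LIMSEQ_le_const2[OF lim]) (use key in blast)
  moreover have "(f (\<iota> p') - f (\<iota> p))\<^sup>2 \<le> (\<Sum>i<?N. \<bar>F i (rt i) - F i (lf i)\<bar>)\<^sup>2"
    using total by (metis abs_ge_zero power2_abs power_mono)
  ultimately show ?thesis by linarith
qed

lemma graph_holder:
  assumes f: "finite_energy f" and p: "p \<in> points \<Gamma>" "p' \<in> points \<Gamma>"
  shows "(f (\<iota> p') - f (\<iota> p))\<^sup>2 \<le> dist (\<iota> p) (\<iota> p') * energy f f"
proof (cases "energy f f = 0")
  \<comment> \<open>Here one cannot divide by the energy before taking the infimum over paths; any
    single path shows that the values agree.\<close>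
  case True
  obtain d where "path_of_length \<Gamma> p d p'" using conn p unfolding connected_graph_def by blast
  then obtain L where L: "chain p L p'" using path_chain by blast
  obtain L' where "chain p L' p'" "nonoverlapping L'" using nonoverlapping_chain[OF L] by blast
  from chain_variation[OF f this] True show ?thesis by simp
next
  case False
  then have pos: "energy f f > 0" using energy_nonneg[OF f] by simp
  have "(f (\<iota> p') - f (\<iota> p))\<^sup>2 / energy f f \<le> graph_dist \<Gamma> p p'"
    unfolding graph_dist_def
  proof (rule cInf_greatest)
    show "{d. path_of_length \<Gamma> p d p'} \<noteq> {}" using conn p unfolding connected_graph_def by blast
    fix d assume "d \<in> {d. path_of_length \<Gamma> p d p'}"
    then obtain L where L: "chain p L p'" "chain_length L = d" using path_chain by blast
    obtain L' where L': "chain p L' p'" "chain_length L' \<le> d" "nonoverlapping L'" using nonoverlapping_chain[OF L(1)] L(2) by blast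
    have "(f (\<iota> p') - f (\<iota> p))\<^sup>2 \<le> chain_length L' * energy f f" by (rule chain_variation[OF f L'(1,3)])
    also have "\<dots> \<le> d * energy f f" using L'(2) pos by simp
    finally show "(f (\<iota> p') - f (\<iota> p))\<^sup>2 / energy f f \<le> d" using pos by (simp add: field_simps)
  qed
  then show ?thesis using dist_\<iota>[OF p] pos by (simp add: field_simps)
qed

theorem finite_energy_holder:
  assumes f: "finite_energy f" and xy: "x \<in> X" "y \<in> X"
  shows "(f y - f x)\<^sup>2 \<le> dist x y * energy f f"
proof -
  obtain a where a: "\<And>n. a n \<in> graph_set \<Gamma> \<iota>" "a \<longlonglongrightarrow> x" using xy(1) unfolding completed_def closure_sequential by blast
  obtain b where b: "\<And>n. b n \<in> graph_set \<Gamma> \<iota>" "b \<longlonglongrightarrow> y" using xy(2) unfolding completed_def closure_sequential by blast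
  have mem: "a n \<in> X" "b n \<in> X" for n using a(1) b(1) closure_subset unfolding completed_def by blast+
  have fa: "(\<lambda>n. f (a n)) \<longlonglongrightarrow> f x"
    by (rule continuous_on_tendsto_compose[OF finite_energy_continuous[OF f] a(2) xy(1)]) (simp add: mem)
  have fb: "(\<lambda>n. f (b n)) \<longlonglongrightarrow> f y"
    by (rule continuous_on_tendsto_compose[OF finite_energy_continuous[OF f] b(2) xy(2)]) (simp add: mem)
  show ?thesis
  proof (rule LIMSEQ_le)
    show "(\<lambda>n. (f (b n) - f (a n))\<^sup>2) \<longlonglongrightarrow> (f y - f x)\<^sup>2" by (intro tendsto_power tendsto_diff fa fb)
    show "(\<lambda>n. dist (a n) (b n) * energy f f) \<longlonglongrightarrow> dist x y * energy f f" by (intro tendsto_mult tendsto_dist a(2) b(2) tendsto_const)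
    have "(f (b n) - f (a n))\<^sup>2 \<le> dist (a n) (b n) * energy f f" for n
    proof -
      obtain p where p: "p \<in> points \<Gamma>" "a n = \<iota> p" using a(1)[of n] unfolding graph_set_def by blast
      obtain p' where p': "p' \<in> points \<Gamma>" "b n = \<iota> p'" using b(1)[of n] unfolding graph_set_def by blast
      show ?thesis using graph_holder[OF f p(1) p'(1)] p(2) p'(2) by simp
    qed
    then show "\<exists>N. \<forall>n\<ge>N. (f (b n) - f (a n))\<^sup>2 \<le> dist (a n) (b n) * energy f f" by blast
  qed
qed

end

section \<open>Minimizers of the energy form\<close>

lemma quadratic_nonneg_imp_linear_zero:
  fixes b c :: real
  assumes "\<And>t. 0 \<le> 2 * t * b + t\<^sup>2 * c"
  shows "b = 0"
proof (rule ccontr)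
  assume "b \<noteq> 0"
  have c: "0 \<le> c" using assms[of 1] assms[of "-1"] by simp
  \<comment> \<open>The denominator \<open>c + 1\<close> also covers \<open>c = 0\<close>.\<close>
  define t where "t = - b / (c + 1)"
  have tc: "t * (c + 1) = - b" using c by (simp add: t_def)
  have "2 * t * b + t\<^sup>2 * c = - t\<^sup>2 * (c + 2)"
  proof -
    have b: "b = - (t * (c + 1))" using tc by simp
    show ?thesis unfolding b by (simp add: power2_eq_square algebra_simps)
  qed
  moreover have "t \<noteq> 0" using tc \<open>b \<noteq> 0\<close> by auto
  then have "t\<^sup>2 * (c + 2) > 0" using c by simp
  ultimately show False using assms[of t] by simp
qed

context completed_graph
begin

section \<open>Test functions have finite energy\<close>

lemma test_function_continuous: "\<phi> \<in> test_functions \<Gamma> \<iota> \<Longrightarrow> continuous_on X \<phi>"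
  by (simp add: test_functions_def)

lemma test_function_edge_ends:
  assumes \<phi>: "\<phi> \<in> test_functions \<Gamma> \<iota>" and e: "e \<in> E"
  obtains \<eta> where "0 < \<eta>" "\<eta> < hi \<Gamma> e - lo \<Gamma> e"
    "\<And>x. x \<in> {lo \<Gamma> e<..<lo \<Gamma> e + \<eta>} \<union> {hi \<Gamma> e - \<eta><..<hi \<Gamma> e} \<Longrightarrow> deriv (on_edge \<Gamma> \<iota> \<phi> e) x = 0"
proof -
  have near: "\<exists>\<eta>>0. \<forall>x\<in>{lo \<Gamma> e<..<hi \<Gamma> e}. \<bar>x - c\<bar> < \<eta> \<longrightarrow> deriv (on_edge \<Gamma> \<iota> \<phi> e) x = 0"
    if c: "c \<in> seg e" "ep e c = Vertex v" "v \<in> verts \<Gamma>" for c v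
  proof -
    obtain N where N: "open N" "\<iota> (Vertex v) \<in> N"
      "\<forall>e\<in>E. \<forall>x\<in>{lo \<Gamma> e<..<hi \<Gamma> e}. \<iota> (ep e x) \<in> N \<longrightarrow> deriv (on_edge \<Gamma> \<iota> \<phi> e) x = 0"
      using \<phi> c(3) unfolding test_functions_def by blast
    obtain \<eta> where \<eta>: "0 < \<eta>" "ball (\<iota> (Vertex v)) \<eta> \<subseteq> N" using N(1,2) openE by blast
    have "deriv (on_edge \<Gamma> \<iota> \<phi> e) x = 0" if x: "x \<in> {lo \<Gamma> e<..<hi \<Gamma> e}" "\<bar>x - c\<bar> < \<eta>" for x
    proof -
      have "x \<in> seg e" using x by auto
      from dist_edge[OF e c(1) this] have "\<iota> (ep e x) \<in> ball (\<iota> (Vertex v)) \<eta>" using c(2) x(2) by simp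
      then show ?thesis using N(3) \<eta>(2) e x(1) by blast
    qed
    then show ?thesis using \<eta>(1) by blast
  qed
  have lh: "lo \<Gamma> e < hi \<Gamma> e" by (rule lo_less_hi[OF e])
  obtain \<eta>1 where 1: "\<eta>1 > 0" "\<forall>x\<in>{lo \<Gamma> e<..<hi \<Gamma> e}. \<bar>x - lo \<Gamma> e\<bar> < \<eta>1 \<longrightarrow> deriv (on_edge \<Gamma> \<iota> \<phi> e) x = 0"
    using near[of "lo \<Gamma> e" "fst e"] lh edge_verts[OF e] by auto
  obtain \<eta>2 where 2: "\<eta>2 > 0" "\<forall>x\<in>{lo \<Gamma> e<..<hi \<Gamma> e}. \<bar>x - hi \<Gamma> e\<bar> < \<eta>2 \<longrightarrow> deriv (on_edge \<Gamma> \<iota> \<phi> e) x = 0"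
    using near[of "hi \<Gamma> e" "snd e"] lh edge_verts[OF e] ep_hi[OF e] by auto
  define \<eta> where "\<eta> = min (min \<eta>1 \<eta>2) ((hi \<Gamma> e - lo \<Gamma> e) / 2)"
  show thesis
  proof (rule that)
    show "0 < \<eta>" "\<eta> < hi \<Gamma> e - lo \<Gamma> e" using 1(1) 2(1) lh by (auto simp: \<eta>_def min_def)
    have le: "\<eta> \<le> \<eta>1" "\<eta> \<le> \<eta>2" "\<eta> \<le> (hi \<Gamma> e - lo \<Gamma> e) / 2"
      unfolding \<eta>_def by linarith+
    fix x assume x: "x \<in> {lo \<Gamma> e<..<lo \<Gamma> e + \<eta>} \<union> {hi \<Gamma> e - \<eta><..<hi \<Gamma> e}"
    then have "x \<in> {lo \<Gamma> e<..<hi \<Gamma> e}" using le(3) lh by (auto simp: field_simps)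
    moreover have "\<bar>x - lo \<Gamma> e\<bar> < \<eta>1 \<or> \<bar>x - hi \<Gamma> e\<bar> < \<eta>2" using x le by auto
    ultimately show "deriv (on_edge \<Gamma> \<iota> \<phi> e) x = 0" using 1(2) 2(2) by blast
  qed
qed

text \<open>The derivatives of a test function vanish near the ends of each edge, hence extend by zero.\<close>
definition ext_deriv :: "('x \<Rightarrow> real) \<Rightarrow> 'v \<times> 'v \<Rightarrow> nat \<Rightarrow> real \<Rightarrow> real" where
  "ext_deriv \<phi> e k x = (if lo \<Gamma> e < x \<and> x < hi \<Gamma> e then (deriv ^^ k) (on_edge \<Gamma> \<iota> \<phi> e) x else 0)"

lemma ext_deriv_ends [simp]: "ext_deriv \<phi> e k (lo \<Gamma> e) = 0" "ext_deriv \<phi> e k (hi \<Gamma> e) = 0"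
  by (simp_all add: ext_deriv_def)

text \<open>Near an end the derivative vanishes, so by continuity the function is constant up to the
  end; the one-sided derivatives exist there and are 0. The recursion starts at order 1, because
  \<open>ext_deriv\<close> of order 0 is 0 at the ends instead of the value of the function.\<close>

lemma test_function_has_derivative:
  assumes \<phi>: "\<phi> \<in> test_functions \<Gamma> \<iota>" and e: "e \<in> E" and x: "x \<in> seg e"
  shows "(on_edge \<Gamma> \<iota> \<phi> e has_real_derivative ext_deriv \<phi> e 1 x) (at x within seg e)"
    and "(ext_deriv \<phi> e (Suc k) has_real_derivative ext_deriv \<phi> e (Suc (Suc k)) x) (at x within seg e)"
proof -
  let ?g = "on_edge \<Gamma> \<iota> \<phi> e"
  obtain \<eta> where \<eta>: "0 < \<eta>" "\<eta> < hi \<Gamma> e - lo \<Gamma> e"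
    "\<And>x. x \<in> {lo \<Gamma> e<..<lo \<Gamma> e + \<eta>} \<union> {hi \<Gamma> e - \<eta><..<hi \<Gamma> e} \<Longrightarrow> deriv ?g x = 0"
    by (rule test_function_edge_ends[OF \<phi> e]) (rule that)
  have fd: "(deriv ^^ n) ?g field_differentiable at y" if "lo \<Gamma> e < y" "y < hi \<Gamma> e" for n y
    using \<phi> e that unfolding test_functions_def by auto
  have cont: "continuous_on (seg e) ?g" by (rule continuous_on_edge[OF test_function_continuous[OF \<phi>] e])
  let ?Z = "{lo \<Gamma> e<..<lo \<Gamma> e + \<eta>} \<union> {hi \<Gamma> e - \<eta><..<hi \<Gamma> e}"
  have zero: "(deriv ^^ Suc k) ?g y = 0" if "y \<in> ?Z" for k y
    using that
  proof (induction k arbitrary: y)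
    case 0
    then show ?case using \<eta>(3) by simp
  next
    case (Suc k)
    have "deriv ((deriv ^^ Suc k) ?g) y = deriv (\<lambda>_. 0) y"
      by (rule deriv_cong_open[of ?Z]) (use Suc in auto)
    then show ?case by simp
  qed
  have const_lo: "?g y = ?g (lo \<Gamma> e)" if "lo \<Gamma> e \<le> y" "y < lo \<Gamma> e + \<eta>" for y
  proof (cases "y = lo \<Gamma> e")
    case False
    show ?thesis
    proof (rule DERIV_isconst2[of "lo \<Gamma> e" y ?g y])
      show "continuous_on {lo \<Gamma> e..y} ?g" by (rule continuous_on_subset[OF cont]) (use that \<eta> in auto)
      fix z assume z: "lo \<Gamma> e < z" "z < y"
      then have "z \<in> ?Z" using that by auto
      then have "deriv ?g z = 0" by (rule \<eta>(3))
      moreover have "?g field_differentiable at z" using fd[of z 0] z that \<eta>(2) by simp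
      ultimately show "DERIV ?g z :> 0" using DERIV_deriv_iff_field_differentiable by metis
    qed (use that False in auto)
  qed simp
  have const_hi: "?g y = ?g (hi \<Gamma> e)" if "hi \<Gamma> e - \<eta> < y" "y \<le> hi \<Gamma> e" for y
  proof (cases "y = hi \<Gamma> e")
    case False
    have "?g (hi \<Gamma> e) = ?g y"
    proof (rule DERIV_isconst2[of y "hi \<Gamma> e" ?g "hi \<Gamma> e"])
      show "continuous_on {y..hi \<Gamma> e} ?g" by (rule continuous_on_subset[OF cont]) (use that \<eta> in auto)
      fix z assume z: "y < z" "z < hi \<Gamma> e"
      then have "z \<in> ?Z" using that by auto
      then have "deriv ?g z = 0" by (rule \<eta>(3))
      moreover have "?g field_differentiable at z" using fd[of z 0] z that \<eta>(2) by simp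
      ultimately show "DERIV ?g z :> 0" using DERIV_deriv_iff_field_differentiable by metis
    qed (use that False in auto)
    then show ?thesis by simp
  qed simp
  consider (inner) "lo \<Gamma> e < x" "x < hi \<Gamma> e" | (lo) "x = lo \<Gamma> e" | (hi) "x = hi \<Gamma> e"
    using x by fastforce
  note cases = this
  have ends: "(F has_real_derivative 0) (at x within seg e)"
    if "x = lo \<Gamma> e \<or> x = hi \<Gamma> e" and F: "\<And>y. y \<in> seg e \<Longrightarrow> \<bar>y - x\<bar> < \<eta> \<Longrightarrow> F y = F x" for F :: "real \<Rightarrow> real"
  proof (rule has_field_derivative_transform_within[where f = "\<lambda>_. F x" and d = \<eta>])
    show "((\<lambda>_. F x) has_real_derivative 0) (at x within seg e)" by simp
    show "F x = F y" if "y \<in> seg e" "dist y x < \<eta>" for y using F[of y] that by (simp add: dist_real_def)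
  qed (use \<eta>(1) x in auto)
  show "(?g has_real_derivative ext_deriv \<phi> e 1 x) (at x within seg e)"
  proof (cases rule: cases)
    case inner
    then have "(?g has_real_derivative deriv ?g x) (at x)"
      using fd[of x 0] by (simp add: DERIV_deriv_iff_field_differentiable)
    then show ?thesis using inner by (simp add: ext_deriv_def has_field_derivative_at_within)
  next
    case lo
    have "(?g has_real_derivative 0) (at x within seg e)"
    proof (rule ends)
      fix y assume "y \<in> seg e" "\<bar>y - x\<bar> < \<eta>"
      then show "?g y = ?g x" using const_lo[of y] lo by simp
    qed (use lo in simp)
    then show ?thesis using lo by simp
  next
    case hi
    have "(?g has_real_derivative 0) (at x within seg e)"
    proof (rule ends)
      fix y assume "y \<in> seg e" "\<bar>y - x\<bar> < \<eta>"
      then show "?g y = ?g x" using const_hi[of y] hi by simp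
    qed (use hi in simp)
    then show ?thesis using hi by simp
  qed
  have near0: "ext_deriv \<phi> e (Suc k) y = 0" if "x = lo \<Gamma> e \<or> x = hi \<Gamma> e" "y \<in> seg e" "\<bar>y - x\<bar> < \<eta>" for y
  proof (cases "lo \<Gamma> e < y \<and> y < hi \<Gamma> e")
    case True
    then have "y \<in> ?Z" using that by auto
    then show ?thesis using zero unfolding ext_deriv_def by presburger
  next
    case False
    then show ?thesis unfolding ext_deriv_def by presburger
  qed
  show "(ext_deriv \<phi> e (Suc k) has_real_derivative ext_deriv \<phi> e (Suc (Suc k)) x) (at x within seg e)"
  proof (cases rule: cases)
    case inner
    have "((deriv ^^ Suc k) ?g has_real_derivative (deriv ^^ Suc (Suc k)) ?g x) (at x)"
      using fd[OF inner, of "Suc k"] by (simp add: DERIV_deriv_iff_field_differentiable)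
    then have "(ext_deriv \<phi> e (Suc k) has_real_derivative (deriv ^^ Suc (Suc k)) ?g x) (at x)"
      by (rule has_field_derivative_transform_within_open[where S = "{lo \<Gamma> e<..<hi \<Gamma> e}"])
         (use inner in \<open>auto simp: ext_deriv_def\<close>)
    then have "(ext_deriv \<phi> e (Suc k) has_real_derivative ext_deriv \<phi> e (Suc (Suc k)) x) (at x)"
      using inner by (simp add: ext_deriv_def)
    then show ?thesis by (rule has_field_derivative_at_within)
  next
    case lo
    have "(ext_deriv \<phi> e (Suc k) has_real_derivative 0) (at x within seg e)"
      by (rule ends) (use lo near0 in auto)
    then show ?thesis using lo by simp
  next
    case hi
    have "(ext_deriv \<phi> e (Suc k) has_real_derivative 0) (at x within seg e)"
      by (rule ends) (use hi near0 in auto)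
    then show ?thesis using hi by simp
  qed
qed

lemma ext_deriv_continuous:
  assumes "\<phi> \<in> test_functions \<Gamma> \<iota>" "e \<in> E"
  shows "continuous_on (seg e) (ext_deriv \<phi> e (Suc k))"
  by (rule DERIV_continuous_on) (rule test_function_has_derivative(2)[OF assms])

lemma test_function_constant_edges:
  assumes \<phi>: "\<phi> \<in> test_functions \<Gamma> \<iota>"
  obtains S where "finite S" "S \<subseteq> E" "\<And>e x. e \<in> E - S \<Longrightarrow> x \<in> seg e \<Longrightarrow> on_edge \<Gamma> \<iota> \<phi> e x = on_edge \<Gamma> \<iota> \<phi> e (lo \<Gamma> e)"
    "\<And>e k x. e \<in> E - S \<Longrightarrow> ext_deriv \<phi> e (Suc k) x = 0"
proof -
  obtain S where S: "finite S" "S \<subseteq> E" "\<forall>e\<in>E - S. \<forall>x\<in>{lo \<Gamma> e<..<hi \<Gamma> e}. deriv (on_edge \<Gamma> \<iota> \<phi> e) x = 0"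
    using \<phi> unfolding test_functions_def by (elim CollectE conjE exE) (rule that)
  show thesis
  proof (rule that[OF S(1,2)])
    fix e x assume e: "e \<in> E - S" and x: "x \<in> seg e"
    then have eE: "e \<in> E" by simp
    have "(on_edge \<Gamma> \<iota> \<phi> e has_real_derivative 0) (at y within seg e)" if "y \<in> seg e" for y
    proof -
      have "ext_deriv \<phi> e 1 y = 0" using S(3) e unfolding ext_deriv_def by auto
      then show ?thesis using test_function_has_derivative(1)[OF \<phi> eE that] by simp
    qed
    then obtain c where "\<And>y. y \<in> seg e \<Longrightarrow> on_edge \<Gamma> \<iota> \<phi> e y = c"
      using has_field_derivative_zero_constant[of "seg e" "on_edge \<Gamma> \<iota> \<phi> e"] by auto
    then show "on_edge \<Gamma> \<iota> \<phi> e x = on_edge \<Gamma> \<iota> \<phi> e (lo \<Gamma> e)" using x lo_less_hi[OF eE] by simp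
  next
    fix e k x assume e: "e \<in> E - S"
    have "(deriv ^^ Suc k) (on_edge \<Gamma> \<iota> \<phi> e) x = 0" if "x \<in> {lo \<Gamma> e<..<hi \<Gamma> e}" for x
      using that
    proof (induction k arbitrary: x)
      case 0
      then show ?case using S(3) e by simp
    next
      case (Suc k)
      have "deriv ((deriv ^^ Suc k) (on_edge \<Gamma> \<iota> \<phi> e)) x = deriv (\<lambda>_. 0) x"
        by (rule deriv_cong_open[of "{lo \<Gamma> e<..<hi \<Gamma> e}"]) (use Suc in auto)
      then show ?case by simp
    qed
    then show "ext_deriv \<phi> e (Suc k) x = 0" unfolding ext_deriv_def by (simp del: funpow.simps)
  qed
qed

lemma dyadic_energy_localized:
  assumes S: "finite S" "S \<subseteq> E" and const: "\<And>e x. e \<in> E - S \<Longrightarrow> x \<in> seg e \<Longrightarrow> on_edge \<Gamma> \<iota> g e x = on_edge \<Gamma> \<iota> g e (lo \<Gamma> e)"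
  shows "\<forall>\<^sub>F n in sequentially. dyadic_energy n f g = (\<Sum>e\<in>S. dyadic_form (lo \<Gamma> e) (hi \<Gamma> e) n (on_edge \<Gamma> \<iota> f e) (on_edge \<Gamma> \<iota> g e))"
proof -
  obtain N where N: "\<And>n. N \<le> n \<Longrightarrow> S \<subseteq> edge_block n" by (rule edge_block_exhausts[OF S]) (rule that)
  have "dyadic_energy n f g = (\<Sum>e\<in>S. dyadic_form (lo \<Gamma> e) (hi \<Gamma> e) n (on_edge \<Gamma> \<iota> f e) (on_edge \<Gamma> \<iota> g e))" if "N \<le> n" for n
    unfolding dyadic_energy_def
  proof (rule sum.mono_neutral_right[OF finite_edge_block N[OF that]])
    show "\<forall>e\<in>edge_block n - S. dyadic_form (lo \<Gamma> e) (hi \<Gamma> e) n (on_edge \<Gamma> \<iota> f e) (on_edge \<Gamma> \<iota> g e) = 0"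
    proof
      fix e assume "e \<in> edge_block n - S"
      then have e: "e \<in> E - S" using edge_block_subset by blast
      then show "dyadic_form (lo \<Gamma> e) (hi \<Gamma> e) n (on_edge \<Gamma> \<iota> f e) (on_edge \<Gamma> \<iota> g e) = 0"
        by (intro dyadic_form_const_zero lo_less_hi const[OF e]) simp_all
    qed
  qed
  then show ?thesis unfolding eventually_sequentially by blast
qed

lemma finite_energyI_convergent:
  assumes "continuous_on X f" "(\<lambda>n. dyadic_energy n f f) \<longlonglongrightarrow> L"
  shows "finite_energy f"
proof -
  have "dyadic_energy n f f \<le> L" for n
    using incseq_le[OF _ assms(2)] dyadic_energy_mono by (simp add: incseq_def)
  then show ?thesis using assms(1) unfolding finite_energy_def by blast
qed

lemma dyadic_energy_test_function_tendsto:
  assumes \<phi>: "\<phi> \<in> test_functions \<Gamma> \<iota>"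
    and S: "finite S" "S \<subseteq> E" "\<And>e x. e \<in> E - S \<Longrightarrow> x \<in> seg e \<Longrightarrow> on_edge \<Gamma> \<iota> \<phi> e x = on_edge \<Gamma> \<iota> \<phi> e (lo \<Gamma> e)"
    and u: "\<And>e x. e \<in> E \<Longrightarrow> x \<in> seg e \<Longrightarrow> (on_edge \<Gamma> \<iota> u e has_real_derivative u' e x) (at x within seg e)"
    and u': "\<And>e. e \<in> E \<Longrightarrow> continuous_on (seg e) (u' e)"
  shows "(\<lambda>n. dyadic_energy n u \<phi>) \<longlonglongrightarrow> (\<Sum>e\<in>S. integral (seg e) (\<lambda>x. u' e x * ext_deriv \<phi> e 1 x))"
proof -
  have "(\<lambda>n. \<Sum>e\<in>S. dyadic_form (lo \<Gamma> e) (hi \<Gamma> e) n (on_edge \<Gamma> \<iota> u e) (on_edge \<Gamma> \<iota> \<phi> e))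
      \<longlonglongrightarrow> (\<Sum>e\<in>S. integral (seg e) (\<lambda>x. u' e x * ext_deriv \<phi> e 1 x))"
  proof (rule tendsto_sum)
    fix e assume "e \<in> S"
    then have e: "e \<in> E" using S(2) by blast
    show "(\<lambda>n. dyadic_form (lo \<Gamma> e) (hi \<Gamma> e) n (on_edge \<Gamma> \<iota> u e) (on_edge \<Gamma> \<iota> \<phi> e))
        \<longlonglongrightarrow> integral (seg e) (\<lambda>x. u' e x * ext_deriv \<phi> e 1 x)"
      using ext_deriv_continuous[OF \<phi> e, of 0]
      by (intro dyadic_form_tendsto_integral lo_less_hi e u u' test_function_has_derivative(1)[OF \<phi>]) auto
  qed
  then show ?thesis
    by (rule Lim_transform_eventually) (use dyadic_energy_localized[OF S, of u] in \<open>simp add: eq_commute\<close>)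
qed

lemma test_function_finite_energy:
  assumes \<phi>: "\<phi> \<in> test_functions \<Gamma> \<iota>"
  shows "finite_energy \<phi>"
proof -
  obtain S where S: "finite S" "S \<subseteq> E" "\<And>e x. e \<in> E - S \<Longrightarrow> x \<in> seg e \<Longrightarrow> on_edge \<Gamma> \<iota> \<phi> e x = on_edge \<Gamma> \<iota> \<phi> e (lo \<Gamma> e)"
    by (rule test_function_constant_edges[OF \<phi>]) (rule that)
  show ?thesis
  proof (rule finite_energyI_convergent[OF test_function_continuous[OF \<phi>]])
    show "(\<lambda>n. dyadic_energy n \<phi> \<phi>) \<longlonglongrightarrow> (\<Sum>e\<in>S. integral (seg e) (\<lambda>x. ext_deriv \<phi> e 1 x * ext_deriv \<phi> e 1 x))"
      using ext_deriv_continuous[OF \<phi>, of _ 0]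
      by (intro dyadic_energy_test_function_tendsto[OF \<phi> S] test_function_has_derivative(1)[OF \<phi>]) auto
  qed
qed

end

section \<open>The potential term and the full quadratic form\<close>

locale potential_graph = completed_graph \<Gamma> \<iota>
  for \<Gamma> :: "'v metric_graph" and \<iota> :: "'v graph_point \<Rightarrow> 'x::metric_space" +
  fixes q :: "'x \<Rightarrow> real"
  assumes potential: "admissible_potential \<Gamma> \<iota> q"
begin

abbreviation "qe \<equiv> on_edge \<Gamma> \<iota> q"

lemma q_nonneg: "e \<in> E \<Longrightarrow> x \<in> seg e \<Longrightarrow> 0 \<le> qe e x"
  using potential ep_mem_points unfolding admissible_potential_def on_edge_def graph_set_def by blast

lemma q_integrable: "e \<in> E \<Longrightarrow> qe e absolutely_integrable_on seg e"
  using potential unfolding admissible_potential_def graph_integrable_def by blast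

definition edge_pot :: "('x \<Rightarrow> real) \<Rightarrow> 'v \<times> 'v \<Rightarrow> real" where
  "edge_pot h e = integral (seg e) (\<lambda>x. qe e x * on_edge \<Gamma> \<iota> h e x)"

definition pot :: "('x \<Rightarrow> real) \<Rightarrow> real" where
  "pot h = (\<Sum>\<^sub>\<infinity>e\<in>E. edge_pot h e)"

lemma q_mult_integrable:
  assumes "continuous_on X h" "e \<in> E"
  shows "(\<lambda>x. qe e x * on_edge \<Gamma> \<iota> h e x) absolutely_integrable_on seg e"
  using absolutely_integrable_continuous_mult[OF continuous_on_edge[OF assms] q_integrable[OF assms(2)]]
  by (simp add: mult.commute)

lemma q_mult_integrable_on:
  assumes "continuous_on X h" "e \<in> E"
  shows "(\<lambda>x. qe e x * on_edge \<Gamma> \<iota> h e x) integrable_on seg e"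
  using q_mult_integrable[OF assms] by (simp add: absolutely_integrable_on_def)

lemma edge_pot_add:
  assumes "continuous_on X g" "continuous_on X h" "e \<in> E"
  shows "edge_pot (\<lambda>y. g y + h y) e = edge_pot g e + edge_pot h e"
  unfolding edge_pot_def on_edge_lambda(2)[where G = "(+)"] distrib_left
  by (intro Henstock_Kurzweil_Integration.integral_add q_mult_integrable_on assms)

lemma edge_pot_cmult: "edge_pot (\<lambda>y. c * h y) e = c * edge_pot h e"
  unfolding edge_pot_def on_edge_lambda(1)[where F = "(*) c"] mult.left_commute[of _ c]
  by (rule Henstock_Kurzweil_Integration.integral_mult_right)

lemma edge_pot_mono:
  assumes "continuous_on X g" "continuous_on X h" "e \<in> E" "\<And>y. y \<in> X \<Longrightarrow> g y \<le> h y"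
  shows "edge_pot g e \<le> edge_pot h e"
  unfolding edge_pot_def
proof (rule integral_le)
  fix x assume x: "x \<in> seg e"
  show "qe e x * on_edge \<Gamma> \<iota> g e x \<le> qe e x * on_edge \<Gamma> \<iota> h e x"
    unfolding on_edge_def[of _ _ g] on_edge_def[of _ _ h]
    by (intro mult_left_mono q_nonneg assms ep_mem_X x)
qed (intro q_mult_integrable_on assms)+

lemma edge_pot_abs_le:
  assumes h: "continuous_on X h" and e: "e \<in> E" and M: "\<And>y. y \<in> X \<Longrightarrow> \<bar>h y\<bar> \<le> M"
  shows "\<bar>edge_pot h e\<bar> \<le> M * edge_pot (\<lambda>_. 1) e"
proof -
  have "edge_pot h e \<le> edge_pot (\<lambda>_. M * 1) e"
    using M by (intro edge_pot_mono h e continuous_intros) (auto simp: abs_le_iff)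
  moreover have "edge_pot (\<lambda>_. (- M) * 1) e \<le> edge_pot h e"
    using M by (intro edge_pot_mono h e continuous_intros) (auto simp: abs_le_iff minus_le_iff)
  ultimately show ?thesis
    unfolding edge_pot_cmult[of M "\<lambda>_. 1"] edge_pot_cmult[of "- M" "\<lambda>_. 1"] by (simp add: abs_le_iff)
qed

text \<open>As \<open>q\<close> is nonnegative, these are the integrals of |q| over the edges. They
  dominate \<open>edge_pot\<close> of every bounded function.\<close>

lemma edge_pot_one_summable: "edge_pot (\<lambda>_. 1) summable_on E"
proof -
  have "(LINT x:seg e|lebesgue. \<bar>qe e x\<bar>) = edge_pot (\<lambda>_. 1) e" if e: "e \<in> E" for e
  proof -
    have "(\<lambda>x. \<bar>qe e x\<bar>) absolutely_integrable_on seg e"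
      using absolutely_integrable_norm[OF q_integrable[OF e]] by (simp add: o_def)
    then have "(LINT x:seg e|lebesgue. \<bar>qe e x\<bar>) = integral (seg e) (\<lambda>x. \<bar>qe e x\<bar>)"
      by (rule set_lebesgue_integral_eq_integral)
    also have "\<dots> = edge_pot (\<lambda>_. 1) e"
      unfolding edge_pot_def on_edge_def[of _ _ "\<lambda>_. 1"] mult_1_right
      using q_nonneg[OF e] by (intro integral_cong) simp
    finally show ?thesis .
  qed
  note eq = this
  have "(\<lambda>e. LINT x:seg e|lebesgue. \<bar>qe e x\<bar>) summable_on E"
    using potential unfolding admissible_potential_def graph_integrable_def by blast
  then show ?thesis by (rule summable_on_cong[THEN iffD1, rotated]) (rule eq)
qed

lemma bounded_on_X:
  assumes "continuous_on X h"
  obtains M where "0 \<le> M" "\<And>y. y \<in> X \<Longrightarrow> \<bar>h y\<bar> \<le> (M :: real)"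
proof -
  have "bounded (h ` X)" by (intro compact_imp_bounded compact_continuous_image assms compact_X)
  then obtain M where M: "\<forall>y\<in>h ` X. norm y \<le> M" unfolding bounded_iff by blast
  show thesis by (rule that[of "max 0 M"]) (use M in \<open>auto simp: le_max_iff_disj\<close>)
qed

lemma edge_pot_summable:
  assumes h: "continuous_on X h"
  shows "edge_pot h summable_on E"
proof -
  obtain M where M: "0 \<le> M" "\<And>y. y \<in> X \<Longrightarrow> \<bar>h y\<bar> \<le> M" by (rule bounded_on_X[OF h]) (rule that)
  have "(\<lambda>e. norm (edge_pot h e)) summable_on E"
  proof (rule summable_on_comparison_test)
    show "(\<lambda>e. M * edge_pot (\<lambda>_. 1) e) summable_on E" by (intro summable_on_cmult_right edge_pot_one_summable)
    show "norm (edge_pot h e) \<le> M * edge_pot (\<lambda>_. 1) e" if "e \<in> E" for e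
      using edge_pot_abs_le[OF h that M(2)] by simp
  qed auto
  then show ?thesis by (rule abs_summable_summable)
qed

lemma pot_add: "continuous_on X g \<Longrightarrow> continuous_on X h \<Longrightarrow> pot (\<lambda>y. g y + h y) = pot g + pot h"
  unfolding pot_def
  by (subst infsum_add[symmetric]) (auto intro!: edge_pot_summable infsum_cong edge_pot_add)

lemma pot_cmult: "pot (\<lambda>y. c * h y) = c * pot h"
  unfolding pot_def edge_pot_cmult by (rule infsum_cmult_right')

lemma pot_mono:
  "continuous_on X g \<Longrightarrow> continuous_on X h \<Longrightarrow> (\<And>y. y \<in> X \<Longrightarrow> g y \<le> h y) \<Longrightarrow> pot g \<le> pot h"
  unfolding pot_def by (intro infsum_mono edge_pot_summable edge_pot_mono)

lemma pot_zero: "pot (\<lambda>_. 0) = 0"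
  using pot_cmult[of 0 "\<lambda>_. 0"] by simp

lemma pot_nonneg: "continuous_on X h \<Longrightarrow> (\<And>y. y \<in> X \<Longrightarrow> 0 \<le> h y) \<Longrightarrow> 0 \<le> pot h"
  using pot_mono[of "\<lambda>_. 0" h] pot_zero by simp

definition QF :: "('x \<Rightarrow> real) \<Rightarrow> ('x \<Rightarrow> real) \<Rightarrow> real" where
  "QF f g = energy f g + pot (\<lambda>y. f y * g y)"

lemma QF_commute: "QF f g = QF g f"
  unfolding QF_def energy_commute[of f g] mult.commute[of "f _"] ..

lemma QF_add_right:
  assumes "finite_energy f" "finite_energy g" "finite_energy h"
  shows "QF f (\<lambda>y. g y + h y) = QF f g + QF f h"
proof -
  have "continuous_on X (\<lambda>y. f y * g y)" "continuous_on X (\<lambda>y. f y * h y)"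
    using assms by (auto intro: continuous_intros finite_energy_continuous)
  then show ?thesis unfolding QF_def energy_add_right[OF assms] distrib_left by (simp add: pot_add)
qed

lemma QF_cmult_right:
  assumes "finite_energy f" "finite_energy g"
  shows "QF f (\<lambda>y. c * g y) = c * QF f g"
  unfolding QF_def energy_cmult_right[OF assms] mult.left_commute[of _ c] pot_cmult by (simp add: distrib_left)

lemma pot_square_nonneg: "finite_energy f \<Longrightarrow> 0 \<le> pot (\<lambda>y. f y * f y)"
  by (intro pot_nonneg continuous_intros finite_energy_continuous) auto

lemma energy_le_QF: "finite_energy f \<Longrightarrow> energy f f \<le> QF f f"
  unfolding QF_def using pot_square_nonneg by simp

lemma QF_nonneg: "finite_energy f \<Longrightarrow> 0 \<le> QF f f"
  using energy_le_QF energy_nonneg order_trans by blast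

lemma QF_square:
  assumes "finite_energy f" "finite_energy g"
  shows "QF (\<lambda>y. f y + t * g y) (\<lambda>y. f y + t * g y) = QF f f + 2 * t * QF f g + t\<^sup>2 * QF g g"
proof -
  let ?h = "\<lambda>y. f y + t * g y"
  have tg: "finite_energy (\<lambda>y. t * g y)" and h: "finite_energy ?h"
    using assms finite_energy_cmult finite_energy_add by blast+
  have "QF ?h ?h = QF ?h f + t * QF ?h g"
    using QF_add_right[OF h assms(1) tg] QF_cmult_right[OF h assms(2)] by simp
  moreover have "QF ?h f = QF f f + t * QF f g"
    unfolding QF_commute[of ?h f] using QF_add_right[OF assms(1) assms(1) tg] QF_cmult_right[OF assms] by simp
  moreover have "QF ?h g = QF f g + t * QF g g"
    unfolding QF_commute[of ?h g] QF_commute[of f g]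
    using QF_add_right[OF assms(2) assms(1) tg] QF_cmult_right[OF assms(2,2)] by simp
  ultimately show ?thesis by (simp add: power2_eq_square algebra_simps)
qed

section \<open>Minimization with prescribed boundary values\<close>

definition has_data :: "('x \<Rightarrow> real) \<Rightarrow> ('x \<Rightarrow> real) \<Rightarrow> bool" where
  "has_data U f \<longleftrightarrow> finite_energy f \<and> (\<forall>x\<in>B. f x = U x)"

definition minimizes :: "('x \<Rightarrow> real) \<Rightarrow> ('x \<Rightarrow> real) \<Rightarrow> bool" where
  "minimizes U u \<longleftrightarrow> has_data U u \<and> (\<forall>f. has_data U f \<longrightarrow> QF u u \<le> QF f f)"

lemma Euler_Lagrange:
  assumes u: "minimizes U u" and h: "finite_energy h" "\<And>x. x \<in> B \<Longrightarrow> h x = 0"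
  shows "QF u h = 0"
proof (rule quadratic_nonneg_imp_linear_zero[where c = "QF h h"])
  fix t
  have uf: "finite_energy u" using u by (simp add: minimizes_def has_data_def)
  have "has_data U (\<lambda>y. u y + t * h y)"
    using u h finite_energy_add[OF uf finite_energy_cmult[OF h(1)]] unfolding minimizes_def has_data_def by simp
  then have "QF u u \<le> QF (\<lambda>y. u y + t * h y) (\<lambda>y. u y + t * h y)" using u unfolding minimizes_def by blast
  then show "0 \<le> 2 * t * QF u h + t\<^sup>2 * QF h h" unfolding QF_square[OF uf h(1)] by simp
qed

text \<open>A Poincare inequality: apply the Hoelder estimate from one boundary point, where
  \<open>h\<close> vanishes, and use that a compact space is bounded.\<close>

lemma sup_bound:
  obtains D where "0 < D" "\<forall>h x. finite_energy h \<longrightarrow> (\<forall>b\<in>B. h b = 0) \<longrightarrow> x \<in> X \<longrightarrow> (h x)\<^sup>2 \<le> D * QF h h"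
proof -
  obtain b where b: "b \<in> B" using boundary_nonempty by blast
  obtain D where D: "\<And>x. x \<in> X \<Longrightarrow> dist b x \<le> D"
    using compact_imp_bounded[OF compact_X] unfolding bounded_any_center[of X b] by blast
  show thesis
  proof (rule that[of "max 1 D"], simp, intro allI impI)
    fix h x assume h: "finite_energy h" "\<forall>b\<in>B. h b = 0" and x: "x \<in> X"
    have bX: "b \<in> X" using b boundary_subset by blast
    have "(h x)\<^sup>2 = (h x - h b)\<^sup>2" using h(2) b by simp
    also have "\<dots> \<le> dist b x * energy h h" by (rule finite_energy_holder[OF h(1) bX x])
    also have "\<dots> \<le> max 1 D * QF h h"
      using D[OF x] energy_le_QF[OF h(1)] energy_nonneg[OF h(1)] by (intro mult_mono) auto
    finally show "(h x)\<^sup>2 \<le> max 1 D * QF h h" .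
  qed
qed

lemma dyadic_energy_pointwise_tendsto:
  assumes "\<And>x. x \<in> X \<Longrightarrow> (\<lambda>j. f j x) \<longlonglongrightarrow> u x"
  shows "(\<lambda>j. dyadic_energy n (f j) (f j)) \<longlonglongrightarrow> dyadic_energy n u u"
  unfolding dyadic_energy_def dyadic_form_def
proof (intro tendsto_sum tendsto_divide tendsto_mult tendsto_diff tendsto_const)
  fix e k assume "e \<in> edge_block n" "k \<in> {..<(2::nat) ^ n}"
  then have e: "e \<in> E" and k: "k < 2 ^ n" using edge_block_subset by auto
  have "node (lo \<Gamma> e) (hi \<Gamma> e) n k \<in> seg e" "node (lo \<Gamma> e) (hi \<Gamma> e) n (Suc k) \<in> seg e"
    using lo_less_hi[OF e] k by (intro node_mem; simp)+
  then have m: "\<iota> (ep e (node (lo \<Gamma> e) (hi \<Gamma> e) n k)) \<in> X" "\<iota> (ep e (node (lo \<Gamma> e) (hi \<Gamma> e) n (Suc k))) \<in> X"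
    using ep_mem_X[OF e] by blast+
  show "(\<lambda>j. on_edge \<Gamma> \<iota> (f j) e (node (lo \<Gamma> e) (hi \<Gamma> e) n k)) \<longlonglongrightarrow> on_edge \<Gamma> \<iota> u e (node (lo \<Gamma> e) (hi \<Gamma> e) n k)"
    "(\<lambda>j. on_edge \<Gamma> \<iota> (f j) e (node (lo \<Gamma> e) (hi \<Gamma> e) n (Suc k))) \<longlonglongrightarrow> on_edge \<Gamma> \<iota> u e (node (lo \<Gamma> e) (hi \<Gamma> e) n (Suc k))"
    unfolding on_edge_def by (intro assms m)+
  show "(\<lambda>j. on_edge \<Gamma> \<iota> (f j) e (node (lo \<Gamma> e) (hi \<Gamma> e) n k)) \<longlonglongrightarrow> on_edge \<Gamma> \<iota> u e (node (lo \<Gamma> e) (hi \<Gamma> e) n k)"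
    "(\<lambda>j. on_edge \<Gamma> \<iota> (f j) e (node (lo \<Gamma> e) (hi \<Gamma> e) n (Suc k))) \<longlonglongrightarrow> on_edge \<Gamma> \<iota> u e (node (lo \<Gamma> e) (hi \<Gamma> e) n (Suc k))"
    unfolding on_edge_def by (intro assms m)+
qed (use lo_less_hi edge_block_subset in fastforce)

text \<open>The direct method. By \<open>sup_bound\<close>, differences with small form are
  uniformly small, so the limit of a minimizing sequence is continuous and keeps the boundary
  values.\<close>

theorem minimizer_exists:
  assumes f0: "has_data U f0"
  shows "\<exists>u. minimizes U u"
proof -
  define A where "A = {QF f f | f. has_data U f}"
  define m where "m = Inf A"
  have A: "A \<noteq> {}" "bdd_below A"
    using f0 QF_nonneg unfolding A_def has_data_def by (auto intro!: bdd_belowI[of _ 0])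
  have m_le: "m \<le> QF f f" if "has_data U f" for f
    unfolding m_def using A(2) that by (intro cInf_lower) (auto simp: A_def)
  have "\<exists>f. has_data U f \<and> QF f f < m + 1 / real (Suc n)" for n
  proof -
    have "Inf A < m + 1 / real (Suc n)" unfolding m_def by simp
    then show ?thesis using A unfolding cInf_less_iff[OF A] by (auto simp: A_def)
  qed
  then obtain f where f: "\<And>n. has_data U (f n)" and fm: "\<And>n. QF (f n) (f n) < m + 1 / real (Suc n)" by metis
  have ff: "finite_energy (f n)" for n using f by (simp add: has_data_def)
  have fB: "f n x = U x" if "x \<in> B" for n x using f that by (simp add: has_data_def)
  obtain D where D: "0 < D" "\<forall>h x. finite_energy h \<longrightarrow> (\<forall>b\<in>B. h b = 0) \<longrightarrow> x \<in> X \<longrightarrow> (h x)\<^sup>2 \<le> D * QF h h"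
    by (rule sup_bound) (rule that)
  \<comment> \<open>Parallelogram identity: the midpoint of two candidates is a candidate, so the
    form of their sum is at least \<open>4 * m\<close>, which leaves little for their
    difference.\<close>
  have diff: "(f i x - f j x)\<^sup>2 \<le> D * (2 * (1 / real (Suc i) + 1 / real (Suc j)))" if x: "x \<in> X" for i j x
  proof -
    let ?d = "\<lambda>y. f i y + (-1) * f j y" and ?s = "\<lambda>y. f i y + 1 * f j y"
    have "has_data U (\<lambda>y. (1/2) * ?s y)"
      unfolding has_data_def
    proof
      show "finite_energy (\<lambda>y. (1/2) * ?s y)"
        by (rule finite_energy_cmult[OF finite_energy_add[OF ff finite_energy_cmult[OF ff]]])
      show "\<forall>x\<in>B. (1/2) * ?s x = U x" by (simp add: fB)
    qed
    then have "m \<le> QF (\<lambda>y. (1/2) * ?s y) (\<lambda>y. (1/2) * ?s y)" by (rule m_le)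
    also have "\<dots> = QF ?s ?s / 4"
    proof -
      have s: "finite_energy ?s" using finite_energy_add[OF ff finite_energy_cmult[OF ff]] .
      show ?thesis
        unfolding QF_cmult_right[OF finite_energy_cmult[OF s] s] QF_commute[of "\<lambda>y. (1/2) * ?s y" ?s] QF_cmult_right[OF s s] by simp
    qed
    finally have "4 * m \<le> QF (f i) (f i) + 2 * QF (f i) (f j) + QF (f j) (f j)"
      using QF_square[OF ff ff, of i 1 j] by simp
    moreover have "QF ?d ?d = QF (f i) (f i) - 2 * QF (f i) (f j) + QF (f j) (f j)"
      using QF_square[OF ff ff, of i "-1" j] by simp
    ultimately have "QF ?d ?d \<le> 2 * (1 / real (Suc i) + 1 / real (Suc j))"
      using fm[of i] fm[of j] by argo
    moreover have "(?d x)\<^sup>2 \<le> D * QF ?d ?d"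
      by (rule D(2)[rule_format, OF finite_energy_diff[OF ff ff] _ x]) (simp add: fB)
    ultimately show ?thesis using D(1) by (smt (verit) mult_left_mono)
  qed
  have "uniformly_Cauchy_on X f"
  proof (rule uniformly_Cauchy_onI)
    fix r :: real assume "0 < r"
    have "0 < r\<^sup>2 / (4 * D)" using \<open>0 < r\<close> D(1) by simp
    then obtain N where N: "1 / real (Suc N) < r\<^sup>2 / (4 * D)" using nat_approx_posE by blast
    show "\<exists>M. \<forall>x\<in>X. \<forall>i\<ge>M. \<forall>j\<ge>M. dist (f i x) (f j x) < r"
    proof (intro exI[of _ N] ballI allI impI)
      fix x i j assume x: "x \<in> X" and "N \<le> i" "N \<le> j"
      then have "1 / real (Suc i) \<le> 1 / real (Suc N)" "1 / real (Suc j) \<le> 1 / real (Suc N)" by (auto simp: frac_le)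
      then have "1 / real (Suc i) + 1 / real (Suc j) < 2 * (r\<^sup>2 / (4 * D))" using N by linarith
      then have "D * (2 * (1 / real (Suc i) + 1 / real (Suc j))) < D * (2 * (2 * (r\<^sup>2 / (4 * D))))"
        using D(1) by (intro mult_strict_left_mono) auto
      also have "\<dots> = r\<^sup>2" using D(1) by simp
      finally have "(f i x - f j x)\<^sup>2 < r\<^sup>2" using diff[OF x, of i j] by linarith
      then have "\<bar>f i x - f j x\<bar> < r" using \<open>0 < r\<close> by (simp add: power2_less_imp_less[of "\<bar>f i x - f j x\<bar>" r])
      then show "dist (f i x) (f j x) < r" by (simp add: dist_real_def)
    qed
  qed
  then obtain u where u: "uniform_limit X f u sequentially"
    using Cauchy_uniformly_convergent unfolding uniformly_convergent_on_def by blast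
  have uc: "continuous_on X u"
    by (rule uniform_limit_theorem[OF _ u]) (auto intro: always_eventually finite_energy_continuous ff)
  have ux: "(\<lambda>j. f j x) \<longlonglongrightarrow> u x" if "x \<in> X" for x using tendsto_uniform_limitI[OF u that] .
  have uB: "u x = U x" if x: "x \<in> B" for x
  proof -
    have "x \<in> X" using x boundary_subset by blast
    from ux[OF this] have "(\<lambda>j. U x) \<longlonglongrightarrow> u x" unfolding fB[OF x] .
    then show ?thesis using LIMSEQ_unique[OF _ tendsto_const] by blast
  qed
  have potlim: "(\<lambda>j. pot (\<lambda>y. f j y * f j y)) \<longlonglongrightarrow> pot (\<lambda>y. u y * u y)"
  proof -
    obtain M where M: "0 \<le> M" "\<And>y. y \<in> X \<Longrightarrow> \<bar>u y\<bar> \<le> M" by (rule bounded_on_X[OF uc]) (rule that)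
    have p1: "0 \<le> pot (\<lambda>_. 1)" by (intro pot_nonneg) auto
    show ?thesis
    proof (rule LIMSEQ_I)
      fix r :: real assume "0 < r"
      \<comment> \<open>Once |f j - u| \<le> \<open>\<epsilon>\<close> \<le> 1, the squares differ
        by at most \<open>\<epsilon> * (2 * M + 1)\<close>. The summand 1 next to
        \<open>pot (\<lambda>_. 1)\<close> keeps the denominator positive.\<close>
      define \<epsilon> where "\<epsilon> = min 1 (r / (2 * (2 * M + 1) * (pot (\<lambda>_. 1) + 1)))"
      have \<epsilon>: "0 < \<epsilon>" "\<epsilon> \<le> 1" using \<open>0 < r\<close> M(1) p1 unfolding \<epsilon>_def by auto
      have small: "\<epsilon> * (2 * M + 1) * pot (\<lambda>_. 1) < r"
      proof -
        have pos: "0 < (2 * M + 1) * (pot (\<lambda>_. 1) + 1)" using M(1) p1 by (intro mult_pos_pos) auto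
        have "\<epsilon> * ((2 * M + 1) * (pot (\<lambda>_. 1) + 1)) \<le> r / (2 * (2 * M + 1) * (pot (\<lambda>_. 1) + 1)) * ((2 * M + 1) * (pot (\<lambda>_. 1) + 1))"
          using pos unfolding \<epsilon>_def by (intro mult_right_mono) auto
        also have "\<dots> = r / 2" using pos M(1) p1 by (simp add: field_simps)
        finally have 1: "\<epsilon> * ((2 * M + 1) * (pot (\<lambda>_. 1) + 1)) \<le> r / 2" .
        have "\<epsilon> * (2 * M + 1) * pot (\<lambda>_. 1) \<le> \<epsilon> * ((2 * M + 1) * (pot (\<lambda>_. 1) + 1))"
          unfolding mult.assoc using \<epsilon>(1) M(1) by (intro mult_left_mono) auto
        then show ?thesis using 1 \<open>0 < r\<close> by linarith
      qed
      obtain N where N: "\<And>j x. N \<le> j \<Longrightarrow> x \<in> X \<Longrightarrow> dist (f j x) (u x) < \<epsilon>"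
        using u \<epsilon>(1) unfolding uniform_limit_sequentially_iff by blast
      show "\<exists>N. \<forall>j\<ge>N. norm (pot (\<lambda>y. f j y * f j y) - pot (\<lambda>y. u y * u y)) < r"
      proof (intro exI[of _ N] allI impI)
        fix j assume j: "N \<le> j"
        let ?h = "\<lambda>y. f j y * f j y + (-1) * (u y * u y)"
        have ch: "continuous_on X ?h" "continuous_on X (\<lambda>y. f j y * f j y)" "continuous_on X (\<lambda>y. (-1) * (u y * u y))"
          by (intro continuous_intros uc finite_energy_continuous ff)+
        have bd: "\<bar>?h y\<bar> \<le> \<epsilon> * (2 * M + 1)" if y: "y \<in> X" for y
        proof -
          have d: "\<bar>f j y - u y\<bar> \<le> \<epsilon>" using N[OF j y] by (simp add: dist_real_def)
          have "?h y = (f j y - u y) * (f j y + u y)" by (simp add: algebra_simps)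
          moreover have "\<bar>f j y + u y\<bar> \<le> 2 * M + 1" using d M(2)[OF y] \<epsilon>(2) by linarith
          ultimately show ?thesis using d \<epsilon>(1) by (simp only: abs_mult) (intro mult_mono, auto)
        qed
        have "pot ?h \<le> pot (\<lambda>_. (\<epsilon> * (2 * M + 1)) * 1)" using bd by (intro pot_mono ch continuous_intros) (simp add: abs_le_iff)
        moreover have "pot (\<lambda>_. (- (\<epsilon> * (2 * M + 1))) * 1) \<le> pot ?h"
        proof (intro pot_mono ch continuous_on_const)
          fix y assume "y \<in> X"
          from bd[OF this] show "(- (\<epsilon> * (2 * M + 1))) * 1 \<le> ?h y" by linarith
        qed
        ultimately have "\<bar>pot ?h\<bar> \<le> \<epsilon> * (2 * M + 1) * pot (\<lambda>_. 1)"
          unfolding pot_cmult[of _ "\<lambda>_. 1"] by (simp add: abs_le_iff)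
        moreover have "pot ?h = pot (\<lambda>y. f j y * f j y) - pot (\<lambda>y. u y * u y)"
          unfolding pot_add[OF ch(2,3)] pot_cmult by simp
        ultimately show "norm (pot (\<lambda>y. f j y * f j y) - pot (\<lambda>y. u y * u y)) < r" using small by simp
      qed
    qed
  qed
  \<comment> \<open>Lower semicontinuity: at a fixed level the form is a finite expression in point
    values, hence passes to the limit, and it is bounded by the energy of each
    \<open>f j\<close>.\<close>
  have key: "dyadic_energy n u u + pot (\<lambda>y. u y * u y) \<le> m" for n
  proof (rule LIMSEQ_le)
    show "(\<lambda>j. dyadic_energy n (f j) (f j) + pot (\<lambda>y. f j y * f j y)) \<longlonglongrightarrow> dyadic_energy n u u + pot (\<lambda>y. u y * u y)"
      by (intro tendsto_add potlim dyadic_energy_pointwise_tendsto ux)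
    show "(\<lambda>j. m + 1 / real (Suc j)) \<longlonglongrightarrow> m"
      using tendsto_add[OF tendsto_const[of m] LIMSEQ_inverse_real_of_nat] by (simp add: inverse_eq_divide)
    have "dyadic_energy n (f j) (f j) + pot (\<lambda>y. f j y * f j y) \<le> m + 1 / real (Suc j)" for j
      using dyadic_energy_le_energy[OF ff, of n j] fm[of j] unfolding QF_def by linarith
    then show "\<exists>N. \<forall>j\<ge>N. dyadic_energy n (f j) (f j) + pot (\<lambda>y. f j y * f j y) \<le> m + 1 / real (Suc j)" by blast
  qed
  have uf: "finite_energy u"
    unfolding finite_energy_def using uc key by (auto intro!: exI[of _ "m - pot (\<lambda>y. u y * u y)"] simp: le_diff_eq)
  have lim: "(\<lambda>n. dyadic_energy n u u + pot (\<lambda>y. u y * u y)) \<longlonglongrightarrow> QF u u"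
    unfolding QF_def by (rule tendsto_add[OF dyadic_energy_tendsto[OF uf uf] tendsto_const])
  have le: "QF u u \<le> m"
    by (rule LIMSEQ_le_const2[OF lim]) (use key in simp)
  have "has_data U u" unfolding has_data_def using uf uB by simp
  moreover have "QF u u \<le> QF f f" if "has_data U f" for f by (rule order_trans[OF le m_le[OF that]])
  ultimately show ?thesis unfolding minimizes_def by (intro exI[of _ u]) simp
qed

end

section \<open>Minimizers are harmonic\<close>

definition tent :: "real \<Rightarrow> real \<Rightarrow> real \<Rightarrow> real" where
  "tent c \<delta> x = max 0 (1 - \<bar>x - c\<bar> / \<delta>)"

lemma tent_scaled: "0 < \<delta> \<Longrightarrow> tent c \<delta> x = max 0 (\<delta> - \<bar>x - c\<bar>) / \<delta>"
  by (simp add: tent_def max_def field_simps)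

lemma tent_bounds: "0 < \<delta> \<Longrightarrow> 0 \<le> tent c \<delta> x" "0 < \<delta> \<Longrightarrow> tent c \<delta> x \<le> 1"
  by (simp_all add: tent_def)

lemma tent_outside: "0 < \<delta> \<Longrightarrow> \<delta> \<le> \<bar>x - c\<bar> \<Longrightarrow> tent c \<delta> x = 0"
  by (simp add: tent_scaled)

lemma tent_lipschitz:
  assumes "0 < \<delta>"
  shows "\<bar>tent c \<delta> t - tent c \<delta> s\<bar> \<le> 1 / \<delta> * \<bar>t - s\<bar>"
proof -
  have "\<bar>max 0 (\<delta> - \<bar>t - c\<bar>) - max 0 (\<delta> - \<bar>s - c\<bar>)\<bar> \<le> \<bar>t - s\<bar>"
    by (auto simp: max_def abs_if)
  then have "\<bar>(max 0 (\<delta> - \<bar>t - c\<bar>) - max 0 (\<delta> - \<bar>s - c\<bar>)) / \<delta>\<bar> \<le> \<bar>t - s\<bar> / \<delta>"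
    using assms by (simp add: divide_right_mono)
  then show ?thesis unfolding tent_scaled[OF assms] diff_divide_distrib by simp
qed

lemma tent_midpoint:
  assumes "0 < \<delta>" "l \<le> r" "r \<le> c - \<delta> \<or> (c - \<delta> \<le> l \<and> r \<le> c) \<or> (c \<le> l \<and> r \<le> c + \<delta>) \<or> c + \<delta> \<le> l"
  shows "2 * tent c \<delta> ((l + r) / 2) = tent c \<delta> l + tent c \<delta> r"
proof -
  have "2 * max 0 (\<delta> - \<bar>(l + r) / 2 - c\<bar>) = max 0 (\<delta> - \<bar>l - c\<bar>) + max 0 (\<delta> - \<bar>r - c\<bar>)"
    using assms by (elim disjE) (auto simp: max_def abs_if field_simps)
  then have "(2 * max 0 (\<delta> - \<bar>(l + r) / 2 - c\<bar>)) / \<delta> = (max 0 (\<delta> - \<bar>l - c\<bar>) + max 0 (\<delta> - \<bar>r - c\<bar>)) / \<delta>"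
    by (rule arg_cong)
  then show ?thesis unfolding tent_scaled[OF assms(1)] add_divide_distrib by simp
qed

lemma node_midpoint: "node a b (Suc m) (Suc (2 * j)) = (node a b m j + node a b m (Suc j)) / 2"
  by (simp add: node_def field_simps)

text \<open>Tents are affine between the nodes, so refining the subdivision does not change their form with a
  function \<open>f\<close>, however irregular.\<close>
lemma dyadic_form_tent_refine:
  assumes "a < b" "n \<le> m"
  shows "dyadic_form a b m f (tent (node a b n k) ((b - a) / 2 ^ n)) = dyadic_form a b n f (tent (node a b n k) ((b - a) / 2 ^ n))"
  using assms(2)
proof (induction m rule: dec_induct)
  case (step m)
  let ?\<delta> = "(b - a) / 2 ^ n" and ?c = "node a b n k"
  define w where "w = (b - a) / 2 ^ m"
  \<comment> \<open>One cell of level \<open>n\<close> consists of \<open>P\<close> cells of level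
    \<open>m\<close>. So the kinks of the tent have the indices \<open>k * P - P\<close>,
    \<open>k * P\<close> and \<open>k * P + P\<close> at level \<open>m\<close>, and no cell has one
    in its interior.\<close>
  define P where "P = (2::nat) ^ (m - n)"
  have w: "w > 0" using assms(1) by (simp add: w_def)
  have pw: "(2::real) ^ m = 2 ^ n * real P" unfolding P_def using step.hyps by (simp flip: power_add)
  have Ppos: "real P > 0" by (simp add: P_def)
  have \<delta>: "?\<delta> = w * real P" unfolding w_def pw using Ppos by simp
  have c: "?c = a + w * real (k * P)" unfolding node_def w_def pw using Ppos by (simp add: field_simps)
  have nd: "node a b m j = a + w * real j" for j by (simp add: node_def w_def)
  have "dyadic_form a b (Suc m) f (tent ?c ?\<delta>) = dyadic_form a b m f (tent ?c ?\<delta>)"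
  proof (rule dyadic_form_Suc_eq)
    fix j :: nat
    have "Suc j + P \<le> k * P \<or> (k * P \<le> j + P \<and> Suc j \<le> k * P) \<or> (k * P \<le> j \<and> Suc j \<le> k * P + P) \<or> k * P + P \<le> j"
      by linarith
    then have "real (Suc j) \<le> real (k * P) - real P \<or> (real (k * P) - real P \<le> real j \<and> real (Suc j) \<le> real (k * P)) \<or>
       (real (k * P) \<le> real j \<and> real (Suc j) \<le> real (k * P) + real P) \<or> real (k * P) + real P \<le> real j"
      by linarith
    then have "w * real (Suc j) \<le> w * (real (k * P) - real P) \<or> (w * (real (k * P) - real P) \<le> w * real j \<and> w * real (Suc j) \<le> w * real (k * P)) \<or>
       (w * real (k * P) \<le> w * real j \<and> w * real (Suc j) \<le> w * (real (k * P) + real P)) \<or> w * (real (k * P) + real P) \<le> w * real j"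
      using w by (simp only: mult_le_cancel_left_pos)
    then have "node a b m (Suc j) \<le> ?c - ?\<delta> \<or> (?c - ?\<delta> \<le> node a b m j \<and> node a b m (Suc j) \<le> ?c) \<or>
       (?c \<le> node a b m j \<and> node a b m (Suc j) \<le> ?c + ?\<delta>) \<or> ?c + ?\<delta> \<le> node a b m j"
      unfolding c nd \<delta> right_diff_distrib distrib_left by argo
    moreover have "node a b m j \<le> node a b m (Suc j)" using assms(1) by (intro node_mono) auto
    ultimately show "2 * tent ?c ?\<delta> (node a b (Suc m) (Suc (2 * j))) = tent ?c ?\<delta> (node a b m j) + tent ?c ?\<delta> (node a b m (Suc j))"
      unfolding node_midpoint using assms(1) by (intro tent_midpoint) auto
  qed
  then show ?case using step.IH by simp
qed simp

lemma tent_node: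
  assumes "a < b"
  shows "tent (node a b n k) ((b - a) / 2 ^ n) (node a b n j) = (if j = k then 1 else 0)"
proof (cases "j = k")
  case False
  let ?w = "(b - a) / 2 ^ n"
  have w: "?w > 0" by (rule divide_pos_pos) (use assms in auto)
  have "node a b n j - node a b n k = ?w * (real j - real k)" by (simp add: node_def right_diff_distrib)
  then have "\<bar>node a b n j - node a b n k\<bar> = ?w * \<bar>real j - real k\<bar>" by (simp only: abs_mult abs_of_pos[OF w])
  moreover have "1 \<le> \<bar>real j - real k\<bar>" using False by linarith
  ultimately have "?w \<le> \<bar>node a b n j - node a b n k\<bar>" using w mult_left_mono[of 1 "\<bar>real j - real k\<bar>" ?w] by simp
  then show ?thesis using False w by (simp add: tent_outside)
qed (simp add: tent_def)

text \<open>Summation by parts against a hat function. At an inner node this is minus a second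
  difference over the cell length; at an end one neighbour is missing and a one-sided difference
  quotient remains, which is where the Kirchhoff condition comes from.\<close>

lemma dyadic_form_tent:
  assumes "a < b" "k \<le> 2 ^ n"
  defines "\<delta> \<equiv> (b - a) / 2 ^ n"
  shows "dyadic_form a b n f (tent (node a b n k) \<delta>) =
    ((if 0 < k then f (node a b n k) - f (node a b n (k - 1)) else 0) -
     (if k < 2 ^ n then f (node a b n (Suc k)) - f (node a b n k) else 0)) / \<delta>"
proof -
  define d where "d j = f (node a b n (Suc j)) - f (node a b n j)" for j
  have "(\<Sum>j<2 ^ n. d j * (tent (node a b n k) \<delta> (node a b n (Suc j)) - tent (node a b n k) \<delta> (node a b n j)))
     = (\<Sum>j<2 ^ n. (if Suc j = k then d j else 0) - (if j = k then d j else 0))"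
    unfolding \<delta>_def tent_node[OF assms(1)] by (intro sum.cong refl) auto
  also have "\<dots> = (\<Sum>j<2 ^ n. (if Suc j = k then d j else 0)) - (\<Sum>j<2 ^ n. (if j = k then d j else 0))"
    by (rule sum_subtractf)
  also have "(\<Sum>j<2 ^ n. (if j = k then d j else 0)) = (if k < 2 ^ n then d k else 0)"
    by simp
  also have "(\<Sum>j<2 ^ n. (if Suc j = k then d j else 0)) = (if 0 < k then d (k - 1) else 0)"
  proof (cases k)
    case (Suc i)
    then have "(\<Sum>j<2 ^ n. (if Suc j = k then d j else 0)) = (\<Sum>j<2 ^ n. (if j = i then d j else 0))"
      by (intro sum.cong) auto
    then show ?thesis using Suc assms(2) by simp
  qed simp
  finally have "dyadic_form a b n f (tent (node a b n k) \<delta>) = ((if 0 < k then d (k - 1) else 0) - (if k < 2 ^ n then d k else 0)) * 2 ^ n / (b - a)"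
    unfolding dyadic_form_def d_def by simp
  also have "\<dots> = ((if 0 < k then d (k - 1) else 0) - (if k < 2 ^ n then d k else 0)) / \<delta>"
    unfolding \<delta>_def by simp
  finally show ?thesis unfolding d_def by (cases k) simp_all
qed

lemma zero_second_difference_imp_linear:
  fixes g :: "nat \<Rightarrow> real"
  assumes "\<And>k. 0 < k \<Longrightarrow> k < N \<Longrightarrow> g (Suc k) + g (k - 1) = 2 * g k" "k \<le> N"
  shows "g k = g 0 + real k * (g 1 - g 0)"
  using assms(2)
proof (induction k rule: less_induct)
  case (less k)
  have "k = 0 \<or> k = 1 \<or> (\<exists>j. k = Suc (Suc j))" by presburger
  then consider "k = 0" | "k = 1" | j where "k = Suc (Suc j)" by blast
  then show ?case
  proof cases
    case 3
    have 1: "g (Suc j) = g 0 + real (Suc j) * (g 1 - g 0)" "g j = g 0 + real j * (g 1 - g 0)"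
      using less.IH[of "Suc j"] less.IH[of j] less.prems 3 by simp_all
    have "g (Suc (Suc j)) + g j = 2 * g (Suc j)" using assms(1)[of "Suc j"] less.prems 3 by simp
    then show ?thesis unfolding 3 using 1 by (simp add: algebra_simps)
  qed simp_all
qed

text \<open>A discrete du Bois-Reymond lemma: only dyadic centres and widths have to be tested, as
  continuity extends the conclusion from the nodes.\<close>

lemma zero_second_difference_imp_affine:
  fixes g :: "real \<Rightarrow> real"
  assumes "a < b" and g: "continuous_on {a..b} g"
    and sd: "\<And>n k. 0 < k \<Longrightarrow> k < 2 ^ n \<Longrightarrow> g (node a b n (Suc k)) + g (node a b n (k - 1)) = 2 * g (node a b n k)"
    and x: "x \<in> {a..b}"
  shows "g x = g a + (g b - g a) / (b - a) * (x - a)"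
proof (rule continuous_eq_on_nodes[OF assms(1) g _ _ x])
  show "continuous_on {a..b} (\<lambda>x. g a + (g b - g a) / (b - a) * (x - a))" by (intro continuous_intros)
  fix n k :: nat assume k: "k \<le> 2 ^ n"
  have lin: "g (node a b n k) = g a + real k * (g (node a b n 1) - g a)" if "k \<le> 2 ^ n" for k
    using zero_second_difference_imp_linear[of "2 ^ n" "\<lambda>k. g (node a b n k)" k] sd that by simp
  have "g b = g a + 2 ^ n * (g (node a b n 1) - g a)" using lin[of "2 ^ n"] by simp
  then have "g (node a b n 1) - g a = (g b - g a) / 2 ^ n" by (simp add: field_simps)
  then show "g (node a b n k) = g a + (g b - g a) / (b - a) * (node a b n k - a)"
    using lin[OF k] assms(1) by (simp add: node_def)
qed

lemma abs_cont_on_cong: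
  assumes "\<And>x. x \<in> {a..b} \<Longrightarrow> f x = g x" "abs_cont_on a b f"
  shows "abs_cont_on a b g"
  unfolding abs_cont_on_def
proof (intro allI impI)
  fix \<epsilon> :: real assume "0 < \<epsilon>"
  from assms(2)[unfolded abs_cont_on_def, rule_format, OF this] obtain \<delta> where "0 < \<delta>" and
    \<delta>: "\<forall>(n::nat) s t. (\<forall>i<n. a \<le> s i \<and> s i \<le> t i \<and> t i \<le> b) \<and>
        (\<forall>i<n. \<forall>j<n. i \<noteq> j \<longrightarrow> {s i<..<t i} \<inter> {s j<..<t j} = {}) \<and>
        (\<Sum>i<n. t i - s i) < \<delta> \<longrightarrow> (\<Sum>i<n. \<bar>f (t i) - f (s i)\<bar>) < \<epsilon>"
    by (elim exE conjE) (rule that)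
  show "\<exists>\<delta>>0. \<forall>(n::nat) s t. (\<forall>i<n. a \<le> s i \<and> s i \<le> t i \<and> t i \<le> b) \<and>
        (\<forall>i<n. \<forall>j<n. i \<noteq> j \<longrightarrow> {s i<..<t i} \<inter> {s j<..<t j} = {}) \<and>
        (\<Sum>i<n. t i - s i) < \<delta> \<longrightarrow> (\<Sum>i<n. \<bar>g (t i) - g (s i)\<bar>) < \<epsilon>"
  proof (intro exI[of _ \<delta>] conjI \<open>0 < \<delta>\<close> allI impI)
    fix n :: nat and s t
    assume *: "(\<forall>i<n. a \<le> s i \<and> s i \<le> t i \<and> t i \<le> b) \<and>
        (\<forall>i<n. \<forall>j<n. i \<noteq> j \<longrightarrow> {s i<..<t i} \<inter> {s j<..<t j} = {}) \<and> (\<Sum>i<n. t i - s i) < \<delta>"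
    have "(\<Sum>i<n. \<bar>g (t i) - g (s i)\<bar>) = (\<Sum>i<n. \<bar>f (t i) - f (s i)\<bar>)"
    proof (intro sum.cong refl)
      fix i assume "i \<in> {..<n}"
      then have "s i \<in> {a..b}" "t i \<in> {a..b}" using * by (auto intro: order_trans)
      then show "\<bar>g (t i) - g (s i)\<bar> = \<bar>f (t i) - f (s i)\<bar>" by (simp add: assms(1))
    qed
    also have "\<dots> < \<epsilon>" by (rule \<delta>[rule_format, OF *])
    finally show "(\<Sum>i<n. \<bar>g (t i) - g (s i)\<bar>) < \<epsilon>" .
  qed
qed

lemma abs_cont_on_add_const: "abs_cont_on a b f \<Longrightarrow> abs_cont_on a b (\<lambda>x. k + f x)"
  by (simp add: abs_cont_on_def)

lemma has_derivative_imp_edge_deriv: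
  assumes "lo \<Gamma> e < hi \<Gamma> e" "x \<in> {lo \<Gamma> e..hi \<Gamma> e}"
    and "(on_edge \<Gamma> \<iota> u e has_real_derivative d) (at x within {lo \<Gamma> e..hi \<Gamma> e})"
  shows "edge_deriv \<Gamma> \<iota> u e x = d"
  unfolding edge_deriv_def
  using assms vector_derivative_within_cbox[of "lo \<Gamma> e" "hi \<Gamma> e" x]
  by (simp add: has_real_derivative_iff_has_vector_derivative)

context completed_graph
begin

section \<open>Tents on the graph\<close>

lemma lipschitz_extension:
  assumes "0 < K" and lip: "\<And>e s t. e \<in> E \<Longrightarrow> s \<in> seg e \<Longrightarrow> t \<in> seg e \<Longrightarrow> \<bar>g (ep e t) - g (ep e s)\<bar> \<le> K * \<bar>t - s\<bar>"
  obtains G :: "'x \<Rightarrow> real" where "continuous_on X G" "\<And>p. p \<in> points \<Gamma> \<Longrightarrow> G (\<iota> p) = g p"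
proof -
  define h where "h = g \<circ> inv_into (points \<Gamma>) \<iota>"
  have h: "h (\<iota> p) = g p" if "p \<in> points \<Gamma>" for p
    unfolding h_def using inv_into_f_f[OF inj_\<iota> that] by simp
  have "uniformly_continuous_on (graph_set \<Gamma> \<iota>) h"
    unfolding uniformly_continuous_on_def
  proof (intro allI impI)
    fix r :: real assume "0 < r"
    show "\<exists>d>0. \<forall>x\<in>graph_set \<Gamma> \<iota>. \<forall>x'\<in>graph_set \<Gamma> \<iota>. dist x' x < d \<longrightarrow> dist (h x') (h x) < r"
    proof (intro exI[of _ "r / K"] conjI ballI impI)
      show "0 < r / K" using \<open>0 < r\<close> assms(1) by simp
      fix x x' assume "x \<in> graph_set \<Gamma> \<iota>" "x' \<in> graph_set \<Gamma> \<iota>" and d: "dist x' x < r / K"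
      then obtain p p' where p: "p \<in> points \<Gamma>" "x = \<iota> p" "p' \<in> points \<Gamma>" "x' = \<iota> p'" unfolding graph_set_def by blast
      have "\<bar>g p' - g p\<bar> \<le> K * dist (\<iota> p) (\<iota> p')" by (rule lipschitz_dist[OF p(1,3) assms(1) lip])
      also have "\<dots> < r" using d p assms(1) by (simp add: dist_commute field_simps)
      finally show "dist (h x') (h x) < r" using h p by (simp add: dist_real_def)
    qed
  qed
  then obtain G where G: "uniformly_continuous_on (closure (graph_set \<Gamma> \<iota>)) G" "\<And>x. x \<in> graph_set \<Gamma> \<iota> \<Longrightarrow> h x = G x"
    by (rule uniformly_continuous_on_extension_on_closure) (rule that)
  show thesis
  proof (rule that)
    show "continuous_on X G" using G(1) uniformly_continuous_imp_continuous unfolding completed_def by blast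
    show "G (\<iota> p) = g p" if "p \<in> points \<Gamma>" for p
      using G(2)[of "\<iota> p"] h[OF that] that by (simp add: graph_set_def)
  qed
qed

definition star_edges :: "'v graph_point \<Rightarrow> ('v \<times> 'v) set" where
  "star_edges w = {e. \<exists>c. at_coord w e c}"

definition coord :: "'v graph_point \<Rightarrow> 'v \<times> 'v \<Rightarrow> real" where
  "coord w e = (THE c. at_coord w e c)"

lemma coord_eq: "at_coord w e c \<Longrightarrow> coord w e = c"
  unfolding coord_def using at_coord_unique by blast

lemma at_coord_coord: "e \<in> star_edges w \<Longrightarrow> at_coord w e (coord w e)"
  unfolding star_edges_def by (elim CollectE exE) (simp add: coord_eq)

lemma star_edges_props: "w \<in> points \<Gamma> \<Longrightarrow> finite (star_edges w)" "star_edges w \<subseteq> E"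
  unfolding star_edges_def by (erule finite_at_coord) (auto simp: at_coord_def)

text \<open>The width is one cell of level \<open>n\<close> on each edge, so it varies from edge to
  edge; all pieces have the value 1 at \<open>w\<close> and therefore fit together.\<close>

definition edge_tent :: "'v graph_point \<Rightarrow> nat \<Rightarrow> 'v \<times> 'v \<Rightarrow> real \<Rightarrow> real" where
  "edge_tent w n e = (if e \<in> star_edges w then tent (coord w e) ((hi \<Gamma> e - lo \<Gamma> e) / 2 ^ n) else (\<lambda>_. 0))"

text \<open>Puts the kinks of the tents at nodes and makes each tent vanish at every end of its edge
  other than \<open>w\<close>.\<close>

definition coords_are_nodes :: "'v graph_point \<Rightarrow> nat \<Rightarrow> bool" where
  "coords_are_nodes w n \<longleftrightarrow> (\<forall>e\<in>star_edges w. \<exists>k\<le>2 ^ n. coord w e = node (lo \<Gamma> e) (hi \<Gamma> e) n k)"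

text \<open>The edges in \<open>S\<close> form a compact subset of the graph, so graph points close
  to \<open>y\<close> avoid them. It makes a tent vanish on the part of the boundary outside the
  graph.\<close>

lemma vanishes_off_graph:
  assumes G: "continuous_on X G" and S: "finite S" "S \<subseteq> E"
    and zero: "\<And>e x. e \<in> E - S \<Longrightarrow> x \<in> seg e \<Longrightarrow> G (\<iota> (ep e x)) = 0" and y: "y \<in> X - graph_set \<Gamma> \<iota>"
  shows "G y = (0::real)"
proof -
  define K where "K = (\<Union>e\<in>S. (\<lambda>x. \<iota> (ep e x)) ` seg e)"
  have "closed K" unfolding K_def
  proof (intro closed_UN S ballI)
    fix e assume "e \<in> S"
    then have "e \<in> E" using S by blast
    then show "closed ((\<lambda>x. \<iota> (ep e x)) ` seg e)"
      by (intro compact_imp_closed compact_continuous_image continuous_on_edge_map compact_Icc)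
  qed
  have "K \<subseteq> graph_set \<Gamma> \<iota>" unfolding K_def graph_set_eq using S(2) by blast
  then have "y \<in> - K" using y by blast
  have "y \<in> X" using y by blast
  then obtain a where a: "\<And>n. a n \<in> graph_set \<Gamma> \<iota>" "a \<longlonglongrightarrow> y" unfolding completed_def closure_sequential by blast
  have aX: "a n \<in> X" for n using a(1) closure_subset unfolding completed_def by blast
  have "\<forall>\<^sub>F n in sequentially. a n \<in> - K"
    using \<open>closed K\<close> \<open>y \<in> - K\<close> by (intro topological_tendstoD[OF a(2)]) auto
  then have ev: "\<forall>\<^sub>F n in sequentially. G (a n) = 0"
  proof (rule eventually_mono)
    fix n assume n: "a n \<in> - K"
    obtain e x where e: "e \<in> E" "x \<in> seg e" "a n = \<iota> (ep e x)" using a(1)[of n] unfolding graph_set_eq by auto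
    have "e \<notin> S" using n e unfolding K_def by blast
    then show "G (a n) = 0" using zero[of e x] e by simp
  qed
  have "(\<lambda>n. G (a n)) \<longlonglongrightarrow> G y"
    by (rule continuous_on_tendsto_compose[OF G a(2)]) (use y aX in auto)
  moreover have "(\<lambda>n. G (a n)) \<longlonglongrightarrow> 0" by (rule tendsto_eventually[OF ev])
  ultimately show ?thesis by (rule LIMSEQ_unique)
qed

text \<open>From level \<open>n\<close> on, refinement does not change the form on the star of
  \<open>w\<close>, so the sequence is eventually constant for an arbitrary \<open>u\<close>. The
  case that \<open>u\<close> is \<open>G\<close> itself gives finite energy.\<close>

lemma tent_function:
  assumes w: "w \<in> points \<Gamma>" and nodes: "coords_are_nodes w n"
  obtains G where "finite_energy G" "\<And>e x. e \<in> E \<Longrightarrow> x \<in> seg e \<Longrightarrow> on_edge \<Gamma> \<iota> G e x = edge_tent w n e x"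
    "\<And>y. y \<in> B \<Longrightarrow> y \<noteq> \<iota> w \<Longrightarrow> G y = 0"
    "\<And>u. (\<lambda>m. dyadic_energy m u G) \<longlonglongrightarrow> (\<Sum>e\<in>star_edges w. dyadic_form (lo \<Gamma> e) (hi \<Gamma> e) n (on_edge \<Gamma> \<iota> u e) (edge_tent w n e))"
proof -
  let ?\<delta> = "\<lambda>e. (hi \<Gamma> e - lo \<Gamma> e) / 2 ^ n"
  note S = star_edges_props(1)[OF w] star_edges_props(2)[of w]
  have \<delta>pos: "0 < ?\<delta> e" if "e \<in> E" for e using lo_less_hi[OF that] by simp
  define g where "g p = (case p of Vertex v \<Rightarrow> if w = Vertex v then 1 else 0 | Inner e x \<Rightarrow> edge_tent w n e x)" for p
  have g_edge: "g (ep e x) = edge_tent w n e x" if e: "e \<in> E" and x: "x \<in> seg e" for e x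
  proof -
    have vertex: "g (Vertex v) = edge_tent w n e x" if v: "ep e x = Vertex v" and kx: "x = lo \<Gamma> e \<or> x = hi \<Gamma> e" for v
    proof (cases "w = Vertex v")
      case True
      then have "at_coord w e x" using e x v by (simp add: at_coord_def)
      then have "e \<in> star_edges w" "coord w e = x" using coord_eq by (auto simp: star_edges_def)
      then show ?thesis using True by (simp add: g_def edge_tent_def tent_def)
    next
      case False
      show ?thesis
      proof (cases "e \<in> star_edges w")
        case True
        then obtain k where k: "k \<le> 2 ^ n" "coord w e = node (lo \<Gamma> e) (hi \<Gamma> e) n k" using nodes unfolding coords_are_nodes_def by blast
        have "coord w e \<noteq> x" using at_coord_coord[OF True] False v by (auto simp: at_coord_def)
        obtain j where j: "x = node (lo \<Gamma> e) (hi \<Gamma> e) n j"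
          using kx node_0[of "lo \<Gamma> e" "hi \<Gamma> e" n] node_top[of "lo \<Gamma> e" "hi \<Gamma> e" n] by metis
        have "j \<noteq> k" using \<open>coord w e \<noteq> x\<close> j k by auto
        then show ?thesis using False True tent_node[OF lo_less_hi[OF e], of n k j] unfolding g_def edge_tent_def k(2) j by simp
      qed (use False in \<open>simp add: g_def edge_tent_def\<close>)
    qed
    show ?thesis
      by (rule ep_cases[OF e x]) (use vertex in \<open>auto simp: g_def\<close>)
  qed
  \<comment> \<open>One Lipschitz constant for the finitely many slopes; the 1 makes it
    positive.\<close>
  define K where "K = 1 + (\<Sum>e\<in>star_edges w. 1 / ?\<delta> e)"
  have \<delta>inv: "0 \<le> 1 / ?\<delta> e" if "e \<in> star_edges w" for e
    by (rule divide_nonneg_pos[OF zero_le_one \<delta>pos]) (use that S(2) in blast)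
  have Kpos: "0 < K" unfolding K_def by (intro add_pos_nonneg sum_nonneg \<delta>inv) auto
  have lip: "\<bar>g (ep e t) - g (ep e s)\<bar> \<le> K * \<bar>t - s\<bar>" if e: "e \<in> E" and st: "s \<in> seg e" "t \<in> seg e" for e s t
  proof (cases "e \<in> star_edges w")
    case True
    have "\<bar>g (ep e t) - g (ep e s)\<bar> \<le> 1 / ?\<delta> e * \<bar>t - s\<bar>"
      unfolding g_edge[OF e st(1)] g_edge[OF e st(2)] edge_tent_def using True tent_lipschitz[OF \<delta>pos[OF e]] by simp
    also have "\<dots> \<le> K * \<bar>t - s\<bar>"
    proof (rule mult_right_mono)
      have "1 / ?\<delta> e \<le> (\<Sum>e\<in>star_edges w. 1 / ?\<delta> e)"
        using S(1) True by (intro member_le_sum \<delta>inv) auto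
      then show "1 / ?\<delta> e \<le> K" by (simp add: K_def)
    qed simp
    finally show ?thesis .
  next
    case False
    then show ?thesis using Kpos by (simp add: g_edge[OF e st(1)] g_edge[OF e st(2)] edge_tent_def)
  qed
  obtain G where G: "continuous_on X G" "\<And>p. p \<in> points \<Gamma> \<Longrightarrow> G (\<iota> p) = g p"
    by (rule lipschitz_extension[OF Kpos lip]) (assumption+, rule that)
  have edge: "on_edge \<Gamma> \<iota> G e x = edge_tent w n e x" if "e \<in> E" "x \<in> seg e" for e x
    unfolding on_edge_def using G(2)[OF ep_mem_points[OF that]] g_edge[OF that] by simp
  have const: "on_edge \<Gamma> \<iota> G e x = on_edge \<Gamma> \<iota> G e (lo \<Gamma> e)" if "e \<in> E - star_edges w" "x \<in> seg e" for e x
    using that edge[of e x] edge[of e "lo \<Gamma> e"] lo_less_hi[of e] by (simp add: edge_tent_def)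
  have lim: "(\<lambda>m. dyadic_energy m u G) \<longlonglongrightarrow> (\<Sum>e\<in>star_edges w. dyadic_form (lo \<Gamma> e) (hi \<Gamma> e) n (on_edge \<Gamma> \<iota> u e) (edge_tent w n e))" for u
  proof (rule tendsto_eventually)
    have "\<forall>\<^sub>F m in sequentially. n \<le> m \<and> dyadic_energy m u G = (\<Sum>e\<in>star_edges w. dyadic_form (lo \<Gamma> e) (hi \<Gamma> e) m (on_edge \<Gamma> \<iota> u e) (on_edge \<Gamma> \<iota> G e))"
      by (intro eventually_conj eventually_ge_at_top dyadic_energy_localized S const)
    then show "\<forall>\<^sub>F m in sequentially. dyadic_energy m u G = (\<Sum>e\<in>star_edges w. dyadic_form (lo \<Gamma> e) (hi \<Gamma> e) n (on_edge \<Gamma> \<iota> u e) (edge_tent w n e))"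
    proof (rule eventually_mono, elim conjE)
      fix m assume m: "n \<le> m" and Em: "dyadic_energy m u G = (\<Sum>e\<in>star_edges w. dyadic_form (lo \<Gamma> e) (hi \<Gamma> e) m (on_edge \<Gamma> \<iota> u e) (on_edge \<Gamma> \<iota> G e))"
      show "dyadic_energy m u G = (\<Sum>e\<in>star_edges w. dyadic_form (lo \<Gamma> e) (hi \<Gamma> e) n (on_edge \<Gamma> \<iota> u e) (edge_tent w n e))"
        unfolding Em
      proof (intro sum.cong refl)
        fix e assume eS: "e \<in> star_edges w"
        then have e: "e \<in> E" using S by blast
        obtain k where k: "k \<le> 2 ^ n" "coord w e = node (lo \<Gamma> e) (hi \<Gamma> e) n k" using nodes eS unfolding coords_are_nodes_def by blast
        have "dyadic_form (lo \<Gamma> e) (hi \<Gamma> e) m (on_edge \<Gamma> \<iota> u e) (on_edge \<Gamma> \<iota> G e) = dyadic_form (lo \<Gamma> e) (hi \<Gamma> e) m (on_edge \<Gamma> \<iota> u e) (edge_tent w n e)"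
          unfolding dyadic_form_def
        proof (intro arg_cong2[where f = "(/)"] arg_cong2[where f = "(*)"] sum.cong refl)
          fix j assume "j \<in> {..<(2::nat) ^ m}"
          then have "node (lo \<Gamma> e) (hi \<Gamma> e) m j \<in> seg e" "node (lo \<Gamma> e) (hi \<Gamma> e) m (Suc j) \<in> seg e"
            using lo_less_hi[OF e] by (intro node_mem; simp)+
          then show "on_edge \<Gamma> \<iota> G e (node (lo \<Gamma> e) (hi \<Gamma> e) m (Suc j)) - on_edge \<Gamma> \<iota> G e (node (lo \<Gamma> e) (hi \<Gamma> e) m j)
            = edge_tent w n e (node (lo \<Gamma> e) (hi \<Gamma> e) m (Suc j)) - edge_tent w n e (node (lo \<Gamma> e) (hi \<Gamma> e) m j)"
            using edge[OF e] by simp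
        qed
        also have "\<dots> = dyadic_form (lo \<Gamma> e) (hi \<Gamma> e) n (on_edge \<Gamma> \<iota> u e) (edge_tent w n e)"
          using eS dyadic_form_tent_refine[OF lo_less_hi[OF e] m] unfolding edge_tent_def k(2) by simp
        finally show "dyadic_form (lo \<Gamma> e) (hi \<Gamma> e) m (on_edge \<Gamma> \<iota> u e) (on_edge \<Gamma> \<iota> G e) = dyadic_form (lo \<Gamma> e) (hi \<Gamma> e) n (on_edge \<Gamma> \<iota> u e) (edge_tent w n e)" .
      qed
    qed
  qed
  show thesis
  proof (rule that[OF _ edge _ lim])
    show "finite_energy G" by (rule finite_energyI_convergent[OF G(1) lim])
    fix y assume y: "y \<in> B" "y \<noteq> \<iota> w"
    show "G y = 0"
    proof (cases "y \<in> graph_set \<Gamma> \<iota>")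
      case True
      then obtain v where v: "y = \<iota> (Vertex v)" "v \<in> verts \<Gamma>" using y unfolding boundary_def by blast
      then have "G y = g (Vertex v)" using G(2)[of "Vertex v"] by (simp add: points_def)
      moreover have "w \<noteq> Vertex v" using v y by auto
      ultimately show ?thesis by (simp add: g_def)
    next
      case False
      then have yX: "y \<in> X - graph_set \<Gamma> \<iota>" using y boundary_subset by blast
      show ?thesis
      proof (rule vanishes_off_graph[OF G(1) S _ yX])
        fix e x assume "e \<in> E - star_edges w" "x \<in> seg e"
        then show "G (\<iota> (ep e x)) = 0" using edge[of e x] by (simp add: on_edge_def edge_tent_def)
      qed
    qed
  qed assumption+
qed

end

context potential_graph
begin

section \<open>Regularity and the Kirchhoff condition\<close>

lemma weak_equation:
  assumes u: "minimizes U u" and w: "w \<in> points \<Gamma>" "\<iota> w \<notin> B" and nodes: "coords_are_nodes w n"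
  shows "(\<Sum>e\<in>star_edges w. dyadic_form (lo \<Gamma> e) (hi \<Gamma> e) n (on_edge \<Gamma> \<iota> u e) (edge_tent w n e)
      + integral (seg e) (\<lambda>x. edge_tent w n e x * (qe e x * on_edge \<Gamma> \<iota> u e x))) = 0"
proof -
  note S = star_edges_props(1)[OF w(1)] star_edges_props(2)[of w]
  obtain G where G: "finite_energy G" "\<And>e x. e \<in> E \<Longrightarrow> x \<in> seg e \<Longrightarrow> on_edge \<Gamma> \<iota> G e x = edge_tent w n e x"
    "\<And>y. y \<in> B \<Longrightarrow> y \<noteq> \<iota> w \<Longrightarrow> G y = 0"
    "\<And>u. (\<lambda>m. dyadic_energy m u G) \<longlonglongrightarrow> (\<Sum>e\<in>star_edges w. dyadic_form (lo \<Gamma> e) (hi \<Gamma> e) n (on_edge \<Gamma> \<iota> u e) (edge_tent w n e))"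
    by (rule tent_function[OF w(1) nodes]) (rule that)
  have uf: "finite_energy u" using u by (simp add: minimizes_def has_data_def)
  have "QF u G = 0" by (rule Euler_Lagrange[OF u G(1)]) (use G(3) w(2) in metis)
  moreover have "energy u G = (\<Sum>e\<in>star_edges w. dyadic_form (lo \<Gamma> e) (hi \<Gamma> e) n (on_edge \<Gamma> \<iota> u e) (edge_tent w n e))"
    by (rule energy_eqI[OF uf G(1) G(4)])
  moreover have "pot (\<lambda>y. u y * G y) = (\<Sum>e\<in>star_edges w. integral (seg e) (\<lambda>x. edge_tent w n e x * (qe e x * on_edge \<Gamma> \<iota> u e x)))"
  proof -
    have ep: "edge_pot (\<lambda>y. u y * G y) e = integral (seg e) (\<lambda>x. edge_tent w n e x * (qe e x * on_edge \<Gamma> \<iota> u e x))" if e: "e \<in> E" for e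
      unfolding edge_pot_def on_edge_lambda(2)[where G = "(*)"]
      by (rule integral_cong) (simp add: G(2)[OF e])
    have "pot (\<lambda>y. u y * G y) = infsum (edge_pot (\<lambda>y. u y * G y)) (star_edges w)"
      unfolding pot_def
    proof (rule infsum_cong_neutral)
      fix e assume e: "e \<in> E - star_edges w"
      then have "edge_pot (\<lambda>y. u y * G y) e = integral (seg e) (\<lambda>x. 0)"
        using ep[of e] by (simp add: edge_tent_def)
      then show "edge_pot (\<lambda>y. u y * G y) e = 0" by simp
    qed (use S(2) in auto)
    also have "\<dots> = (\<Sum>e\<in>star_edges w. edge_pot (\<lambda>y. u y * G y) e)" by (rule infsum_finite[OF S(1)])
    also have "\<dots> = (\<Sum>e\<in>star_edges w. integral (seg e) (\<lambda>x. edge_tent w n e x * (qe e x * on_edge \<Gamma> \<iota> u e x)))"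
      using S(2) ep by (intro sum.cong refl) blast
    finally show ?thesis .
  qed
  ultimately show ?thesis unfolding QF_def sum.distrib by simp
qed

text \<open>Let \<open>v\<close> be the second antiderivative of qu. Testing with tents shows that
  \<open>u\<close> and \<open>v\<close> have the same second differences at all nodes, so u - v is
  affine and \<open>u\<close> inherits the derivative of \<open>v\<close>.\<close>

lemma minimizer_edge_regular:
  assumes u: "minimizes U u" and e: "e \<in> E"
  obtains \<kappa> where "\<And>x. x \<in> seg e \<Longrightarrow>
    (on_edge \<Gamma> \<iota> u e has_real_derivative \<kappa> + integral {lo \<Gamma> e..x} (\<lambda>x. qe e x * on_edge \<Gamma> \<iota> u e x)) (at x within seg e)"
proof -
  let ?l = "lo \<Gamma> e" and ?h = "hi \<Gamma> e" and ?u = "on_edge \<Gamma> \<iota> u e"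
  let ?r = "\<lambda>x. qe e x * ?u x"
  have lh: "?l < ?h" by (rule lo_less_hi[OF e])
  have uc: "continuous_on X u" using u by (simp add: minimizes_def has_data_def finite_energy_def)
  have r: "?r absolutely_integrable_on seg e" by (rule q_mult_integrable[OF uc e])
  define v where "v = second_antideriv ?l ?h ?r"
  have dv: "(v has_real_derivative integral {?l..x} ?r) (at x within seg e)" if "x \<in> seg e" for x
    unfolding v_def by (rule second_antideriv_has_derivative[OF r that])
  define g where "g x = ?u x - v x" for x
  have gc: "continuous_on (seg e) g"
    unfolding g_def by (intro continuous_on_diff continuous_on_edge[OF uc e] DERIV_continuous_on[OF dv])
  have sd: "g (node ?l ?h n (Suc k)) + g (node ?l ?h n (k - 1)) = 2 * g (node ?l ?h n k)" if k: "0 < k" "k < 2 ^ n" for n k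
  proof -
    let ?c = "node ?l ?h n k" and ?\<delta> = "(?h - ?l) / 2 ^ n"
    have \<delta>: "0 < ?\<delta>" using lh by simp
    have c: "?l < ?c" "?c < ?h"
      using node_strict_mono[OF lh, of 0 k n] node_strict_mono[OF lh, of k "2 ^ n" n] k by auto
    define w where "w = ep e ?c"
    have at: "at_coord w e' c' \<longleftrightarrow> e' = e \<and> c' = ?c" for e' c'
      unfolding at_coord_def w_def using ep_eq_inner[OF e c, of e' c'] e c by auto
    have star: "star_edges w = {e}" unfolding star_edges_def at by auto
    have coord: "coord w e = ?c" by (rule coord_eq) (simp add: at)
    have "w \<in> points \<Gamma>" unfolding w_def using e c by (intro ep_mem_points) auto
    moreover have "\<iota> w \<notin> B" unfolding w_def by (rule inner_notin_boundary[OF e c])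
    moreover have "coords_are_nodes w n" unfolding coords_are_nodes_def star using coord k(2) by (auto intro!: exI[of _ k])
    ultimately have "(\<Sum>e\<in>star_edges w. dyadic_form (lo \<Gamma> e) (hi \<Gamma> e) n (on_edge \<Gamma> \<iota> u e) (edge_tent w n e)
      + integral (seg e) (\<lambda>x. edge_tent w n e x * (qe e x * on_edge \<Gamma> \<iota> u e x))) = 0"
      by (rule weak_equation[OF u])
    moreover have "edge_tent w n e = tent ?c ?\<delta>" unfolding edge_tent_def star coord by simp
    ultimately have weak: "dyadic_form ?l ?h n ?u (tent ?c ?\<delta>) + integral (seg e) (\<lambda>x. tent ?c ?\<delta> x * ?r x) = 0"
      unfolding star by simp
    have D: "dyadic_form ?l ?h n ?u (tent ?c ?\<delta>) = ((?u ?c - ?u (node ?l ?h n (k - 1))) - (?u (node ?l ?h n (Suc k)) - ?u ?c)) / ?\<delta>"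
      using dyadic_form_tent[OF lh, of k n ?u] k by simp
    have nodes: "node ?l ?h n (Suc k) = ?c + ?\<delta>" "node ?l ?h n (k - 1) = ?c - ?\<delta>"
      using node_diff[of ?l ?h n k] node_diff[of ?l ?h n "k - 1"] k by auto
    have "v (?c + ?\<delta>) + v (?c - ?\<delta>) - 2 * v ?c = ?\<delta> * integral (seg e) (\<lambda>x. tent ?c ?\<delta> x * ?r x)"
      unfolding v_def tent_def by (rule second_antideriv_second_difference[OF r \<delta>])
    moreover have "?\<delta> * integral (seg e) (\<lambda>x. tent ?c ?\<delta> x * ?r x) = ?u (node ?l ?h n (Suc k)) + ?u (node ?l ?h n (k - 1)) - 2 * ?u ?c"
    proof -
      have "integral (seg e) (\<lambda>x. tent ?c ?\<delta> x * ?r x) = - (((?u ?c - ?u (node ?l ?h n (k - 1))) - (?u (node ?l ?h n (Suc k)) - ?u ?c)) / ?\<delta>)"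
        using weak unfolding D by linarith
      moreover have "I = - (s / d) \<Longrightarrow> 0 < d \<Longrightarrow> d * I = - s" for I s d :: real by simp
      ultimately have "?\<delta> * integral (seg e) (\<lambda>x. tent ?c ?\<delta> x * ?r x) =
          - ((?u ?c - ?u (node ?l ?h n (k - 1))) - (?u (node ?l ?h n (Suc k)) - ?u ?c))" using \<delta> by blast
      then show ?thesis by linarith
    qed
    ultimately show ?thesis unfolding g_def nodes by simp
  qed
  define \<kappa> where "\<kappa> = (g ?h - g ?l) / (?h - ?l)"
  have aff: "g x = g ?l + \<kappa> * (x - ?l)" if "x \<in> seg e" for x
    unfolding \<kappa>_def by (rule zero_second_difference_imp_affine[OF lh gc sd that])
  show thesis
  proof (rule that)
    fix x assume x: "x \<in> seg e"
    have "((\<lambda>x. g ?l + \<kappa> * (x - ?l)) has_real_derivative \<kappa>) (at x within seg e)"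
      by (auto intro!: derivative_eq_intros)
    then have "((\<lambda>x. (g ?l + \<kappa> * (x - ?l)) + v x) has_real_derivative \<kappa> + integral {?l..x} ?r) (at x within seg e)"
      by (rule DERIV_add[OF _ dv[OF x]])
    then show "(?u has_real_derivative \<kappa> + integral {?l..x} ?r) (at x within seg e)"
    proof (rule has_field_derivative_transform_within[where d = 1])
      fix y assume "y \<in> seg e"
      from aff[OF this] show "g ?l + \<kappa> * (y - ?l) + v y = ?u y" unfolding g_def[of y] by linarith
    qed (use x in auto)
  qed
qed


text \<open>Test with tents at \<open>v\<close> that shrink to a point. On each incident edge the
  form tends to minus the normal derivative, and the potential term disappears.\<close>

lemma minimizer_Kirchhoff:
  assumes u: "minimizes U u" and v: "v \<in> verts \<Gamma>" "2 \<le> degree \<Gamma> v"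
  shows "(\<Sum>e\<in>incident \<Gamma> v. normal_deriv \<Gamma> \<iota> u e v) = 0"
proof -
  let ?w = "Vertex v"
  have uc: "continuous_on X u" using u by (simp add: minimizes_def has_data_def finite_energy_def)
  have wp: "?w \<in> points \<Gamma>" using v(1) by (simp add: points_def)
  have wB: "\<iota> ?w \<notin> B"
  proof
    assume "\<iota> ?w \<in> B"
    then obtain v' where v': "\<iota> ?w = \<iota> (Vertex v')" "v' \<in> verts \<Gamma>" "degree \<Gamma> v' = 1"
      using imageI[OF wp, of \<iota>] unfolding boundary_def graph_set_def by blast
    then have "Vertex v' \<in> points \<Gamma>" by (simp add: points_def)
    then have "v = v'" using inj_onD[OF inj_\<iota> v'(1) wp] by simp
    then show False using v v' by simp
  qed
  have star: "star_edges ?w = incident \<Gamma> v"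
    unfolding star_edges_def incident_def at_coord_vertex[OF v(1)] by auto
  have I: "e \<in> E" "lo \<Gamma> e < hi \<Gamma> e" "(v = fst e \<and> coord ?w e = lo \<Gamma> e) \<or> (v \<noteq> fst e \<and> coord ?w e = hi \<Gamma> e)" if "e \<in> incident \<Gamma> v" for e
  proof -
    show e: "e \<in> E" using that by (simp add: incident_def)
    show "lo \<Gamma> e < hi \<Gamma> e" by (rule lo_less_hi[OF e])
    show "(v = fst e \<and> coord ?w e = lo \<Gamma> e) \<or> (v \<noteq> fst e \<and> coord ?w e = hi \<Gamma> e)"
    proof (cases "v = fst e")
      case True
      then have "at_coord ?w e (lo \<Gamma> e)" using at_coord_vertex[OF v(1)] e by blast
      then show ?thesis using True coord_eq by blast
    next
      case False
      then have "v = snd e" using that by (auto simp: incident_def)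
      then have "at_coord ?w e (hi \<Gamma> e)" using at_coord_vertex[OF v(1)] e by blast
      then show ?thesis using False coord_eq by blast
    qed
  qed
  have nodes: "coords_are_nodes ?w n" for n
    unfolding coords_are_nodes_def star
  proof
    fix e assume "e \<in> incident \<Gamma> v"
    from I(3)[OF this] show "\<exists>k\<le>2 ^ n. coord ?w e = node (lo \<Gamma> e) (hi \<Gamma> e) n k"
      using node_0[of "lo \<Gamma> e" "hi \<Gamma> e" n] node_top[of "lo \<Gamma> e" "hi \<Gamma> e" n] by (metis le0 order_refl)
  qed
  let ?D = "\<lambda>n e. dyadic_form (lo \<Gamma> e) (hi \<Gamma> e) n (on_edge \<Gamma> \<iota> u e) (edge_tent ?w n e)"
  let ?J = "\<lambda>n e. integral (seg e) (\<lambda>x. edge_tent ?w n e x * (qe e x * on_edge \<Gamma> \<iota> u e x))"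
  have eq: "(\<Sum>e\<in>incident \<Gamma> v. ?D n e + ?J n e) = 0" for n
    using weak_equation[OF u wp wB nodes] unfolding star .
  have J0: "(\<lambda>n. ?J n e) \<longlonglongrightarrow> 0" if e: "e \<in> incident \<Gamma> v" for e
  proof -
    let ?r = "\<lambda>x. qe e x * on_edge \<Gamma> \<iota> u e x"
    let ?c = "coord ?w e"
    have r: "?r absolutely_integrable_on seg e" by (rule q_mult_integrable[OF uc I(1)[OF e]])
    have et: "edge_tent ?w n e = tent ?c ((hi \<Gamma> e - lo \<Gamma> e) / 2 ^ n)" for n using e star by (simp add: edge_tent_def)
    have \<delta>: "0 < (hi \<Gamma> e - lo \<Gamma> e) / 2 ^ n" for n by (rule divide_pos_pos) (use I(2)[OF e] in auto)
    have cont: "continuous_on S (edge_tent ?w n e)" for n S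
      unfolding et tent_def using \<delta>[of n] by (intro continuous_intros) auto
    have int: "(\<lambda>x. edge_tent ?w n e x * ?r x) integrable_on seg e" for n
      using absolutely_integrable_continuous_mult[OF cont r] by (simp add: absolutely_integrable_on_def)
    \<comment> \<open>The tents are bounded by 1 and converge to the indicator of a single point,
      which has measure 0.\<close>
    have "(\<lambda>n. ?J n e) \<longlonglongrightarrow> integral (seg e) (\<lambda>x. if x = ?c then ?r x else 0)"
    proof (rule dominated_convergence(2)[where h = "\<lambda>x. \<bar>?r x\<bar>"])
      show "(\<lambda>x. edge_tent ?w n e x * ?r x) integrable_on seg e" for n by (rule int)
      show "(\<lambda>x. \<bar>?r x\<bar>) integrable_on seg e" using r by (simp add: absolutely_integrable_on_def)
      fix n x
      have "\<bar>edge_tent ?w n e x\<bar> \<le> 1" unfolding et using tent_bounds[OF \<delta>[of n], of ?c x] by simp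
      then have "\<bar>edge_tent ?w n e x\<bar> * \<bar>?r x\<bar> \<le> 1 * \<bar>?r x\<bar>" by (intro mult_right_mono) auto
      then show "norm (edge_tent ?w n e x * ?r x) \<le> \<bar>?r x\<bar>" by (simp only: real_norm_def abs_mult mult_1)
    next
      fix x
      show "(\<lambda>n. edge_tent ?w n e x * ?r x) \<longlonglongrightarrow> (if x = ?c then ?r x else 0)"
      proof (cases "x = ?c")
        case True
        then show ?thesis unfolding et by (simp add: tent_def)
      next
        case False
        then have "\<forall>\<^sub>F n in sequentially. (hi \<Gamma> e - lo \<Gamma> e) * (1 / 2) ^ n < \<bar>x - ?c\<bar>"
          by (intro order_tendstoD(2)[OF tendsto_half_powers]) simp
        then have "\<forall>\<^sub>F n in sequentially. edge_tent ?w n e x * ?r x = 0"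
        proof (rule eventually_mono)
          fix n assume "(hi \<Gamma> e - lo \<Gamma> e) * (1 / 2) ^ n < \<bar>x - ?c\<bar>"
          then have "tent ?c ((hi \<Gamma> e - lo \<Gamma> e) / 2 ^ n) x = 0"
            using \<delta>[of n] by (intro tent_outside) (simp_all add: power_divide)
          then show "edge_tent ?w n e x * ?r x = 0" unfolding et by simp
        qed
        then show ?thesis using False by (simp add: tendsto_eventually)
      qed
    qed
    moreover have "integral (seg e) (\<lambda>x. if x = ?c then ?r x else 0) = integral (seg e) (\<lambda>x. 0)"
      by (rule integral_spike[of "{?c}"]) auto
    ultimately show ?thesis by simp
  qed
  have D: "(\<lambda>n. ?D n e) \<longlonglongrightarrow> - normal_deriv \<Gamma> \<iota> u e v" if e: "e \<in> incident \<Gamma> v" for e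
  proof -
    let ?l = "lo \<Gamma> e" and ?h = "hi \<Gamma> e" and ?u = "on_edge \<Gamma> \<iota> u e"
    note lh = I(2)[OF e]
    obtain \<kappa> where \<kappa>: "\<And>x. x \<in> seg e \<Longrightarrow>
      (?u has_real_derivative \<kappa> + integral {?l..x} (\<lambda>x. qe e x * ?u x)) (at x within seg e)"
      by (rule minimizer_edge_regular[OF u I(1)[OF e]]) (rule that)
    have der: "(?u has_real_derivative edge_deriv \<Gamma> \<iota> u e x) (at x within seg e)" if "x \<in> seg e" for x
      using \<kappa>[OF that] has_derivative_imp_edge_deriv[OF lh that \<kappa>[OF that]] by simp
    have slope: "(\<lambda>n. (?u (y n) - ?u c) / (y n - c)) \<longlonglongrightarrow> edge_deriv \<Gamma> \<iota> u e c"
      if c: "c \<in> seg e" and y: "\<And>n. y n \<in> seg e" "\<And>n. y n \<noteq> c" "y \<longlonglongrightarrow> c" for c y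
    proof -
      have "((\<lambda>y. (?u y - ?u c) / (y - c)) \<longlongrightarrow> edge_deriv \<Gamma> \<iota> u e c) (at c within seg e)"
        using der[OF c] by (simp add: has_field_derivative_iff)
      then show ?thesis
        by (rule filterlim_compose[of "\<lambda>y. (?u y - ?u c) / (y - c)"])
          (use y in \<open>simp add: filterlim_at\<close>)
    qed
    have lim: "(\<lambda>n. c + s * ((?h - ?l) / 2 ^ n)) \<longlonglongrightarrow> c" for c s :: real
    proof -
      have "(\<lambda>n. c + s * (?h - ?l) * (1 / 2) ^ n) \<longlonglongrightarrow> c + 0" by (intro tendsto_add tendsto_const tendsto_half_powers)
      then show ?thesis by (simp add: power_divide)
    qed
    have et: "edge_tent ?w n e = tent (coord ?w e) ((?h - ?l) / 2 ^ n)" for n using e star by (simp add: edge_tent_def)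
    from I(3)[OF e] show ?thesis
    proof
      assume c: "v = fst e \<and> coord ?w e = ?l"
      have n1: "node ?l ?h n 1 = ?l + 1 * ((?h - ?l) / 2 ^ n)" for n by (simp add: node_def)
      have "?D n e = - ((?u (node ?l ?h n 1) - ?u ?l) / (node ?l ?h n 1 - ?l))" for n
      proof -
        have "?D n e = dyadic_form ?l ?h n ?u (tent (node ?l ?h n 0) ((?h - ?l) / 2 ^ n))" unfolding et conjunct2[OF c] node_0 ..
        also have "\<dots> = - (?u (node ?l ?h n 1) - ?u ?l) / ((?h - ?l) / 2 ^ n)"
          by (subst dyadic_form_tent[OF lh]) simp_all
        also have "(?h - ?l) / 2 ^ n = node ?l ?h n 1 - ?l" using n1[of n] by simp
        finally show ?thesis unfolding minus_divide_left .
      qed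
      moreover have "(\<lambda>n. (?u (node ?l ?h n 1) - ?u ?l) / (node ?l ?h n 1 - ?l)) \<longlonglongrightarrow> edge_deriv \<Gamma> \<iota> u e ?l"
      proof (rule slope)
        show "node ?l ?h n 1 \<in> seg e" for n using lh by (intro node_mem) auto
        show "node ?l ?h n 1 \<noteq> ?l" for n using node_strict_mono[OF lh, of 0 1 n] by simp
        show "(\<lambda>n. node ?l ?h n 1) \<longlonglongrightarrow> ?l" unfolding n1 by (rule lim)
      qed (use lh in auto)
      ultimately show ?thesis using c by (simp add: normal_deriv_def tendsto_minus)
    next
      assume c: "v \<noteq> fst e \<and> coord ?w e = ?h"
      have n1: "node ?l ?h n (2 ^ n - 1) = ?h + (-1) * ((?h - ?l) / 2 ^ n)" for n
      proof -
        have "?h - node ?l ?h n (2 ^ n - 1) = (?h - ?l) / 2 ^ n" using node_diff[of ?l ?h n "2 ^ n - 1"] by simp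
        then show ?thesis by linarith
      qed
      have "?D n e = (?u (node ?l ?h n (2 ^ n - 1)) - ?u ?h) / (node ?l ?h n (2 ^ n - 1) - ?h)" for n
      proof -
        have "?D n e = dyadic_form ?l ?h n ?u (tent (node ?l ?h n (2 ^ n)) ((?h - ?l) / 2 ^ n))" unfolding et conjunct2[OF c] node_top ..
        also have "\<dots> = (?u ?h - ?u (node ?l ?h n (2 ^ n - 1))) / ((?h - ?l) / 2 ^ n)"
          by (subst dyadic_form_tent[OF lh]) simp_all
        \<comment> \<open>Turned into a quotient at the upper end. Its limit is the derivative in
          the stored coordinate, that is, minus the normal derivative.\<close>
        also have "\<dots> = (- (?u ?h - ?u (node ?l ?h n (2 ^ n - 1)))) / (- ((?h - ?l) / 2 ^ n))" by (simp only: minus_divide_divide)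
        also have "- ((?h - ?l) / 2 ^ n) = node ?l ?h n (2 ^ n - 1) - ?h" using n1[of n] by linarith
        finally show ?thesis by simp
      qed
      moreover have "(\<lambda>n. (?u (node ?l ?h n (2 ^ n - 1)) - ?u ?h) / (node ?l ?h n (2 ^ n - 1) - ?h)) \<longlonglongrightarrow> edge_deriv \<Gamma> \<iota> u e ?h"
      proof (rule slope)
        show "node ?l ?h n (2 ^ n - 1) \<in> seg e" for n using lh by (intro node_mem) auto
        show "node ?l ?h n (2 ^ n - 1) \<noteq> ?h" for n using node_strict_mono[OF lh, of "2 ^ n - 1" "2 ^ n" n] by simp
        show "(\<lambda>n. node ?l ?h n (2 ^ n - 1)) \<longlonglongrightarrow> ?h" unfolding n1 by (rule lim)
      qed (use lh in auto)
      ultimately show ?thesis using c by (simp add: normal_deriv_def)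
    qed
  qed
  have "(\<lambda>n. \<Sum>e\<in>incident \<Gamma> v. ?D n e + ?J n e) \<longlonglongrightarrow> (\<Sum>e\<in>incident \<Gamma> v. - normal_deriv \<Gamma> \<iota> u e v + 0)"
    by (intro tendsto_sum tendsto_add D J0)
  then have "(\<lambda>n::nat. 0) \<longlonglongrightarrow> - (\<Sum>e\<in>incident \<Gamma> v. normal_deriv \<Gamma> \<iota> u e v)"
    unfolding eq by (simp add: sum_negf)
  then show ?thesis using LIMSEQ_unique[OF tendsto_const] by fastforce
qed

theorem minimizer_harmonic:
  assumes u: "minimizes U u"
  shows "is_harmonic_extension \<Gamma> \<iota> q U u"
  unfolding is_harmonic_extension_def
proof (intro conjI)
  show uc: "continuous_on X u" using u by (simp add: minimizes_def has_data_def finite_energy_def)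
  show "\<forall>x\<in>B. u x = U x" using u by (simp add: minimizes_def has_data_def)
  show "q_harmonic \<Gamma> \<iota> q u"
    unfolding q_harmonic_def
  proof (intro conjI ballI impI)
    fix e assume e: "e \<in> E"
    let ?l = "lo \<Gamma> e" and ?h = "hi \<Gamma> e" and ?u = "on_edge \<Gamma> \<iota> u e"
    let ?r = "\<lambda>x. qe e x * ?u x"
    have lh: "?l < ?h" by (rule lo_less_hi[OF e])
    have r: "?r absolutely_integrable_on seg e" by (rule q_mult_integrable[OF uc e])
    obtain \<kappa> where \<kappa>: "\<And>x. x \<in> seg e \<Longrightarrow> (?u has_real_derivative \<kappa> + integral {?l..x} ?r) (at x within seg e)"
      by (rule minimizer_edge_regular[OF u e]) (rule that)
    have ed: "edge_deriv \<Gamma> \<iota> u e x = \<kappa> + integral {?l..x} ?r" if "x \<in> seg e" for x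
      by (rule has_derivative_imp_edge_deriv[OF lh that \<kappa>[OF that]])
    show "?u differentiable_on seg e"
      unfolding differentiable_on_def real_differentiable_def using \<kappa> by blast
    have "abs_cont_on ?l ?h (\<lambda>x. \<kappa> + integral {?l..x} ?r)"
      by (intro abs_cont_on_add_const abs_cont_on_indefinite_integral r)
    then show "abs_cont_on ?l ?h (edge_deriv \<Gamma> \<iota> u e)"
      by (rule abs_cont_on_cong[rotated]) (simp add: ed)
    have "AE x in lebesgue. x \<in> {?l<..<?h} \<longrightarrow> ((\<lambda>x. integral {?l..x} ?r) has_real_derivative ?r x) (at x)"
      using r by (intro AE_has_derivative_indefinite_integral) (simp add: absolutely_integrable_on_def)
    then show "AE x in lebesgue. x \<in> {?l<..<?h} \<longrightarrow> (edge_deriv \<Gamma> \<iota> u e has_real_derivative ?r x) (at x)"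
    proof (rule eventually_mono, intro impI)
      fix x assume *: "x \<in> {?l<..<?h} \<longrightarrow> ((\<lambda>x. integral {?l..x} ?r) has_real_derivative ?r x) (at x)" and x: "x \<in> {?l<..<?h}"
      have "((\<lambda>x. \<kappa> + integral {?l..x} ?r) has_real_derivative 0 + ?r x) (at x)"
        by (rule DERIV_add[OF DERIV_const]) (use * x in blast)
      then have "((\<lambda>x. \<kappa> + integral {?l..x} ?r) has_real_derivative ?r x) (at x)" by simp
      then show "(edge_deriv \<Gamma> \<iota> u e has_real_derivative ?r x) (at x)"
        by (rule has_field_derivative_transform_within_open[OF _ open_greaterThanLessThan x]) (simp add: ed)
    qed
  next
    fix v assume v: "v \<in> verts \<Gamma>" "2 \<le> degree \<Gamma> v"
    have wp: "Vertex v \<in> points \<Gamma>" using v(1) by (simp add: points_def)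
    have "graph_set \<Gamma> \<iota> \<subseteq> X" unfolding completed_def by (rule closure_subset)
    from continuous_on_subset[OF uc this]
    show "continuous (at (\<iota> (Vertex v)) within graph_set \<Gamma> \<iota>) u"
      unfolding continuous_on_eq_continuous_within using wp by (simp add: graph_set_def)
    show "(\<Sum>e\<in>incident \<Gamma> v. normal_deriv \<Gamma> \<iota> u e v) = 0" by (rule minimizer_Kirchhoff[OF u v])
  qed
qed

end

section \<open>The maximum principle\<close>

lemma abs_cont_on_subinterval:
  assumes "abs_cont_on a b f" "a \<le> c" "d \<le> b"
  shows "abs_cont_on c d f"
  unfolding abs_cont_on_def
proof (intro allI impI)
  fix \<epsilon> :: real assume "0 < \<epsilon>"
  from assms(1)[unfolded abs_cont_on_def, rule_format, OF this] obtain \<delta> where "0 < \<delta>" and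
    \<delta>: "\<forall>(n::nat) s t. (\<forall>i<n. a \<le> s i \<and> s i \<le> t i \<and> t i \<le> b) \<and>
        (\<forall>i<n. \<forall>j<n. i \<noteq> j \<longrightarrow> {s i<..<t i} \<inter> {s j<..<t j} = {}) \<and>
        (\<Sum>i<n. t i - s i) < \<delta> \<longrightarrow> (\<Sum>i<n. \<bar>f (t i) - f (s i)\<bar>) < \<epsilon>"
    by (elim exE conjE) (rule that)
  show "\<exists>\<delta>>0. \<forall>(n::nat) s t. (\<forall>i<n. c \<le> s i \<and> s i \<le> t i \<and> t i \<le> d) \<and>
        (\<forall>i<n. \<forall>j<n. i \<noteq> j \<longrightarrow> {s i<..<t i} \<inter> {s j<..<t j} = {}) \<and>
        (\<Sum>i<n. t i - s i) < \<delta> \<longrightarrow> (\<Sum>i<n. \<bar>f (t i) - f (s i)\<bar>) < \<epsilon>"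
  proof (intro exI[of _ \<delta>] conjI \<open>0 < \<delta>\<close> allI impI)
    fix n :: nat and s t
    assume *: "(\<forall>i<n. c \<le> s i \<and> s i \<le> t i \<and> t i \<le> d) \<and>
        (\<forall>i<n. \<forall>j<n. i \<noteq> j \<longrightarrow> {s i<..<t i} \<inter> {s j<..<t j} = {}) \<and> (\<Sum>i<n. t i - s i) < \<delta>"
    show "(\<Sum>i<n. \<bar>f (t i) - f (s i)\<bar>) < \<epsilon>"
    proof (rule \<delta>[rule_format], intro conjI)
      show "\<forall>i<n. a \<le> s i \<and> s i \<le> t i \<and> t i \<le> b" using * assms(2,3) by (meson order_trans)
    qed (use * in blast)+
  qed
qed

lemma abs_cont_on_continuous:
  assumes "abs_cont_on a b f"
  shows "continuous_on {a..b} f"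
proof (rule continuous_onI)
  fix x \<epsilon> :: real assume x: "x \<in> {a..b}" and "0 < \<epsilon>"
  from assms[unfolded abs_cont_on_def, rule_format, OF this(2)] obtain \<delta> where "0 < \<delta>" and
    \<delta>: "\<forall>(n::nat) s t. (\<forall>i<n. a \<le> s i \<and> s i \<le> t i \<and> t i \<le> b) \<and>
        (\<forall>i<n. \<forall>j<n. i \<noteq> j \<longrightarrow> {s i<..<t i} \<inter> {s j<..<t j} = {}) \<and>
        (\<Sum>i<n. t i - s i) < \<delta> \<longrightarrow> (\<Sum>i<n. \<bar>f (t i) - f (s i)\<bar>) < \<epsilon>"
    by (elim exE conjE) (rule that)
  have "dist (f y) (f x) \<le> \<epsilon>" if y: "y \<in> {a..b}" "dist y x < \<delta>" for y
  proof -
    have "(\<Sum>i<(1::nat). \<bar>f (max x y) - f (min x y)\<bar>) < \<epsilon>"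
      by (rule \<delta>[rule_format, of 1 "\<lambda>_. min x y" "\<lambda>_. max x y"])
        (use x y in \<open>auto simp: dist_real_def min_def max_def\<close>)
    then show ?thesis by (cases "x \<le> y") (simp_all add: dist_real_def min_def max_def abs_minus_commute)
  qed
  then show "\<exists>d>0. \<forall>y\<in>{a..b}. dist y x < d \<longrightarrow> dist (f y) (f x) \<le> \<epsilon>" using \<open>0 < \<delta>\<close> by blast
qed

lemma abs_cont_on_diff:
  assumes "abs_cont_on a b f" "abs_cont_on a b g"
  shows "abs_cont_on a b (\<lambda>x. f x - g x)"
  unfolding abs_cont_on_def
proof (intro allI impI)
  fix \<epsilon> :: real assume "0 < \<epsilon>"
  then have \<epsilon>: "0 < \<epsilon> / 2" by simp
  from assms(1)[unfolded abs_cont_on_def, rule_format, OF \<epsilon>] obtain \<delta> where "0 < \<delta>" and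
    \<delta>: "\<forall>(n::nat) s t. (\<forall>i<n. a \<le> s i \<and> s i \<le> t i \<and> t i \<le> b) \<and>
        (\<forall>i<n. \<forall>j<n. i \<noteq> j \<longrightarrow> {s i<..<t i} \<inter> {s j<..<t j} = {}) \<and>
        (\<Sum>i<n. t i - s i) < \<delta> \<longrightarrow> (\<Sum>i<n. \<bar>f (t i) - f (s i)\<bar>) < \<epsilon> / 2"
    by (elim exE conjE) (rule that)
  from assms(2)[unfolded abs_cont_on_def, rule_format, OF \<epsilon>] obtain \<delta>' where "0 < \<delta>'" and
    \<delta>': "\<forall>(n::nat) s t. (\<forall>i<n. a \<le> s i \<and> s i \<le> t i \<and> t i \<le> b) \<and>
        (\<forall>i<n. \<forall>j<n. i \<noteq> j \<longrightarrow> {s i<..<t i} \<inter> {s j<..<t j} = {}) \<and>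
        (\<Sum>i<n. t i - s i) < \<delta>' \<longrightarrow> (\<Sum>i<n. \<bar>g (t i) - g (s i)\<bar>) < \<epsilon> / 2"
    by (elim exE conjE) (rule that)
  show "\<exists>\<delta>>0. \<forall>(n::nat) s t. (\<forall>i<n. a \<le> s i \<and> s i \<le> t i \<and> t i \<le> b) \<and>
        (\<forall>i<n. \<forall>j<n. i \<noteq> j \<longrightarrow> {s i<..<t i} \<inter> {s j<..<t j} = {}) \<and>
        (\<Sum>i<n. t i - s i) < \<delta> \<longrightarrow> (\<Sum>i<n. \<bar>f (t i) - g (t i) - (f (s i) - g (s i))\<bar>) < \<epsilon>"
  proof (intro exI[of _ "min \<delta> \<delta>'"] conjI allI impI)
    show "0 < min \<delta> \<delta>'" using \<open>0 < \<delta>\<close> \<open>0 < \<delta>'\<close> by simp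
    fix n :: nat and s t
    assume *: "(\<forall>i<n. a \<le> s i \<and> s i \<le> t i \<and> t i \<le> b) \<and>
        (\<forall>i<n. \<forall>j<n. i \<noteq> j \<longrightarrow> {s i<..<t i} \<inter> {s j<..<t j} = {}) \<and> (\<Sum>i<n. t i - s i) < min \<delta> \<delta>'"
    have lt: "(\<Sum>i<n. t i - s i) < \<delta>" "(\<Sum>i<n. t i - s i) < \<delta>'" using * by auto
    have "(\<Sum>i<n. \<bar>f (t i) - f (s i)\<bar>) < \<epsilon> / 2"
      by (rule \<delta>[rule_format]) (use * lt in blast)
    moreover have "(\<Sum>i<n. \<bar>g (t i) - g (s i)\<bar>) < \<epsilon> / 2"
      by (rule \<delta>'[rule_format]) (use * lt in blast)
    moreover have "(\<Sum>i<n. \<bar>f (t i) - g (t i) - (f (s i) - g (s i))\<bar>) \<le> (\<Sum>i<n. \<bar>f (t i) - f (s i)\<bar> + \<bar>g (t i) - g (s i)\<bar>)"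
      by (rule sum_mono) linarith
    ultimately show "(\<Sum>i<n. \<bar>f (t i) - g (t i) - (f (s i) - g (s i))\<bar>) < \<epsilon>"
      unfolding sum.distrib by linarith
  qed
qed

lemma mvt_within:
  fixes f :: "real \<Rightarrow> real"
  assumes "x < y" "{x..y} \<subseteq> {a..b}"
    and "\<And>t. t \<in> {a..b} \<Longrightarrow> (f has_real_derivative f' t) (at t within {a..b})"
  shows "\<exists>z\<in>{x<..<y}. f y - f x = f' z * (y - x)"
proof (rule mvt_simple[OF assms(1)])
  fix t assume "x \<le> t" "t \<le> y"
  then have "t \<in> {a..b}" using assms(2) by auto
  from has_field_derivative_subset[OF assms(3)[OF this] assms(2)]
  show "(f has_derivative (*) (f' t)) (at t within {x..y})" by (simp add: has_field_derivative_def)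
qed

text \<open>The points with f = M and f' = 0 form a clopen subset of the edge. Near such a point
  \<open>f\<close> is positive, so f'' \<ge> 0 almost everywhere and f' is nondecreasing by absolute
  continuity; hence \<open>f\<close> is at least \<open>M\<close> on both sides, and the upper bound
  gives equality.\<close>

lemma edge_strong_maximum:
  fixes f f' p :: "real \<Rightarrow> real"
  assumes "a < b"
    and f: "\<And>x. x \<in> {a..b} \<Longrightarrow> (f has_real_derivative f' x) (at x within {a..b})"
    and ac: "abs_cont_on a b f'"
    and ode: "AE x in lebesgue. x \<in> {a<..<b} \<longrightarrow> (f' has_real_derivative p x * f x) (at x)"
    and p: "\<And>x. x \<in> {a..b} \<Longrightarrow> 0 \<le> p x"
    and M: "0 < M" "\<And>x. x \<in> {a..b} \<Longrightarrow> f x \<le> M"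
    and s: "s \<in> {a..b}" "f s = M" "f' s = 0" and x: "x \<in> {a..b}"
  shows "f x = M"
proof -
  define Z where "Z = {x \<in> {a..b}. f x = M \<and> f' x = 0}"
  have fc: "continuous_on {a..b} f" by (rule DERIV_continuous_on[OF f])
  have fc': "continuous_on {a..b} f'" by (rule abs_cont_on_continuous[OF ac])
  have cl: "closedin (top_of_set {a..b}) Z"
  proof -
    have "Z = ({a..b} \<inter> f -` {M}) \<inter> ({a..b} \<inter> f' -` {0})" by (auto simp: Z_def)
    then show ?thesis using fc fc' by (auto intro!: closedin_Int continuous_closedin_preimage)
  qed
  have op: "openin (top_of_set {a..b}) Z"
    unfolding openin_contains_ball
  proof (intro conjI ballI)
    show "Z \<subseteq> {a..b}" by (auto simp: Z_def)
    fix t assume "t \<in> Z"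
    then have t: "t \<in> {a..b}" "f t = M" "f' t = 0" by (auto simp: Z_def)
    obtain \<eta> where \<eta>: "0 < \<eta>" "\<And>y. y \<in> {a..b} \<Longrightarrow> dist y t < \<eta> \<Longrightarrow> dist (f y) (f t) < M"
      using fc t(1) M(1) unfolding continuous_on_iff by blast
    have fpos: "0 < f y" if "y \<in> {a..b}" "\<bar>y - t\<bar> < \<eta>" for y
      using \<eta>(2)[OF that(1)] that(2) t(2) by (auto simp: dist_real_def)
    have mono: "f' y \<le> f' z" if yz: "y \<le> z" "{y..z} \<subseteq> {a..b}" "\<bar>y - t\<bar> < \<eta>" "\<bar>z - t\<bar> < \<eta>" for y z
    proof (rule abs_cont_on_AE_deriv_nonneg_imp_le[OF yz(1)])
      show "abs_cont_on y z f'" by (rule abs_cont_on_subinterval[OF ac]) (use yz in auto)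
      show "AE x in lebesgue. x \<in> {y<..<z} \<longrightarrow> (\<exists>d\<ge>0. (f' has_real_derivative d) (at x))"
      proof (rule eventually_mono[OF ode], intro impI)
        fix x assume *: "x \<in> {a<..<b} \<longrightarrow> (f' has_real_derivative p x * f x) (at x)" and x: "x \<in> {y<..<z}"
        have "y \<in> {a..b}" "z \<in> {a..b}" using yz(1,2) by auto
        then have xab: "x \<in> {a<..<b}" using x by auto
        moreover have "0 < f x" using xab x yz(3,4) by (intro fpos) auto
        ultimately show "\<exists>d\<ge>0. (f' has_real_derivative d) (at x)"
          using * p[of x] by (intro exI[of _ "p x * f x"]) auto
      qed
    qed
    have const: "f y = M" if y: "y \<in> {a..b}" "\<bar>y - t\<bar> < \<eta>" for y
    proof -
      have "M \<le> f y"
      proof (cases y t rule: linorder_cases)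
        case less
        have sub: "{y..t} \<subseteq> {a..b}" using y t by auto
        obtain z where z: "z \<in> {y<..<t}" "f t - f y = f' z * (t - y)" using mvt_within[OF less sub f] by blast
        have "f' z \<le> f' t" by (rule mono) (use z y t less \<eta>(1) in auto)
        then have "f' z * (t - y) \<le> 0" using t(3) less by (simp add: mult_nonpos_nonneg)
        then show ?thesis using z(2) t(2) by linarith
      next
        case greater
        have sub: "{t..y} \<subseteq> {a..b}" using y t by auto
        obtain z where z: "z \<in> {t<..<y}" "f y - f t = f' z * (y - t)" using mvt_within[OF greater sub f] by blast
        have "f' t \<le> f' z" by (rule mono) (use z y t greater \<eta>(1) in auto)
        then have "0 \<le> f' z * (y - t)" using t(3) greater by simp
        then show ?thesis using z(2) t(2) by linarith
      qed (use t in simp)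
      then show ?thesis using M(2)[OF y(1)] by linarith
    qed
    have "y \<in> Z" if y: "y \<in> ball t \<eta> \<inter> {a..b}" for y
    proof -
      have ya: "y \<in> {a..b}" "\<bar>y - t\<bar> < \<eta>" using y by (auto simp: dist_real_def)
      have "((\<lambda>_. M) has_real_derivative 0) (at y within {a..b})" by simp
      then have "(f has_real_derivative 0) (at y within {a..b})"
      proof (rule has_field_derivative_transform_within[where d = "\<eta> - \<bar>y - t\<bar>"])
        fix x' assume "x' \<in> {a..b}" "dist x' y < \<eta> - \<bar>y - t\<bar>"
        then show "M = f x'" using const[of x'] by (simp add: dist_real_def)
      qed (use ya in auto)
      then have "f' y = 0"
        using f[OF ya(1)] vector_derivative_within_closed_interval[OF assms(1) ya(1), of f]
        by (metis has_real_derivative_iff_has_vector_derivative)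
      then show ?thesis using const[OF ya] ya by (simp add: Z_def)
    qed
    then show "\<exists>e>0. ball t e \<inter> {a..b} \<subseteq> Z" using \<eta>(1) by blast
  qed
  have "Z = {} \<or> Z = {a..b}"
    using connected_Icc[of a b] cl op unfolding connected_clopen by blast
  moreover have "s \<in> Z" using s by (simp add: Z_def)
  ultimately show ?thesis using x unfolding Z_def by blast
qed

lemma deriv_at_left_max:
  fixes f :: "real \<Rightarrow> real"
  assumes "a < b" "(f has_real_derivative d) (at a within {a..b})" "\<And>x. x \<in> {a..b} \<Longrightarrow> f x \<le> f a"
  shows "d \<le> 0"
proof (rule ccontr)
  assume "\<not> d \<le> 0"
  then obtain e where e: "e > 0" "\<And>h. h > 0 \<Longrightarrow> a + h \<in> {a..b} \<Longrightarrow> h < e \<Longrightarrow> f a < f (a + h)"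
    using has_real_derivative_pos_inc_right[OF assms(2)] by auto
  define h where "h = min (e / 2) (b - a)"
  have "h > 0" "a + h \<in> {a..b}" "h < e" using e(1) assms(1) by (auto simp: h_def min_def)
  then show False using e(2)[of h] assms(3)[of "a + h"] by auto
qed

lemma deriv_at_right_max:
  fixes f :: "real \<Rightarrow> real"
  assumes "a < b" "(f has_real_derivative d) (at b within {a..b})" "\<And>x. x \<in> {a..b} \<Longrightarrow> f x \<le> f b"
  shows "0 \<le> d"
proof (rule ccontr)
  assume "\<not> 0 \<le> d"
  then obtain e where e: "e > 0" "\<And>h. h > 0 \<Longrightarrow> b - h \<in> {a..b} \<Longrightarrow> h < e \<Longrightarrow> f b < f (b - h)"
    using has_real_derivative_neg_dec_left[OF assms(2)] by auto
  define h where "h = min (e / 2) (b - a)"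
  have "h > 0" "b - h \<in> {a..b}" "h < e" using e(1) assms(1) by (auto simp: h_def min_def)
  then show False using e(2)[of h] assms(3)[of "b - h"] by auto
qed

context potential_graph
begin

lemma q_harmonic_edge:
  assumes "q_harmonic \<Gamma> \<iota> q u" "e \<in> E"
  shows "x \<in> seg e \<Longrightarrow> (on_edge \<Gamma> \<iota> u e has_real_derivative edge_deriv \<Gamma> \<iota> u e x) (at x within seg e)"
    and "abs_cont_on (lo \<Gamma> e) (hi \<Gamma> e) (edge_deriv \<Gamma> \<iota> u e)"
    and "AE x in lebesgue. x \<in> {lo \<Gamma> e<..<hi \<Gamma> e} \<longrightarrow> (edge_deriv \<Gamma> \<iota> u e has_real_derivative qe e x * on_edge \<Gamma> \<iota> u e x) (at x)"
proof -
  have d: "on_edge \<Gamma> \<iota> u e differentiable_on seg e" using assms unfolding q_harmonic_def by blast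
  show "(on_edge \<Gamma> \<iota> u e has_real_derivative edge_deriv \<Gamma> \<iota> u e x) (at x within seg e)" if "x \<in> seg e"
  proof -
    have "on_edge \<Gamma> \<iota> u e differentiable (at x within seg e)" using d that unfolding differentiable_on_def by blast
    then show ?thesis
      unfolding edge_deriv_def has_real_derivative_iff_has_vector_derivative vector_derivative_works .
  qed
  show "abs_cont_on (lo \<Gamma> e) (hi \<Gamma> e) (edge_deriv \<Gamma> \<iota> u e)" using assms unfolding q_harmonic_def by blast
  show "AE x in lebesgue. x \<in> {lo \<Gamma> e<..<hi \<Gamma> e} \<longrightarrow> (edge_deriv \<Gamma> \<iota> u e has_real_derivative qe e x * on_edge \<Gamma> \<iota> u e x) (at x)"
    using assms unfolding q_harmonic_def by blast
qed

text \<open>A positive maximum of u1 - u2 cannot lie in the boundary. It spreads over each edge by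
  \<open>edge_strong_maximum\<close>, over the graph by connectedness and to the boundary by
  density, where the difference is 0.\<close>

lemma harmonic_comparison:
  assumes u1: "is_harmonic_extension \<Gamma> \<iota> q U u1" and u2: "is_harmonic_extension \<Gamma> \<iota> q U u2" and x: "x \<in> X"
  shows "u1 x \<le> u2 x"
proof (rule ccontr)
  assume neg: "\<not> u1 x \<le> u2 x"
  have h1: "continuous_on X u1" "q_harmonic \<Gamma> \<iota> q u1" "\<And>x. x \<in> B \<Longrightarrow> u1 x = U x"
    and h2: "continuous_on X u2" "q_harmonic \<Gamma> \<iota> q u2" "\<And>x. x \<in> B \<Longrightarrow> u2 x = U x"
    using u1 u2 unfolding is_harmonic_extension_def by auto
  define w where "w y = u1 y - u2 y" for y
  have wc: "continuous_on X w" unfolding w_def by (intro continuous_intros h1 h2)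
  have wB: "w y = 0" if "y \<in> B" for y using that h1(3) h2(3) by (simp add: w_def)
  obtain y0 where y0: "y0 \<in> X" "\<And>y. y \<in> X \<Longrightarrow> w y \<le> w y0"
    using continuous_attains_sup[OF compact_X _ wc] x by blast
  define M where "M = w y0"
  have M: "0 < M" "\<And>y. y \<in> X \<Longrightarrow> w y \<le> M" using y0(2)[OF x] neg y0(2) by (auto simp: M_def w_def)
  let ?d = "\<lambda>e x. edge_deriv \<Gamma> \<iota> u1 e x - edge_deriv \<Gamma> \<iota> u2 e x"
  have dw: "(on_edge \<Gamma> \<iota> w e has_real_derivative ?d e t) (at t within seg e)" if "e \<in> E" "t \<in> seg e" for e t
  proof -
    have "on_edge \<Gamma> \<iota> w e = (\<lambda>t. on_edge \<Gamma> \<iota> u1 e t - on_edge \<Gamma> \<iota> u2 e t)" by (simp add: on_edge_def w_def fun_eq_iff)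
    then show ?thesis
      using DERIV_diff[OF q_harmonic_edge(1)[OF h1(2) that] q_harmonic_edge(1)[OF h2(2) that]] by simp
  qed
  have wle: "on_edge \<Gamma> \<iota> w e t \<le> M" if "e \<in> E" "t \<in> seg e" for e t
    unfolding on_edge_def by (intro M ep_mem_X that)
  \<comment> \<open>At a maximum all normal derivatives are nonpositive; by Kirchhoff they add up to
    0, so each of them vanishes. This replaces the derivative test at an interior maximum.\<close>
  have vertex: "?d e s = 0" if e: "e \<in> E" and s: "s \<in> seg e" and v: "ep e s = Vertex v" and wM: "on_edge \<Gamma> \<iota> w e s = M" for e s v
  proof -
    have vp: "v \<in> verts \<Gamma>" using ep_mem_points[OF e s] v by (auto simp: points_def)
    have "w (\<iota> (Vertex v)) = M" using wM v by (simp add: on_edge_def)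
    then have "\<iota> (Vertex v) \<notin> B" using wB M(1) by force
    from degree_ge_2[OF vp this] have deg: "2 \<le> degree \<Gamma> v" .
    let ?n = "\<lambda>e. normal_deriv \<Gamma> \<iota> u1 e v - normal_deriv \<Gamma> \<iota> u2 e v"
    have "(\<Sum>e\<in>incident \<Gamma> v. normal_deriv \<Gamma> \<iota> u1 e v) = 0" "(\<Sum>e\<in>incident \<Gamma> v. normal_deriv \<Gamma> \<iota> u2 e v) = 0"
      using h1(2) h2(2) vp deg unfolding q_harmonic_def by blast+
    then have sum0: "(\<Sum>e\<in>incident \<Gamma> v. ?n e) = 0" by (simp add: sum_subtractf)
    have le0: "?n e' \<le> 0" if "e' \<in> incident \<Gamma> v" for e'
    proof -
      have e': "e' \<in> E" "v = fst e' \<or> v = snd e'" using that by (auto simp: incident_def)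
      have lh: "lo \<Gamma> e' < hi \<Gamma> e'" by (rule lo_less_hi[OF e'(1)])
      show ?thesis
      proof (cases "v = fst e'")
        case True
        have "?d e' (lo \<Gamma> e') \<le> 0"
        proof (rule deriv_at_left_max[OF lh dw[OF e'(1)]])
          have "on_edge \<Gamma> \<iota> w e' (lo \<Gamma> e') = M" using True \<open>w (\<iota> (Vertex v)) = M\<close> by (simp add: on_edge_def)
          then show "on_edge \<Gamma> \<iota> w e' t \<le> on_edge \<Gamma> \<iota> w e' (lo \<Gamma> e')" if "t \<in> seg e'" for t using wle[OF e'(1) that] by simp
        qed (use lh in auto)
        then show ?thesis using True by (simp add: normal_deriv_def)
      next
        case False
        then have sn: "v = snd e'" using e' by simp
        have "0 \<le> ?d e' (hi \<Gamma> e')"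
        proof (rule deriv_at_right_max[OF lh dw[OF e'(1)]])
          have "on_edge \<Gamma> \<iota> w e' (hi \<Gamma> e') = M" using sn \<open>w (\<iota> (Vertex v)) = M\<close> ep_hi[OF e'(1)] by (simp add: on_edge_def)
          then show "on_edge \<Gamma> \<iota> w e' t \<le> on_edge \<Gamma> \<iota> w e' (hi \<Gamma> e')" if "t \<in> seg e'" for t using wle[OF e'(1) that] by simp
        qed (use lh in auto)
        then show ?thesis using False by (simp add: normal_deriv_def)
      qed
    qed
    have fin: "finite (incident \<Gamma> v)" by (rule finite_incident[OF vp])
    have "(\<Sum>e\<in>incident \<Gamma> v. - ?n e) = 0" using sum0 by (simp only: sum_negf neg_equal_0_iff_equal)
    then have zero: "\<forall>e\<in>incident \<Gamma> v. - ?n e = 0"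
      using le0 by (subst (asm) sum_nonneg_eq_0_iff[OF fin]) auto
    have ev: "(v = fst e \<and> s = lo \<Gamma> e) \<or> (v = snd e \<and> s = hi \<Gamma> e)" by (rule ep_vertexD[OF e s v])
    then have "e \<in> incident \<Gamma> v" using e by (auto simp: incident_def)
    then have "?n e = 0" using zero by fastforce
    then show ?thesis using ev edge_verts(3)[OF e] by (auto simp: normal_deriv_def)
  qed
  have edge: "on_edge \<Gamma> \<iota> w e t = M" if e: "e \<in> E" and s: "s \<in> seg e" and t: "t \<in> seg e" and wM: "on_edge \<Gamma> \<iota> w e s = M" for e s t
  proof -
    have lh: "lo \<Gamma> e < hi \<Gamma> e" by (rule lo_less_hi[OF e])
    have d0: "?d e s = 0"
    proof (cases rule: ep_cases[OF e s])
      case 3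
      have "(on_edge \<Gamma> \<iota> w e has_real_derivative ?d e s) (at s)"
        using dw[OF e s] at_within_Icc_at[OF 3(1,2)] by simp
      then show ?thesis
      proof (rule DERIV_local_max[where d = "min (s - lo \<Gamma> e) (hi \<Gamma> e - s)"])
        show "\<forall>y. \<bar>s - y\<bar> < min (s - lo \<Gamma> e) (hi \<Gamma> e - s) \<longrightarrow> on_edge \<Gamma> \<iota> w e y \<le> on_edge \<Gamma> \<iota> w e s"
          unfolding wM by (intro allI impI wle e) auto
      qed (use 3 in simp)
    qed (use vertex[OF e s _ wM] in blast)+
    have ode: "AE x in lebesgue. x \<in> {lo \<Gamma> e<..<hi \<Gamma> e} \<longrightarrow> (?d e has_real_derivative qe e x * on_edge \<Gamma> \<iota> w e x) (at x)"
      using q_harmonic_edge(3)[OF h1(2) e] q_harmonic_edge(3)[OF h2(2) e]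
    proof eventually_elim
      case (elim x)
      show ?case
      proof
        assume "x \<in> {lo \<Gamma> e<..<hi \<Gamma> e}"
        then have "(?d e has_real_derivative qe e x * on_edge \<Gamma> \<iota> u1 e x - qe e x * on_edge \<Gamma> \<iota> u2 e x) (at x)"
          using elim by (intro DERIV_diff) auto
        then show "(?d e has_real_derivative qe e x * on_edge \<Gamma> \<iota> w e x) (at x)"
          by (simp add: on_edge_def w_def right_diff_distrib)
      qed
    qed
    show ?thesis
      by (rule edge_strong_maximum[OF lh dw[OF e] _ ode q_nonneg[OF e] M(1) wle[OF e] s wM d0 t])
        (assumption, intro abs_cont_on_diff q_harmonic_edge(2)[OF h1(2) e] q_harmonic_edge(2)[OF h2(2) e], assumption+)
  qed
  have "y0 \<notin> B" using wB M(1) unfolding M_def by force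
  then have "y0 \<in> graph_set \<Gamma> \<iota>" using y0(1) unfolding boundary_def by blast
  then obtain p0 where p0: "p0 \<in> points \<Gamma>" "y0 = \<iota> p0" unfolding graph_set_def by blast
  have path: "w (\<iota> p') = M" if "path_of_length \<Gamma> p d p'" "w (\<iota> p) = M" for p d p'
    using that
  proof (induction rule: path_of_length.induct)
    case (path_step p d e s t)
    then have "on_edge \<Gamma> \<iota> w e s = M" by (simp add: on_edge_def)
    from edge[OF path_step.hyps(2-4) this] show ?case by (simp add: on_edge_def)
  qed
  have all: "w y = M" if y: "y \<in> graph_set \<Gamma> \<iota>" for y
  proof -
    obtain p where p: "p \<in> points \<Gamma>" "y = \<iota> p" using y unfolding graph_set_def by blast
    obtain d where "path_of_length \<Gamma> p0 d p" using conn p0(1) p(1) unfolding connected_graph_def by blast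
    from path[OF this] show ?thesis using p0 p by (simp add: M_def)
  qed
  obtain b where b: "b \<in> B" using boundary_nonempty by blast
  then have "b \<in> closure (graph_set \<Gamma> \<iota>)" using boundary_subset unfolding completed_def by blast
  from continuous_constant_on_closure[where f = w and x = b and a = M, OF _ all this] wc have "w b = M" unfolding completed_def by blast
  then show False using wB[OF b] M(1) by simp
qed

theorem harmonic_unique:
  assumes "is_harmonic_extension \<Gamma> \<iota> q U u1" "is_harmonic_extension \<Gamma> \<iota> q U u2" "x \<in> X"
  shows "u1 x = u2 x"
  using harmonic_comparison[OF assms] harmonic_comparison[OF assms(2,1,3)] by simp

section \<open>The Dirichlet-Neumann form\<close>

text \<open>Integration by parts on a single edge leaves no end terms, because the derivative of a
  test function vanishes at the ends.\<close>

lemma edge_green_identity: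
  assumes u: "continuous_on X u" "q_harmonic \<Gamma> \<iota> q u" and \<phi>: "\<phi> \<in> test_functions \<Gamma> \<iota>" and e: "e \<in> E"
  shows "(LINT x:seg e|lebesgue. on_edge \<Gamma> \<iota> u e x * schroedinger \<Gamma> \<iota> q \<phi> e x)
    = integral (seg e) (\<lambda>x. edge_deriv \<Gamma> \<iota> u e x * ext_deriv \<phi> e 1 x) + edge_pot (\<lambda>y. u y * \<phi> y) e"
proof -
  let ?u = "on_edge \<Gamma> \<iota> u e" and ?u' = "edge_deriv \<Gamma> \<iota> u e" and ?d1 = "ext_deriv \<phi> e (Suc 0)" and ?d2 = "ext_deriv \<phi> e (Suc (Suc 0))"
  let ?p = "\<lambda>x. qe e x * on_edge \<Gamma> \<iota> (\<lambda>y. u y * \<phi> y) e x"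
  let ?f = "\<lambda>x. ?u x * schroedinger \<Gamma> \<iota> q \<phi> e x" and ?g = "\<lambda>x. ?p x - ?u x * ?d2 x"
  have lh: "lo \<Gamma> e < hi \<Gamma> e" by (rule lo_less_hi[OF e])
  have cu: "continuous_on (seg e) ?u" and cu': "continuous_on (seg e) ?u'"
    and cd: "continuous_on (seg e) ?d1" "continuous_on (seg e) ?d2"
    using continuous_on_edge[OF u(1) e] abs_cont_on_continuous[OF q_harmonic_edge(2)[OF u(2) e]] ext_deriv_continuous[OF \<phi> e] by auto
  have c2: "continuous_on (seg e) (\<lambda>x. ?u x * ?d2 x)" and c1: "continuous_on (seg e) (\<lambda>x. ?u' x * ?d1 x)"
    by (intro continuous_intros cu cu' cd)+
  have u\<phi>: "continuous_on X (\<lambda>y. u y * \<phi> y)" by (intro continuous_on_mult u(1) test_function_continuous[OF \<phi>])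
  have g: "?g absolutely_integrable_on seg e"
    by (intro set_integral_diff(1) q_mult_integrable[OF u\<phi> e] absolutely_integrable_continuous_real c2)
  \<comment> \<open>At the two ends \<open>schroedinger\<close> takes two-sided derivatives, which
    involve values of \<open>on_edge\<close> outside the edge; these points are left out as a null
    set.\<close>
  have eq: "?f x = ?g x" if "x \<in> seg e - {lo \<Gamma> e, hi \<Gamma> e}" for x
  proof -
    have "?d2 x = deriv (deriv (on_edge \<Gamma> \<iota> \<phi> e)) x" using that by (auto simp: ext_deriv_def)
    then show ?thesis by (simp add: schroedinger_def on_edge_def algebra_simps)
  qed
  have f: "?f absolutely_integrable_on seg e"
    by (rule absolutely_integrable_spike[OF g, of "{lo \<Gamma> e, hi \<Gamma> e}"]) (use eq in auto)
  have "(LINT x:seg e|lebesgue. ?f x) = integral (seg e) ?f" by (rule set_lebesgue_integral_eq_integral(2)[OF f])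
  also have "\<dots> = integral (seg e) ?g"
    by (rule integral_spike[of "{lo \<Gamma> e, hi \<Gamma> e}"]) (use eq in auto)
  also have "\<dots> = edge_pot (\<lambda>y. u y * \<phi> y) e - integral (seg e) (\<lambda>x. ?u x * ?d2 x)"
    unfolding edge_pot_def
    by (rule integral_diff[OF q_mult_integrable_on[OF u\<phi> e] integrable_continuous_real[OF c2]])
  finally have 1: "(LINT x:seg e|lebesgue. ?f x) = edge_pot (\<lambda>y. u y * \<phi> y) e - integral (seg e) (\<lambda>x. ?u x * ?d2 x)" .
  have "((\<lambda>x. ?u' x * ?d1 x + ?u x * ?d2 x) has_integral (?u (hi \<Gamma> e) * ?d1 (hi \<Gamma> e) - ?u (lo \<Gamma> e) * ?d1 (lo \<Gamma> e))) (seg e)"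
  proof (rule fundamental_theorem_of_calculus)
    fix x assume x: "x \<in> seg e"
    have "((\<lambda>x. ?u x * ?d1 x) has_real_derivative ?u x * ?d2 x + ?u' x * ?d1 x) (at x within seg e)"
      by (rule DERIV_mult'[OF q_harmonic_edge(1)[OF u(2) e x] test_function_has_derivative(2)[OF \<phi> e x]])
    then show "((\<lambda>x. ?u x * ?d1 x) has_vector_derivative ?u' x * ?d1 x + ?u x * ?d2 x) (at x within seg e)"
      by (simp add: has_real_derivative_iff_has_vector_derivative add.commute)
  qed (use lh in simp)
  then have "integral (seg e) (\<lambda>x. ?u' x * ?d1 x + ?u x * ?d2 x) = 0" by (intro integral_unique) simp
  then have "integral (seg e) (\<lambda>x. ?u' x * ?d1 x) + integral (seg e) (\<lambda>x. ?u x * ?d2 x) = 0"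
    by (simp add: Henstock_Kurzweil_Integration.integral_add[OF integrable_continuous_real[OF c1] integrable_continuous_real[OF c2]])
  then show ?thesis unfolding 1 by simp
qed

lemma green_identity:
  assumes u: "finite_energy u" "q_harmonic \<Gamma> \<iota> q u" and \<phi>: "\<phi> \<in> test_functions \<Gamma> \<iota>"
  shows "graph_integral \<Gamma> (\<lambda>e x. on_edge \<Gamma> \<iota> u e x * schroedinger \<Gamma> \<iota> q \<phi> e x) = QF u \<phi>"
proof -
  obtain S where S: "finite S" "S \<subseteq> E" "\<And>e x. e \<in> E - S \<Longrightarrow> x \<in> seg e \<Longrightarrow> on_edge \<Gamma> \<iota> \<phi> e x = on_edge \<Gamma> \<iota> \<phi> e (lo \<Gamma> e)"
    "\<And>e k x. e \<in> E - S \<Longrightarrow> ext_deriv \<phi> e (Suc k) x = 0"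
    by (rule test_function_constant_edges[OF \<phi>]) (rule that)
  define I where "I e = integral (seg e) (\<lambda>x. edge_deriv \<Gamma> \<iota> u e x * ext_deriv \<phi> e 1 x)" for e
  have uc: "continuous_on X u" by (rule finite_energy_continuous[OF u(1)])
  have u\<phi>: "continuous_on X (\<lambda>y. u y * \<phi> y)" by (intro continuous_on_mult uc test_function_continuous[OF \<phi>])
  have I0: "I e = 0" if "e \<in> E - S" for e using S(4)[OF that, of 0] by (simp add: I_def)
  have sI: "I summable_on E"
    by (rule iffD1[OF summable_on_cong_neutral summable_on_finite[OF S(1)]]) (use I0 S(2) in auto)
  have "(\<Sum>\<^sub>\<infinity>e\<in>E. I e) = (\<Sum>\<^sub>\<infinity>e\<in>S. I e)" by (rule infsum_cong_neutral) (use I0 S(2) in auto)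
  then have "(\<Sum>\<^sub>\<infinity>e\<in>E. I e) = (\<Sum>e\<in>S. I e)" using S(1) by simp
  moreover have "energy u \<phi> = (\<Sum>e\<in>S. I e)"
    unfolding I_def
  proof (rule energy_eqI[OF u(1) test_function_finite_energy[OF \<phi>] dyadic_energy_test_function_tendsto[OF \<phi> S(1-3)]])
    show "continuous_on (seg e) (edge_deriv \<Gamma> \<iota> u e)" if "e \<in> E" for e
      by (rule abs_cont_on_continuous[OF q_harmonic_edge(2)[OF u(2) that]])
  qed (assumption | rule q_harmonic_edge(1)[OF u(2)])+
  moreover have "graph_integral \<Gamma> (\<lambda>e x. on_edge \<Gamma> \<iota> u e x * schroedinger \<Gamma> \<iota> q \<phi> e x)
    = (\<Sum>\<^sub>\<infinity>e\<in>E. I e + edge_pot (\<lambda>y. u y * \<phi> y) e)"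
    unfolding graph_integral_def I_def by (intro infsum_cong edge_green_identity uc u(2) \<phi>)
  moreover have "\<dots> = (\<Sum>\<^sub>\<infinity>e\<in>E. I e) + pot (\<lambda>y. u y * \<phi> y)"
    unfolding pot_def by (rule infsum_add[OF sI edge_pot_summable[OF u\<phi>]])
  ultimately show ?thesis unfolding QF_def by simp
qed

section \<open>Equilibrium potentials and the sign of their mutual energies\<close>

definition equilibrium :: "'x set \<Rightarrow> 'x \<Rightarrow> real" where
  "equilibrium C = (SOME u. minimizes (indicator C) u)"

lemma has_data_cutoff:
  assumes "clopen_in B C"
  shows "has_data (indicator C) (cutoff \<Gamma> \<iota> C)"
  unfolding has_data_def
  using test_function_finite_energy[OF cutoff_props(1)[OF assms]] cutoff_props(2,3)[OF assms]
  by (auto simp: indicator_def)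

lemma equilibrium_minimizes:
  assumes "clopen_in B C"
  shows "minimizes (indicator C) (equilibrium C)"
  unfolding equilibrium_def by (rule someI_ex[OF minimizer_exists[OF has_data_cutoff[OF assms]]])

lemma equilibrium_props:
  assumes "clopen_in B C"
  shows "finite_energy (equilibrium C)" "x \<in> B \<Longrightarrow> equilibrium C x = indicator C x"
  using equilibrium_minimizes[OF assms] unfolding minimizes_def has_data_def by auto

text \<open>By the Euler-Lagrange equation only boundary values of the second argument count. So the
  chosen \<open>cutoff\<close> may be replaced by an equilibrium potential, which makes the
  expression symmetric.\<close>

lemma QF_equilibrium_cong:
  assumes C: "clopen_in B C" and h: "finite_energy h" and h': "finite_energy h'" and eq: "\<And>x. x \<in> B \<Longrightarrow> h x = h' x"
  shows "QF (equilibrium C) h = QF (equilibrium C) h'"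
proof -
  have "0 = QF (equilibrium C) (\<lambda>y. h y + (-1) * h' y)"
    by (rule Euler_Lagrange[OF equilibrium_minimizes[OF C] finite_energy_diff[OF h h'], symmetric]) (use eq in simp)
  also have "\<dots> = QF (equilibrium C) h + (-1) * QF (equilibrium C) h'"
    using QF_add_right[OF equilibrium_props(1)[OF C] h finite_energy_cmult[OF h']] QF_cmult_right[OF equilibrium_props(1)[OF C] h', of "-1"] by (simp only:)
  finally show ?thesis by simp
qed

text \<open>\<open>harmonic_extension\<close> is a choice too, but by uniqueness it agrees with the
  equilibrium potential on the completion, and the integral sees no other values.\<close>

lemma DN_function_eq_DN_form:
  assumes C: "clopen_in B C" and D: "clopen_in B D"
  shows "DN_function \<Gamma> \<iota> q (indicator C) D = QF (equilibrium C) (equilibrium D)"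
proof -
  let ?u = "harmonic_extension \<Gamma> \<iota> q (indicator C)"
  have harm: "is_harmonic_extension \<Gamma> \<iota> q (indicator C) (equilibrium C)" by (rule minimizer_harmonic[OF equilibrium_minimizes[OF C]])
  then have "is_harmonic_extension \<Gamma> \<iota> q (indicator C) ?u" unfolding harmonic_extension_def by (rule someI[of "is_harmonic_extension \<Gamma> \<iota> q (indicator C)"])
  then have eq: "?u x = equilibrium C x" if "x \<in> X" for x by (rule harmonic_unique[OF _ harm that])
  have "DN_function \<Gamma> \<iota> q (indicator C) D
    = graph_integral \<Gamma> (\<lambda>e x. on_edge \<Gamma> \<iota> (equilibrium C) e x * schroedinger \<Gamma> \<iota> q (cutoff \<Gamma> \<iota> D) e x)"
    unfolding DN_function_def graph_integral_def
  proof (intro infsum_cong set_lebesgue_integral_cong allI impI)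
    fix e x assume "e \<in> E" "x \<in> seg e"
    then show "on_edge \<Gamma> \<iota> ?u e x * schroedinger \<Gamma> \<iota> q (cutoff \<Gamma> \<iota> D) e x
      = on_edge \<Gamma> \<iota> (equilibrium C) e x * schroedinger \<Gamma> \<iota> q (cutoff \<Gamma> \<iota> D) e x"
      using eq ep_mem_X unfolding on_edge_def by simp
  qed simp
  also have "\<dots> = QF (equilibrium C) (cutoff \<Gamma> \<iota> D)"
    using harm equilibrium_props(1)[OF C] cutoff_props(1)[OF D] unfolding is_harmonic_extension_def by (intro green_identity) auto
  also have "\<dots> = QF (equilibrium C) (equilibrium D)"
    using has_data_cutoff[OF D] equilibrium_props[OF D] unfolding has_data_def by (intro QF_equilibrium_cong[OF C]) auto
  finally show ?thesis .
qed

definition DN_form :: "'x set \<Rightarrow> 'x set \<Rightarrow> real" where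
  "DN_form C D = QF (equilibrium C) (equilibrium D)"

lemma DN_form_commute: "DN_form C D = DN_form D C"
  unfolding DN_form_def by (rule QF_commute)

lemma DN_form_Un_disjoint:
  assumes C: "clopen_in B C" and D: "clopen_in B D" and D': "clopen_in B D'" and disj: "D \<inter> D' = {}"
  shows "DN_form C (D \<union> D') = DN_form C D + DN_form C D'"
proof -
  have "DN_form C (D \<union> D') = QF (equilibrium C) (\<lambda>y. equilibrium D y + equilibrium D' y)"
    unfolding DN_form_def
  proof (rule QF_equilibrium_cong[OF C])
    fix x assume "x \<in> B"
    then show "equilibrium (D \<union> D') x = equilibrium D x + equilibrium D' x"
      using disj equilibrium_props(2)[OF D] equilibrium_props(2)[OF D'] equilibrium_props(2)[OF clopen_in_Un[OF D D']] by (auto simp: indicator_def)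
  qed (intro finite_energy_add equilibrium_props(1) clopen_in_Un D D')+
  then show ?thesis unfolding DN_form_def using QF_add_right equilibrium_props(1) C D D' by simp
qed

text \<open>Covers the absolute value and the truncation at 1, the two contractions that determine
  the signs of \<open>DN_form\<close>.\<close>

lemma QF_contraction:
  assumes f: "finite_energy f" and g: "continuous_on X g"
    and "\<And>x y. x \<in> X \<Longrightarrow> y \<in> X \<Longrightarrow> \<bar>g x - g y\<bar> \<le> \<bar>f x - f y\<bar>" "\<And>x. x \<in> X \<Longrightarrow> \<bar>g x\<bar> \<le> \<bar>f x\<bar>"
  shows "QF g g \<le> QF f f"
  unfolding QF_def
proof (rule add_mono[OF energy_contraction[OF assms(1-3)] pot_mono])
  show "g y * g y \<le> f y * f y" if "y \<in> X" for y
    using assms(4)[OF that] by (metis abs_ge_zero abs_mult_self_eq mult_mono)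
qed (assumption | intro continuous_on_mult finite_energy_continuous f g)+

text \<open>The competitor \<open>\<bar>u\<^sub>C - u\<^sub>D\<bar>\<close> has the same boundary values as the minimizer \<open>u\<^sub>C + u\<^sub>D\<close>.\<close>
lemma DN_form_nonpos:
  assumes C: "clopen_in B C" and D: "clopen_in B D" and disj: "C \<inter> D = {}"
  shows "DN_form C D \<le> 0"
proof -
  let ?w = "\<lambda>y. equilibrium C y + 1 * equilibrium D y" and ?f = "\<lambda>y. equilibrium C y + (-1) * equilibrium D y"
  let ?g = "\<lambda>y. \<bar>?f y\<bar>"
  let ?h = "\<lambda>y. ?g y + (-1) * ?w y"
  have fe: "finite_energy (equilibrium C)" "finite_energy (equilibrium D)" by (rule equilibrium_props(1)[OF C], rule equilibrium_props(1)[OF D])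
  have w: "finite_energy ?w" and f: "finite_energy ?f" by (rule finite_energy_add[OF fe(1) finite_energy_cmult[OF fe(2)]])+
  have gc: "continuous_on X ?g" by (rule continuous_on_rabs[OF finite_energy_continuous[OF f]])
  have g: "finite_energy ?g" by (rule finite_energy_contraction[OF f gc]) linarith
  have h: "finite_energy ?h" by (rule finite_energy_diff[OF g w])
  have h0: "?h x = 0" if "x \<in> B" for x
    using disj equilibrium_props(2)[OF C that] equilibrium_props(2)[OF D that] by (auto simp: indicator_def)
  have "QF ?h ?w = QF ?h (equilibrium C) + 1 * QF ?h (equilibrium D)"
    using QF_add_right[OF h fe(1) finite_energy_cmult[OF fe(2)]] QF_cmult_right[OF h fe(2)] by (simp only:)
  then have "QF ?w ?h = 0"
    using Euler_Lagrange[OF equilibrium_minimizes[OF C] h h0] Euler_Lagrange[OF equilibrium_minimizes[OF D] h h0] QF_commute[of ?h] by simp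
  moreover have "(\<lambda>y. ?w y + 1 * ?h y) = ?g" by auto
  ultimately have "QF ?w ?w \<le> QF ?g ?g" using QF_square[OF w h, of 1] QF_nonneg[OF h] by simp
  also have "QF ?g ?g \<le> QF ?f ?f" by (rule QF_contraction[OF f gc]) auto
  \<comment> \<open>The forms of the sum and the difference differ by
    \<open>4 * DN_form C D\<close>.\<close>
  finally show ?thesis unfolding QF_square[OF fe] DN_form_def by simp
qed

text \<open>The competitor \<open>min 1 (u\<^sub>C + t u\<^sub>D)\<close>, with small \<open>t > 0\<close>, has the same boundary values as \<open>u\<^sub>C\<close>.\<close>
lemma DN_form_nonneg:
  assumes C: "clopen_in B C" and D: "clopen_in B D" and sub: "D \<subseteq> C"
  shows "0 \<le> DN_form C D"
proof (rule ccontr)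
  assume neg: "\<not> 0 \<le> DN_form C D"
  have fe: "finite_energy (equilibrium C)" "finite_energy (equilibrium D)" by (rule equilibrium_props(1)[OF C], rule equilibrium_props(1)[OF D])
  have Q: "0 \<le> QF (equilibrium D) (equilibrium D)" by (rule QF_nonneg[OF fe(2)])
  \<comment> \<open>Small enough for the linear term to win: with this \<open>t\<close> the
    quadratic term of \<open>QF\<close> divided by \<open>t\<close> stays below
    \<open>- DN_form C D\<close>. The summand 1 avoids a division by zero.\<close>
  define t where "t = - DN_form C D / (QF (equilibrium D) (equilibrium D) + 1)"
  have t: "0 < t" "t * (QF (equilibrium D) (equilibrium D) + 1) = - DN_form C D"
    using neg Q by (auto simp: t_def intro: divide_neg_pos)
  let ?w = "\<lambda>y. equilibrium C y + t * equilibrium D y"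
  let ?g = "\<lambda>y. min 1 (?w y)"
  have w: "finite_energy ?w" by (rule finite_energy_add[OF fe(1) finite_energy_cmult[OF fe(2)]])
  have gc: "continuous_on X ?g" by (intro continuous_on_min continuous_on_const finite_energy_continuous w)
  have con: "\<bar>?g x - ?g y\<bar> \<le> \<bar>?w x - ?w y\<bar>" for x y by (simp add: min_def)
  have g: "finite_energy ?g" by (rule finite_energy_contraction[OF w gc con])
  have "?g x = indicator C x" if "x \<in> B" for x
    using sub t(1) equilibrium_props(2)[OF C that] equilibrium_props(2)[OF D that] by (auto simp: indicator_def)
  then have "QF (equilibrium C) (equilibrium C) \<le> QF ?g ?g" using equilibrium_minimizes[OF C] g unfolding minimizes_def has_data_def by blast
  also have "\<dots> \<le> QF ?w ?w" by (rule QF_contraction[OF w gc con]) auto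
  finally have "0 \<le> t * (2 * DN_form C D + t * QF (equilibrium D) (equilibrium D))"
    unfolding QF_square[OF fe] DN_form_def by (simp add: power2_eq_square algebra_simps)
  then have "0 \<le> 2 * DN_form C D + t * QF (equilibrium D) (equilibrium D)" using t(1) by (simp add: zero_le_mult_iff)
  moreover have "t * QF (equilibrium D) (equilibrium D) = - DN_form C D - t" using t(2) by (simp add: algebra_simps)
  ultimately show False using t(1) neg by linarith
qed

text \<open>A Gram matrix: the double sum is the form of the combination of the equilibrium
  potentials with coefficients \<open>a\<close>.\<close>

lemma DN_form_positive_semidefinite:
  assumes "finite I" "\<And>i. i \<in> I \<Longrightarrow> clopen_in B (C i)"
  shows "0 \<le> (\<Sum>i\<in>I. \<Sum>j\<in>I. a i * a j * DN_form (C i) (C j))"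
proof -
  have fe: "finite_energy (equilibrium (C i))" if "i \<in> I" for i using equilibrium_props(1) assms(2)[OF that] .
  have sum: "finite_energy (\<lambda>y. \<Sum>j\<in>J. a j * equilibrium (C j) y) \<and>
      (\<forall>f. finite_energy f \<longrightarrow> QF f (\<lambda>y. \<Sum>j\<in>J. a j * equilibrium (C j) y) = (\<Sum>j\<in>J. a j * QF f (equilibrium (C j))))" if "J \<subseteq> I" for J
    using finite_subset[OF that assms(1)] that
  proof (induction J rule: finite_induct)
    case empty
    have "finite_energy (\<lambda>_. 0)" using finite_energy_cmult[OF equilibrium_props(1)[OF clopen_in_empty], of 0] by simp
    moreover have "QF f (\<lambda>_. 0) = 0" if "finite_energy f" for f
      using QF_cmult_right[OF that that, of 0] by simp
    ultimately show ?case by simp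
  next
    case (insert j J)
    have j: "finite_energy (equilibrium (C j))" and aj: "finite_energy (\<lambda>y. a j * equilibrium (C j) y)" using fe finite_energy_cmult insert.prems by auto
    have J: "finite_energy (\<lambda>y. \<Sum>j\<in>J. a j * equilibrium (C j) y)" using insert by blast
    have "QF f (\<lambda>y. a j * equilibrium (C j) y + (\<Sum>j\<in>J. a j * equilibrium (C j) y)) = a j * QF f (equilibrium (C j)) + (\<Sum>j\<in>J. a j * QF f (equilibrium (C j)))"
      if "finite_energy f" for f
      unfolding QF_add_right[OF that aj J] QF_cmult_right[OF that j] using insert that by simp
    then show ?case using insert.hyps finite_energy_add[OF aj J] by simp
  qed
  let ?s = "\<lambda>y. \<Sum>j\<in>I. a j * equilibrium (C j) y"
  have s: "finite_energy ?s" "QF f ?s = (\<Sum>j\<in>I. a j * QF f (equilibrium (C j)))" if "finite_energy f" for f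
    using sum[OF subset_refl] that by blast+
  have fs: "finite_energy ?s" using sum[OF subset_refl] by blast
  have "QF ?s ?s = (\<Sum>i\<in>I. a i * QF (equilibrium (C i)) ?s)" unfolding s(2)[OF fs] QF_commute[of ?s] ..
  also have "\<dots> = (\<Sum>i\<in>I. \<Sum>j\<in>I. a i * a j * DN_form (C i) (C j))"
    unfolding DN_form_def by (intro sum.cong refl) (simp add: s(2)[OF fe] sum_distrib_left mult.assoc)
  finally show ?thesis using QF_nonneg[OF fs] by simp
qed

end

section \<open>The Dirichlet to Neumann map\<close>

context completed_graph
begin

lemma clopen_generate_borel: "sigma_sets B {C. clopen_in B C} = sets (restrict_space borel B)"
proof -
  have rs: "sets (restrict_space borel B) = sigma_sets B ((\<inter>) B ` {S. open S})"
    unfolding sets_restrict_space sets_borel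
    by (rule sigma_sets_Int) (use closed_boundary borel_closed[of B] in \<open>auto simp: sets_borel[symmetric]\<close>)
  show ?thesis
    unfolding rs
  proof (rule sigma_sets_eqI)
    fix C assume "C \<in> {C. clopen_in B C}"
    then obtain U where "open U" "C = B \<inter> U" unfolding clopen_in_def openin_open by blast
    then show "C \<in> sigma_sets B ((\<inter>) B ` {S. open S})" by (intro sigma_sets.Basic) auto
  next
    fix S assume "S \<in> (\<inter>) B ` {S. open S}"
    then obtain U where U: "open U" "S = B \<inter> U" by auto
    obtain C :: "nat \<Rightarrow> 'x set" where C: "\<And>n. clopen_in B (C n)" "U \<inter> B = (\<Union>n. C n)" by (rule open_boundary_UN_clopen[OF U(1)]) (rule that)
    have "(\<Union>n. C n) \<in> sigma_sets B {C. clopen_in B C}" using C(1) by (intro sigma_sets.Union sigma_sets.Basic) simp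
    then show "S \<in> sigma_sets B {C. clopen_in B C}" using U(2) C(2) by (simp add: Int_commute)
  qed
qed

end

sublocale completed_graph \<subseteq> boundary: clopen_generated B
  by unfold_locales (rule compact_boundary clopen_generate_borel)+

context potential_graph
begin

section \<open>Extension of the set functions to Borel measures\<close>

lemma DN_form_positive_part:
  assumes C: "clopen_in B C"
  shows "clopen_in B D \<Longrightarrow> 0 \<le> DN_form C (D \<inter> C)"
    and "clopen_in B D \<Longrightarrow> clopen_in B D' \<Longrightarrow> D \<inter> D' = {} \<Longrightarrow> DN_form C ((D \<union> D') \<inter> C) = DN_form C (D \<inter> C) + DN_form C (D' \<inter> C)"
proof -
  show "0 \<le> DN_form C (D \<inter> C)" if "clopen_in B D"
    by (intro DN_form_nonneg C clopen_in_Int that) simp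
  show "DN_form C ((D \<union> D') \<inter> C) = DN_form C (D \<inter> C) + DN_form C (D' \<inter> C)" if "clopen_in B D" "clopen_in B D'" "D \<inter> D' = {}"
    unfolding Int_Un_distrib2 by (intro DN_form_Un_disjoint C clopen_in_Int that) (use that(3) in blast)
qed

lemma DN_form_negative_part:
  assumes C: "clopen_in B C"
  shows "clopen_in B D \<Longrightarrow> 0 \<le> - DN_form C (D - C)"
    and "clopen_in B D \<Longrightarrow> clopen_in B D' \<Longrightarrow> D \<inter> D' = {} \<Longrightarrow> - DN_form C (D \<union> D' - C) = - DN_form C (D - C) + - DN_form C (D' - C)"
proof -
  have cl: "clopen_in B (D - C)" if "clopen_in B D" for D
  proof -
    have "D - C = D \<inter> (B - C)" using clopen_in_subset[OF that] by blast
    then show ?thesis using clopen_in_Int[OF that clopen_in_Diff[OF C]] by simp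
  qed
  show "0 \<le> - DN_form C (D - C)" if "clopen_in B D"
    using DN_form_nonpos[OF C cl[OF that]] by auto
  show "- DN_form C (D \<union> D' - C) = - DN_form C (D - C) + - DN_form C (D' - C)" if "clopen_in B D" "clopen_in B D'" "D \<inter> D' = {}"
  proof -
    have "DN_form C ((D - C) \<union> (D' - C)) = DN_form C (D - C) + DN_form C (D' - C)"
      using that(3) by (intro DN_form_Un_disjoint C cl that) blast
    then show ?thesis by (simp add: Un_Diff)
  qed
qed

lemma DN_form_split:
  assumes C: "clopen_in B C" and D: "clopen_in B D"
  shows "DN_form C D = DN_form C (D \<inter> C) - - DN_form C (D - C)"
proof -
  have eq: "D - C = D \<inter> (B - C)" "D \<inter> C \<union> (D - C) = D" using clopen_in_subset[OF D] by blast+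
  have "clopen_in B (D - C)" unfolding eq(1) by (intro clopen_in_Int clopen_in_Diff C D)
  then have "DN_form C (D \<inter> C \<union> (D - C)) = DN_form C (D \<inter> C) + DN_form C (D - C)"
    by (intro DN_form_Un_disjoint C clopen_in_Int D) auto
  then show ?thesis unfolding eq(2) by simp
qed

text \<open>A negative coefficient exchanges the roles of the two contents of its summand, so both
  sums stay nonnegative. Whole combinations are treated at once because the pairing asks for one
  pair of measures representing \<open>DN_map\<close>.\<close>

lemma DN_form_combination_extension:
  assumes "finite I" "\<And>i. i \<in> I \<Longrightarrow> clopen_in B (C i)"
  obtains M N where "finite_measure M" "sets M = boundary.\<B>" "finite_measure N" "sets N = boundary.\<B>"
    "\<And>D. clopen_in B D \<Longrightarrow> measure M D - measure N D = (\<Sum>i\<in>I. a i * DN_form (C i) D)"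
proof -
  define p where "p i D = DN_form (C i) (D \<inter> C i)" for i D
  define n where "n i D = - DN_form (C i) (D - C i)" for i D
  define P where "P D = (\<Sum>i\<in>I. max 0 (a i) * p i D + max 0 (- a i) * n i D)" for D
  define N where "N D = (\<Sum>i\<in>I. max 0 (a i) * n i D + max 0 (- a i) * p i D)" for D
  note pn = DN_form_positive_part[OF assms(2), folded p_def] DN_form_negative_part[OF assms(2), folded n_def]
  have diff: "P D - N D = (\<Sum>i\<in>I. a i * DN_form (C i) D)" if "clopen_in B D" for D
    unfolding P_def N_def sum_subtractf[symmetric]
  proof (intro sum.cong refl)
    fix i assume "i \<in> I"
    then have eq: "DN_form (C i) D = p i D - n i D" unfolding p_def n_def by (intro DN_form_split assms(2) that)
    show "max 0 (a i) * p i D + max 0 (- a i) * n i D - (max 0 (a i) * n i D + max 0 (- a i) * p i D) = a i * DN_form (C i) D"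
      unfolding eq by (simp add: max_def algebra_simps)
  qed
  have P: "0 \<le> P D" "0 \<le> N D" if "clopen_in B D" for D
    unfolding P_def N_def using pn(1,3) that by (intro sum_nonneg add_nonneg_nonneg mult_nonneg_nonneg; simp)+
  have P2: "P (D \<union> D') = P D + P D'" "N (D \<union> D') = N D + N D'" if "clopen_in B D" "clopen_in B D'" "D \<inter> D' = {}" for D D'
    unfolding P_def N_def sum.distrib[symmetric] using pn(2,4)[OF _ that]
    by (auto intro!: sum.cong simp: algebra_simps)
  obtain M1 where M1: "finite_measure M1" "sets M1 = boundary.\<B>" "\<And>C. clopen_in B C \<Longrightarrow> measure M1 C = P C"
    by (rule boundary.content_extension[of P, OF P(1) P2(1)]) (assumption | rule that)+
  obtain M2 where M2: "finite_measure M2" "sets M2 = boundary.\<B>" "\<And>C. clopen_in B C \<Longrightarrow> measure M2 C = N C"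
    by (rule boundary.content_extension[of N, OF P(2) P2(2)]) (assumption | rule that)+
  show thesis by (rule that[OF M1(1,2) M2(1,2)]) (simp add: M1(3) M2(3) diff)
qed

lemma DN_measure_props:
  assumes C: "clopen_in B C"
  shows "DN_measure \<Gamma> \<iota> q C \<in> signed_radon_measures B"
    and "clopen_in B D \<Longrightarrow> DN_measure \<Gamma> \<iota> q C D = DN_form C D"
proof -
  obtain M N where M: "finite_measure M" "sets M = boundary.\<B>" "finite_measure N" "sets N = boundary.\<B>"
    "\<And>D. clopen_in B D \<Longrightarrow> measure M D - measure N D = (\<Sum>i\<in>{C}. 1 * DN_form i D)"
    by (rule DN_form_combination_extension[of "{C}" "\<lambda>i. i" "\<lambda>_. 1"]) (use C that in auto)
  have "\<exists>\<mu>. \<mu> \<in> signed_radon_measures B \<and> (\<forall>D. clopen_in B D \<longrightarrow> \<mu> D = DN_function \<Gamma> \<iota> q (indicator C) D)"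
    using boundary.measure_difference_signed_radon[OF M(1-4)] M(5) DN_function_eq_DN_form[OF C]
    by (intro exI[of _ "\<lambda>D. measure M D - measure N D"]) (simp add: DN_form_def)
  from someI_ex[OF this]
  have *: "DN_measure \<Gamma> \<iota> q C \<in> signed_radon_measures B \<and> (\<forall>D. clopen_in B D \<longrightarrow> DN_measure \<Gamma> \<iota> q C D = DN_function \<Gamma> \<iota> q (indicator C) D)"
    unfolding DN_measure_def .
  then show "DN_measure \<Gamma> \<iota> q C \<in> signed_radon_measures B" by blast
  show "DN_measure \<Gamma> \<iota> q C D = DN_form C D" if "clopen_in B D"
    using * that DN_function_eq_DN_form[OF C that] unfolding DN_form_def by simp
qed

section \<open>The pairing with finite-valued functions\<close>

abbreviation "level F c \<equiv> {x \<in> B. F x = c}"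

lemma level_clopen: "finite_valued F \<Longrightarrow> clopen_in B (level F c)"
  using finite_valued_level_clopen[of F "{c}"] by simp

lemma DN_map_signed_radon:
  assumes F: "finite_valued F"
  shows "DN_map \<Gamma> \<iota> q F \<in> signed_radon_measures B"
proof -
  have "DN_map \<Gamma> \<iota> q F = (\<lambda>A. \<Sum>c\<in>F ` B. c * DN_measure \<Gamma> \<iota> q (level F c) A)" by (rule ext) (rule DN_map_def)
  also have "\<dots> \<in> signed_radon_measures B"
    using F by (intro boundary.signed_radon_sum DN_measure_props(1) level_clopen) (auto simp: finite_valued_def)
  finally show ?thesis .
qed

lemma DN_map_clopen:
  assumes F: "finite_valued F" and D: "clopen_in B D"
  shows "DN_map \<Gamma> \<iota> q F D = (\<Sum>c\<in>F ` B. c * DN_form (level F c) D)"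
  unfolding DN_map_def using DN_measure_props(2)[OF level_clopen[OF F] D] by simp

text \<open>Each \<open>DN_measure\<close> is a choice, known only on clopen sets. Uniqueness
  identifies their combination with a constructed difference of measures on all Borel sets, which is
  what evaluating the pairing requires.\<close>

lemma pairing_DN_map:
  assumes F: "finite_valued F" and G: "finite_valued G"
  shows "pairing B (DN_map \<Gamma> \<iota> q F) G = (\<Sum>b\<in>G ` B. \<Sum>a\<in>F ` B. a * b * DN_form (level F a) (level G b))"
proof -
  have fin: "finite (F ` B)" "finite (G ` B)" using F G by (simp_all add: finite_valued_def)
  obtain M N where M: "finite_measure M" "sets M = boundary.\<B>" "finite_measure N" "sets N = boundary.\<B>"
    "\<And>D. clopen_in B D \<Longrightarrow> measure M D - measure N D = (\<Sum>c\<in>F ` B. c * DN_form (level F c) D)"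
    by (rule DN_form_combination_extension[OF fin(1), of "level F" "\<lambda>c. c"]) (use level_clopen[OF F] that in auto)
  have eq: "DN_map \<Gamma> \<iota> q F A = measure M A - measure N A" if "A \<in> boundary.\<B>" for A
    by (rule boundary.signed_radon_eqI[OF DN_map_signed_radon[OF F] boundary.measure_difference_signed_radon[OF M(1-4)] _ that])
      (simp add: DN_map_clopen[OF F] M(5))
  have "pairing B (DN_map \<Gamma> \<iota> q F) G = (\<Sum>b\<in>G ` B. b * DN_map \<Gamma> \<iota> q F (level G b))"
    by (rule boundary.pairing_finite_valued[OF DN_map_signed_radon[OF F] M(1-4) eq fin(2)])
      (assumption | rule boundary.clopen_in_sets[OF level_clopen[OF G]])+
  then show ?thesis
    unfolding DN_map_clopen[OF F level_clopen[OF G]] sum_distrib_left by (simp only: ac_simps)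
qed

lemma pairing_DN_map_commute:
  assumes "finite_valued F" "finite_valued G"
  shows "pairing B (DN_map \<Gamma> \<iota> q F) G = pairing B (DN_map \<Gamma> \<iota> q G) F"
  unfolding pairing_DN_map[OF assms] pairing_DN_map[OF assms(2,1)]
  by (subst sum.swap) (simp add: DN_form_commute[of "level F _"] mult.commute mult.left_commute)

lemma pairing_DN_map_nonneg:
  assumes "finite_valued F"
  shows "0 \<le> pairing B (DN_map \<Gamma> \<iota> q F) F"
  unfolding pairing_DN_map[OF assms assms]
  using DN_form_positive_semidefinite[of "F ` B" "level F" "\<lambda>c. c"] level_clopen[OF assms] assms
  by (subst sum.swap) (simp add: finite_valued_def)

end

theorem theorem5p2:
  fixes \<Gamma> :: "'v metric_graph"
    and \<iota> :: "'v graph_point \<Rightarrow> 'x::metric_space"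
    and q :: "'x \<Rightarrow> real"
  assumes "metric_graph \<Gamma>"
    and "connected_graph \<Gamma>"
    and "is_completion \<Gamma> \<iota>"
    and "weakly_connected \<Gamma> \<iota>"
    and "compact (completed \<Gamma> \<iota>)"
    and "boundary \<Gamma> \<iota> \<noteq> {}"
    and "admissible_potential \<Gamma> \<iota> q"
  shows "DN_map \<Gamma> \<iota> q \<in> finite_range_functions (boundary \<Gamma> \<iota>)
           \<rightarrow> signed_radon_measures (boundary \<Gamma> \<iota>) \<and>
    mtopology_of (C_space (boundary \<Gamma> \<iota>)) closure_of finite_range_functions (boundary \<Gamma> \<iota>)
      = mspace (C_space (boundary \<Gamma> \<iota>)) \<and>
    (\<forall>F\<in>finite_range_functions (boundary \<Gamma> \<iota>). \<forall>G\<in>finite_range_functions (boundary \<Gamma> \<iota>).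
      pairing (boundary \<Gamma> \<iota>) (DN_map \<Gamma> \<iota> q F) G = pairing (boundary \<Gamma> \<iota>) (DN_map \<Gamma> \<iota> q G) F) \<and>
    (\<forall>F\<in>finite_range_functions (boundary \<Gamma> \<iota>).
      0 \<le> pairing (boundary \<Gamma> \<iota>) (DN_map \<Gamma> \<iota> q F) F)"
proof -
  interpret potential_graph \<Gamma> \<iota> q by unfold_locales fact+
  show ?thesis
    using finite_range_functions_dense DN_map_signed_radon pairing_DN_map_commute pairing_DN_map_nonneg
    by (simp add: finite_range_functions_iff)
qed

end
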